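(* The De Gregorio equation $\omega_t+u\,\omega_x=u_x\,\omega$, $u_x=\mathbf H(\omega)$, $u(0)=0$, on $x\in\mathbb R$ admits infinitely many self-similar solutions of the form $$\omega_s(x,t)=(T-t)^{c_\omega}\,\Omega\!\left(\frac{x}{(T-t)^{c_l}}\right),$$ distinct under rescaling, with $c_l=c_\omega=-1$ and with odd self-similar profiles $\Omega\in H^1(\mathbb R)$ supported on $[-1,1]$. Among these there is a unique self-similar profile that is strictly negative on $(0,1)$.
   Context: All functions are real-valued. $\mathbf H$ is the Hilbert transform on $\mathbb R$: $\mathbf H(\omega)(x)=\frac1\pi\,\mathrm{P.V.}\!\int_{\mathbb R}\frac{\omega(y)}{x-y}\,dy$. Here $T$ is the finite blowup time. Substituting the ansatz into the equation, $\Omega$ is a self-similar profile with factors $(c_l,c_\omega)$, $c_\omega=-1$, when it solves the profile equation $$(c_l x+U)\,\Omega_x=(c_\omega+U_x)\,\Omega,\qquad U_x=\mathbf H(\Omega),\qquad U(0)=0$$ on $\mathbb R$ (for $\Omega\in H^1(\mathbb R)$, almost everywhere). Rescaling: if $(\Omega,c_l,c_\omega)$ solves the profile equation, so does $(\alpha\Omega(\beta x),\alpha c_l,\alpha c_\omega)$ for $\alpha,\beta\in\mathbb R$, $\beta\ne0$; "distinct under rescaling" means that no two of the solutions are related by such a transformation. *)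

theory Defs
  imports "HOL-Analysis.Analysis"
begin

definition square_integrable :: "(real \<Rightarrow> real) \<Rightarrow> bool" where
  "square_integrable f \<longleftrightarrow>
     f \<in> borel_measurable lborel \<and> integrable lborel (\<lambda>x. (f x)\<^sup>2)"

text \<open>Weak derivatives are tested against compactly supported \<open>C\<^sup>1\<close> functions; this
  is a standard choice of test class for Sobolev spaces on the line. A weak derivative is
  determined up to null sets.\<close>

definition weak_derivative :: "(real \<Rightarrow> real) \<Rightarrow> (real \<Rightarrow> real) \<Rightarrow> bool" where
  "weak_derivative f g \<longleftrightarrow>
     (\<forall>\<phi> \<phi>'. (\<forall>x. (\<phi> has_real_derivative \<phi>' x) (at x)) \<longrightarrow>
        continuous_on UNIV \<phi>' \<longrightarrow> compact (closure {x. \<phi> x \<noteq> 0}) \<longrightarrow>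
        (LINT x|lborel. f x * \<phi>' x) = - (LINT x|lborel. g x * \<phi> x))"

text \<open>An element of \<open>H\<^sup>1(\<real>)\<close> is identified with its unique continuous representative, so
  that equality of functions and pointwise sign conditions are meaningful.\<close>

definition sobolev_H1 :: "(real \<Rightarrow> real) \<Rightarrow> bool" where
  "sobolev_H1 f \<longleftrightarrow>
     continuous_on UNIV f \<and> square_integrable f \<and>
     (\<exists>g. square_integrable g \<and> weak_derivative f g)"

text \<open>The principal value is the limit of symmetric truncations. For \<open>f\<close> in \<open>H\<^sup>1(\<real>)\<close>
  the truncated integrals converge absolutely, the limit exists at every \<open>x\<close>, and it
  depends continuously on \<open>x\<close>.\<close>

definition hilbert_transform :: "(real \<Rightarrow> real) \<Rightarrow> real \<Rightarrow> real" where
  "hilbert_transform f x =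
     1 / pi * Lim (at_right 0) (\<lambda>\<epsilon>. LINT y:{y. \<epsilon> < \<bar>x - y\<bar>}|lborel. f y / (x - y))"

text \<open>The velocity determined by \<open>u\<^sub>x = H(\<omega>)\<close>, \<open>u(0) = 0\<close>. Since \<open>H(\<omega>)\<close> is continuous for
  \<open>\<omega>\<close> in \<open>H\<^sup>1(\<real>)\<close>, the derivative is the classical one at every point.\<close>

definition velocity_of :: "(real \<Rightarrow> real) \<Rightarrow> (real \<Rightarrow> real) \<Rightarrow> bool" where
  "velocity_of \<omega> u \<longleftrightarrow>
     u 0 = 0 \<and> (\<forall>x. (u has_real_derivative hilbert_transform \<omega> x) (at x))"

definition self_similar_profile :: "real \<Rightarrow> real \<Rightarrow> (real \<Rightarrow> real) \<Rightarrow> bool" where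
  "self_similar_profile cl cw \<Omega> \<longleftrightarrow>
     sobolev_H1 \<Omega> \<and>
     (\<exists>U \<Omega>x. velocity_of \<Omega> U \<and> weak_derivative \<Omega> \<Omega>x \<and> square_integrable \<Omega>x \<and>
        (AE x in lborel. (cl * x + U x) * \<Omega>x x = (cw + hilbert_transform \<Omega> x) * \<Omega> x))"

text \<open>Strong solutions with values in \<open>H\<^sup>1(\<real>)\<close> over a set \<open>I\<close> of times: at every time
  the equation holds for almost every \<open>x\<close>, with \<open>\<omega>\<^sub>x\<close> the weak derivative in space and
  \<open>\<omega>\<^sub>t\<close> the classical derivative in time.\<close>

definition de_gregorio_solution :: "real set \<Rightarrow> (real \<Rightarrow> real \<Rightarrow> real) \<Rightarrow> bool" where
  "de_gregorio_solution I \<omega> \<longleftrightarrow>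
     (\<forall>t\<in>I. sobolev_H1 (\<lambda>x. \<omega> x t) \<and>
        (\<exists>u \<omega>x. velocity_of (\<lambda>x. \<omega> x t) u \<and>
           weak_derivative (\<lambda>x. \<omega> x t) \<omega>x \<and> square_integrable \<omega>x \<and>
           (AE x in lborel. \<exists>\<omega>t. ((\<lambda>s. \<omega> x s) has_real_derivative \<omega>t) (at t) \<and>
              \<omega>t + u x * \<omega>x x = hilbert_transform (\<lambda>y. \<omega> y t) x * \<omega> x t)))"

definition self_similar_solution ::
    "real \<Rightarrow> real \<Rightarrow> real \<Rightarrow> (real \<Rightarrow> real) \<Rightarrow> real \<Rightarrow> real \<Rightarrow> real" where
  "self_similar_solution T cl cw \<Omega> x t =
     (T - t) powr cw * \<Omega> (x / (T - t) powr cl)"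

definition rescaling_of ::
    "(real \<Rightarrow> real) \<times> real \<times> real \<Rightarrow> (real \<Rightarrow> real) \<times> real \<times> real \<Rightarrow> bool" where
  "rescaling_of = (\<lambda>(\<Omega>, cl, cw) (\<Omega>', cl', cw').
     \<exists>\<alpha> \<beta>. \<beta> \<noteq> 0 \<and> \<Omega>' = (\<lambda>x. \<alpha> * \<Omega> (\<beta> * x)) \<and> cl' = \<alpha> * cl \<and> cw' = \<alpha> * cw)"

definition odd_function :: "(real \<Rightarrow> real) \<Rightarrow> bool" where
  "odd_function f \<longleftrightarrow> (\<forall>x. f (- x) = - f x)"

definition supported_on :: "(real \<Rightarrow> real) \<Rightarrow> real set \<Rightarrow> bool" where
  "supported_on f K \<longleftrightarrow> closure {x. f x \<noteq> 0} \<subseteq> K"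

end

theory Submission
  imports Defs "HOL-Complex_Analysis.Great_Picard"
begin

text \<open>
  The nonlinear profile equation is linear in disguise. With \<open>V x = U x - x\<close> it reads
  \<open>V \<Omega>' = V' \<Omega>\<close>, so the quotient \<open>V / \<Omega>\<close> is constant wherever \<open>\<Omega>\<close> does not vanish. If
  \<open>V = - l \<Omega>\<close> on \<open>[-1, 1]\<close>, then the profile equation holds, and differentiating gives
  \<open>H \<Omega> = 1 - l \<Omega>'\<close>. For an odd \<open>\<Omega>\<close> that equals \<open>- f\<close> on \<open>[0, 1]\<close>, with \<open>f\<close> the primitive of
  \<open>\<phi>\<close>, this is \<open>neg_hilbert \<phi> = 1 + l \<phi>\<close> on \<open>[0, 1]\<close>; together with
  \<open>f 1 = 0\<close> it is the predicate \<open>half_profile l \<phi>\<close>, and \<open>profile_of \<phi>\<close> is the resulting \<open>\<Omega>\<close>.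

  The inhomogeneous term disappears in the variable \<open>q = f / x - f'\<close>, which is \<open>- x\<close> times the
  derivative of the chord slope \<open>f / x\<close> (\<open>slope_drop\<close>). Half profiles correspond to eigenfunctions of a symmetric,
  strictly positive, compact kernel (\<open>drop_kernel\<close>): \<open>drop_eigenfunction\<close> and
  \<open>half_profile_of_eigenfunction\<close>. The constant lost in passing to \<open>q\<close> can be normalised to \<open>1\<close>, since it
  vanishes only for \<open>f = 0\<close>, by the Pohozaev identity \<open>l \<integral>f\<^sup>2 = 2 c \<integral>x f\<close>; the same identity
  shows that \<open>l \<noteq> 0\<close> determines \<open>\<phi>\<close>. A compact symmetric operator has an eigenfunction
  as long as it is not zero. Subtracting finitely many spectral projections from the kernel cannot
  remove its logarithmic singularity, so the eigenvalues are infinite in number (\<open>infinite_eigenvalues\<close>).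
  An eigenfunction for the largest eigenvalue can be chosen nonnegative, because the kernel is positive; then \<open>f / x\<close> decreases
  to its value \<open>0\<close> at \<open>1\<close>, and \<open>f > 0\<close> on \<open>(0, 1)\<close> (\<open>positive_half_profile\<close>).

  For uniqueness, a negative profile in \<open>H\<^sup>1\<close> is first shown to come from a half profile with
  \<open>l > 0\<close>. Here \<open>\<Omega>'\<close> is only square-integrable, but \<open>\<Omega>\<close> is then \<open>1/2\<close>-Hoelder, which is enough for
  \<open>V / \<Omega>\<close> to have derivative zero everywhere on \<open>(0, 1)\<close> (\<open>negative_profile_is_half_profile\<close>).
  Next, \<open>f > 0\<close> forces \<open>f / x\<close> to be decreasing. Indeed \<open>S = f / x\<close>, as a radial function
  on the unit ball of \<open>\<real>\<^sup>3\<close> and zero outside, solves \<open>2 pi\<^sup>2 (1 + l S) = S * |z|\<^sup>-\<^sup>2\<close> (a convolution) on the ball, and the method of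
  moving planes applies to this equation (\<open>positive_half_profile_slope_decreasing\<close>).
  Hence \<open>q \<ge> 0\<close>. Two nonnegative eigenfunctions of a strictly positive kernel are not
  orthogonal, so they have the same eigenvalue, and then the half profiles agree.

  A rescaling that fixes \<open>c\<^sub>l = c\<^sub>\<omega> = -1\<close> has \<open>\<alpha> = 1\<close>, so it is a dilation \<open>\<Omega> (\<beta> x)\<close>. If \<open>\<bar>\<beta>\<bar> > 1\<close>, the dilated profile
  vanishes near \<open>1\<close> (if \<open>\<bar>\<beta>\<bar> < 1\<close>, the original one does), and then its own dilates by factors \<open>r\<close> slightly above \<open>1\<close> are half profiles
  with eigenvalue \<open>r l\<close>. These are mutually orthogonal, although they depend continuously on
  \<open>r\<close>, which is absurd (\<open>half_profile_support_full\<close>). The case \<open>\<beta> = -1\<close> would make \<open>\<phi>\<close> constant.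
\<close>

section \<open>The unit interval as a measure space\<close>

abbreviation I :: "real measure" where "I \<equiv> restrict_space lborel {0..1}"

lemma FTC_lborel:
  fixes F f :: "real \<Rightarrow> real"
  assumes "finite S" "a \<le> b" "continuous_on {a..b} F"
    and "\<And>x. x \<in> {a<..<b} - S \<Longrightarrow> (F has_real_derivative f x) (at x)"
    and "set_integrable lborel {a..b} f"
  shows "(LBINT x:{a..b}. f x) = F b - F a"
proof -
  have "(f has_integral (F b - F a)) {a..b}"
    using assms by (intro fundamental_theorem_of_calculus_interior_strong)
      (auto simp: has_real_derivative_iff_has_vector_derivative)
  then show ?thesis
    using set_borel_integral_eq_integral(2)[OF assms(5)] by (simp add: integral_unique)
qed

lemma FTC_lborel_nonneg:
  fixes F f :: "real \<Rightarrow> real"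
  assumes "finite S" "a \<le> b" "continuous_on {a..b} F"
    and "\<And>x. x \<in> {a<..<b} - S \<Longrightarrow> (F has_real_derivative f x) (at x)"
    and nonneg: "\<And>x. x \<in> {a..b} \<Longrightarrow> 0 \<le> f x"
    and meas: "f \<in> borel_measurable borel"
  shows "set_integrable lborel {a..b} f" "(LBINT x:{a..b}. f x) = F b - F a"
proof -
  have "(f has_integral (F b - F a)) {a..b}"
    using assms by (intro fundamental_theorem_of_calculus_interior_strong)
      (auto simp: has_real_derivative_iff_has_vector_derivative)
  then have "f absolutely_integrable_on {a..b}"
    using nonneg by (intro nonnegative_absolutely_integrable_1) auto
  then have "set_integrable lebesgue {a..b} f" .
  moreover have "(\<lambda>x. indicator {a..b} x *\<^sub>R f x) \<in> borel_measurable lborel"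
    using meas by measurable
  ultimately show *: "set_integrable lborel {a..b} f"
    unfolding set_integrable_def by (simp add: integrable_completion)
  show "(LBINT x:{a..b}. f x) = F b - F a"
    by (rule FTC_lborel[OF assms(1-4) *])
qed

lemma integrable_I_iff:
  fixes f :: "real \<Rightarrow> real"
  shows "integrable I f \<longleftrightarrow> set_integrable lborel {0..1} f"
  by (simp add: integrable_restrict_space set_integrable_def)

lemma integral_I_eq:
  fixes f :: "real \<Rightarrow> real"
  shows "(\<integral>x. f x \<partial>I) = (LBINT x:{0..1}. f x)"
  by (simp add: integral_restrict_space set_lebesgue_integral_def)

lemma space_I [simp]: "space I = {0..1}"
  by (simp add: space_restrict_space)

lemma measurable_I_borel: "f \<in> borel_measurable borel \<Longrightarrow> f \<in> borel_measurable I"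
  by (simp add: measurable_restrict_space1)

lemma measurable_ident_I [measurable]: "(\<lambda>x. x) \<in> borel_measurable I"
  by (rule measurable_I_borel) simp

lemma measurable_fst_I [measurable]: "fst \<in> borel_measurable (I \<Otimes>\<^sub>M I)"
  using measurable_compose[OF measurable_fst measurable_ident_I] by (simp add: comp_def)

lemma measurable_snd_I [measurable]: "snd \<in> borel_measurable (I \<Otimes>\<^sub>M I)"
  using measurable_compose[OF measurable_snd measurable_ident_I] by (simp add: comp_def)

lemma finite_measure_I: "finite_measure I"
  by (rule finite_measureI) (simp add: emeasure_restrict_space)

interpretation I: finite_measure I by (rule finite_measure_I)

interpretation II: pair_sigma_finite I I ..

lemma measure_I [simp]: "measure I {0..1} = 1"
  by (simp add: measure_restrict_space)

lemma AE_I_neq: "AE y in I. y \<noteq> x"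
  using AE_lborel_singleton[of x] by (auto simp: AE_restrict_space_iff elim: eventually_mono)

lemma continuous_on_measurable_I:
  fixes f :: "real \<Rightarrow> real"
  assumes "continuous_on {0..1} f" shows "f \<in> borel_measurable I"
  using borel_measurable_continuous_on_restrict[OF assms]
  by (subst measurable_cong_sets[of _ "restrict_space borel {0..1}"]) (auto simp: sets_restrict_space)

lemma integrable_I_bounded:
  fixes f :: "real \<Rightarrow> real"
  assumes "f \<in> borel_measurable I" "\<And>x. x \<in> {0..1} \<Longrightarrow> \<bar>f x\<bar> \<le> B"
  shows "integrable I f"
  by (rule I.integrable_const_bound[of _ B]) (use assms in \<open>auto intro!: AE_I2\<close>)

lemma FTC_I:
  fixes F f :: "real \<Rightarrow> real"
  assumes "finite S" "continuous_on {0..1} F"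
    and "\<And>x. x \<in> {0<..<1} - S \<Longrightarrow> (F has_real_derivative f x) (at x)"
    and "integrable I f"
  shows "(\<integral>x. f x \<partial>I) = F 1 - F 0"
  using FTC_lborel[of S 0 1 F f] assms by (auto simp: integrable_I_iff integral_I_eq)

section \<open>Square-integrable functions\<close>

definition L2 :: "real measure \<Rightarrow> (real \<Rightarrow> real) \<Rightarrow> bool" where
  "L2 M f \<longleftrightarrow> f \<in> borel_measurable M \<and> integrable M (\<lambda>x. (f x)\<^sup>2)"

definition inner_L2 :: "real measure \<Rightarrow> (real \<Rightarrow> real) \<Rightarrow> (real \<Rightarrow> real) \<Rightarrow> real" where
  "inner_L2 M f g = (\<integral>x. f x * g x \<partial>M)"

definition norm_L2 :: "real measure \<Rightarrow> (real \<Rightarrow> real) \<Rightarrow> real" where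
  "norm_L2 M f = sqrt (\<integral>x. (f x)\<^sup>2 \<partial>M)"

lemma L2_mult_integrable:
  assumes "L2 M f" "L2 M g" shows "integrable M (\<lambda>x. f x * g x)"
proof (rule Bochner_Integration.integrable_bound[of _ "\<lambda>x. (f x)\<^sup>2 + (g x)\<^sup>2"])
  show "integrable M (\<lambda>x. (f x)\<^sup>2 + (g x)\<^sup>2)" using assms by (auto simp: L2_def)
  show "(\<lambda>x. f x * g x) \<in> borel_measurable M"
    using assms unfolding L2_def by (intro borel_measurable_times) blast+
  have "\<bar>a * b\<bar> \<le> a\<^sup>2 + b\<^sup>2" for a b :: real
  proof -
    have "0 \<le> (\<bar>a\<bar> - \<bar>b\<bar>)\<^sup>2" by simp
    then have "2 * (\<bar>a\<bar> * \<bar>b\<bar>) \<le> a\<^sup>2 + b\<^sup>2" by (simp add: power2_diff)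
    moreover have "0 \<le> \<bar>a\<bar> * \<bar>b\<bar>" by simp
    ultimately show ?thesis unfolding abs_mult by linarith
  qed
  then show "AE x in M. norm (f x * g x) \<le> norm ((f x)\<^sup>2 + (g x)\<^sup>2)" by auto
qed

lemma L2_lin:
  assumes "L2 M f" "L2 M g" shows "L2 M (\<lambda>x. a * f x + b * g x)"
proof -
  have "(\<lambda>x. (a * f x + b * g x)\<^sup>2) = (\<lambda>x. a\<^sup>2 * (f x)\<^sup>2 + 2 * a * b * (f x * g x) + b\<^sup>2 * (g x)\<^sup>2)"
    by (auto simp: power2_eq_square algebra_simps)
  then show ?thesis
    using assms L2_mult_integrable[OF assms] unfolding L2_def
    by (intro conjI borel_measurable_add borel_measurable_times borel_measurable_const) simp_all
qed

lemma norm_L2_nonneg: "0 \<le> norm_L2 M f" by (simp add: norm_L2_def)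
lemma norm_L2_sq: "(norm_L2 M f)\<^sup>2 = inner_L2 M f f"
  by (simp add: norm_L2_def inner_L2_def power2_eq_square[symmetric])
lemma inner_L2_commute: "inner_L2 M f g = inner_L2 M g f" by (simp add: inner_L2_def mult.commute)

lemma inner_L2_lin:
  assumes "L2 M f" "L2 M g" "L2 M h"
  shows "inner_L2 M (\<lambda>x. a * f x + b * g x) h = a * inner_L2 M f h + b * inner_L2 M g h"
proof -
  have "(\<lambda>x. (a * f x + b * g x) * h x) = (\<lambda>x. a * (f x * h x) + b * (g x * h x))"
    by (auto simp: algebra_simps)
  then show ?thesis using L2_mult_integrable assms by (simp add: inner_L2_def)
qed

lemma inner_L2_lin2:
  assumes "L2 M f" "L2 M g" "L2 M h"
  shows "inner_L2 M h (\<lambda>x. a * f x + b * g x) = a * inner_L2 M h f + b * inner_L2 M h g"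
  using inner_L2_lin[OF assms] by (simp add: inner_L2_commute)

lemma Cauchy_Schwarz_L2:
  assumes "L2 M f" "L2 M g" shows "\<bar>inner_L2 M f g\<bar> \<le> norm_L2 M f * norm_L2 M g"
proof -
  have "0 \<le> inner_L2 M h h" for h by (simp add: inner_L2_def)
  then have *: "0 \<le> a\<^sup>2 * inner_L2 M f f + 2 * a * b * inner_L2 M f g + b\<^sup>2 * inner_L2 M g g" for a b
    using inner_L2_lin[OF assms L2_lin[OF assms], of a b a b] inner_L2_lin2[OF assms assms(1), of a b] inner_L2_lin2[OF assms assms(2), of a b]
      inner_L2_commute[of M g f]
    by (smt (verit) distrib_left mult.assoc mult.commute power2_eq_square)
  have "(inner_L2 M f g)\<^sup>2 \<le> inner_L2 M f f * inner_L2 M g g"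
  proof (cases "inner_L2 M g g = 0")
    case True
    have "inner_L2 M f g = 0"
    proof (rule ccontr)
      assume n: "inner_L2 M f g \<noteq> 0"
      have "0 \<le> inner_L2 M f f + 2 * b * inner_L2 M f g" for b using *[of 1 b] True by simp
      from this[of "- (inner_L2 M f f + 1) / (2 * inner_L2 M f g)"]
      have "0 \<le> inner_L2 M f f + (- (inner_L2 M f f + 1))" using n by (simp add: field_simps)
      then show False by simp
    qed
    then show ?thesis using True by simp
  next
    case False
    then have p: "inner_L2 M g g > 0" using \<open>\<And>h. 0 \<le> inner_L2 M h h\<close>[of g] by simp
    have "0 \<le> inner_L2 M g g * (inner_L2 M f f * inner_L2 M g g - (inner_L2 M f g)\<^sup>2)"
      using *[of "inner_L2 M g g" "- inner_L2 M f g"] by (simp add: power2_eq_square algebra_simps)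
    then show ?thesis using p by (simp add: zero_le_mult_iff)
  qed
  then have "(inner_L2 M f g)\<^sup>2 \<le> (norm_L2 M f * norm_L2 M g)\<^sup>2"
    by (simp add: power_mult_distrib norm_L2_sq)
  then show ?thesis
    by (metis abs_le_square_iff abs_of_nonneg mult_nonneg_nonneg norm_L2_nonneg)
qed

lemma norm_L2_triangle:
  assumes "L2 M f" "L2 M g" shows "norm_L2 M (\<lambda>x. f x + g x) \<le> norm_L2 M f + norm_L2 M g"
proof -
  have "(norm_L2 M (\<lambda>x. f x + g x))\<^sup>2 = (norm_L2 M f)\<^sup>2 + 2 * inner_L2 M f g + (norm_L2 M g)\<^sup>2"
    using inner_L2_lin[OF assms L2_lin[OF assms], of 1 1 1 1] inner_L2_lin2[OF assms assms(1), of 1 1]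
      inner_L2_lin2[OF assms assms(2), of 1 1] inner_L2_commute[of M g f] by (simp add: norm_L2_sq)
  also have "\<dots> \<le> (norm_L2 M f + norm_L2 M g)\<^sup>2"
    using Cauchy_Schwarz_L2[OF assms] by (simp add: power2_sum)
  finally show ?thesis by (rule power2_le_imp_le) (simp add: norm_L2_nonneg)
qed

lemma norm_L2_scale: "norm_L2 M (\<lambda>x. a * f x) = \<bar>a\<bar> * norm_L2 M f"
  by (simp add: norm_L2_def power_mult_distrib real_sqrt_mult)

lemma L2_scale: "L2 M f \<Longrightarrow> L2 M (\<lambda>x. a * f x)"
  using L2_lin[of M f f a 0] by simp

lemma L2_add: "L2 M f \<Longrightarrow> L2 M g \<Longrightarrow> L2 M (\<lambda>x. f x + g x)"
  using L2_lin[of M f g 1 1] by simp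

lemma L2_diff: "L2 M f \<Longrightarrow> L2 M g \<Longrightarrow> L2 M (\<lambda>x. f x - g x)"
  using L2_lin[of M f g 1 "-1"] by simp

lemma L2_I_bounded:
  assumes "f \<in> borel_measurable I" "\<And>x. x \<in> {0..1} \<Longrightarrow> \<bar>f x\<bar> \<le> B"
  shows "L2 I f"
  unfolding L2_def
proof
  show "integrable I (\<lambda>x. (f x)\<^sup>2)"
  proof (rule integrable_I_bounded)
    show "(\<lambda>x. (f x)\<^sup>2) \<in> borel_measurable I" using assms(1) by measurable
    show "\<bar>(f x)\<^sup>2\<bar> \<le> B\<^sup>2" if "x \<in> {0..1}" for x
      using assms(2)[OF that] by (simp add: power2_le_iff_abs_le)
  qed
qed fact

lemma L2_I_continuous:
  assumes "continuous_on {0..1} f" shows "L2 I f"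
proof -
  have "bounded (f ` {0..1})" using compact_continuous_image[OF assms] compact_imp_bounded by blast
  then obtain B where "\<And>x. x \<in> {0..1} \<Longrightarrow> \<bar>f x\<bar> \<le> B" unfolding bounded_iff by force
  then show ?thesis using L2_I_bounded continuous_on_measurable_I[OF assms] by blast
qed

lemma L2_I_integrable: "L2 I f \<Longrightarrow> integrable I f"
  using L2_mult_integrable[of I f "\<lambda>_. 1"] L2_I_bounded[of "\<lambda>_. 1" 1] by simp

lemma L2_cong_AE:
  assumes "L2 I f" "g \<in> borel_measurable I" "AE x in I. f x = g x" shows "L2 I g"
  unfolding L2_def
proof
  show "integrable I (\<lambda>x. (g x)\<^sup>2)"
  proof (rule integrable_cong_AE_imp)
    show "integrable I (\<lambda>x. (f x)\<^sup>2)" using assms(1) by (simp add: L2_def)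
    show "(\<lambda>x. (g x)\<^sup>2) \<in> borel_measurable I" using assms(2) by measurable
    show "AE x in I. (f x)\<^sup>2 = (g x)\<^sup>2" using assms(3) by eventually_elim simp
  qed
qed fact

lemma norm_L2_cong_AE:
  assumes "f \<in> borel_measurable M" "g \<in> borel_measurable M" "AE x in M. f x = g x"
  shows "norm_L2 M f = norm_L2 M g"
proof -
  have "(\<integral>x. (f x)\<^sup>2 \<partial>M) = (\<integral>x. (g x)\<^sup>2 \<partial>M)"
  proof (rule integral_cong_AE)
    show "(\<lambda>x. (f x)\<^sup>2) \<in> borel_measurable M" using assms(1) by measurable
    show "(\<lambda>x. (g x)\<^sup>2) \<in> borel_measurable M" using assms(2) by measurable
    show "AE x in M. (f x)\<^sup>2 = (g x)\<^sup>2" using assms(3) by eventually_elim simp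
  qed
  then show ?thesis by (simp add: norm_L2_def)
qed

lemma inner_L2_cong_AE:
  assumes "L2 I f" "L2 I g" "L2 I f'" "L2 I g'" "AE x in I. f x = f' x" "AE x in I. g x = g' x"
  shows "inner_L2 I f g = inner_L2 I f' g'"
  unfolding inner_L2_def
proof (rule integral_cong_AE)
  show "(\<lambda>x. f x * g x) \<in> borel_measurable I" using L2_mult_integrable[OF assms(1,2)] by blast
  show "(\<lambda>x. f' x * g' x) \<in> borel_measurable I" using L2_mult_integrable[OF assms(3,4)] by blast
  show "AE x in I. f x * g x = f' x * g' x" using assms(5,6) by eventually_elim simp
qed

section \<open>Integral operators with square-integrable kernels\<close>

text \<open>Uniformly bounded rows in \<open>L\<^sup>2\<close> are enough for the pointwise formula defining
  \<open>kernel_op\<close> and for Fubini; every kernel below, even with a logarithmic singularity, has this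
  property.\<close>
definition bounded_kernel :: "(real \<Rightarrow> real \<Rightarrow> real) \<Rightarrow> bool" where
  "bounded_kernel k \<longleftrightarrow> (\<lambda>(x, y). k x y) \<in> borel_measurable (I \<Otimes>\<^sub>M I) \<and>
     (\<exists>C. \<forall>x\<in>{0..1}. L2 I (k x) \<and> norm_L2 I (k x) \<le> C)"

definition kernel_op :: "(real \<Rightarrow> real \<Rightarrow> real) \<Rightarrow> (real \<Rightarrow> real) \<Rightarrow> real \<Rightarrow> real" where
  "kernel_op k \<phi> x = (\<integral>y. k x y * \<phi> y \<partial>I)"

lemma bounded_kernelE:
  assumes "bounded_kernel k"
  obtains C where "\<And>x. x \<in> {0..1} \<Longrightarrow> L2 I (k x) \<and> norm_L2 I (k x) \<le> C"
  using assms unfolding bounded_kernel_def by blast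

lemma kernel_op_inner_L2: "kernel_op k \<phi> x = inner_L2 I (k x) \<phi>" by (simp add: kernel_op_def inner_L2_def)

lemma bounded_kernelI:
  assumes "(\<lambda>(x, y). k x y) \<in> borel_measurable (I \<Otimes>\<^sub>M I)"
    "\<And>x y. x \<in> {0..1} \<Longrightarrow> y \<in> {0..1} \<Longrightarrow> \<bar>k x y\<bar> \<le> B"
  shows "bounded_kernel k"
  unfolding bounded_kernel_def
proof (intro conjI exI ballI)
  fix x :: real assume x: "x \<in> {0..1}"
  have m: "k x \<in> borel_measurable I"
    using measurable_compose[OF measurable_Pair1'[of x I I] assms(1)] x by simp
  show *: "L2 I (k x)" by (rule L2_I_bounded[OF m]) (use assms(2) x in auto)
  have "(\<integral>y. (k x y)\<^sup>2 \<partial>I) \<le> (\<integral>y. B\<^sup>2 \<partial>I)"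
  proof (rule integral_mono)
    show "integrable I (\<lambda>y. (k x y)\<^sup>2)" using * by (simp add: L2_def)
    show "(k x y)\<^sup>2 \<le> B\<^sup>2" if "y \<in> space I" for y
      using assms(2)[OF x, of y] that by (intro abs_le_square_iff[THEN iffD1]) auto
  qed simp
  then show "norm_L2 I (k x) \<le> \<bar>B\<bar>" unfolding norm_L2_def by (simp add: real_le_lsqrt)
qed fact

lemma kernel_op_measurable:
  assumes "(\<lambda>(x, y). k x y) \<in> borel_measurable (I \<Otimes>\<^sub>M I)" "\<phi> \<in> borel_measurable I"
  shows "kernel_op k \<phi> \<in> borel_measurable I"
proof -
  note [measurable] = assms
  have "(\<lambda>(x, y). k x y * \<phi> y) \<in> borel_measurable (I \<Otimes>\<^sub>M I)" by measurable
  then show ?thesis unfolding kernel_op_def[abs_def] by (rule I.borel_measurable_lebesgue_integral)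
qed

lemma kernel_op_bounded:
  assumes "bounded_kernel k" "L2 I \<phi>"
  obtains C where "\<And>x. x \<in> {0..1} \<Longrightarrow> \<bar>kernel_op k \<phi> x\<bar> \<le> C"
proof -
  obtain C where C: "\<And>x. x \<in> {0..1} \<Longrightarrow> L2 I (k x) \<and> norm_L2 I (k x) \<le> C" using bounded_kernelE[OF assms(1)] by blast
  have "\<bar>kernel_op k \<phi> x\<bar> \<le> C * norm_L2 I \<phi>" if "x \<in> {0..1}" for x
    using Cauchy_Schwarz_L2[of I "k x" \<phi>] C[OF that] assms(2) mult_right_mono[of "norm_L2 I (k x)" C "norm_L2 I \<phi>"] norm_L2_nonneg[of I \<phi>]
    unfolding kernel_op_inner_L2 by linarith
  then show ?thesis using that by blast
qed

lemma kernel_op_L2: "bounded_kernel k \<Longrightarrow> L2 I \<phi> \<Longrightarrow> L2 I (kernel_op k \<phi>)"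
proof -
  assume k: "bounded_kernel k" and \<phi>: "L2 I \<phi>"
  obtain C where "\<And>x. x \<in> {0..1} \<Longrightarrow> \<bar>kernel_op k \<phi> x\<bar> \<le> C" using kernel_op_bounded[OF k \<phi>] by blast
  moreover have "kernel_op k \<phi> \<in> borel_measurable I" using k \<phi> by (intro kernel_op_measurable) (auto simp: bounded_kernel_def L2_def)
  ultimately show "L2 I (kernel_op k \<phi>)" by (intro L2_I_bounded)
qed

lemma kernel_op_lin:
  assumes "bounded_kernel k" "L2 I f" "L2 I g" "x \<in> {0..1}"
  shows "kernel_op k (\<lambda>x. a * f x + b * g x) x = a * kernel_op k f x + b * kernel_op k g x"
  unfolding kernel_op_inner_L2 using assms by (intro inner_L2_lin2) (auto simp: bounded_kernel_def)

lemma kernel_op_cong_AE: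
  assumes "bounded_kernel k" "L2 I f" "L2 I g" "AE x in I. f x = g x" "x \<in> {0..1}"
  shows "kernel_op k f x = kernel_op k g x"
  unfolding kernel_op_inner_L2 using assms by (intro inner_L2_cong_AE) (auto simp: bounded_kernel_def)

text \<open>The transpose of the kernel is the adjoint operator. Fubini applies because the rows are bounded in
  \<open>L\<^sup>2\<close>.\<close>
lemma adjoint:
  assumes k: "bounded_kernel k" and \<phi>: "L2 I \<phi>" and \<psi>: "L2 I \<psi>"
  shows "inner_L2 I \<psi> (kernel_op k \<phi>) = inner_L2 I (kernel_op (\<lambda>x y. k y x) \<psi>) \<phi>"
proof -
  have [measurable]: "(\<lambda>(x, y). k x y) \<in> borel_measurable (I \<Otimes>\<^sub>M I)" using k by (simp add: bounded_kernel_def)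
  have [measurable]: "\<phi> \<in> borel_measurable I" "\<psi> \<in> borel_measurable I" using \<phi> \<psi> by (auto simp: L2_def)
  obtain C where C: "\<And>x. x \<in> {0..1} \<Longrightarrow> L2 I (k x) \<and> norm_L2 I (k x) \<le> C" using bounded_kernelE[OF k] by blast
  have sec: "integrable I (\<lambda>y. k x y * \<phi> y)" if "x \<in> {0..1}" for x
    using L2_mult_integrable C[OF that] \<phi> by blast
  have m: "(\<lambda>(x, y). \<psi> x * (k x y * \<phi> y)) \<in> borel_measurable (I \<Otimes>\<^sub>M I)" by measurable
  have int: "integrable (I \<Otimes>\<^sub>M I) (\<lambda>(x, y). \<psi> x * (k x y * \<phi> y))"
  proof (rule II.Fubini_integrable[OF m])
    have bound: "(\<integral>y. \<bar>k x y * \<phi> y\<bar> \<partial>I) \<le> C * norm_L2 I \<phi>" if x: "x \<in> {0..1}" for x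
    proof -
      have L: "L2 I (\<lambda>y. \<bar>k x y\<bar>)" "L2 I (\<lambda>y. \<bar>\<phi> y\<bar>)" using C[OF x] \<phi> by (auto simp: L2_def)
      have "(\<integral>y. \<bar>k x y * \<phi> y\<bar> \<partial>I) = inner_L2 I (\<lambda>y. \<bar>k x y\<bar>) (\<lambda>y. \<bar>\<phi> y\<bar>)" by (simp add: inner_L2_def abs_mult)
      also have "\<dots> \<le> norm_L2 I (k x) * norm_L2 I \<phi>" using Cauchy_Schwarz_L2[OF L] by (simp add: norm_L2_def)
      also have "\<dots> \<le> C * norm_L2 I \<phi>" using C[OF x] by (intro mult_right_mono norm_L2_nonneg) auto
      finally show ?thesis .
    qed
    show "integrable I (\<lambda>x. \<integral>y. norm ((\<lambda>(x, y). \<psi> x * (k x y * \<phi> y)) (x, y)) \<partial>I)"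
    proof (rule Bochner_Integration.integrable_bound[of _ "\<lambda>x. \<psi> x * (C * norm_L2 I \<phi>)"])
      show "integrable I (\<lambda>x. \<psi> x * (C * norm_L2 I \<phi>))" using L2_I_integrable[OF \<psi>] by simp
      have "(\<lambda>(x, y). norm (\<psi> x * (k x y * \<phi> y))) \<in> borel_measurable (I \<Otimes>\<^sub>M I)" by measurable
      then show "(\<lambda>x. \<integral>y. norm ((\<lambda>(x, y). \<psi> x * (k x y * \<phi> y)) (x, y)) \<partial>I) \<in> borel_measurable I"
        using I.borel_measurable_lebesgue_integral by (simp add: split_beta')
      show "AE x in I. norm (\<integral>y. norm ((\<lambda>(x, y). \<psi> x * (k x y * \<phi> y)) (x, y)) \<partial>I) \<le> norm (\<psi> x * (C * norm_L2 I \<phi>))"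
      proof (rule AE_I2)
        fix x assume x: "x \<in> space I"
        have "(\<integral>y. \<bar>\<psi> x * (k x y * \<phi> y)\<bar> \<partial>I) = \<bar>\<psi> x\<bar> * (\<integral>y. \<bar>k x y * \<phi> y\<bar> \<partial>I)"
          by (simp add: abs_mult mult.assoc)
        also have "\<dots> \<le> \<bar>\<psi> x\<bar> * (C * norm_L2 I \<phi>)" using bound x by (intro mult_left_mono) auto
        also have "\<dots> \<le> \<bar>\<psi> x * (C * norm_L2 I \<phi>)\<bar>" unfolding abs_mult[of "\<psi> x"] by (intro mult_left_mono) auto
        finally have *: "(\<integral>y. \<bar>\<psi> x * (k x y * \<phi> y)\<bar> \<partial>I) \<le> \<bar>\<psi> x * (C * norm_L2 I \<phi>)\<bar>" .
        have "0 \<le> (\<integral>y. \<bar>\<psi> x * (k x y * \<phi> y)\<bar> \<partial>I)" by simp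
        with * show "norm (\<integral>y. norm ((\<lambda>(x, y). \<psi> x * (k x y * \<phi> y)) (x, y)) \<partial>I) \<le> norm (\<psi> x * (C * norm_L2 I \<phi>))"
          by simp
      qed
    qed
    show "AE x in I. integrable I (\<lambda>y. (\<lambda>(x, y). \<psi> x * (k x y * \<phi> y)) (x, y))"
      using sec by (auto intro!: AE_I2)
  qed
  have "inner_L2 I \<psi> (kernel_op k \<phi>) = (\<integral>x. \<integral>y. \<psi> x * (k x y * \<phi> y) \<partial>I \<partial>I)"
    unfolding inner_L2_def kernel_op_def by simp
  also have "\<dots> = (\<integral>y. \<integral>x. \<psi> x * (k x y * \<phi> y) \<partial>I \<partial>I)"
    using II.Fubini_integral[of "\<lambda>x y. \<psi> x * (k x y * \<phi> y)"] int by (simp add: split_beta')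
  also have "\<dots> = inner_L2 I (kernel_op (\<lambda>x y. k y x) \<psi>) \<phi>"
    unfolding inner_L2_def kernel_op_def
  proof (rule Bochner_Integration.integral_cong[OF refl])
    fix y
    have "(\<integral>x. \<psi> x * (k x y * \<phi> y) \<partial>I) = (\<integral>x. k x y * \<psi> x * \<phi> y \<partial>I)"
      by (intro Bochner_Integration.integral_cong) auto
    then show "(\<integral>x. \<psi> x * (k x y * \<phi> y) \<partial>I) = (\<integral>x. k x y * \<psi> x \<partial>I) * \<phi> y" by simp
  qed
  finally show ?thesis .
qed

text \<open>Rows that depend continuously on the point, in \<open>L\<^sup>2\<close>, map bounded sets of
  \<open>L\<^sup>2\<close> to equicontinuous sets of functions; by Arzela--Ascoli this makes the operator
  compact.\<close>
definition L2kernel :: "(real \<Rightarrow> real \<Rightarrow> real) \<Rightarrow> bool" where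
  "L2kernel k \<longleftrightarrow> bounded_kernel k \<and> (\<forall>x\<in>{0..1}. ((\<lambda>x'. norm_L2 I (\<lambda>y. k x' y - k x y)) \<longlongrightarrow> 0) (at x within {0..1}))"

lemma L2kernelD:
  assumes "L2kernel k"
  shows "bounded_kernel k" "x \<in> {0..1} \<Longrightarrow> ((\<lambda>x'. norm_L2 I (\<lambda>y. k x' y - k x y)) \<longlongrightarrow> 0) (at x within {0..1})"
  using assms unfolding L2kernel_def by auto

lemma L2kernel_lin:
  assumes k: "L2kernel k" and h: "L2kernel h" shows "L2kernel (\<lambda>x y. a * k x y + b * h x y)"
proof -
  have [measurable]: "(\<lambda>(x, y). k x y) \<in> borel_measurable (I \<Otimes>\<^sub>M I)" "(\<lambda>(x, y). h x y) \<in> borel_measurable (I \<Otimes>\<^sub>M I)"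
    using k h by (auto simp: L2kernel_def bounded_kernel_def)
  obtain C where C: "\<And>x. x \<in> {0..1} \<Longrightarrow> L2 I (k x) \<and> norm_L2 I (k x) \<le> C" using bounded_kernelE[OF L2kernelD(1)[OF k]] by blast
  obtain D where D: "\<And>x. x \<in> {0..1} \<Longrightarrow> L2 I (h x) \<and> norm_L2 I (h x) \<le> D" using bounded_kernelE[OF L2kernelD(1)[OF h]] by blast
  have tri: "norm_L2 I (\<lambda>y. a * f y + b * g y) \<le> \<bar>a\<bar> * norm_L2 I f + \<bar>b\<bar> * norm_L2 I g" if "L2 I f" "L2 I g" for f g
    using norm_L2_triangle[OF L2_scale[OF that(1)] L2_scale[OF that(2)], of a b] by (simp add: norm_L2_scale)
  show ?thesis unfolding L2kernel_def bounded_kernel_def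
  proof (intro conjI exI ballI)
    show "(\<lambda>(x, y). a * k x y + b * h x y) \<in> borel_measurable (I \<Otimes>\<^sub>M I)" by measurable
    fix x :: real assume x: "x \<in> {0..1}"
    show "L2 I (\<lambda>y. a * k x y + b * h x y)" using C[OF x] D[OF x] by (intro L2_lin) auto
    have "norm_L2 I (\<lambda>y. a * k x y + b * h x y) \<le> \<bar>a\<bar> * norm_L2 I (k x) + \<bar>b\<bar> * norm_L2 I (h x)"
      using C[OF x] D[OF x] by (intro tri) auto
    also have "\<dots> \<le> \<bar>a\<bar> * C + \<bar>b\<bar> * D" using C[OF x] D[OF x] by (intro add_mono mult_left_mono) auto
    finally show "norm_L2 I (\<lambda>y. a * k x y + b * h x y) \<le> \<bar>a\<bar> * C + \<bar>b\<bar> * D" .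
    show "((\<lambda>x'. norm_L2 I (\<lambda>y. a * k x' y + b * h x' y - (a * k x y + b * h x y))) \<longlongrightarrow> 0) (at x within {0..1})"
    proof (rule tendsto_sandwich[OF _ _ tendsto_const])
      show "((\<lambda>x'. \<bar>a\<bar> * norm_L2 I (\<lambda>y. k x' y - k x y) + \<bar>b\<bar> * norm_L2 I (\<lambda>y. h x' y - h x y)) \<longlongrightarrow> 0) (at x within {0..1})"
        using tendsto_add[OF tendsto_mult_left[OF L2kernelD(2)[OF k x], of "\<bar>a\<bar>"] tendsto_mult_left[OF L2kernelD(2)[OF h x], of "\<bar>b\<bar>"]]
        by simp
      show "\<forall>\<^sub>F x' in at x within {0..1}. norm_L2 I (\<lambda>y. a * k x' y + b * h x' y - (a * k x y + b * h x y)) \<le>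
        \<bar>a\<bar> * norm_L2 I (\<lambda>y. k x' y - k x y) + \<bar>b\<bar> * norm_L2 I (\<lambda>y. h x' y - h x y)"
        unfolding eventually_at_filter
      proof (rule eventuallyI, intro impI)
        fix x' :: real assume x': "x' \<in> {0..1}"
        have *: "norm_L2 I (\<lambda>y. a * (k x' y - k x y) + b * (h x' y - h x y)) \<le> \<bar>a\<bar> * norm_L2 I (\<lambda>y. k x' y - k x y) + \<bar>b\<bar> * norm_L2 I (\<lambda>y. h x' y - h x y)"
          using C[OF x] D[OF x] C[OF x'] D[OF x'] by (intro tri L2_diff) auto
        show "norm_L2 I (\<lambda>y. a * k x' y + b * h x' y - (a * k x y + b * h x y)) \<le>
          \<bar>a\<bar> * norm_L2 I (\<lambda>y. k x' y - k x y) + \<bar>b\<bar> * norm_L2 I (\<lambda>y. h x' y - h x y)"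
        proof -
          have "(\<lambda>y. a * (k x' y - k x y) + b * (h x' y - h x y)) = (\<lambda>y. a * k x' y + b * h x' y - (a * k x y + b * h x y))"
            by (rule ext) (simp add: algebra_simps)
          then show ?thesis using * by simp
        qed
      qed
    qed (simp add: norm_L2_nonneg)
  qed
qed

lemma L2kernel_rank_one:
  assumes "continuous_on {0..1} w" shows "L2kernel (\<lambda>x y. w x * w y)"
proof -
  have w: "L2 I w" by (rule L2_I_continuous[OF assms])
  then have [measurable]: "w \<in> borel_measurable I" by (simp add: L2_def)
  obtain B where B: "\<And>x. x \<in> {0..1} \<Longrightarrow> \<bar>w x\<bar> \<le> B"
    using compact_imp_bounded[OF compact_continuous_image[OF assms]] unfolding bounded_iff by force
  show ?thesis unfolding L2kernel_def
  proof
    show "bounded_kernel (\<lambda>x y. w x * w y)"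
    proof (rule bounded_kernelI)
      show "\<bar>w x * w y\<bar> \<le> B * B" if "x \<in> {0..1}" "y \<in> {0..1}" for x y
        using B[OF that(1)] B[OF that(2)] abs_ge_zero[of "w x"] unfolding abs_mult by (intro mult_mono) linarith+
    qed measurable
    show "\<forall>x\<in>{0..1}. ((\<lambda>x'. norm_L2 I (\<lambda>y. w x' * w y - w x * w y)) \<longlongrightarrow> 0) (at x within {0..1})"
    proof
      fix x :: real assume x: "x \<in> {0..1}"
      have "((\<lambda>x'. \<bar>w x' - w x\<bar> * norm_L2 I w) \<longlongrightarrow> \<bar>w x - w x\<bar> * norm_L2 I w) (at x within {0..1})"
        using assms x by (intro tendsto_intros) (auto simp: continuous_on_def)
      moreover have "norm_L2 I (\<lambda>y. w x' * w y - w x * w y) = \<bar>w x' - w x\<bar> * norm_L2 I w" for x'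
        using norm_L2_scale[of I "w x' - w x" w] by (simp add: algebra_simps)
      ultimately show "((\<lambda>x'. norm_L2 I (\<lambda>y. w x' * w y - w x * w y)) \<longlongrightarrow> 0) (at x within {0..1})" by simp
    qed
  qed
qed

lemma kernel_op_diff_bound:
  assumes k: "bounded_kernel k" "x \<in> {0..1}" "x' \<in> {0..1}" "L2 I \<phi>"
  shows "\<bar>kernel_op k \<phi> x' - kernel_op k \<phi> x\<bar> \<le> norm_L2 I (\<lambda>y. k x' y - k x y) * norm_L2 I \<phi>"
proof -
  have L: "L2 I (k x)" "L2 I (k x')" using k by (auto simp: bounded_kernel_def)
  have "kernel_op k \<phi> x' - kernel_op k \<phi> x = inner_L2 I (\<lambda>y. k x' y - k x y) \<phi>"
    using inner_L2_lin[OF L(2) L(1) k(4), of 1 "-1"] by (simp add: kernel_op_inner_L2)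
  then show ?thesis using Cauchy_Schwarz_L2[OF L2_diff[OF L(2) L(1)] k(4)] by simp
qed

lemma kernel_op_continuous:
  assumes k: "L2kernel k" "L2 I \<phi>" shows "continuous_on {0..1} (kernel_op k \<phi>)"
  unfolding continuous_on_def
proof
  fix x :: real assume x: "x \<in> {0..1}"
  have "((\<lambda>x'. norm_L2 I (\<lambda>y. k x' y - k x y) * norm_L2 I \<phi>) \<longlongrightarrow> 0 * norm_L2 I \<phi>) (at x within {0..1})"
    using L2kernelD(2)[OF k(1) x] by (intro tendsto_intros)
  then have lim: "((\<lambda>x'. norm_L2 I (\<lambda>y. k x' y - k x y) * norm_L2 I \<phi>) \<longlongrightarrow> 0) (at x within {0..1})" by simp
  have "\<forall>\<^sub>F x' in at x within {0..1}. norm (kernel_op k \<phi> x' - kernel_op k \<phi> x) \<le> norm_L2 I (\<lambda>y. k x' y - k x y) * norm_L2 I \<phi>"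
    unfolding eventually_at_filter using kernel_op_diff_bound[OF L2kernelD(1)[OF k(1)] x _ k(2)] by simp
  then have "((\<lambda>x'. kernel_op k \<phi> x' - kernel_op k \<phi> x) \<longlongrightarrow> 0) (at x within {0..1})"
    using lim by (rule Lim_null_comparison)
  then show "(kernel_op k \<phi> \<longlongrightarrow> kernel_op k \<phi> x) (at x within {0..1})" by (simp add: LIM_zero_iff)
qed

section \<open>Square-integrability of the logarithm\<close>

text \<open>The logarithm grows more slowly than any power; the fourth root is chosen so that squares of
  logarithms are controlled by the integrable function \<open>1 / sqrt\<close>.\<close>
lemma ln_one_plus_le: assumes "u \<ge> 0" shows "ln (1 + u) \<le> 4 * sqrt (sqrt (u::real))"
proof -
  have *: "ln (1 + u) \<le> 2 * ln (1 + sqrt u)" if "u \<ge> 0" for u :: real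
  proof -
    have "1 + u \<le> (1 + sqrt u)\<^sup>2" using that by (simp add: power2_eq_square algebra_simps)
    then have "ln (1 + u) \<le> ln ((1 + sqrt u)\<^sup>2)" using that by (intro ln_mono) auto
    also have "\<dots> = 2 * ln (1 + sqrt u)" using that by (subst ln_realpow) (auto intro: add_pos_nonneg)
    finally show ?thesis .
  qed
  have "ln (1 + u) \<le> 4 * ln (1 + sqrt (sqrt u))" using *[of u] *[of "sqrt u"] assms by simp
  also have "\<dots> \<le> 4 * sqrt (sqrt u)" using ln_add_one_self_le_self[of "sqrt (sqrt u)"] assms by simp
  finally show ?thesis .
qed

lemma ln_diff_sq:
  assumes "a > 0" "b > 0" "\<bar>a - b\<bar> \<le> h"
  shows "(ln a - ln b)\<^sup>2 \<le> 16 * sqrt h * (1 / sqrt a + 1 / sqrt b)"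
proof -
  have *: "(ln a - ln b)\<^sup>2 \<le> 16 * sqrt h * (1 / sqrt a + 1 / sqrt b)" if "a > 0" "a \<le> b" "b - a \<le> h" for a b :: real
  proof -
    have b: "b > 0" using that by simp
    have u: "(b - a) / a \<ge> 0" using that by simp
    have "ln b - ln a = ln (1 + (b - a) / a)"
    proof -
      have "1 + (b - a) / a = b / a" using that by (simp add: field_simps)
      then show ?thesis using that b by (simp add: ln_div)
    qed
    then have "0 \<le> ln b - ln a" "ln b - ln a \<le> 4 * sqrt (sqrt ((b - a) / a))"
      using ln_one_plus_le[OF u] that by auto
    then have "(ln b - ln a)\<^sup>2 \<le> (4 * sqrt (sqrt ((b - a) / a)))\<^sup>2" by (intro power_mono)
    also have "\<dots> = 16 * sqrt ((b - a) / a)" using u by (simp add: power_mult_distrib)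
    also have "\<dots> = 16 * sqrt (b - a) * (1 / sqrt a)" by (simp add: real_sqrt_divide)
    also have "\<dots> \<le> 16 * sqrt h * (1 / sqrt a + 1 / sqrt b)"
      using that b by (intro mult_mono) auto
    finally show ?thesis by (simp add: power2_commute)
  qed
  show ?thesis
  proof (cases "a \<le> b")
    case True then show ?thesis using *[of a b] assms by auto
  next
    case False then show ?thesis using *[of b a] assms by (auto simp: power2_commute add.commute)
  qed
qed

lemma ln_sq_bound:
  assumes "t > 0" shows "(ln t)\<^sup>2 \<le> 16 / sqrt t + t\<^sup>2"
proof (cases "t \<le> 1")
  case True
  then have u: "1/t - 1 \<ge> 0" using assms by (simp add: field_simps)
  have "- ln t \<le> 4 * sqrt (sqrt (1/t - 1))" using ln_one_plus_le[OF u] assms by (simp add: ln_div)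
  moreover have "0 \<le> - ln t" using True assms by simp
  ultimately have "(- ln t)\<^sup>2 \<le> (4 * sqrt (sqrt (1/t - 1)))\<^sup>2" by (intro power_mono)
  also have "\<dots> = 16 * sqrt (1/t - 1)" using u by (simp add: power_mult_distrib)
  also have "\<dots> \<le> 16 * sqrt (1/t)" by simp
  also have "\<dots> = 16 / sqrt t" by (simp add: real_sqrt_divide)
  finally show ?thesis by (simp add: add_increasing2)
next
  case False
  then have "0 \<le> ln t" "ln t \<le> t" using ln_le_minus_one[of t] by auto
  then have "(ln t)\<^sup>2 \<le> t\<^sup>2" by (intro power_mono)
  then show ?thesis using assms by (simp add: add_increasing)
qed

lemma inv_sqrt_integral:
  assumes "a \<le> b"
  shows "set_integrable lborel {a..b} (\<lambda>y. 1 / sqrt \<bar>x - y\<bar>)" (is ?A)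
    and "(LBINT y:{a..b}. 1 / sqrt \<bar>x - y\<bar>) \<le> 4 * sqrt (b - a)" (is ?B)
proof -
  define F where "F y = (if y \<le> x then - 2 * sqrt (x - y) else 2 * sqrt (y - x))" for y :: real
  have F: "F = (\<lambda>y. 2 * sqrt (max 0 (y - x)) - 2 * sqrt (max 0 (x - y)))"
    by (auto simp: F_def fun_eq_iff max_def)
  have c: "continuous_on {a..b} F" unfolding F by (intro continuous_intros)
  have d: "(F has_real_derivative 1 / sqrt \<bar>x - y\<bar>) (at y)" if "y \<in> {a<..<b} - {x}" for y
  proof (cases "y < x")
    case True
    have "((\<lambda>y. - 2 * sqrt (x - y)) has_real_derivative 1 / sqrt \<bar>x - y\<bar>) (at y)"
      using True by (auto intro!: derivative_eq_intros simp: divide_simps)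
    then show ?thesis
      by (rule has_field_derivative_transform_within_open[of _ _ _ "{..<x}"]) (use True in \<open>auto simp: F_def\<close>)
  next
    case False
    then have "y > x" using that by auto
    have "((\<lambda>y. 2 * sqrt (y - x)) has_real_derivative 1 / sqrt \<bar>x - y\<bar>) (at y)"
      using \<open>y > x\<close> by (auto intro!: derivative_eq_intros simp: divide_simps)
    then show ?thesis
      by (rule has_field_derivative_transform_within_open[of _ _ _ "{x<..}"]) (use \<open>y > x\<close> in \<open>auto simp: F_def\<close>)
  qed
  note R = FTC_lborel_nonneg[of "{x}", OF _ assms c d]
  show ?A by (rule R) auto
  have "(LBINT y:{a..b}. 1 / sqrt \<bar>x - y\<bar>) = F b - F a" by (rule R) auto
  also have "\<dots> \<le> 4 * sqrt (b - a)"
  proof -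
    have s: "sqrt u \<le> sqrt v + sqrt w" if "u \<le> v + w" "0 \<le> v" "0 \<le> w" for u v w
      using that sqrt_add_le_add_sqrt[of v w] by (smt (verit) real_sqrt_le_mono)
    consider "b \<le> x" | "a \<le> x" "x < b" | "x < a" using assms by linarith
    then show ?thesis
    proof cases
      case 1
      have "0 \<le> sqrt (b - a)" using assms by simp
      then have "2 * sqrt (x - a) - 2 * sqrt (x - b) \<le> 4 * sqrt (b - a)"
        using 1 assms s[of "x - a" "b - a" "x - b"] by linarith
      then show ?thesis using 1 assms by (auto simp: F_def)
    next
      case 2
      have "sqrt (b - x) \<le> sqrt (b - a)" "sqrt (x - a) \<le> sqrt (b - a)" using 2 by auto
      then have "2 * sqrt (b - x) + 2 * sqrt (x - a) \<le> 4 * sqrt (b - a)" by linarith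
      then show ?thesis using 2 by (auto simp: F_def)
    next
      case 3
      have "0 \<le> sqrt (b - a)" using assms by simp
      then have "2 * sqrt (b - x) - 2 * sqrt (a - x) \<le> 4 * sqrt (b - a)"
        using 3 assms s[of "b - x" "b - a" "a - x"] by linarith
      then show ?thesis using 3 assms by (auto simp: F_def)
    qed
  qed
  finally show ?B .
qed

lemma inv_sqrt_I:
  "integrable I (\<lambda>y. 1 / sqrt \<bar>x - y\<bar>)" "(\<integral>y. 1 / sqrt \<bar>x - y\<bar> \<partial>I) \<le> 4"
  using inv_sqrt_integral[of 0 1 x] by (auto simp: integrable_I_iff integral_I_eq)

lemma ln_L2: "L2 I (\<lambda>y. ln \<bar>x - y\<bar>)"
  unfolding L2_def
proof
  show "integrable I (\<lambda>y. (ln \<bar>x - y\<bar>)\<^sup>2)"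
  proof (rule Bochner_Integration.integrable_bound[of _ "\<lambda>y. 16 * (1 / sqrt \<bar>x - y\<bar>) + (x - y)\<^sup>2"])
    show "integrable I (\<lambda>y. 16 * (1 / sqrt \<bar>x - y\<bar>) + (x - y)\<^sup>2)"
    proof (rule Bochner_Integration.integrable_add)
      show "integrable I (\<lambda>y. 16 * (1 / sqrt \<bar>x - y\<bar>))" by (intro integrable_mult_right inv_sqrt_I)
      show "integrable I (\<lambda>y. (x - y)\<^sup>2)"
      proof (rule integrable_I_bounded)
        show "(\<lambda>y. (x - y)\<^sup>2) \<in> borel_measurable I" by measurable
        show "\<bar>(x - y)\<^sup>2\<bar> \<le> (\<bar>x\<bar> + 1)\<^sup>2" if "y \<in> {0..1}" for y
          using that by (auto simp: abs_le_square_iff[symmetric])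
      qed
    qed
    show "AE y in I. norm ((ln \<bar>x - y\<bar>)\<^sup>2) \<le> norm (16 * (1 / sqrt \<bar>x - y\<bar>) + (x - y)\<^sup>2)"
      using AE_I_neq[of x]
    proof eventually_elim
      case (elim y)
      then show ?case using ln_sq_bound[of "\<bar>x - y\<bar>"] by auto
    qed
  qed measurable
qed measurable

text \<open>Translation is \<open>1/4\<close>-Hoelder continuous on the logarithm, in \<open>L\<^sup>2\<close>.
  This modulus gives the continuity of all logarithmic kernels and of the Hilbert transform.\<close>
lemma ln_L2_diff:
  "(\<integral>y. (ln \<bar>x - y\<bar> - ln \<bar>x' - y\<bar>)\<^sup>2 \<partial>I) \<le> 128 * sqrt \<bar>x - x'\<bar>"
proof -
  have "(\<integral>y. (ln \<bar>x - y\<bar> - ln \<bar>x' - y\<bar>)\<^sup>2 \<partial>I) \<le>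
    (\<integral>y. 16 * sqrt \<bar>x - x'\<bar> * (1 / sqrt \<bar>x - y\<bar> + 1 / sqrt \<bar>x' - y\<bar>) \<partial>I)"
  proof (rule integral_mono_AE)
    show "integrable I (\<lambda>y. (ln \<bar>x - y\<bar> - ln \<bar>x' - y\<bar>)\<^sup>2)"
      using L2_lin[OF ln_L2 ln_L2, of 1 x "-1" x'] by (simp add: L2_def)
    show "integrable I (\<lambda>y. 16 * sqrt \<bar>x - x'\<bar> * (1 / sqrt \<bar>x - y\<bar> + 1 / sqrt \<bar>x' - y\<bar>))"
      by (intro integrable_mult_right Bochner_Integration.integrable_add inv_sqrt_I)
    show "AE y in I. (ln \<bar>x - y\<bar> - ln \<bar>x' - y\<bar>)\<^sup>2 \<le> 16 * sqrt \<bar>x - x'\<bar> * (1 / sqrt \<bar>x - y\<bar> + 1 / sqrt \<bar>x' - y\<bar>)"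
      using AE_I_neq[of x] AE_I_neq[of x']
      by eventually_elim (intro ln_diff_sq; auto)
  qed
  also have "\<dots> = 16 * sqrt \<bar>x - x'\<bar> * ((\<integral>y. 1 / sqrt \<bar>x - y\<bar> \<partial>I) + (\<integral>y. 1 / sqrt \<bar>x' - y\<bar> \<partial>I))"
    using inv_sqrt_I(1)[of x] inv_sqrt_I(1)[of x'] by simp
  also have "\<dots> \<le> 16 * sqrt \<bar>x - x'\<bar> * (4 + 4)"
    by (intro mult_left_mono add_mono inv_sqrt_I) auto
  finally show ?thesis by simp
qed

section \<open>The Hilbert transform of an odd function on the half line\<close>

definition log_minus :: "real \<Rightarrow> real \<Rightarrow> real" where "log_minus x y = ln \<bar>x - y\<bar>"
definition log_plus :: "real \<Rightarrow> real \<Rightarrow> real" where "log_plus x y = ln \<bar>x + y\<bar>"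
text \<open>The kernel of the Green type operator that turns \<open>f\<close> into the primitive of \<open>- H
  f\<close>, see \<open>prim_neg_hilbert_log_ratio\<close>.\<close>
definition log_ratio :: "real \<Rightarrow> real \<Rightarrow> real" where "log_ratio x y = log_plus x y - log_minus x y"
definition log_kernel :: "real \<Rightarrow> real \<Rightarrow> real" where "log_kernel x y = log_plus x y + log_minus x y"
text \<open>For \<open>prim \<phi> 1 = 0\<close> this is the negative of the Hilbert transform of the odd
  extension of the primitive of \<open>\<phi>\<close> (\<open>hilbert_odd_ext\<close>): integration by parts
  moves the derivative from the logarithm to the function, and oddness folds the line onto \<open>[0,
  1]\<close>.\<close>
definition neg_hilbert :: "(real \<Rightarrow> real) \<Rightarrow> real \<Rightarrow> real" where "neg_hilbert \<phi> x = - kernel_op log_kernel \<phi> x / pi"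
definition volterra :: "real \<Rightarrow> real \<Rightarrow> real" where "volterra x y = (if y \<le> x then 1 else 0)"
text \<open>The primitive from \<open>0\<close> on \<open>[0, 1]\<close>, written as an integral operator so
  that its adjoint comes from the general lemma.\<close>
definition prim :: "(real \<Rightarrow> real) \<Rightarrow> real \<Rightarrow> real" where "prim \<phi> = kernel_op volterra \<phi>"

lemma log_plus_log_minus: "log_plus x y = log_minus (- x) y"
  unfolding log_plus_def log_minus_def by (rule arg_cong[of _ _ ln]) (auto simp: abs_if)

lemma log_minus_L2: "L2 I (log_minus x)"
  using ln_L2[of x] by (simp add: log_minus_def[abs_def])

lemma log_plus_L2: "L2 I (log_plus x)"
  using log_minus_L2[of "- x"] by (simp add: log_plus_log_minus[abs_def])

lemma log_minus_diff: "norm_L2 I (\<lambda>y. log_minus x' y - log_minus x y) \<le> sqrt (128 * sqrt \<bar>x' - x\<bar>)"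
  unfolding norm_L2_def log_minus_def by (rule real_sqrt_le_mono[OF ln_L2_diff])

lemma log_plus_diff: "norm_L2 I (\<lambda>y. log_plus x' y - log_plus x y) \<le> sqrt (128 * sqrt \<bar>x' - x\<bar>)"
  using log_minus_diff[of "- x'" "- x"] by (simp add: log_plus_log_minus abs_minus_commute)

lemma norm_L2_log_minus: assumes "\<bar>x\<bar> \<le> 1" shows "norm_L2 I (log_minus x) \<le> 9"
proof -
  have "(\<integral>y. (log_minus x y)\<^sup>2 \<partial>I) \<le> (\<integral>y. 16 * (1 / sqrt \<bar>x - y\<bar>) + 4 \<partial>I)"
  proof (rule integral_mono_AE)
    show "integrable I (\<lambda>y. (log_minus x y)\<^sup>2)" using log_minus_L2 by (simp add: L2_def)
    show "integrable I (\<lambda>y. 16 * (1 / sqrt \<bar>x - y\<bar>) + 4)"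
      by (intro Bochner_Integration.integrable_add integrable_mult_right inv_sqrt_I) simp
    have "AE y in I. y \<in> {0..1}" by (rule AE_I2) simp
    then show "AE y in I. (log_minus x y)\<^sup>2 \<le> 16 * (1 / sqrt \<bar>x - y\<bar>) + 4"
      using AE_I_neq[of x]
    proof eventually_elim
      case (elim y)
      have "(\<bar>x - y\<bar>)\<^sup>2 \<le> 2\<^sup>2" using elim assms by (intro power_mono) auto
      then show ?case using elim ln_sq_bound[of "\<bar>x - y\<bar>"] by (simp add: log_minus_def)
    qed
  qed
  also have "\<dots> = 16 * (\<integral>y. 1 / sqrt \<bar>x - y\<bar> \<partial>I) + 4"
  proof -
    have "(\<integral>y. 16 * (1 / sqrt \<bar>x - y\<bar>) + 4 \<partial>I) = (\<integral>y. 16 * (1 / sqrt \<bar>x - y\<bar>) \<partial>I) + (\<integral>y. 4 \<partial>I)"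
      by (rule Bochner_Integration.integral_add) (intro integrable_mult_right inv_sqrt_I, simp)
    then show ?thesis by (simp only: Bochner_Integration.integral_mult_right_zero) simp
  qed
  also have "\<dots> \<le> 9\<^sup>2" using inv_sqrt_I(2)[of x] by simp
  finally show ?thesis unfolding norm_L2_def by (intro real_le_lsqrt) auto
qed

lemma L2kernel_from_modulus:
  assumes meas: "(\<lambda>(x, y). k x y) \<in> borel_measurable (I \<Otimes>\<^sub>M I)"
    and "\<And>x. x \<in> {0..1} \<Longrightarrow> L2 I (k x) \<and> norm_L2 I (k x) \<le> C"
    and mod: "\<And>x x'. x \<in> {0..1} \<Longrightarrow> x' \<in> {0..1} \<Longrightarrow> norm_L2 I (\<lambda>y. k x' y - k x y) \<le> sqrt (128 * sqrt \<bar>x' - x\<bar>)"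
  shows "L2kernel k"
  unfolding L2kernel_def bounded_kernel_def
proof (intro conjI exI ballI)
  fix x :: real assume x: "x \<in> {0..1}"
  have "((\<lambda>x'. sqrt (128 * sqrt \<bar>x' - x\<bar>)) \<longlongrightarrow> sqrt (128 * sqrt \<bar>x - x\<bar>)) (at x within {0..1})"
    by (intro tendsto_intros)
  then have "((\<lambda>x'. sqrt (128 * sqrt \<bar>x' - x\<bar>)) \<longlongrightarrow> 0) (at x within {0..1})" by simp
  moreover have "\<forall>\<^sub>F x' in at x within {0..1}. norm (norm_L2 I (\<lambda>y. k x' y - k x y)) \<le> sqrt (128 * sqrt \<bar>x' - x\<bar>)"
    unfolding eventually_at_filter using mod[OF x] by (simp add: norm_L2_nonneg)
  ultimately show "((\<lambda>x'. norm_L2 I (\<lambda>y. k x' y - k x y)) \<longlongrightarrow> 0) (at x within {0..1})"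
    by (rule Lim_null_comparison[rotated])
qed (use assms in auto)

lemma log_minus_L2kernel: "L2kernel log_minus"
proof (rule L2kernel_from_modulus[of _ 9])
  show "(\<lambda>(x, y). log_minus x y) \<in> borel_measurable (I \<Otimes>\<^sub>M I)" unfolding log_minus_def by measurable
qed (use log_minus_L2 norm_L2_log_minus log_minus_diff in auto)

lemma log_plus_L2kernel: "L2kernel log_plus"
proof (rule L2kernel_from_modulus)
  show "(\<lambda>(x, y). log_plus x y) \<in> borel_measurable (I \<Otimes>\<^sub>M I)" unfolding log_plus_def by measurable
  show "L2 I (log_plus x) \<and> norm_L2 I (log_plus x) \<le> 9" if "x \<in> {0..1}" for x
    using log_plus_L2 norm_L2_log_minus[of "- x"] that by (simp add: log_plus_log_minus[abs_def])
qed (use log_plus_diff in auto)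

lemma log_ratio_L2kernel: "L2kernel log_ratio"
  using L2kernel_lin[OF log_plus_L2kernel log_minus_L2kernel, of 1 "-1"] by (simp add: log_ratio_def[abs_def])

lemma log_kernel_L2kernel: "L2kernel log_kernel"
  using L2kernel_lin[OF log_plus_L2kernel log_minus_L2kernel, of 1 1] by (simp add: log_kernel_def[abs_def])

lemma log_ratio_sym: "log_ratio x y = log_ratio y x"
  by (simp add: log_ratio_def log_plus_def log_minus_def add.commute abs_minus_commute)

lemma log_ratio_L2: "L2 I (log_ratio x)"
  unfolding log_ratio_def[abs_def] by (intro L2_diff log_plus_L2 log_minus_L2)

lemma log_kernel_L2: "L2 I (log_kernel x)"
  unfolding log_kernel_def[abs_def] by (intro L2_add log_plus_L2 log_minus_L2)

lemma neg_hilbert_continuous: assumes "L2 I \<phi>" shows "continuous_on UNIV (neg_hilbert \<phi>)"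
proof -
  have "continuous_on UNIV (kernel_op log_kernel \<phi>)"
    unfolding continuous_on_def
  proof
    fix x :: real
    have b: "norm (kernel_op log_kernel \<phi> x' - kernel_op log_kernel \<phi> x) \<le> 2 * sqrt (128 * sqrt \<bar>x' - x\<bar>) * norm_L2 I \<phi>" for x'
    proof -
      have "kernel_op log_kernel \<phi> x' - kernel_op log_kernel \<phi> x = inner_L2 I (\<lambda>y. log_kernel x' y - log_kernel x y) \<phi>"
        using inner_L2_lin[OF log_kernel_L2 log_kernel_L2 assms, of 1 x' "-1" x] by (simp add: kernel_op_inner_L2)
      moreover have "norm_L2 I (\<lambda>y. log_kernel x' y - log_kernel x y) \<le> norm_L2 I (\<lambda>y. log_plus x' y - log_plus x y) + norm_L2 I (\<lambda>y. log_minus x' y - log_minus x y)"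
        using norm_L2_triangle[OF L2_diff[OF log_plus_L2[of x'] log_plus_L2[of x]] L2_diff[OF log_minus_L2[of x'] log_minus_L2[of x]]]
        by (simp add: log_kernel_def algebra_simps)
      ultimately show ?thesis
        using Cauchy_Schwarz_L2[OF L2_diff[OF log_kernel_L2[of x'] log_kernel_L2[of x]] assms] log_minus_diff[of x' x] log_plus_diff[of x' x]
          mult_right_mono[of "norm_L2 I (\<lambda>y. log_kernel x' y - log_kernel x y)" "2 * sqrt (128 * sqrt \<bar>x' - x\<bar>)" "norm_L2 I \<phi>"] norm_L2_nonneg[of I \<phi>]
        by simp
    qed
    have "((\<lambda>x'. 2 * sqrt (128 * sqrt \<bar>x' - x\<bar>) * norm_L2 I \<phi>) \<longlongrightarrow> 2 * sqrt (128 * sqrt \<bar>x - x\<bar>) * norm_L2 I \<phi>) (at x)"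
      by (intro tendsto_intros)
    then have l: "((\<lambda>x'. 2 * sqrt (128 * sqrt \<bar>x' - x\<bar>) * norm_L2 I \<phi>) \<longlongrightarrow> 0) (at x)" by simp
    have "((\<lambda>x'. kernel_op log_kernel \<phi> x' - kernel_op log_kernel \<phi> x) \<longlongrightarrow> 0) (at x)"
      by (rule Lim_null_comparison[OF _ l]) (use b in simp)
    then show "(kernel_op log_kernel \<phi> \<longlongrightarrow> kernel_op log_kernel \<phi> x) (at x)" by (simp add: LIM_zero_iff)
  qed
  then show ?thesis unfolding neg_hilbert_def[abs_def] by (intro continuous_intros) auto
qed

lemma neg_hilbert_L2: "L2 I \<phi> \<Longrightarrow> L2 I (neg_hilbert \<phi>)"
  using neg_hilbert_continuous by (intro L2_I_continuous) (auto intro: continuous_on_subset)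

lemma volterra_bounded_kernel: "bounded_kernel volterra"
proof (rule bounded_kernelI[of _ 1])
  show "(\<lambda>(x, y). volterra x y) \<in> borel_measurable (I \<Otimes>\<^sub>M I)" unfolding volterra_def by measurable
qed (auto simp: volterra_def)

lemma volterra_L2: "L2 I (volterra x)"
proof (rule L2_I_bounded[of _ 1])
  show "volterra x \<in> borel_measurable I" unfolding volterra_def[abs_def] by measurable
qed (auto simp: volterra_def)

lemma prim_L2: "L2 I \<phi> \<Longrightarrow> L2 I (prim \<phi>)"
  unfolding prim_def by (rule kernel_op_L2[OF volterra_bounded_kernel])

lemma prim_1: "prim \<phi> 1 = (\<integral>y. \<phi> y \<partial>I)"
  unfolding prim_def kernel_op_def by (rule Bochner_Integration.integral_cong) (auto simp: volterra_def)

lemma prim_set: assumes "x \<in> {0..1}" shows "prim h x = (LBINT s:{0..x}. h s)"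
proof -
  have "prim h x = (LBINT s. indicator {0..1} s * (volterra x s * h s))"
    by (simp add: prim_def kernel_op_def integral_restrict_space)
  also have "\<dots> = (LBINT s:{0..x}. h s)"
    unfolding set_lebesgue_integral_def using assms
    by (intro Bochner_Integration.integral_cong) (auto simp: volterra_def indicator_def)
  finally show ?thesis .
qed

lemma FTC_prim:
  fixes F h :: "real \<Rightarrow> real"
  assumes "finite S" "x \<in> {0..1}" "continuous_on {0..x} F"
    and "\<And>s. s \<in> {0<..<x} - S \<Longrightarrow> (F has_real_derivative h s) (at s)" "integrable I h"
  shows "prim h x = F x - F 0"
proof -
  have "set_integrable lborel {0..x} h"
    using assms(5) unfolding integrable_I_iff by (rule set_integrable_subset) (use assms(2) in auto)
  then show ?thesis using FTC_lborel[of S 0 x F h] assms by (simp add: prim_set)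
qed

text \<open>The transpose of the Volterra kernel integrates from \<open>z\<close> to \<open>1\<close>.\<close>
lemma FTC_from:
  fixes F h :: "real \<Rightarrow> real"
  assumes "finite S" "z \<in> {0..1}" "continuous_on {z..1} F"
    and "\<And>s. s \<in> {z<..<1} - S \<Longrightarrow> (F has_real_derivative h s) (at s)" "integrable I h"
  shows "kernel_op (\<lambda>x y. volterra y x) h z = F 1 - F z"
proof -
  have "set_integrable lborel {z..1} h"
    using assms(5) unfolding integrable_I_iff by (rule set_integrable_subset) (use assms(2) in auto)
  moreover have "kernel_op (\<lambda>x y. volterra y x) h z = (LBINT s. indicator {0..1} s * (volterra s z * h s))"
    by (simp add: kernel_op_def integral_restrict_space)
  moreover have "\<dots> = (LBINT s:{z..1}. h s)"
    unfolding set_lebesgue_integral_def using assms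
    by (intro Bochner_Integration.integral_cong) (auto simp: volterra_def indicator_def)
  ultimately show ?thesis using FTC_lborel[of S z 1 F h] assms by simp
qed

section \<open>The Pohozaev identity\<close>

definition x_ln :: "real \<Rightarrow> real" where "x_ln t = t * ln \<bar>t\<bar>"

lemma x_ln_minus: "x_ln (- t) = - x_ln t" by (simp add: x_ln_def)

lemma DERIV_ln_abs: assumes "t \<noteq> 0" shows "((\<lambda>t::real. ln \<bar>t\<bar>) has_real_derivative 1 / t) (at t)"
proof (cases "t > 0")
  case True
  have "(ln has_real_derivative 1 / t) (at t)" using True by (auto intro!: derivative_eq_intros)
  then show ?thesis
    by (rule has_field_derivative_transform_within_open[of _ _ _ "{0<..}"]) (use True in auto)
next
  case False
  then have "t < 0" using assms by simp
  have "((\<lambda>t. ln (- t)) has_real_derivative 1 / t) (at t)" using \<open>t < 0\<close> by (auto intro!: derivative_eq_intros)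
  then show ?thesis
    by (rule has_field_derivative_transform_within_open[of _ _ _ "{..<0}"]) (use \<open>t < 0\<close> in auto)
qed

lemma x_ln_deriv: assumes "t \<noteq> 0" shows "(x_ln has_real_derivative ln \<bar>t\<bar> + 1) (at t)"
  unfolding x_ln_def[abs_def] using DERIV_mult[OF DERIV_ident DERIV_ln_abs[OF assms]] assms by (simp add: add.commute)

lemma x_ln_cont: "continuous_on A x_ln"
proof -
  have "isCont x_ln t" for t
  proof (cases "t = 0")
    case False
    then show ?thesis using x_ln_deriv DERIV_isCont by blast
  next
    case True
    have b: "norm (x_ln u) \<le> sqrt (16 * (\<bar>u\<bar> * sqrt \<bar>u\<bar>) + u ^ 4)" for u
    proof (cases "u = 0")
      case False
      have "(x_ln u)\<^sup>2 = u\<^sup>2 * (ln \<bar>u\<bar>)\<^sup>2" by (simp add: x_ln_def power_mult_distrib)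
      also have "\<dots> \<le> u\<^sup>2 * (16 / sqrt \<bar>u\<bar> + \<bar>u\<bar>\<^sup>2)" using ln_sq_bound[of "\<bar>u\<bar>"] False by (intro mult_left_mono) auto
      finally have 1: "(x_ln u)\<^sup>2 \<le> u\<^sup>2 * (16 / sqrt \<bar>u\<bar> + \<bar>u\<bar>\<^sup>2)" .
      have 2: "u\<^sup>2 / sqrt \<bar>u\<bar> = \<bar>u\<bar> * sqrt \<bar>u\<bar>"
      proof -
        have "u\<^sup>2 = \<bar>u\<bar> * (sqrt \<bar>u\<bar> * sqrt \<bar>u\<bar>)" by (simp add: power2_eq_square)
        then have "u\<^sup>2 / sqrt \<bar>u\<bar> = \<bar>u\<bar> * (sqrt \<bar>u\<bar> * sqrt \<bar>u\<bar>) / sqrt \<bar>u\<bar>" by (rule arg_cong)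
        also have "\<dots> = \<bar>u\<bar> * sqrt \<bar>u\<bar>"
        proof -
          have "a * (s * s) / s = a * s" if "s \<noteq> 0" for a s :: real using that by simp
          then show ?thesis using False by (metis real_sqrt_eq_zero_cancel_iff abs_eq_0_iff)
        qed
        finally show ?thesis .
      qed
      have "u\<^sup>2 * (16 / sqrt \<bar>u\<bar> + \<bar>u\<bar>\<^sup>2) = 16 * (u\<^sup>2 / sqrt \<bar>u\<bar>) + u ^ 4"
        by (simp add: distrib_left power4_eq_xxxx power2_eq_square)
      then show ?thesis using 1 unfolding 2 by (simp add: real_le_rsqrt)
    qed (simp add: x_ln_def)
    have "((\<lambda>u. sqrt (16 * (\<bar>u\<bar> * sqrt \<bar>u\<bar>) + u ^ 4)) \<longlongrightarrow> sqrt (16 * (\<bar>0\<bar> * sqrt \<bar>0\<bar>) + 0 ^ 4)) (at (0::real))"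
      by (intro tendsto_intros)
    then have "((\<lambda>u. sqrt (16 * (\<bar>u\<bar> * sqrt \<bar>u\<bar>) + u ^ 4)) \<longlongrightarrow> 0) (at (0::real))" by simp
    then have "(x_ln \<longlongrightarrow> 0) (at 0)" by (rule Lim_null_comparison[rotated]) (use b in simp)
    then show ?thesis using True by (simp add: isCont_def x_ln_def)
  qed
  then show ?thesis by (simp add: continuous_at_imp_continuous_on)
qed

lemma x_ln_cont_comp: "continuous_on A f \<Longrightarrow> continuous_on A (\<lambda>x. x_ln (f x))"
  using continuous_on_compose[OF _ x_ln_cont, of A f] by (simp add: comp_def)

lemma x_ln_deriv_comp:
  assumes "(f has_real_derivative d) (at s)" "f s \<noteq> 0"
  shows "((\<lambda>s. x_ln (f s)) has_real_derivative (ln \<bar>f s\<bar> + 1) * d) (at s)"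
  using DERIV_chain2[OF x_ln_deriv[OF assms(2)] assms(1)] .

text \<open>Up to \<open>2 x\<close>, a primitive of \<open>log_kernel x y\<close> in \<open>x\<close>, and a
  primitive of \<open>log_ratio x y\<close> in \<open>y\<close>. This coincidence is behind the identities that
  follow.\<close>
definition x_ln_sum :: "real \<Rightarrow> real \<Rightarrow> real" where "x_ln_sum x y = x_ln (x + y) + x_ln (x - y)"

lemma x_ln_sum_cont: "continuous_on A (x_ln_sum x)"
  unfolding x_ln_sum_def[abs_def] by (intro continuous_intros x_ln_cont_comp)

lemma integrable_log_kernel: "integrable I (\<lambda>s. log_kernel s y)"
proof -
  have "(\<lambda>s. log_kernel s y) = log_kernel y" for y
    by (rule ext) (simp add: log_kernel_def log_plus_def log_minus_def add.commute abs_minus_commute)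
  then show ?thesis using L2_I_integrable[OF log_kernel_L2] by simp
qed

lemma prim_log_kernel: assumes "x \<in> {0..1}" "y \<in> {0..1}" shows "prim (\<lambda>s. log_kernel s y) x = x_ln_sum x y - 2 * x"
proof -
  define F where "F s = x_ln (s + y) + x_ln (s - y) - 2 * s" for s
  have "prim (\<lambda>s. log_kernel s y) x = F x - F 0"
  proof (rule FTC_prim[of "{y}"])
    show "continuous_on {0..x} F" unfolding F_def by (intro continuous_intros x_ln_cont_comp)
    fix s assume s: "s \<in> {0<..<x} - {y}"
    have "((\<lambda>s. x_ln (s + y) + x_ln (s - y) - 2 * s) has_real_derivative
       (ln \<bar>s + y\<bar> + 1) * 1 + (ln \<bar>s - y\<bar> + 1) * 1 - 2) (at s)"
      using s assms by (intro DERIV_add DERIV_diff x_ln_deriv_comp) (auto intro!: derivative_eq_intros)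
    then show "(F has_real_derivative log_kernel s y) (at s)"
      by (simp add: F_def[abs_def] log_kernel_def log_plus_def log_minus_def)
  qed (use assms integrable_log_kernel in auto)
  then show ?thesis by (simp add: F_def x_ln_sum_def x_ln_minus)
qed

lemma integral_from_log_ratio: assumes "x \<in> {0..1}" "z \<in> {0..1}" shows "kernel_op (\<lambda>x y. volterra y x) (log_ratio x) z = x_ln_sum x 1 - x_ln_sum x z"
proof (rule FTC_from[of "{x}"])
  fix s assume s: "s \<in> {z<..<1} - {x}"
  have "((\<lambda>s. x_ln (x + s) + x_ln (x - s)) has_real_derivative (ln \<bar>x + s\<bar> + 1) * 1 + (ln \<bar>x - s\<bar> + 1) * (-1)) (at s)"
    using s assms by (intro DERIV_add x_ln_deriv_comp) (auto intro!: derivative_eq_intros)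
  then show "(x_ln_sum x has_real_derivative log_ratio x s) (at s)"
    by (simp add: x_ln_sum_def[abs_def] log_ratio_def log_plus_def log_minus_def)
qed (use assms L2_I_integrable[OF log_ratio_L2] x_ln_sum_cont in auto)

lemma L2_mult_bounded:
  assumes "L2 I f" "h \<in> borel_measurable I" "\<And>x. x \<in> {0..1} \<Longrightarrow> \<bar>h x\<bar> \<le> B"
  shows "L2 I (\<lambda>x. h x * f x)"
proof -
  have [measurable]: "f \<in> borel_measurable I" "h \<in> borel_measurable I" using assms by (auto simp: L2_def)
  show ?thesis unfolding L2_def
  proof
    show "integrable I (\<lambda>x. (h x * f x)\<^sup>2)"
    proof (rule Bochner_Integration.integrable_bound[of _ "\<lambda>x. B\<^sup>2 * (f x)\<^sup>2"])
      show "integrable I (\<lambda>x. B\<^sup>2 * (f x)\<^sup>2)" using assms(1) by (simp add: L2_def)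
      show "AE x in I. norm ((h x * f x)\<^sup>2) \<le> norm (B\<^sup>2 * (f x)\<^sup>2)"
      proof (rule AE_I2)
        fix x assume "x \<in> space I"
        then have "(h x)\<^sup>2 \<le> B\<^sup>2" using assms(3)[of x] by (intro abs_le_square_iff[THEN iffD1]) auto
        then show "norm ((h x * f x)\<^sup>2) \<le> norm (B\<^sup>2 * (f x)\<^sup>2)"
          by (simp add: power_mult_distrib mult_right_mono)
      qed
    qed measurable
  qed measurable
qed

lemma L2_id_mult: "L2 I f \<Longrightarrow> L2 I (\<lambda>x. x * f x)"
  by (rule L2_mult_bounded[of _ _ 1]) auto

lemma prim_neg_hilbert:
  assumes "L2 I \<phi>" "prim \<phi> 1 = 0" "x \<in> {0..1}"
  shows "prim (neg_hilbert \<phi>) x = - inner_L2 I (x_ln_sum x) \<phi> / pi"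
proof -
  have log_kernel: "bounded_kernel log_kernel" using L2kernelD(1)[OF log_kernel_L2kernel] .
  have "prim (neg_hilbert \<phi>) x = - inner_L2 I (volterra x) (kernel_op log_kernel \<phi>) / pi"
    by (simp add: prim_def kernel_op_def neg_hilbert_def[abs_def] inner_L2_def)
  also have "inner_L2 I (volterra x) (kernel_op log_kernel \<phi>) = inner_L2 I (kernel_op (\<lambda>x y. log_kernel y x) (volterra x)) \<phi>"
    by (rule adjoint[OF log_kernel assms(1) volterra_L2])
  also have "\<dots> = (\<integral>y. (x_ln_sum x y - 2 * x) * \<phi> y \<partial>I)"
    unfolding inner_L2_def
  proof (rule Bochner_Integration.integral_cong[OF refl])
    fix y assume "y \<in> space I"
    then show "kernel_op (\<lambda>x y. log_kernel y x) (volterra x) y * \<phi> y = (x_ln_sum x y - 2 * x) * \<phi> y"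
      using prim_log_kernel[OF assms(3), of y] by (simp add: prim_def kernel_op_def mult.commute)
  qed
  also have "\<dots> = (\<integral>y. x_ln_sum x y * \<phi> y - 2 * x * \<phi> y \<partial>I)"
    by (intro Bochner_Integration.integral_cong) (auto simp: algebra_simps)
  also have "\<dots> = inner_L2 I (x_ln_sum x) \<phi> - 2 * x * (\<integral>y. \<phi> y \<partial>I)"
    using L2_mult_integrable[OF L2_I_continuous[OF x_ln_sum_cont[of _ x]] assms(1)] L2_I_integrable[OF assms(1)]
    unfolding inner_L2_def by simp
  also have "\<dots> = inner_L2 I (x_ln_sum x) \<phi>" using assms(2) by (simp add: prim_1)
  finally show ?thesis .
qed

text \<open>Both sides equal \<open>- \<integral> x_ln_sum x y * \<phi> y dy / pi\<close>: on the left the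
  primitive falls on the kernel, on the right the primitive is moved to the kernel by the adjoint. The condition
  \<open>prim \<phi> 1 = 0\<close> removes the terms that do not depend on \<open>y\<close>.\<close>
lemma prim_neg_hilbert_log_ratio:
  assumes "L2 I \<phi>" "prim \<phi> 1 = 0" "x \<in> {0..1}"
  shows "prim (neg_hilbert \<phi>) x = kernel_op log_ratio (prim \<phi>) x / pi"
proof -
  have "kernel_op log_ratio (prim \<phi>) x = inner_L2 I (kernel_op (\<lambda>x y. volterra y x) (log_ratio x)) \<phi>"
    unfolding kernel_op_inner_L2[of log_ratio] prim_def by (rule adjoint[OF volterra_bounded_kernel assms(1) log_ratio_L2])
  also have "\<dots> = (\<integral>z. x_ln_sum x 1 * \<phi> z - x_ln_sum x z * \<phi> z \<partial>I)"
    unfolding inner_L2_def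
  proof (rule Bochner_Integration.integral_cong[OF refl])
    fix z assume "z \<in> space I"
    then have "kernel_op (\<lambda>x y. volterra y x) (log_ratio x) z = x_ln_sum x 1 - x_ln_sum x z" using integral_from_log_ratio[OF assms(3)] by simp
    then show "kernel_op (\<lambda>x y. volterra y x) (log_ratio x) z * \<phi> z = x_ln_sum x 1 * \<phi> z - x_ln_sum x z * \<phi> z"
      by (simp only: left_diff_distrib)
  qed
  also have "\<dots> = x_ln_sum x 1 * (\<integral>z. \<phi> z \<partial>I) - inner_L2 I (x_ln_sum x) \<phi>"
    using L2_mult_integrable[OF L2_I_continuous[OF x_ln_sum_cont[of _ x]] assms(1)] L2_I_integrable[OF assms(1)]
    unfolding inner_L2_def by simp
  also have "\<dots> = - inner_L2 I (x_ln_sum x) \<phi>" using assms(2) by (simp add: prim_1)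
  finally show ?thesis using prim_neg_hilbert[OF assms] by simp
qed

text \<open>The commutator of the Hilbert transform with multiplication by \<open>x\<close>, in a form free of
  singular integrals.\<close>
lemma x_neg_hilbert_prim:
  assumes "L2 I \<phi>" "prim \<phi> 1 = 0" "x \<in> {0..1}"
  shows "x * neg_hilbert \<phi> x - prim (neg_hilbert \<phi>) x = kernel_op log_ratio (\<lambda>y. y * \<phi> y) x / pi"
proof -
  have [simp]: "integrable I (\<lambda>y. x_ln_sum x y * \<phi> y)" "integrable I (\<lambda>y. log_kernel x y * \<phi> y)"
    by (rule L2_mult_integrable[OF L2_I_continuous[OF x_ln_sum_cont] assms(1)]) (rule L2_mult_integrable[OF log_kernel_L2 assms(1)])
  have "pi * (x * neg_hilbert \<phi> x - prim (neg_hilbert \<phi>) x) = inner_L2 I (x_ln_sum x) \<phi> - x * kernel_op log_kernel \<phi> x"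
    by (simp add: prim_neg_hilbert[OF assms] neg_hilbert_def field_simps)
  also have "\<dots> = (\<integral>y. x_ln_sum x y * \<phi> y - x * (log_kernel x y * \<phi> y) \<partial>I)" by (simp add: inner_L2_def kernel_op_def)
  also have "\<dots> = (\<integral>y. log_ratio x y * (y * \<phi> y) \<partial>I)"
    by (intro Bochner_Integration.integral_cong)
      (auto simp: x_ln_sum_def x_ln_def log_kernel_def log_ratio_def log_plus_def log_minus_def algebra_simps)
  finally show ?thesis by (simp add: kernel_op_def field_simps)
qed

lemma second_moment:
  assumes "L2 I \<phi>" "prim \<phi> 1 = 0"
  shows "(\<integral>z. z\<^sup>2 * \<phi> z \<partial>I) = - 2 * (\<integral>x. x * prim \<phi> x \<partial>I)"
proof -
  have c: "L2 I (\<lambda>x::real. 2 * x)" "L2 I (\<lambda>x::real. x\<^sup>2)"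
    by (intro L2_I_continuous continuous_intros)+
  have "inner_L2 I (\<lambda>x. 2 * x) (kernel_op volterra \<phi>) = inner_L2 I (kernel_op (\<lambda>x y. volterra y x) (\<lambda>x. 2 * x)) \<phi>"
    by (rule adjoint[OF volterra_bounded_kernel assms(1) c(1)])
  also have "\<dots> = (\<integral>z. 1 * \<phi> z - z\<^sup>2 * \<phi> z \<partial>I)"
    unfolding inner_L2_def
  proof (rule Bochner_Integration.integral_cong[OF refl])
    fix z assume z: "z \<in> space I"
    have "kernel_op (\<lambda>x y. volterra y x) (\<lambda>x. 2 * x) z = 1\<^sup>2 - z\<^sup>2"
      by (rule FTC_from[of "{}"]) (use z L2_I_integrable[OF c(1)] in \<open>auto intro!: continuous_intros derivative_eq_intros\<close>)
    then show "kernel_op (\<lambda>x y. volterra y x) (\<lambda>x. 2 * x) z * \<phi> z = 1 * \<phi> z - z\<^sup>2 * \<phi> z" by (simp only: left_diff_distrib power_one)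
  qed
  also have "\<dots> = - (\<integral>z. z\<^sup>2 * \<phi> z \<partial>I)"
    using L2_I_integrable[OF assms(1)] L2_mult_integrable[OF c(2) assms(1)] assms(2) by (simp add: prim_1)
  finally show ?thesis by (simp add: inner_L2_def prim_def mult.assoc)
qed

lemma prim_cong_AE:
  assumes "L2 I f" "L2 I g" "AE x in I. f x = g x" "x \<in> {0..1}" shows "prim f x = prim g x"
  unfolding prim_def by (rule kernel_op_cong_AE[OF volterra_bounded_kernel assms])

lemma prim_const_lin:
  assumes "L2 I \<phi>" "x \<in> {0..1}" shows "prim (\<lambda>y. c + l * \<phi> y) x = c * x + l * prim \<phi> x"
proof -
  have "prim (\<lambda>y. c * 1 + l * \<phi> y) x = c * prim (\<lambda>_. 1) x + l * prim \<phi> x"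
    unfolding prim_def by (rule kernel_op_lin[OF volterra_bounded_kernel _ assms(1) assms(2)]) (auto intro!: L2_I_continuous continuous_intros)
  moreover have "prim (\<lambda>_. 1) x = x - 0"
    by (rule FTC_prim[of "{}"]) (use assms(2) in \<open>auto intro!: continuous_intros derivative_eq_intros\<close>)
  ultimately show ?thesis by simp
qed

text \<open>The multiplier \<open>x \<phi>\<close>. Pairing \<open>f = prim \<phi>\<close> with \<open>log_ratio
  (x \<phi>)\<close> can be evaluated in two ways, because \<open>log_ratio\<close> is symmetric:
  \<open>x_neg_hilbert_prim\<close> expresses the operator on \<open>x \<phi>\<close> through the equation, and
  \<open>prim_neg_hilbert_log_ratio\<close> does so for the operator on \<open>f\<close>. The terms
  \<open>\<integral> x \<phi> f\<close> cancel.\<close>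
lemma pohozaev:
  assumes \<phi>: "L2 I \<phi>" and 0: "prim \<phi> 1 = 0" and eq: "AE x in I. neg_hilbert \<phi> x = c + l * \<phi> x"
  shows "l * (\<integral>x. (prim \<phi> x)\<^sup>2 \<partial>I) = 2 * c * (\<integral>x. x * prim \<phi> x \<partial>I)"
proof -
  have gen1: "b = - d" if "a - b = d + a" for a b d :: real using that by linarith
  have gen2: "- (c * (- 2 * y)) = 2 * c * y" for y :: real by simp
  let ?f = "prim \<phi>"
  have f: "L2 I ?f" by (rule prim_L2[OF \<phi>])
  have x\<phi>: "L2 I (\<lambda>x. x * \<phi> x)" by (rule L2_id_mult[OF \<phi>])
  have log_ratio: "bounded_kernel log_ratio" by (rule L2kernelD(1)[OF log_ratio_L2kernel])
  have cl: "L2 I (\<lambda>x. c + l * \<phi> x)"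
    using L2_lin[OF L2_I_continuous[of "\<lambda>_. 1"] \<phi>, of c l] by (simp add: continuous_intros)
  have p: "prim (neg_hilbert \<phi>) x = c * x + l * ?f x" if "x \<in> {0..1}" for x
    using prim_cong_AE[OF neg_hilbert_L2[OF \<phi>] cl eq that] prim_const_lin[OF \<phi> that] by simp
  have [simp]: "integrable I (\<lambda>x. ?f x * ?f x)" "integrable I (\<lambda>x. x\<^sup>2 * \<phi> x)" "integrable I (\<lambda>x. x * \<phi> x * ?f x)"
    using L2_mult_integrable[OF f f] L2_mult_integrable[OF x\<phi> f] L2_I_integrable[OF L2_id_mult[OF x\<phi>]]
    by (simp_all add: power2_eq_square mult.assoc)
  have "inner_L2 I ?f (kernel_op log_ratio (\<lambda>x. x * \<phi> x)) = inner_L2 I (kernel_op log_ratio ?f) (\<lambda>x. x * \<phi> x)"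
  proof -
    have "(\<lambda>x y. log_ratio y x) = log_ratio" by (intro ext) (rule log_ratio_sym)
    then show ?thesis using adjoint[OF log_ratio x\<phi> f] by simp
  qed
  (* First evaluation: the operator falls on f. *)
  moreover have "inner_L2 I (kernel_op log_ratio ?f) (\<lambda>x. x * \<phi> x) = (\<integral>x. pi * (c * (x\<^sup>2 * \<phi> x) + l * (x * \<phi> x * ?f x)) \<partial>I)"
    unfolding inner_L2_def
  proof (rule Bochner_Integration.integral_cong[OF refl])
    fix x assume "x \<in> space I"
    then have "kernel_op log_ratio ?f x = pi * (c * x + l * ?f x)" using prim_neg_hilbert_log_ratio[OF \<phi> 0, of x] p[of x] by (simp add: field_simps)
    then show "kernel_op log_ratio ?f x * (x * \<phi> x) = pi * (c * (x\<^sup>2 * \<phi> x) + l * (x * \<phi> x * ?f x))"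
      by (simp add: power2_eq_square algebra_simps)
  qed
  (* Second evaluation: the operator falls on x times the density. *)
  moreover have "inner_L2 I ?f (kernel_op log_ratio (\<lambda>x. x * \<phi> x)) = (\<integral>x. pi * (l * (x * \<phi> x * ?f x) - l * (?f x * ?f x)) \<partial>I)"
    unfolding inner_L2_def
  proof (rule integral_cong_AE)
    show "(\<lambda>x. ?f x * kernel_op log_ratio (\<lambda>x. x * \<phi> x) x) \<in> borel_measurable I"
      by (rule borel_measurable_integrable[OF L2_mult_integrable[OF f kernel_op_L2[OF log_ratio x\<phi>]]])
    show "(\<lambda>x. pi * (l * (x * \<phi> x * ?f x) - l * (?f x * ?f x))) \<in> borel_measurable I"
      by (rule borel_measurable_integrable) (intro integrable_mult_right Bochner_Integration.integrable_diff; simp)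
    have "AE x in I. x \<in> {0..1}" by (rule AE_I2) simp
    then show "AE x in I. ?f x * kernel_op log_ratio (\<lambda>x. x * \<phi> x) x = pi * (l * (x * \<phi> x * ?f x) - l * (?f x * ?f x))"
      using eq
    proof eventually_elim
      case (elim x)
      have k: "kernel_op log_ratio (\<lambda>x. x * \<phi> x) x = pi * (x * (c + l * \<phi> x) - (c * x + l * ?f x))"
        using x_neg_hilbert_prim[OF \<phi> 0 elim(1)] p[OF elim(1)] elim(2) by (simp add: field_simps)
      show ?case unfolding k by (simp add: algebra_simps)
    qed
  qed
  ultimately have "pi * (l * (\<integral>x. x * \<phi> x * ?f x \<partial>I) - l * (\<integral>x. ?f x * ?f x \<partial>I)) =
    pi * (c * (\<integral>x. x\<^sup>2 * \<phi> x \<partial>I) + l * (\<integral>x. x * \<phi> x * ?f x \<partial>I))"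
    by (simp only: Bochner_Integration.integral_mult_right_zero Bochner_Integration.integral_diff
        Bochner_Integration.integral_add integrable_mult_right
        \<open>integrable I (\<lambda>x. ?f x * ?f x)\<close> \<open>integrable I (\<lambda>x. x\<^sup>2 * \<phi> x)\<close> \<open>integrable I (\<lambda>x. x * \<phi> x * ?f x)\<close>)
  then have "l * (\<integral>x. x * \<phi> x * ?f x \<partial>I) - l * (\<integral>x. ?f x * ?f x \<partial>I) =
    c * (\<integral>x. x\<^sup>2 * \<phi> x \<partial>I) + l * (\<integral>x. x * \<phi> x * ?f x \<partial>I)"
    by (rule mult_left_cancel[OF pi_neq_zero, THEN iffD1])
  then have *: "l * (\<integral>x. ?f x * ?f x \<partial>I) = - (c * (\<integral>x. x\<^sup>2 * \<phi> x \<partial>I))" by (rule gen1)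
  have e: "(\<integral>x. (?f x)\<^sup>2 \<partial>I) = (\<integral>x. ?f x * ?f x \<partial>I)" unfolding power2_eq_square ..
  have "l * (\<integral>x. (?f x)\<^sup>2 \<partial>I) = l * (\<integral>x. ?f x * ?f x \<partial>I)" by (rule arg_cong[OF e])
  also have "\<dots> = - (c * (\<integral>x. x\<^sup>2 * \<phi> x \<partial>I))" by (rule *)
  also have "\<dots> = - (c * (- 2 * (\<integral>x. x * ?f x \<partial>I)))" by (rule arg_cong[OF second_moment[OF \<phi> 0]])
  also have "\<dots> = 2 * c * (\<integral>x. x * ?f x \<partial>I)" by (rule gen2)
  finally show ?thesis .
qed

section \<open>Primitives of continuous functions\<close>

lemma prim_integral:
  assumes "continuous_on {0..1} \<phi>" "x \<in> {0..1}" shows "prim \<phi> x = integral {0..x} \<phi>"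
proof -
  have "set_integrable lborel {0..1} \<phi>"
    using L2_I_integrable[OF L2_I_continuous[OF assms(1)]] by (simp add: integrable_I_iff)
  then have "set_integrable lborel {0..x} \<phi>" by (rule set_integrable_subset) (use assms(2) in auto)
  then show ?thesis using prim_set[OF assms(2)] set_borel_integral_eq_integral(2) by metis
qed

lemma prim_deriv_within:
  assumes "continuous_on {0..1} \<phi>" "x \<in> {0..1}"
  shows "(prim \<phi> has_real_derivative \<phi> x) (at x within {0..1})"
proof -
  have "((\<lambda>x. integral {0..x} \<phi>) has_real_derivative \<phi> x) (at x within {0..1})"
    by (rule integral_has_real_derivative[OF assms])
  then show ?thesis
    by (rule has_field_derivative_transform_within[of _ _ _ _ 1]) (use assms prim_integral[OF assms(1)] in auto)
qed

lemma prim_deriv: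
  assumes "continuous_on {0..1} \<phi>" "0 < x" "x < 1"
  shows "(prim \<phi> has_real_derivative \<phi> x) (at x)"
  using prim_deriv_within[OF assms(1), of x] assms(2,3) by (simp add: at_within_Icc_at)

lemma prim_continuous:
  assumes "continuous_on {0..1} \<phi>" shows "continuous_on {0..1} (prim \<phi>)"
  unfolding continuous_on_eq_continuous_within using DERIV_continuous[OF prim_deriv_within[OF assms]] by blast

lemma prim_0: assumes "continuous_on {0..1} \<phi>" shows "prim \<phi> 0 = 0"
  using prim_integral[OF assms, of 0] by simp

section \<open>The slope-drop kernel\<close>

text \<open>What \<open>log_ratio\<close> becomes when \<open>q = f / x - f'\<close> is taken as the unknown in
  place of \<open>f'\<close>, see \<open>log_ratio_y_recovered_deriv\<close>. Both the weight and
  \<open>log_ratio\<close> are symmetric; the value \<open>0\<close> on the diagonal and on the axes makes the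
  kernel nonnegative everywhere.\<close>
definition drop_kernel :: "real \<Rightarrow> real \<Rightarrow> real" where
  "drop_kernel x z = (if 0 < x \<and> 0 < z \<and> x \<noteq> z then ((x\<^sup>2 + z\<^sup>2) / (2 * x * z) * log_ratio x z - 1) / pi else 0)"

text \<open>Off the diagonal this is \<open>log_ratio x z - pi * drop_kernel x z\<close>. It takes values in
  \<open>[0, 1]\<close>, so the singularity of \<open>pi * drop_kernel\<close> is exactly that of
  \<open>log_ratio\<close>.\<close>
definition drop_remainder :: "real \<Rightarrow> real \<Rightarrow> real" where
  "drop_remainder x z = (if 0 < x \<and> 0 < z \<and> x \<noteq> z then 1 - (x - z)\<^sup>2 / (2 * x * z) * log_ratio x z else 0)"

lemma drop_kernel_sym: "drop_kernel x z = drop_kernel z x"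
proof -
  have e: "(x\<^sup>2 + z\<^sup>2) / (2 * x * z) = (z\<^sup>2 + x\<^sup>2) / (2 * z * x)" by (simp add: add.commute mult.commute mult.left_commute)
  show ?thesis unfolding drop_kernel_def e log_ratio_sym[of x z] by auto
qed

lemma drop_remainder_sym: "drop_remainder x z = drop_remainder z x"
proof -
  have "(x - z)\<^sup>2 = (z - x)\<^sup>2" "2 * x * z = 2 * z * x" by (simp_all add: power2_commute)
  then show ?thesis unfolding drop_remainder_def log_ratio_sym[of x z] by auto
qed

text \<open>With \<open>t = x / z\<close> the logarithm is \<open>2 artanh t\<close>.\<close>
lemma ln_ratio_bounds:
  assumes "0 < x" "x < (z::real)"
  shows "2 * x / z \<le> log_ratio x z" "log_ratio x z \<le> 2 * x / (z - x)"
proof -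
  define t where "t = x / z"
  have t: "0 < t" "t < 1" using assms by (auto simp: t_def)
  have L: "log_ratio x z = ln (1 + t) - ln (1 - t)"
  proof -
    have "ln (z + x) = ln z + ln (1 + t)" "ln (z - x) = ln z + ln (1 - t)"
    proof -
      have "z + x = z * (1 + t)" "z - x = z * (1 - t)" using assms by (simp_all add: t_def field_simps)
      then show "ln (z + x) = ln z + ln (1 + t)" "ln (z - x) = ln z + ln (1 - t)"
        using assms t by (simp_all add: ln_mult_pos)
    qed
    then show ?thesis using assms by (simp add: log_ratio_def log_plus_def log_minus_def add.commute)
  qed
  define h where "h s = ln (1 + s) - ln (1 - s) - 2 * s" for s :: real
  have "h 0 \<le> h t"
  proof (rule DERIV_nonneg_imp_nondecreasing[of 0 t h])
    fix s assume s: "0 \<le> s" "s \<le> t"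
    then have s1: "s < 1" using t by simp
    have "(h has_real_derivative 1 / (1 + s) + 1 / (1 - s) - 2) (at s)"
      unfolding h_def[abs_def] using s s1 by (auto intro!: derivative_eq_intros)
    moreover have "1 / (1 + s) + 1 / (1 - s) - 2 \<ge> 0"
    proof -
      have P: "(1 + s) * (1 - s) > 0" using s s1 by (intro mult_pos_pos) auto
      have "(1 + s) * (1 - s) \<le> 1" by (simp add: algebra_simps)
      have "1 / (1 + s) + 1 / (1 - s) = 2 / ((1 + s) * (1 - s))" using s s1 by (simp add: add_frac_eq)
      moreover have "2 / ((1 + s) * (1 - s)) \<ge> 2" using P \<open>(1 + s) * (1 - s) \<le> 1\<close> by (simp add: le_divide_eq)
      ultimately show ?thesis by simp
    qed
    ultimately show "\<exists>y. (h has_real_derivative y) (at s) \<and> 0 \<le> y" by auto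
  qed (use t in auto)
  then show "2 * x / z \<le> log_ratio x z" unfolding L by (simp add: h_def t_def)
  have "log_ratio x z = ln (1 + 2 * x / (z - x))"
  proof -
    have "1 + 2 * x / (z - x) = (z + x) / (z - x)" using assms by (simp add: field_simps)
    then show ?thesis using assms by (simp add: log_ratio_def log_plus_def log_minus_def ln_div add.commute)
  qed
  also have "\<dots> \<le> 2 * x / (z - x)" using assms by (intro ln_add_one_self_le_self) auto
  finally show "log_ratio x z \<le> 2 * x / (z - x)" .
qed

text \<open>Positivity is \<open>log_ratio x z \<ge> 2 x / z\<close> for \<open>x < z\<close>, and
  \<open>(x\<^sup>2 + z\<^sup>2) / (2 x z) * 2 x / z > 1\<close>.\<close>
lemma drop_kernel_pos: assumes "0 < x" "0 < z" "x \<noteq> z" shows "0 < drop_kernel x z"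
proof -
  have *: "0 < drop_kernel x z" if "0 < x" "x < z" for x z
  proof -
    have "1 < (x\<^sup>2 + z\<^sup>2) / (2 * x * z) * (2 * x / z)"
      using that by (simp add: field_simps power2_eq_square)
    also have "\<dots> \<le> (x\<^sup>2 + z\<^sup>2) / (2 * x * z) * log_ratio x z"
      using ln_ratio_bounds(1)[OF that] that by (intro mult_left_mono) auto
    finally show ?thesis using that by (simp add: drop_kernel_def)
  qed
  show ?thesis using *[of x z] *[of z x] assms drop_kernel_sym[of x z] by (cases "x < z") auto
qed

lemma drop_kernel_nonneg: "0 \<le> drop_kernel x z"
  using drop_kernel_pos[of x z] by (cases "0 < x \<and> 0 < z \<and> x \<noteq> z") (auto simp: drop_kernel_def)

lemma drop_remainder_bounds: "0 \<le> drop_remainder x z" "drop_remainder x z \<le> 1" "0 \<le> x \<Longrightarrow> 0 < z \<Longrightarrow> drop_remainder x z \<le> 2 * x / z"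
proof -
  have *: "0 \<le> drop_remainder x z" "drop_remainder x z \<le> 1" "drop_remainder x z \<le> 2 * x / z" if xz: "0 < x" "x < z" for x z
  proof -
    let ?c = "(x - z)\<^sup>2 / (2 * x * z)"
    have c: "0 \<le> ?c" using xz by simp
    have R: "drop_remainder x z = 1 - ?c * log_ratio x z" using xz by (simp add: drop_remainder_def)
    have "?c * log_ratio x z \<le> ?c * (2 * x / (z - x))" using ln_ratio_bounds(2)[OF xz] c by (rule mult_left_mono)
    also have "?c * (2 * x / (z - x)) = (z - x) / z"
    proof -
      have "(d * d) / (2 * x * z) * (2 * x / d) = d / z" if "d \<noteq> 0" for d
        using that xz by (simp add: field_simps)
      moreover have "(x - z)\<^sup>2 = (z - x) * (z - x)" by (simp add: power2_eq_square algebra_simps)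
      ultimately show ?thesis using xz by simp
    qed
    also have "\<dots> \<le> 1" using xz by simp
    finally show "0 \<le> drop_remainder x z" by (simp add: R)
    have "?c * (2 * x / z) \<le> ?c * log_ratio x z" using ln_ratio_bounds(1)[OF xz] c by (rule mult_left_mono)
    moreover have "?c * (2 * x / z) = (z - x)\<^sup>2 / z\<^sup>2"
      using xz by (simp add: power2_eq_square field_simps)
    moreover have "1 - (z - x)\<^sup>2 / z\<^sup>2 = 2 * x / z - x\<^sup>2 / z\<^sup>2"
      using xz by (simp add: power2_eq_square field_simps)
    moreover have "0 \<le> x\<^sup>2 / z\<^sup>2" "0 \<le> (z - x)\<^sup>2 / z\<^sup>2" by simp_all
    ultimately show "drop_remainder x z \<le> 1" "drop_remainder x z \<le> 2 * x / z" unfolding R by linarith+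
  qed
  have trivial: "drop_remainder x z = 0" if "\<not> (0 < x \<and> 0 < z \<and> x \<noteq> z)" for x z using that by (auto simp: drop_remainder_def)
  show 1: "0 \<le> drop_remainder x z" "drop_remainder x z \<le> 1"
    using *(1,2)[of x z] *(1,2)[of z x] trivial[of x z] drop_remainder_sym[of x z]
    by (cases "0 < x \<and> 0 < z \<and> x \<noteq> z"; cases "x < z"; force)+
  show "drop_remainder x z \<le> 2 * x / z" if "0 \<le> x" "0 < z"
  proof (cases "x < z")
    case True
    then show ?thesis using *(3)[of x z] trivial[of x z] that by (cases "0 < x") auto
  next
    case False
    then have "1 \<le> x / z" using that by simp
    then show ?thesis using 1(2) by simp
  qed
qed

lemma AE_I_pos: "AE z in I. 0 < z \<and> z \<le> 1"
proof -
  have "AE z in I. z \<in> {0..1}" by (rule AE_I2) simp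
  then show ?thesis using AE_I_neq[of 0] by eventually_elim auto
qed

lemma drop_remainder_measurable: "(\<lambda>(x, y). drop_remainder x y) \<in> borel_measurable (I \<Otimes>\<^sub>M I)"
  unfolding drop_remainder_def log_ratio_def log_plus_def log_minus_def by measurable

lemma drop_kernel_measurable: "(\<lambda>(x, y). drop_kernel x y) \<in> borel_measurable (I \<Otimes>\<^sub>M I)"
  unfolding drop_kernel_def log_ratio_def log_plus_def log_minus_def by measurable

lemma measurable_section:
  "(\<lambda>(x, y). k x y) \<in> borel_measurable (I \<Otimes>\<^sub>M I) \<Longrightarrow> x \<in> {0..1} \<Longrightarrow> k x \<in> borel_measurable I"
proof -
  assume m: "(\<lambda>(x, y). k x y) \<in> borel_measurable (I \<Otimes>\<^sub>M I)" and "x \<in> {0..1}"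
  then show "k x \<in> borel_measurable I"
    using measurable_compose[OF measurable_Pair1'[of x I I] m] by simp
qed

text \<open>Pointwise convergence of the rows, off a null set, and dominated convergence. At \<open>x =
  0\<close> the bound \<open>2 x / z\<close> replaces the formula, which is singular there.\<close>
lemma drop_remainder_L2kernel: "L2kernel drop_remainder"
  unfolding L2kernel_def
proof (intro conjI ballI)
  show bounded_kernel: "bounded_kernel drop_remainder" by (rule bounded_kernelI[OF drop_remainder_measurable, of 1]) (use drop_remainder_bounds in auto)
  fix x :: real assume x: "x \<in> {0..1}"
  have m: "drop_remainder x \<in> borel_measurable I" if "x \<in> {0..1}" for x
    by (rule measurable_section[OF drop_remainder_measurable that])
  show "((\<lambda>x'. norm_L2 I (\<lambda>y. drop_remainder x' y - drop_remainder x y)) \<longlongrightarrow> 0) (at x within {0..1})"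
    unfolding tendsto_at_iff_sequentially
  proof (intro allI impI)
    fix X :: "nat \<Rightarrow> real" assume X: "\<forall>i. X i \<in> {0..1} - {x}" and lim: "X \<longlonglongrightarrow> x"
    have "(\<lambda>i. \<integral>y. (drop_remainder (X i) y - drop_remainder x y)\<^sup>2 \<partial>I) \<longlonglongrightarrow> (\<integral>y. 0 \<partial>I)"
    proof (rule integral_dominated_convergence[where w="\<lambda>_. 1"])
      show "(\<lambda>y. (drop_remainder (X i) y - drop_remainder x y)\<^sup>2) \<in> borel_measurable I" for i
        using m[of "X i"] m[OF x] X by (intro borel_measurable_power borel_measurable_diff) auto
      show "AE y in I. norm ((drop_remainder (X i) y - drop_remainder x y)\<^sup>2) \<le> 1" for i
      proof (rule AE_I2)
        fix y
        have "\<bar>drop_remainder (X i) y - drop_remainder x y\<bar> \<le> 1" using drop_remainder_bounds(1,2)[of "X i" y] drop_remainder_bounds(1,2)[of x y] by linarith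
        then show "norm ((drop_remainder (X i) y - drop_remainder x y)\<^sup>2) \<le> 1" by (simp add: abs_square_le_1)
      qed
      show "AE y in I. (\<lambda>i. (drop_remainder (X i) y - drop_remainder x y)\<^sup>2) \<longlonglongrightarrow> 0"
        using AE_I_pos AE_I_neq[of x]
      proof eventually_elim
        case (elim y)
        have "(\<lambda>i. drop_remainder (X i) y) \<longlonglongrightarrow> drop_remainder x y"
        proof (cases "x = 0")
          case True
          have "(\<lambda>i. 2 * X i / y) \<longlonglongrightarrow> 2 * x / y" using lim elim by (intro tendsto_intros) auto
          then have l: "(\<lambda>i. 2 * X i / y) \<longlonglongrightarrow> 0" using True by simp
          have "(\<lambda>i. drop_remainder (X i) y) \<longlonglongrightarrow> 0"
            by (rule Lim_null_comparison[OF _ l]) (use drop_remainder_bounds elim X in auto)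
          then show ?thesis using True by (simp add: drop_remainder_def)
        next
          case False
          then have x0: "x > 0" using x by simp
          have ev: "\<forall>\<^sub>F i in sequentially. X i \<noteq> y" "\<forall>\<^sub>F i in sequentially. 0 < X i"
            using tendsto_imp_eventually_ne[OF lim, of y] order_tendstoD(1)[OF lim x0] elim by auto
          have "(\<lambda>i. 1 - (X i - y)\<^sup>2 / (2 * X i * y) * (ln \<bar>X i + y\<bar> - ln \<bar>X i - y\<bar>)) \<longlonglongrightarrow>
             1 - (x - y)\<^sup>2 / (2 * x * y) * (ln \<bar>x + y\<bar> - ln \<bar>x - y\<bar>)"
            using lim elim x0 by (intro tendsto_intros) auto
          moreover have "1 - (x - y)\<^sup>2 / (2 * x * y) * (ln \<bar>x + y\<bar> - ln \<bar>x - y\<bar>) = drop_remainder x y"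
            using x0 elim by (simp add: drop_remainder_def log_ratio_def log_plus_def log_minus_def)
          moreover have "\<forall>\<^sub>F i in sequentially. 1 - (X i - y)\<^sup>2 / (2 * X i * y) * (ln \<bar>X i + y\<bar> - ln \<bar>X i - y\<bar>) = drop_remainder (X i) y"
            using ev by eventually_elim (use elim in \<open>simp add: drop_remainder_def log_ratio_def log_plus_def log_minus_def\<close>)
          ultimately show ?thesis by (simp add: Lim_transform_eventually)
        qed
        then have "(\<lambda>i. (drop_remainder (X i) y - drop_remainder x y)\<^sup>2) \<longlonglongrightarrow> (drop_remainder x y - drop_remainder x y)\<^sup>2" by (intro tendsto_intros)
        then show ?case by simp
      qed
    qed auto
    then have "(\<lambda>i. sqrt (\<integral>y. (drop_remainder (X i) y - drop_remainder x y)\<^sup>2 \<partial>I)) \<longlonglongrightarrow> sqrt 0" by (intro tendsto_intros) simp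
    then show "((\<lambda>x'. norm_L2 I (\<lambda>y. drop_remainder x' y - drop_remainder x y)) \<circ> X) \<longlonglongrightarrow> 0"
      by (simp add: norm_L2_def comp_def)
  qed
qed

lemma drop_kernel_AE: assumes "0 \<le> x" shows "AE z in I. drop_kernel x z = (1 / pi) * log_ratio x z + (- 1 / pi) * drop_remainder x z"
  using AE_I_pos AE_I_neq[of x]
proof eventually_elim
  case (elim z)
  show ?case
  proof (cases "x = 0")
    case True
    then show ?thesis by (simp add: drop_kernel_def drop_remainder_def log_ratio_def log_plus_def log_minus_def)
  next
    case False
    then have "(x\<^sup>2 + z\<^sup>2) / (2 * x * z) = 1 + (x - z)\<^sup>2 / (2 * x * z)"
      using elim by (simp add: field_simps power2_eq_square)
    then have "(x\<^sup>2 + z\<^sup>2) / (2 * x * z) * log_ratio x z = log_ratio x z + (x - z)\<^sup>2 / (2 * x * z) * log_ratio x z"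
      by (simp only: distrib_right mult_1)
    then show ?thesis using elim False assms by (simp add: drop_kernel_def drop_remainder_def diff_divide_distrib add_divide_distrib)
  qed
qed

lemma drop_kernel_L2kernel: "L2kernel drop_kernel"
proof -
  define k where "k x z = (1 / pi) * log_ratio x z + (- 1 / pi) * drop_remainder x z" for x z
  have k: "L2kernel k" using L2kernel_lin[OF log_ratio_L2kernel drop_remainder_L2kernel, of "1 / pi" "- 1 / pi"] by (simp add: k_def[abs_def])
  obtain C where C: "\<And>x. x \<in> {0..1} \<Longrightarrow> L2 I (k x) \<and> norm_L2 I (k x) \<le> C" using bounded_kernelE[OF L2kernelD(1)[OF k]] by blast
  have m: "drop_kernel x \<in> borel_measurable I" if "x \<in> {0..1}" for x by (rule measurable_section[OF drop_kernel_measurable that])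
  have ae: "AE z in I. k x z = drop_kernel x z" if "x \<in> {0..1}" for x
    using drop_kernel_AE[of x] that by (auto simp: k_def elim: eventually_mono)
  have km: "k x \<in> borel_measurable I" if "x \<in> {0..1}" for x using C[OF that] by (simp add: L2_def)
  have nd: "norm_L2 I (\<lambda>y. k x' y - k x y) = norm_L2 I (\<lambda>y. drop_kernel x' y - drop_kernel x y)" if "x \<in> {0..1}" "x' \<in> {0..1}" for x x'
  proof (rule norm_L2_cong_AE)
    show "AE y in I. k x' y - k x y = drop_kernel x' y - drop_kernel x y"
      using ae[OF that(1)] ae[OF that(2)] by eventually_elim simp
  qed (use m km that in \<open>auto intro!: borel_measurable_diff\<close>)
  show ?thesis unfolding L2kernel_def bounded_kernel_def
  proof (intro conjI exI ballI)
    show "(\<lambda>(x, y). drop_kernel x y) \<in> borel_measurable (I \<Otimes>\<^sub>M I)" by (rule drop_kernel_measurable)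
    fix x :: real assume x: "x \<in> {0..1}"
    show "L2 I (drop_kernel x)" using C[OF x] by (intro L2_cong_AE[OF _ m[OF x] ae[OF x]]) simp
    show "norm_L2 I (drop_kernel x) \<le> C" using C[OF x] norm_L2_cong_AE[OF km[OF x] m[OF x] ae[OF x]] by simp
    have ev: "\<forall>\<^sub>F x' in at x within {0..1}. norm_L2 I (\<lambda>y. k x' y - k x y) = norm_L2 I (\<lambda>y. drop_kernel x' y - drop_kernel x y)"
      unfolding eventually_at_filter using nd[OF x] by (intro always_eventually) simp
    show "((\<lambda>x'. norm_L2 I (\<lambda>y. drop_kernel x' y - drop_kernel x y)) \<longlongrightarrow> 0) (at x within {0..1})"
      by (rule Lim_transform_eventually[OF L2kernelD(2)[OF k x] ev])
  qed
qed

lemma drop_kernel_L2: assumes "x \<in> {0..1}" shows "L2 I (drop_kernel x)"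
proof -
  obtain C where "\<And>x. x \<in> {0..1} \<Longrightarrow> L2 I (drop_kernel x) \<and> norm_L2 I (drop_kernel x) \<le> C" using bounded_kernelE[OF L2kernelD(1)[OF drop_kernel_L2kernel]] by blast
  then show ?thesis using assms by blast
qed

section \<open>Recovering a function from its slope drop\<close>

definition slope_kernel :: "real \<Rightarrow> real \<Rightarrow> real" where "slope_kernel y z = (if y \<le> z \<and> 0 < z then 1 / z else 0)"
text \<open>If \<open>q = f / x - f'\<close> and \<open>f 1 = 0\<close>, then \<open>f / x =
  \<integral>\<^sub>x\<^sup>1 q z / z dz\<close>. So \<open>chord_slope q\<close> recovers \<open>f / x\<close>,
  and \<open>recovered_deriv q\<close> recovers \<open>f'\<close>.\<close>
definition chord_slope :: "(real \<Rightarrow> real) \<Rightarrow> real \<Rightarrow> real" where "chord_slope q = kernel_op slope_kernel q"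
definition recovered_deriv :: "(real \<Rightarrow> real) \<Rightarrow> real \<Rightarrow> real" where "recovered_deriv q y = chord_slope q y - q y"

context
  fixes q :: "real \<Rightarrow> real"
  assumes q: "continuous_on {0..1} q"
begin

lemma chord_slope_integral: assumes "0 < y" "y \<le> 1" shows "chord_slope q y = integral {y..1} (\<lambda>z. q z / z)"
proof -
  have c: "continuous_on {y..1} (\<lambda>z. q z / z)"
    using assms by (intro continuous_intros continuous_on_subset[OF q]) auto
  have "set_integrable lborel {y..1} (\<lambda>z. q z / z)" by (rule borel_integrable_atLeastAtMost') (rule c)
  moreover have "chord_slope q y = (LBINT s. indicator {0..1} s * (slope_kernel y s * q s))"
    by (simp add: chord_slope_def kernel_op_def integral_restrict_space)
  moreover have "\<dots> = (LBINT s:{y..1}. q s / s)"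
    unfolding set_lebesgue_integral_def using assms
    by (intro Bochner_Integration.integral_cong) (auto simp: slope_kernel_def indicator_def)
  ultimately show ?thesis by (simp add: set_borel_integral_eq_integral(2))
qed

lemma chord_slope_1: "chord_slope q 1 = 0"
  using chord_slope_integral[of 1] by simp

lemma chord_slope_deriv_within:
  assumes "0 < a" "a \<le> 1" "y \<in> {a..1}"
  shows "(chord_slope q has_real_derivative - q y / y) (at y within {a..1})"
proof -
  have c: "continuous_on {a..1} (\<lambda>z. q z / z)"
    using assms by (intro continuous_intros continuous_on_subset[OF q]) auto
  have int: "(\<lambda>z. q z / z) integrable_on {a..1}" by (rule integrable_continuous_real[OF c])
  have "((\<lambda>x. integral {a..1} (\<lambda>z. q z / z) - integral {a..x} (\<lambda>z. q z / z)) has_real_derivative 0 - q y / y) (at y within {a..1})"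
    by (intro DERIV_diff DERIV_const integral_has_real_derivative[OF c assms(3)])
  then have "((\<lambda>x. integral {a..1} (\<lambda>z. q z / z) - integral {a..x} (\<lambda>z. q z / z)) has_real_derivative - q y / y) (at y within {a..1})"
    by simp
  then show ?thesis
  proof (rule has_field_derivative_transform_within[of _ _ _ _ 1])
    fix x assume "x \<in> {a..1}"
    then show "integral {a..1} (\<lambda>z. q z / z) - integral {a..x} (\<lambda>z. q z / z) = chord_slope q x"
      using Henstock_Kurzweil_Integration.integral_combine[of a x 1 "\<lambda>z. q z / z"] int chord_slope_integral[of x] assms by auto
  qed (use assms in auto)
qed

lemma chord_slope_deriv: assumes "0 < y" "y < 1" shows "(chord_slope q has_real_derivative - q y / y) (at y)"
  using chord_slope_deriv_within[of "y / 2" y] assms by (simp add: at_within_Icc_at)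

lemma chord_slope_continuous: "continuous_on {0<..1} (chord_slope q)"
  unfolding continuous_on_eq_continuous_within
proof
  fix y :: real assume y: "y \<in> {0<..1}"
  have "continuous (at y within {y/2..1}) (chord_slope q)"
    using chord_slope_deriv_within[of "y/2" y] y by (intro DERIV_continuous) auto
  moreover have "at y within {0<..1} = at y within {y/2..1}"
    by (rule at_within_nhd[of _ "{y/2<..<2}"]) (use y in auto)
  ultimately show "continuous (at y within {0<..1}) (chord_slope q)" by (simp add: continuous_within)
qed

text \<open>The chord slope may diverge logarithmically at \<open>0\<close>; this is still
  square-integrable.\<close>
lemma chord_slope_bound: "\<exists>B\<ge>0. \<forall>y\<in>{0<..1}. \<bar>chord_slope q y\<bar> \<le> B * - ln y"
proof -
  obtain B where B: "\<And>x. x \<in> {0..1} \<Longrightarrow> \<bar>q x\<bar> \<le> B"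
    using compact_imp_bounded[OF compact_continuous_image[OF q]] unfolding bounded_iff by force
  have B0: "B \<ge> 0" using B[of 0] by simp
  have "\<bar>chord_slope q y\<bar> \<le> B * - ln y" if y: "y \<in> {0<..1}" for y
  proof -
    have c: "continuous_on {y..1} (\<lambda>z. q z / z)"
      using y by (intro continuous_intros continuous_on_subset[OF q]) auto
    have I: "((\<lambda>z. B / z) has_integral (B * ln 1 - B * ln y)) {y..1}"
      by (rule fundamental_theorem_of_calculus)
        (use y in \<open>auto intro!: derivative_eq_intros simp: has_real_derivative_iff_has_vector_derivative[symmetric]\<close>)
    have "norm (integral {y..1} (\<lambda>z. q z / z)) \<le> integral {y..1} (\<lambda>z. B / z)"
      by (rule integral_norm_bound_integral[OF integrable_continuous_real[OF c] has_integral_integrable[OF I]])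
        (use y B in \<open>auto simp: abs_div intro!: divide_right_mono\<close>)
    then show ?thesis using chord_slope_integral[of y] y integral_unique[OF I] by simp
  qed
  then show ?thesis using B0 by blast
qed

lemma L2_D: "L2 M f \<Longrightarrow> integrable M (\<lambda>x. (f x)\<^sup>2)"
  by (simp add: L2_def)

lemma recovered_deriv_L2: "L2 I (recovered_deriv q)"
proof -
  obtain B where B1: "B \<ge> 0" "\<forall>y\<in>{0<..1}. \<bar>chord_slope q y\<bar> \<le> B * - ln y" using chord_slope_bound by (elim exE conjE)
  have B: "B \<ge> 0" "\<And>y. y \<in> {0<..1} \<Longrightarrow> \<bar>chord_slope q y\<bar> \<le> B * - ln y" by (rule B1(1)) (rule bspec[OF B1(2)])
  have "(\<lambda>(x, y). slope_kernel x y) \<in> borel_measurable (I \<Otimes>\<^sub>M I)" unfolding slope_kernel_def by measurable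
  then have m: "chord_slope q \<in> borel_measurable I"
    unfolding chord_slope_def by (rule kernel_op_measurable[OF _ continuous_on_measurable_I[OF q]])
  have L: "L2 I (\<lambda>y. ln \<bar>0 - y\<bar>)" by (rule ln_L2)
  have "L2 I (chord_slope q)" unfolding L2_def
  proof
    show "integrable I (\<lambda>x. (chord_slope q x)\<^sup>2)"
    proof (rule Bochner_Integration.integrable_bound[of _ "\<lambda>y. B\<^sup>2 * (ln \<bar>0 - y\<bar>)\<^sup>2"])
      show "integrable I (\<lambda>y. B\<^sup>2 * (ln \<bar>0 - y\<bar>)\<^sup>2)" by (rule integrable_mult_right, rule L2_D[OF L])
      show "(\<lambda>x. (chord_slope q x)\<^sup>2) \<in> borel_measurable I" using m by (rule borel_measurable_power)
      show "AE x in I. norm ((chord_slope q x)\<^sup>2) \<le> norm (B\<^sup>2 * (ln \<bar>0 - x\<bar>)\<^sup>2)"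
        using AE_I_pos
      proof eventually_elim
        case (elim y)
        have "\<bar>chord_slope q y\<bar>\<^sup>2 \<le> (B * - ln y)\<^sup>2"
          by (rule power_mono[OF B(2)]) (use elim in auto)
        also have "\<dots> = B\<^sup>2 * (ln \<bar>0 - y\<bar>)\<^sup>2" using elim by (simp add: power_mult_distrib)
        finally show ?case by simp
      qed
    qed
  qed (rule m)
  then show ?thesis unfolding recovered_deriv_def[abs_def] by (rule L2_diff[OF _ L2_I_continuous[OF q]])
qed

lemma prim_recovered_deriv: assumes "x \<in> {0..1}" shows "prim (recovered_deriv q) x = x * chord_slope q x"
proof -
  obtain B where B1: "B \<ge> 0" "\<forall>y\<in>{0<..1}. \<bar>chord_slope q y\<bar> \<le> B * - ln y" using chord_slope_bound by (elim exE conjE)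
  have B: "B \<ge> 0" "\<And>y. y \<in> {0<..1} \<Longrightarrow> \<bar>chord_slope q y\<bar> \<le> B * - ln y" by (rule B1(1)) (rule bspec[OF B1(2)])
  define F where "F y = y * chord_slope q y" for y
  have c: "continuous_on {0..1} F"
    unfolding continuous_on_def
  proof
    fix y :: real assume y: "y \<in> {0..1}"
    show "(F \<longlongrightarrow> F y) (at y within {0..1})"
    proof (cases "y = 0")
      case True
      have "(x_ln \<longlongrightarrow> x_ln 0) (at 0 within {0..1})" using x_ln_cont[of "{0..1}"] by (auto simp: continuous_on_def)
      then have "((\<lambda>u. B * \<bar>x_ln u\<bar>) \<longlongrightarrow> B * \<bar>x_ln 0\<bar>) (at 0 within {0..1})"
        by (intro tendsto_intros)
      then have l: "((\<lambda>u. B * \<bar>x_ln u\<bar>) \<longlongrightarrow> 0) (at 0 within {0..1})" by (simp add: x_ln_def)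
      have b: "norm (F u) \<le> B * \<bar>x_ln u\<bar>" if "u \<in> {0..1}" for u
      proof (cases "u = 0")
        case False
        then have "\<bar>F u\<bar> = u * \<bar>chord_slope q u\<bar>" using that by (simp add: F_def abs_mult)
        also have "\<dots> \<le> u * (B * - ln u)" using False that by (intro mult_left_mono B(2)) auto
        also have "\<dots> \<le> B * \<bar>x_ln u\<bar>" using False that by (simp add: x_ln_def abs_mult)
        finally show ?thesis by simp
      qed (simp add: F_def x_ln_def)
      have "(F \<longlongrightarrow> 0) (at 0 within {0..1})"
        by (rule Lim_null_comparison[OF _ l]) (use b in \<open>auto simp: eventually_at_filter\<close>)
      then show ?thesis using True by (simp add: F_def)
    next
      case False
      have "continuous_on {0<..1} F" unfolding F_def[abs_def] by (intro continuous_intros chord_slope_continuous)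
      then have "(F \<longlongrightarrow> F y) (at y within {0<..1})" using y False by (auto simp: continuous_on_def)
      moreover have "at y within {0<..1} = at y within {0..1}"
        by (rule at_within_nhd[of _ "{0<..}"]) (use y False in auto)
      ultimately show ?thesis by simp
    qed
  qed
  have "prim (recovered_deriv q) x = F x - F 0"
  proof (rule FTC_prim[of "{}"])
    show "continuous_on {0..x} F" using c by (rule continuous_on_subset) (use assms in auto)
    fix s assume s: "s \<in> {0<..<x} - {}"
    have "((\<lambda>y. y * chord_slope q y) has_real_derivative 1 * chord_slope q s + (- q s / s) * s) (at s)"
      using s assms by (intro DERIV_mult DERIV_ident chord_slope_deriv) auto
    then show "(F has_real_derivative recovered_deriv q s) (at s)" using s by (simp add: F_def[abs_def] recovered_deriv_def)
  qed (use assms L2_I_integrable[OF recovered_deriv_L2] in auto)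
  then show ?thesis by (simp add: F_def)
qed

lemma prim_recovered_deriv_1: "prim (recovered_deriv q) 1 = 0"
  using prim_recovered_deriv[of 1] chord_slope_1 by simp

text \<open>This is where \<open>drop_kernel\<close> comes from. By the adjoint, the left side is the integral
  of \<open>q\<close> against \<open>(1 / z) \<integral>\<^sub>0\<^sup>z y log_ratio x y dy - z log_ratio x
  z\<close>, and the inner integral is elementary: \<open>(z\<^sup>2 - x\<^sup>2) / 2 * log_ratio x z + x
  z\<close>.\<close>
lemma log_ratio_y_recovered_deriv: assumes x: "x \<in> {0..1}" shows "kernel_op log_ratio (\<lambda>y. y * recovered_deriv q y) x = - pi * x * kernel_op drop_kernel q x"
proof (cases "x = 0")
  case True
  then show ?thesis by (simp add: kernel_op_def log_ratio_def log_plus_def log_minus_def)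
next
  case False
  then have x0: "0 < x" using x by simp
  have qL: "L2 I q" by (rule L2_I_continuous[OF q])
  have yq: "L2 I (\<lambda>y. y * q y)" by (rule L2_id_mult[OF qL])
  have Lkb: "bounded_kernel log_ratio" by (rule L2kernelD(1)[OF log_ratio_L2kernel])
  define G where "G y z = (if y \<le> z \<and> 0 < z then y / z else 0)" for y z :: real
  have G1: "\<bar>G y z\<bar> \<le> 1" if "0 \<le> y" for y z using that by (simp add: G_def)
  have G: "bounded_kernel G"
  proof (rule bounded_kernelI[of _ 1])
    show "(\<lambda>(x, y). G x y) \<in> borel_measurable (I \<Otimes>\<^sub>M I)" unfolding G_def by measurable
  qed (use G1 in auto)
  have yg: "y * chord_slope q y = kernel_op G q y" for y
  proof -
    have "y * chord_slope q y = (\<integral>z. y * (slope_kernel y z * q z) \<partial>I)" unfolding chord_slope_def kernel_op_def by (rule integral_mult_right_zero[symmetric])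
    also have "\<dots> = kernel_op G q y" unfolding kernel_op_def
      by (intro Bochner_Integration.integral_cong) (auto simp: G_def slope_kernel_def)
    finally show ?thesis .
  qed
  have "kernel_op log_ratio (\<lambda>y. y * recovered_deriv q y) x = kernel_op log_ratio (\<lambda>y. 1 * kernel_op G q y + (-1) * (y * q y)) x"
    by (intro arg_cong[of _ _ "\<lambda>f. kernel_op log_ratio f x"] ext) (simp add: recovered_deriv_def right_diff_distrib yg)
  also have "\<dots> = kernel_op log_ratio (kernel_op G q) x - kernel_op log_ratio (\<lambda>y. y * q y) x"
    using kernel_op_lin[OF Lkb kernel_op_L2[OF G qL] yq x, of 1 "-1"] by simp
  also have "kernel_op log_ratio (kernel_op G q) x = inner_L2 I (kernel_op (\<lambda>x y. G y x) (log_ratio x)) q"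
    unfolding kernel_op_inner_L2[of log_ratio] by (rule adjoint[OF G qL log_ratio_L2])
  also have "kernel_op log_ratio (\<lambda>y. y * q y) x = inner_L2 I (\<lambda>y. y * log_ratio x y) q"
    unfolding kernel_op_def inner_L2_def by (intro Bochner_Integration.integral_cong) auto
  finally have 1: "kernel_op log_ratio (\<lambda>y. y * recovered_deriv q y) x = inner_L2 I (kernel_op (\<lambda>x y. G y x) (log_ratio x)) q - inner_L2 I (\<lambda>y. y * log_ratio x y) q" .
  have GT: "bounded_kernel (\<lambda>x y. G y x)"
  proof (rule bounded_kernelI[of _ 1])
    show "(\<lambda>(x, y). G y x) \<in> borel_measurable (I \<Otimes>\<^sub>M I)" unfolding G_def by measurable
  qed (use G1 in auto)
  have GL: "L2 I (kernel_op (\<lambda>x y. G y x) (log_ratio x))" by (rule kernel_op_L2[OF GT log_ratio_L2])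
  have yL: "L2 I (\<lambda>y. y * log_ratio x y)" by (rule L2_id_mult[OF log_ratio_L2])
  have NL: "L2 I (drop_kernel x)" by (rule drop_kernel_L2[OF x])
  have pr: "prim (\<lambda>y. y * log_ratio x y) z = (z\<^sup>2 - x\<^sup>2) / 2 * log_ratio x z + x * z" if z: "z \<in> {0..1}" for z
  proof -
    (* The primitive is written with x_ln so that it is visibly continuous across y = x. *)
    define F where "F y = ((y - x) * x_ln (x + y) + (x + y) * x_ln (x - y)) / 2 + x * y" for y
    have Feq: "F y = (y\<^sup>2 - x\<^sup>2) / 2 * log_ratio x y + x * y" for y
    proof -
      have "((y - x) * ((x + y) * a) + (x + y) * ((x - y) * b)) / 2 + x * y = (y\<^sup>2 - x\<^sup>2) / 2 * (a - b) + x * y" for a b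
        by (simp add: power2_eq_square field_simps)
      then show ?thesis unfolding F_def x_ln_def log_ratio_def log_plus_def log_minus_def .
    qed
    have "prim (\<lambda>y. y * log_ratio x y) z = F z - F 0"
    proof (rule FTC_prim[of "{x}"])
      show "continuous_on {0..z} F" unfolding F_def by (intro continuous_intros x_ln_cont_comp) auto
      fix s assume s: "s \<in> {0<..<z} - {x}"
      have "(F has_real_derivative ((1 * x_ln (x + s) + ((ln \<bar>x + s\<bar> + 1) * 1) * (s - x)) +
          (1 * x_ln (x - s) + ((ln \<bar>x - s\<bar> + 1) * (-1)) * (x + s))) / 2 + x) (at s)"
        unfolding F_def[abs_def] using s x0
        by (intro DERIV_add DERIV_cdivide DERIV_mult x_ln_deriv_comp) (auto intro!: derivative_eq_intros)
      moreover have "((1 * x_ln (x + s) + ((ln \<bar>x + s\<bar> + 1) * 1) * (s - x)) +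
          (1 * x_ln (x - s) + ((ln \<bar>x - s\<bar> + 1) * (-1)) * (x + s))) / 2 + x = s * log_ratio x s"
      proof -
        have "((1 * ((x + s) * a) + ((a + 1) * 1) * (s - x)) + (1 * ((x - s) * b) + ((b + 1) * (-1)) * (x + s))) / 2 + x = s * (a - b)" for a b
          by (simp add: field_simps)
        then show ?thesis unfolding x_ln_def log_ratio_def log_plus_def log_minus_def .
      qed
      ultimately show "(F has_real_derivative s * log_ratio x s) (at s)" by simp
    qed (use z L2_I_integrable[OF yL] in auto)
    then show ?thesis by (simp add: Feq log_ratio_def log_plus_def log_minus_def)
  qed
  have "inner_L2 I (kernel_op (\<lambda>x y. G y x) (log_ratio x)) q - inner_L2 I (\<lambda>y. y * log_ratio x y) q =
    inner_L2 I (\<lambda>z. 1 * kernel_op (\<lambda>x y. G y x) (log_ratio x) z + (-1) * (z * log_ratio x z)) q"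
    using inner_L2_lin[OF GL yL qL, of 1 "-1"] by simp
  also have "\<dots> = inner_L2 I (\<lambda>z. (- pi * x) * drop_kernel x z + 0 * drop_kernel x z) q"
  proof (rule inner_L2_cong_AE[OF L2_lin[OF GL yL] qL L2_lin[OF NL NL] qL])
    show "AE z in I. 1 * kernel_op (\<lambda>x y. G y x) (log_ratio x) z + - 1 * (z * log_ratio x z) = - pi * x * drop_kernel x z + 0 * drop_kernel x z"
      using AE_I_pos AE_I_neq[of x]
    proof eventually_elim
      case (elim z)
      have "kernel_op (\<lambda>x y. G y x) (log_ratio x) z = (\<integral>y. (1 / z) * (volterra z y * (y * log_ratio x y)) \<partial>I)"
        unfolding kernel_op_def using elim
        by (intro Bochner_Integration.integral_cong) (auto simp: G_def volterra_def)
      also have "\<dots> = (1 / z) * prim (\<lambda>y. y * log_ratio x y) z"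
        unfolding prim_def kernel_op_def by (rule integral_mult_right_zero)
      also have "\<dots> = (1 / z) * ((z\<^sup>2 - x\<^sup>2) / 2 * log_ratio x z + x * z)" using pr[of z] elim by simp
      finally have g: "kernel_op (\<lambda>x y. G y x) (log_ratio x) z = (1 / z) * ((z\<^sup>2 - x\<^sup>2) / 2 * log_ratio x z + x * z)" .
      have gen: "1 * a + - 1 * b = a - b" for a b :: real by simp
      have "(1 / z) * ((z\<^sup>2 - x\<^sup>2) / 2 * log_ratio x z + x * z) - z * log_ratio x z = - pi * x * drop_kernel x z + 0 * drop_kernel x z"
      proof -
        have "(1 / z) * ((z\<^sup>2 - x\<^sup>2) / 2 * L + x * z) - z * L = - pi * x * (((x\<^sup>2 + z\<^sup>2) / (2 * x * z) * L - 1) / pi)" for L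
          using elim x0 by (simp add: field_simps power2_eq_square)
        moreover have "drop_kernel x z = ((x\<^sup>2 + z\<^sup>2) / (2 * x * z) * log_ratio x z - 1) / pi" using elim x0 by (simp add: drop_kernel_def)
        ultimately show ?thesis by (simp only: mult_zero_left add_0_right)
      qed
      then show ?case unfolding g gen .
    qed
  qed simp
  also have "\<dots> = (- pi * x) * inner_L2 I (drop_kernel x) q" using inner_L2_lin[OF NL NL qL, of "- pi * x" 0] by simp
  finally show ?thesis using 1 by (simp add: kernel_op_inner_L2)
qed

end

section \<open>Eigenfunctions of symmetric compact kernels\<close>

lemma norm_L2_le_sup:
  assumes "L2 I f" "\<And>x. x \<in> {0..1} \<Longrightarrow> \<bar>f x\<bar> \<le> B" shows "norm_L2 I f \<le> B"
proof -
  have B: "0 \<le> B" using assms(2)[of 0] by simp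
  have "(\<integral>x. (f x)\<^sup>2 \<partial>I) \<le> (\<integral>x. B\<^sup>2 \<partial>I)"
  proof (rule integral_mono)
    show "integrable I (\<lambda>x. (f x)\<^sup>2)" using assms(1) by (simp add: L2_def)
    show "(f x)\<^sup>2 \<le> B\<^sup>2" if "x \<in> space I" for x
      using assms(2)[of x] that B by (intro abs_le_square_iff[THEN iffD1]) auto
  qed simp
  then show ?thesis unfolding norm_L2_def using B by (intro real_le_lsqrt) auto
qed

lemma continuous_norm_L2_0:
  assumes "continuous_on {0..1} f" "norm_L2 I f = 0" "x \<in> {0..1}" shows "f x = 0"
proof -
  have c: "continuous_on {0..1} (\<lambda>x. (f x)\<^sup>2)" using assms(1) by (intro continuous_intros)
  have "integrable I (\<lambda>x. (f x)\<^sup>2)" using L2_I_continuous[OF assms(1)] by (simp add: L2_def)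
  then have "integral {0..1} (\<lambda>x. (f x)\<^sup>2) = 0"
    using assms(2) set_borel_integral_eq_integral(2)[of "{0..1}" "\<lambda>x. (f x)\<^sup>2"]
    by (simp add: integrable_I_iff norm_L2_def integral_I_eq)
  then show ?thesis
    using integral_eq_0_iff[OF c] assms(3) by auto
qed

lemma kernel_op_sup_bound:
  assumes k: "bounded_kernel k"
  obtains C where "C > 0" "\<And>\<phi> x. L2 I \<phi> \<Longrightarrow> x \<in> {0..1} \<Longrightarrow> \<bar>kernel_op k \<phi> x\<bar> \<le> C * norm_L2 I \<phi>"
    "\<And>\<phi>. L2 I \<phi> \<Longrightarrow> norm_L2 I (kernel_op k \<phi>) \<le> C * norm_L2 I \<phi>"
proof -
  obtain C0 where C0: "\<And>x. x \<in> {0..1} \<Longrightarrow> L2 I (k x) \<and> norm_L2 I (k x) \<le> C0" using bounded_kernelE[OF k] by blast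
  define C where "C = \<bar>C0\<bar> + 1"
  have b: "\<bar>kernel_op k \<phi> x\<bar> \<le> C * norm_L2 I \<phi>" if "L2 I \<phi>" "x \<in> {0..1}" for \<phi> x
  proof -
    have "\<bar>kernel_op k \<phi> x\<bar> \<le> norm_L2 I (k x) * norm_L2 I \<phi>" unfolding kernel_op_inner_L2 using Cauchy_Schwarz_L2 C0[OF that(2)] that(1) by blast
    also have "\<dots> \<le> C * norm_L2 I \<phi>" using C0[OF that(2)] by (intro mult_right_mono norm_L2_nonneg) (auto simp: C_def)
    finally show ?thesis .
  qed
  moreover have "norm_L2 I (kernel_op k \<phi>) \<le> C * norm_L2 I \<phi>" if "L2 I \<phi>" for \<phi>
    by (rule norm_L2_le_sup[OF kernel_op_L2[OF k that] b[OF that]])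
  moreover have "C > 0" by (simp add: C_def)
  ultimately show ?thesis using that by blast
qed

text \<open>A maximising sequence for the operator norm \<open>M\<close> of \<open>A\<close> has, by
  compactness, images \<open>A f\<^sub>n\<close> that converge uniformly to some \<open>u \<noteq> 0\<close>
  with \<open>A (A u) = M\<^sup>2 u\<close>, because \<open>\<parallel>A (A f\<^sub>n) - M\<^sup>2
  f\<^sub>n\<parallel>\<close> tends to \<open>0\<close>. As \<open>(A - M) (A + M) u = 0\<close>, either
  \<open>A u + M u\<close> is an eigenfunction for \<open>M\<close>, or \<open>u\<close> is one for \<open>-
  M\<close>. For a nonnegative kernel, replacing \<open>f\<^sub>n\<close> by its absolute value only increases
  \<open>\<parallel>A f\<^sub>n\<parallel>\<close>, so \<open>u\<close> may be taken nonnegative, and the second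
  alternative is impossible.\<close>
theorem hilbert_eigen:
  assumes k: "L2kernel k" and sym: "\<And>x y. k x y = k y x"
    and nz: "L2 I \<phi>0" "x0 \<in> {0..1}" "kernel_op k \<phi>0 x0 \<noteq> 0"
  shows "\<exists>\<mu> w. \<mu> \<noteq> 0 \<and> continuous_on {0..1} w \<and> (\<exists>x\<in>{0..1}. w x \<noteq> 0) \<and>
    (\<forall>x\<in>{0..1}. kernel_op k w x = \<mu> * w x) \<and> ((\<forall>x y. 0 \<le> k x y) \<longrightarrow> 0 < \<mu> \<and> (\<forall>x\<in>{0..1}. 0 \<le> w x))"
proof -
  define A where "A = kernel_op k"
  have bk: "bounded_kernel k" by (rule L2kernelD(1)[OF k])
  have AL2: "L2 I (A \<phi>)" if "L2 I \<phi>" for \<phi> unfolding A_def by (rule kernel_op_L2[OF bk that])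
  have Ac: "continuous_on {0..1} (A \<phi>)" if "L2 I \<phi>" for \<phi> unfolding A_def by (rule kernel_op_continuous[OF k that])
  have Alin: "A (\<lambda>x. a * f x + b * g x) x = a * A f x + b * A g x" if "L2 I f" "L2 I g" "x \<in> {0..1}" for a b f g x
    unfolding A_def by (rule kernel_op_lin[OF bk that])
  have Acong: "A f x = A g x" if "\<And>y. y \<in> {0..1} \<Longrightarrow> f y = g y" for f g x
    unfolding A_def kernel_op_def using that by (intro Bochner_Integration.integral_cong) auto
  have Asym: "inner_L2 I \<psi> (A \<phi>) = inner_L2 I (A \<psi>) \<phi>" if "L2 I \<phi>" "L2 I \<psi>" for \<phi> \<psi>
  proof -
    have "(\<lambda>x y. k y x) = k" using sym by (intro ext) simp
    then show ?thesis using adjoint[OF bk that] unfolding A_def by simp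
  qed
  obtain C where C: "C > 0" and Cx: "\<And>\<phi> x. L2 I \<phi> \<Longrightarrow> x \<in> {0..1} \<Longrightarrow> \<bar>A \<phi> x\<bar> \<le> C * norm_L2 I \<phi>"
    and Cn: "\<And>\<phi>. L2 I \<phi> \<Longrightarrow> norm_L2 I (A \<phi>) \<le> C * norm_L2 I \<phi>"
    unfolding A_def using kernel_op_sup_bound[OF bk] by blast
  define X where "X = {norm_L2 I (A \<phi>) | \<phi>. L2 I \<phi> \<and> norm_L2 I \<phi> \<le> 1}"
  define M where "M = Sup X"
  have bdd: "bdd_above X"
  proof (rule bdd_aboveI[of _ C])
    fix v assume "v \<in> X"
    then obtain \<phi> where v: "v = norm_L2 I (A \<phi>)" "L2 I \<phi>" "norm_L2 I \<phi> \<le> 1" by (auto simp: X_def)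
    have "C * norm_L2 I \<phi> \<le> C * 1" using C v(3) by (intro mult_left_mono) auto
    then show "v \<le> C" using Cn[OF v(2)] v(1) by simp
  qed
  have zero: "L2 I (\<lambda>_. 0)" by (rule L2_I_continuous) (intro continuous_intros)
  have Xne: "X \<noteq> {}" using zero by (auto simp: X_def norm_L2_def intro!: exI[of _ "\<lambda>_. 0"])
  have nA: "norm_L2 I (A \<phi>) \<le> M * norm_L2 I \<phi>" if \<phi>: "L2 I \<phi>" for \<phi>
  proof (cases "norm_L2 I \<phi> = 0")
    case True
    then show ?thesis using Cn[OF \<phi>] by simp
  next
    case False
    then have n: "norm_L2 I \<phi> > 0" using norm_L2_nonneg[of I \<phi>] by simp
    let ?\<psi> = "\<lambda>x. (1 / norm_L2 I \<phi>) * \<phi> x + 0 * \<phi> x"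
    have \<psi>: "L2 I ?\<psi>" by (rule L2_lin[OF \<phi> \<phi>])
    have "norm_L2 I ?\<psi> = 1" using n norm_L2_scale[of I "1 / norm_L2 I \<phi>" \<phi>] by simp
    then have "norm_L2 I (A ?\<psi>) \<in> X" using \<psi> unfolding X_def by force
    then have "norm_L2 I (A ?\<psi>) \<le> M" unfolding M_def using bdd by (rule cSup_upper)
    moreover have "norm_L2 I (A ?\<psi>) = (1 / norm_L2 I \<phi>) * norm_L2 I (A \<phi>)"
    proof -
      have "norm_L2 I (A ?\<psi>) = norm_L2 I (\<lambda>x. (1 / norm_L2 I \<phi>) * A \<phi> x)"
        unfolding norm_L2_def using Alin[OF \<phi> \<phi>, of _ "1 / norm_L2 I \<phi>" 0]
        by (intro arg_cong[of _ _ sqrt] Bochner_Integration.integral_cong) (auto simp: norm_L2_def)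
      then show ?thesis using n norm_L2_scale[of I "1 / norm_L2 I \<phi>" "A \<phi>"] by simp
    qed
    ultimately have "(1 / norm_L2 I \<phi>) * norm_L2 I (A \<phi>) \<le> M" by (simp only:)
    then show ?thesis using n by (simp add: field_simps)
  qed
  have A0: "norm_L2 I (A \<phi>0) \<noteq> 0"
    using continuous_norm_L2_0[OF Ac[OF nz(1)] _ nz(2)] nz(3) by (auto simp: A_def)
  then have "0 < norm_L2 I (A \<phi>0)" using norm_L2_nonneg[of I "A \<phi>0"] by simp
  with nA[OF nz(1)] have "0 < M * norm_L2 I \<phi>0" by linarith
  then have M: "M > 0" using norm_L2_nonneg[of I \<phi>0] by (simp add: zero_less_mult_iff)
  have "\<exists>\<phi>. L2 I \<phi> \<and> norm_L2 I \<phi> \<le> 1 \<and> norm_L2 I (A \<phi>) > M - 1 / real (Suc n) \<and> ((\<forall>x y. 0 \<le> k x y) \<longrightarrow> (\<forall>x. 0 \<le> \<phi> x))" for n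
  proof -
    have "M - 1 / real (Suc n) < Sup X" by (simp add: M_def)
    then obtain v where "v \<in> X" "M - 1 / real (Suc n) < v" using less_cSup_iff[OF Xne bdd] by blast
    then obtain \<phi> where \<phi>: "L2 I \<phi>" "norm_L2 I \<phi> \<le> 1" "M - 1 / real (Suc n) < norm_L2 I (A \<phi>)" by (auto simp: X_def)
    show ?thesis
    proof (cases "\<forall>x y. 0 \<le> k x y")
      case False then show ?thesis using \<phi> by blast
    next
      case True
      have a: "L2 I (\<lambda>x. \<bar>\<phi> x\<bar>)" using \<phi>(1) unfolding L2_def by (intro conjI borel_measurable_abs) auto
      have "norm_L2 I (A \<phi>) \<le> norm_L2 I (A (\<lambda>x. \<bar>\<phi> x\<bar>))"
        unfolding norm_L2_def
      proof (intro real_sqrt_le_mono integral_mono)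
        show "integrable I (\<lambda>x. (A \<phi> x)\<^sup>2)" using AL2[OF \<phi>(1)] by (simp add: L2_def)
        show "integrable I (\<lambda>x. (A (\<lambda>x. \<bar>\<phi> x\<bar>) x)\<^sup>2)" using AL2[OF a] by (simp add: L2_def)
        fix x assume "x \<in> space I"
        have "\<bar>A \<phi> x\<bar> \<le> (\<integral>y. \<bar>k x y * \<phi> y\<bar> \<partial>I)" unfolding A_def kernel_op_def by (rule integral_abs_bound)
        also have "\<dots> = A (\<lambda>x. \<bar>\<phi> x\<bar>) x" unfolding A_def kernel_op_def using True by (simp add: abs_mult)
        finally have "\<bar>A \<phi> x\<bar> \<le> \<bar>A (\<lambda>x. \<bar>\<phi> x\<bar>) x\<bar>" by simp
        then show "(A \<phi> x)\<^sup>2 \<le> (A (\<lambda>x. \<bar>\<phi> x\<bar>) x)\<^sup>2" by (rule abs_le_square_iff[THEN iffD1])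
      qed
      moreover have "norm_L2 I (\<lambda>x. \<bar>\<phi> x\<bar>) = norm_L2 I \<phi>" by (simp add: norm_L2_def)
      ultimately show ?thesis using \<phi> a by (intro exI[of _ "\<lambda>x. \<bar>\<phi> x\<bar>"]) auto
    qed
  qed
  then obtain \<phi> where \<phi>: "\<And>n. L2 I (\<phi> n)" "\<And>n. norm_L2 I (\<phi> n) \<le> 1" "\<And>n. norm_L2 I (A (\<phi> n)) > M - 1 / real (Suc n)"
    and pos: "\<And>n x. \<forall>x y. 0 \<le> k x y \<Longrightarrow> 0 \<le> \<phi> n x" by metis
  obtain u and r :: "nat \<Rightarrow> nat" where uc: "continuous_on {0..1} u" and r: "strict_mono r"
    and unif: "\<And>e. 0 < e \<Longrightarrow> \<exists>N. \<forall>n x. n \<ge> N \<and> x \<in> {0..1} \<longrightarrow> norm (A (\<phi> (r n)) x - u x) < e"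
  proof (rule Arzela_Ascoli[of "{0..1::real}" "\<lambda>n. A (\<phi> n)" C])
    show "norm (A (\<phi> n) x) \<le> C" if "x \<in> {0..1}" for n x
    proof -
      have "C * norm_L2 I (\<phi> n) \<le> C * 1" using C \<phi>(2) by (intro mult_left_mono) auto
      then show ?thesis using Cx[OF \<phi>(1) that, of n] by simp
    qed
    show "\<exists>d>0. \<forall>n y. y \<in> {0..1} \<and> norm (x - y) < d \<longrightarrow> norm (A (\<phi> n) x - A (\<phi> n) y) < e"
      if "x \<in> {0..1}" "0 < e" for x e
    proof -
      have "\<forall>\<^sub>F x' in at x within {0..1}. norm_L2 I (\<lambda>y. k x' y - k x y) < e"
        using order_tendstoD(2)[OF L2kernelD(2)[OF k that(1)] that(2)] .
      then obtain d where d: "d > 0" "\<And>x'. x' \<in> {0..1} \<Longrightarrow> x' \<noteq> x \<Longrightarrow> dist x' x < d \<Longrightarrow> norm_L2 I (\<lambda>y. k x' y - k x y) < e"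
        unfolding eventually_at by auto
      have "norm (A (\<phi> n) x - A (\<phi> n) y) < e" if y: "y \<in> {0..1}" "norm (x - y) < d" for n y
      proof (cases "y = x")
        case True then show ?thesis using \<open>0 < e\<close> by simp
      next
        case False
        have "\<bar>A (\<phi> n) y - A (\<phi> n) x\<bar> \<le> norm_L2 I (\<lambda>z. k y z - k x z) * norm_L2 I (\<phi> n)"
          unfolding A_def by (rule kernel_op_diff_bound[OF bk \<open>x \<in> {0..1}\<close> y(1) \<phi>(1)])
        also have "\<dots> \<le> norm_L2 I (\<lambda>z. k y z - k x z) * 1" by (intro mult_left_mono \<phi>(2) norm_L2_nonneg)
        also have "\<dots> < e" using d(2)[of y] y False by (simp add: dist_real_def abs_minus_commute)
        finally show ?thesis by (simp add: abs_minus_commute)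
      qed
      then show ?thesis using d(1) by blast
    qed
  qed auto
  define f where "f n = \<phi> (r n)" for n
  define un where "un n = A (f n)" for n
  have fL: "L2 I (f n)" and fn: "norm_L2 I (f n) \<le> 1" for n using \<phi> by (auto simp: f_def)
  have unL: "L2 I (un n)" for n unfolding un_def by (rule AL2[OF fL])
  have uL: "L2 I u" by (rule L2_I_continuous[OF uc])
  have dL: "L2 I (\<lambda>x. u x - un n x)" for n by (rule L2_diff[OF uL unL])
  have conv: "(\<lambda>n. norm_L2 I (\<lambda>x. u x - un n x)) \<longlonglongrightarrow> 0"
  proof (rule LIMSEQ_I)
    fix e :: real assume e: "0 < e"
    obtain N where N: "\<And>n x. n \<ge> N \<Longrightarrow> x \<in> {0..1} \<Longrightarrow> norm (A (\<phi> (r n)) x - u x) < e / 2"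
      using unif[of "e / 2"] e by auto
    have "norm_L2 I (\<lambda>x. u x - un n x) \<le> e / 2" if "n \<ge> N" for n
      by (rule norm_L2_le_sup[OF dL]) (use N[OF that] in \<open>force simp: un_def f_def abs_minus_commute\<close>)
    then show "\<exists>no. \<forall>n\<ge>no. norm (norm_L2 I (\<lambda>x. u x - un n x) - 0) < e"
      using e norm_L2_nonneg by (intro exI[of _ N]) force
  qed
  have ptw: "(\<lambda>n. un n x) \<longlonglongrightarrow> u x" if "x \<in> {0..1}" for x
    unfolding LIMSEQ_iff un_def f_def using unif that by blast
  have nun: "(\<lambda>n. norm_L2 I (un n)) \<longlonglongrightarrow> M"
  proof (rule tendsto_sandwich)
    show "(\<lambda>n. M - 1 / real (Suc n)) \<longlonglongrightarrow> M"
      using tendsto_diff[OF tendsto_const LIMSEQ_inverse_real_of_nat, of M] by (simp add: inverse_eq_divide)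
    show "\<forall>\<^sub>F n in sequentially. M - 1 / real (Suc n) \<le> norm_L2 I (un n)"
    proof (rule always_eventually, rule allI)
      fix n
      have "n \<le> r n" using r by (rule seq_suble)
      then have "1 / real (Suc (r n)) \<le> 1 / real (Suc n)" by (simp add: frac_le)
      then show "M - 1 / real (Suc n) \<le> norm_L2 I (un n)" using \<phi>(3)[of "r n"] by (simp add: un_def f_def)
    qed
    show "\<forall>\<^sub>F n in sequentially. norm_L2 I (un n) \<le> M"
    proof (rule always_eventually, rule allI)
      fix n
      have "M * norm_L2 I (f n) \<le> M * 1" using M fn by (intro mult_left_mono) auto
      then show "norm_L2 I (un n) \<le> M" using nA[OF fL, of n] by (simp add: un_def)
    qed
  qed simp
  have nu: "norm_L2 I u > 0"
  proof -
    have "norm_L2 I (un n) \<le> norm_L2 I u + norm_L2 I (\<lambda>x. u x - un n x)" for n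
      using norm_L2_triangle[OF uL L2_scale[OF dL, of "-1"], of n] norm_L2_scale[of I "-1" "\<lambda>x. u x - un n x"] by simp
    then have "M \<le> norm_L2 I u + 0"
      by (intro LIMSEQ_le[OF nun tendsto_add[OF tendsto_const conv]]) auto
    then show ?thesis using M by simp
  qed
  (* The defect of f n as an eigenfunction of the square of A. *)
  define z where "z n x = 1 * A (un n) x + (- M\<^sup>2) * f n x" for n x
  have AunL: "L2 I (A (un n))" for n by (rule AL2[OF unL])
  have zL: "L2 I (z n)" for n unfolding z_def[abs_def] by (rule L2_lin[OF AunL fL])
  have zn: "(norm_L2 I (z n))\<^sup>2 \<le> M\<^sup>2 * (M\<^sup>2 - (norm_L2 I (un n))\<^sup>2)" for n
  proof -
    have "(norm_L2 I (z n))\<^sup>2 = inner_L2 I (A (un n)) (A (un n)) - 2 * M\<^sup>2 * inner_L2 I (A (un n)) (f n) + M\<^sup>2 * M\<^sup>2 * inner_L2 I (f n) (f n)"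
      unfolding norm_L2_sq using inner_L2_lin[OF AunL[of n] fL[of n] zL[of n], of 1 "- M\<^sup>2"]
        inner_L2_lin2[OF AunL[of n] fL[of n] AunL[of n], of 1 "- M\<^sup>2"]
        inner_L2_lin2[OF AunL[of n] fL[of n] fL[of n], of 1 "- M\<^sup>2"] inner_L2_commute[of I "f n" "A (un n)"]
      unfolding z_def[symmetric] by (simp add: algebra_simps)
    also have "inner_L2 I (A (un n)) (f n) = (norm_L2 I (un n))\<^sup>2"
      using Asym[OF fL unL, of n n] by (simp add: norm_L2_sq un_def)
    also have "inner_L2 I (A (un n)) (A (un n)) \<le> M\<^sup>2 * (norm_L2 I (un n))\<^sup>2"
      using power_mono[OF nA[OF unL, of n] norm_L2_nonneg, of 2] by (simp add: norm_L2_sq power_mult_distrib)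
    also have "M\<^sup>2 * M\<^sup>2 * inner_L2 I (f n) (f n) \<le> M\<^sup>2 * M\<^sup>2 * 1"
      using power_mono[OF fn norm_L2_nonneg, of n 2] by (intro mult_left_mono) (auto simp: norm_L2_sq)
    finally show ?thesis by (simp add: algebra_simps)
  qed
  have z0: "(\<lambda>n. norm_L2 I (z n)) \<longlonglongrightarrow> 0"
  proof -
    have "(\<lambda>n. sqrt (M\<^sup>2 * (M\<^sup>2 - (norm_L2 I (un n))\<^sup>2))) \<longlonglongrightarrow> sqrt (M\<^sup>2 * (M\<^sup>2 - M\<^sup>2))"
      by (intro tendsto_intros nun)
    then have l: "(\<lambda>n. sqrt (M\<^sup>2 * (M\<^sup>2 - (norm_L2 I (un n))\<^sup>2))) \<longlonglongrightarrow> 0" by simp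
    show ?thesis
      by (rule Lim_null_comparison[OF _ l]) (use zn norm_L2_nonneg in \<open>simp add: real_le_rsqrt\<close>)
  qed
  have AuL: "L2 I (A u)" by (rule AL2[OF uL])
  have AAu: "A (A u) x = M\<^sup>2 * u x" if x: "x \<in> {0..1}" for x
  proof -
    let ?e = "\<lambda>n x. u x - un n x"
    have dec: "A (A u) x - M\<^sup>2 * u x = A (A (?e n)) x + A (z n) x + M\<^sup>2 * (un n x - u x)" for n
    proof -
      have "A (A (?e n)) x = A (\<lambda>x. 1 * A u x + (-1) * A (un n) x) x"
        by (rule Acong) (use Alin[OF uL unL, of _ 1 "-1" n] in auto)
      also have "\<dots> = A (A u) x - A (A (un n)) x" using Alin[OF AuL AunL x, of 1 "-1" n] by simp
      finally have 1: "A (A (?e n)) x = A (A u) x - A (A (un n)) x" .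
      have 2: "A (z n) x = A (A (un n)) x - M\<^sup>2 * un n x"
        unfolding z_def[abs_def] using Alin[OF AunL fL x, of 1 n "- M\<^sup>2" n] by (simp add: un_def)
      show ?thesis unfolding 1 2 by (simp add: algebra_simps)
    qed
    have "(\<lambda>n. A (A (?e n)) x + A (z n) x + M\<^sup>2 * (un n x - u x)) \<longlonglongrightarrow> 0 + 0 + M\<^sup>2 * (u x - u x)"
    proof (intro tendsto_add tendsto_mult tendsto_const tendsto_diff ptw[OF x])
      have l: "(\<lambda>n. C * (C * norm_L2 I (?e n))) \<longlonglongrightarrow> 0"
        using tendsto_mult[OF tendsto_const tendsto_mult[OF tendsto_const conv], of C C] by simp
      have "norm (A (A (?e n)) x) \<le> C * (C * norm_L2 I (?e n))" for n
        using order_trans[OF Cx[OF AL2[OF dL] x, of n] mult_left_mono[OF Cn[OF dL, of n], of C]] C by simp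
      then show "(\<lambda>n. A (A (?e n)) x) \<longlonglongrightarrow> 0"
        by (intro Lim_null_comparison[OF _ l]) simp
      have l: "(\<lambda>n. C * norm_L2 I (z n)) \<longlonglongrightarrow> 0"
        using tendsto_mult[OF tendsto_const z0, of C] by simp
      show "(\<lambda>n. A (z n) x) \<longlonglongrightarrow> 0"
        by (rule Lim_null_comparison[OF _ l]) (use Cx[OF zL x] in simp)
    qed
    then have "(\<lambda>n. A (A u) x - M\<^sup>2 * u x) \<longlonglongrightarrow> 0" unfolding dec[symmetric] by simp
    then have "A (A u) x - M\<^sup>2 * u x = 0" by (simp add: LIMSEQ_const_iff)
    then show ?thesis by simp
  qed
  (* Factorisation of the second-order equation: w solves A w = M w. *)
  define w where "w x = 1 * A u x + M * u x" for x
  have wc: "continuous_on {0..1} w" unfolding w_def by (intro continuous_intros Ac[OF uL] uc)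
  have Aw: "A w x = M * w x" if "x \<in> {0..1}" for x
    unfolding w_def[abs_def] using Alin[OF AuL uL that, of 1 M] AAu[OF that]
    by (simp add: power2_eq_square algebra_simps)
  have u0: "\<exists>x\<in>{0..1}. u x \<noteq> 0"
  proof (rule ccontr)
    assume "\<not> ?thesis"
    then have "norm_L2 I u \<le> 0" by (intro norm_L2_le_sup[OF uL]) auto
    then show False using nu by simp
  qed
  have posu: "0 \<le> u x" if "\<forall>x y. 0 \<le> k x y" "x \<in> {0..1}" for x
  proof (rule LIMSEQ_le_const[OF ptw[OF that(2)]], intro exI allI impI)
    fix n
    show "0 \<le> un n x" unfolding un_def A_def kernel_op_def f_def using that(1) pos[OF that(1)] by simp
  qed
  have posAu: "0 \<le> A u x" if "\<forall>x y. 0 \<le> k x y" for x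
    unfolding A_def kernel_op_def using that posu[OF that]
    by (intro Bochner_Integration.integral_nonneg_AE AE_I2) auto
  show ?thesis
  proof (cases "\<exists>x\<in>{0..1}. w x \<noteq> 0")
    case True
    have "0 \<le> w x" if "\<forall>x y. 0 \<le> k x y" "x \<in> {0..1}" for x
      unfolding w_def using posAu[OF that(1)] posu[OF that] M by simp
    then show ?thesis using True Aw wc M unfolding A_def by (intro exI[of _ M] exI[of _ w]) auto
  next
    case False
    then have w: "A u x = - M * u x" if "x \<in> {0..1}" for x using that by (force simp: w_def)
    have "\<not> (\<forall>x y. 0 \<le> k x y)"
    proof
      assume h: "\<forall>x y. 0 \<le> k x y"
      obtain x where x: "x \<in> {0..1}" "u x \<noteq> 0" using u0 by blast
      then have "u x > 0" using posu[OF h x(1)] by simp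
      then have "M * u x > 0" using M by simp
      then show False using w[OF x(1)] posAu[OF h, of x] by simp
    qed
    then show ?thesis using u0 uc w M unfolding A_def by (intro exI[of _ "- M"] exI[of _ u]) auto
  qed
qed

section \<open>Half profiles as eigenfunctions\<close>

lemma L2_cont_int: fixes f :: "real \<Rightarrow> real" shows "continuous_on {0..1} f \<Longrightarrow> integrable I f"
  by (rule L2_I_integrable[OF L2_I_continuous])

lemma integral_pos:
  fixes h :: "real \<Rightarrow> real"
  assumes "continuous_on {0..1} h" "\<And>x. x \<in> {0..1} \<Longrightarrow> 0 \<le> h x" "x0 \<in> {0..1}" "h x0 \<noteq> 0"
  shows "0 < (\<integral>x. h x \<partial>I)"
proof -
  have "(\<integral>x. h x \<partial>I) = integral {0..1} h"
    using L2_cont_int[OF assms(1)] by (simp add: integral_I_eq integrable_I_iff set_borel_integral_eq_integral(2))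
  moreover have "integral {0..1} h \<noteq> 0" using integral_eq_0_iff[OF assms(1)] assms(2-4) by auto
  moreover have "0 \<le> integral {0..1} h" using assms(2) by (intro Henstock_Kurzweil_Integration.integral_nonneg integrable_continuous_real assms(1)) auto
  ultimately show ?thesis by simp
qed

text \<open>The quotient has the limit \<open>\<phi> 0\<close> at \<open>0\<close>, so \<open>0\<close> is the
  continuous value there.\<close>
definition slope_drop :: "(real \<Rightarrow> real) \<Rightarrow> real \<Rightarrow> real" where
  "slope_drop \<phi> x = (if x = 0 then 0 else prim \<phi> x / x - \<phi> x)"

context
  fixes \<phi> :: "real \<Rightarrow> real"
  assumes c: "continuous_on {0..1} \<phi>" and p1: "prim \<phi> 1 = 0"
begin

lemma slope_drop_continuous: "continuous_on {0..1} (slope_drop \<phi>)"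
  unfolding continuous_on_def
proof
  fix x :: real assume x: "x \<in> {0..1}"
  have ct: "(\<phi> \<longlongrightarrow> \<phi> x) (at x within {0..1})" using c x by (simp add: continuous_on_def)
  have pt: "(prim \<phi> \<longlongrightarrow> prim \<phi> x) (at x within {0..1})" using prim_continuous[OF c] x by (simp add: continuous_on_def)
  show "(slope_drop \<phi> \<longlongrightarrow> slope_drop \<phi> x) (at x within {0..1})"
  proof (cases "x = 0")
    case True
    have "((\<lambda>y. (prim \<phi> y - prim \<phi> x) / (y - x)) \<longlongrightarrow> \<phi> x) (at x within {0..1})"
      using prim_deriv_within[OF c x] by (simp add: has_field_derivative_iff)
    then have "((\<lambda>y. (prim \<phi> y - prim \<phi> x) / (y - x) - \<phi> y) \<longlongrightarrow> \<phi> x - \<phi> x) (at x within {0..1})"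
      by (intro tendsto_diff ct)
    then have "((\<lambda>y. prim \<phi> y / y - \<phi> y) \<longlongrightarrow> 0) (at 0 within {0..1})" using True prim_0[OF c] by simp
    moreover have "\<forall>\<^sub>F y in at 0 within {0..1}. prim \<phi> y / y - \<phi> y = slope_drop \<phi> y"
      by (simp add: eventually_at_filter slope_drop_def)
    ultimately show ?thesis using True by (simp add: slope_drop_def Lim_transform_eventually)
  next
    case False
    have "((\<lambda>y. prim \<phi> y / y - \<phi> y) \<longlongrightarrow> prim \<phi> x / x - \<phi> x) (at x within {0..1})"
      using False by (intro tendsto_intros ct pt)
    moreover have "\<forall>\<^sub>F y in at x within {0..1}. prim \<phi> y / y - \<phi> y = slope_drop \<phi> y"
    proof -
      have "\<forall>\<^sub>F y in at x within {0..1}. y \<noteq> 0"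
        using tendsto_imp_eventually_ne[OF tendsto_ident_at False] .
      then show ?thesis by eventually_elim (simp add: slope_drop_def)
    qed
    ultimately show ?thesis using False by (simp add: slope_drop_def Lim_transform_eventually)
  qed
qed

lemma chord_slope_slope_drop: assumes "y \<in> {0<..1}" shows "chord_slope (slope_drop \<phi>) y = prim \<phi> y / y"
proof -
  have "((\<lambda>z. slope_drop \<phi> z / z) has_integral (- (prim \<phi> 1 / 1) - - (prim \<phi> y / y))) {y..1}"
  proof (rule fundamental_theorem_of_calculus)
    fix z assume z: "z \<in> {y..1}"
    have "(prim \<phi> has_real_derivative \<phi> z) (at z within {y..1})"
      by (rule DERIV_subset[OF prim_deriv_within[OF c]]) (use z assms in auto)
    then have "((\<lambda>z. - (prim \<phi> z / z)) has_real_derivative - ((\<phi> z * z - prim \<phi> z * 1) / (z * z))) (at z within {y..1})"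
      using z assms by (intro DERIV_minus DERIV_divide DERIV_ident) auto
    moreover have "- ((\<phi> z * z - prim \<phi> z * 1) / (z * z)) = slope_drop \<phi> z / z"
      using z assms by (simp add: slope_drop_def field_simps)
    ultimately show "((\<lambda>z. - (prim \<phi> z / z)) has_vector_derivative slope_drop \<phi> z / z) (at z within {y..1})"
      by (simp add: has_real_derivative_iff_has_vector_derivative)
  qed (use assms in auto)
  then show ?thesis using chord_slope_integral[OF slope_drop_continuous, of y] assms p1 by (simp add: integral_unique)
qed

lemma recovered_deriv_slope_drop: assumes "y \<in> {0<..1}" shows "recovered_deriv (slope_drop \<phi>) y = \<phi> y"
  using chord_slope_slope_drop[OF assms] assms by (simp add: recovered_deriv_def slope_drop_def)

text \<open>Both \<open>x_neg_hilbert_prim\<close> and \<open>log_ratio_y_recovered_deriv\<close> evaluate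
  \<open>log_ratio\<close> on \<open>y \<phi> y\<close>; the constant \<open>c0\<close> contributes \<open>x c0
  - c0 x = 0\<close>.\<close>
lemma drop_eigenfunction:
  assumes eq: "\<And>x. x \<in> {0..1} \<Longrightarrow> neg_hilbert \<phi> x = c0 + l * \<phi> x" and x: "x \<in> {0..1}"
  shows "kernel_op drop_kernel (slope_drop \<phi>) x = l * slope_drop \<phi> x"
proof (cases "x = 0")
  case True
  then show ?thesis by (simp add: kernel_op_def drop_kernel_def slope_drop_def)
next
  case False
  have \<phi>: "L2 I \<phi>" by (rule L2_I_continuous[OF c])
  have q: "continuous_on {0..1} (slope_drop \<phi>)" by (rule slope_drop_continuous)
  have "kernel_op log_ratio (\<lambda>y. y * \<phi> y) x = kernel_op log_ratio (\<lambda>y. y * recovered_deriv (slope_drop \<phi>) y) x"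
  proof (rule kernel_op_cong_AE[OF L2kernelD(1)[OF log_ratio_L2kernel] L2_id_mult[OF \<phi>] L2_id_mult[OF recovered_deriv_L2[OF q]] _ x])
    show "AE y in I. y * \<phi> y = y * recovered_deriv (slope_drop \<phi>) y"
      using AE_I_pos by eventually_elim (simp add: recovered_deriv_slope_drop)
  qed
  also have "\<dots> = - pi * x * kernel_op drop_kernel (slope_drop \<phi>) x" by (rule log_ratio_y_recovered_deriv[OF q x])
  finally have 1: "x * neg_hilbert \<phi> x - prim (neg_hilbert \<phi>) x = - x * kernel_op drop_kernel (slope_drop \<phi>) x"
    using x_neg_hilbert_prim[OF \<phi> p1 x] by simp
  have "prim (neg_hilbert \<phi>) x = prim (\<lambda>y. c0 + l * \<phi> y) x"
    unfolding prim_def kernel_op_def by (intro Bochner_Integration.integral_cong) (use eq in auto)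
  also have "\<dots> = c0 * x + l * prim \<phi> x" by (rule prim_const_lin[OF \<phi> x])
  finally have "x * (c0 + l * \<phi> x) - (c0 * x + l * prim \<phi> x) = - x * kernel_op drop_kernel (slope_drop \<phi>) x" using 1 eq[OF x] by simp
  moreover have "x * (l * slope_drop \<phi> x) = l * prim \<phi> x - l * (x * \<phi> x)" using False by (simp add: slope_drop_def field_simps)
  moreover have "x * (c0 + l * \<phi> x) = c0 * x + l * (x * \<phi> x)" by (simp add: algebra_simps)
  ultimately have "x * kernel_op drop_kernel (slope_drop \<phi>) x = x * (l * slope_drop \<phi> x)" by linarith
  then show ?thesis using False by simp
qed

text \<open>The Pohozaev identity with \<open>c = 0\<close> says that the primitive has zero norm.\<close>
lemma zero_of_homogeneous:
  assumes eq: "\<And>x. x \<in> {0..1} \<Longrightarrow> neg_hilbert \<phi> x = l * \<phi> x" and l: "l \<noteq> 0" and x: "x \<in> {0..1}"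
  shows "\<phi> x = 0"
proof -
  have \<phi>: "L2 I \<phi>" by (rule L2_I_continuous[OF c])
  have "AE x in I. neg_hilbert \<phi> x = 0 + l * \<phi> x" by (rule AE_I2) (use eq in simp)
  from pohozaev[OF \<phi> p1 this] l have "norm_L2 I (prim \<phi>) = 0" by (simp add: norm_L2_def)
  then have p0: "prim \<phi> y = 0" if "y \<in> {0..1}" for y
    using continuous_norm_L2_0[OF prim_continuous[OF c] _ that] by simp
  have z: "\<phi> y = 0" if "0 < y" "y < 1" for y
  proof -
    have "((\<lambda>_. 0) has_real_derivative \<phi> y) (at y)"
      by (rule has_field_derivative_transform_within_open[OF prim_deriv[OF c that], of "{0<..<1}"]) (use that p0 in auto)
    then show ?thesis using DERIV_unique[OF DERIV_const] by metis
  qed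
  have "neg_hilbert \<phi> x = 0"
  proof -
    have "AE y in I. log_kernel x y * \<phi> y = 0"
      using AE_I_pos AE_I_neq[of 1] by eventually_elim (use z in auto)
    then have "kernel_op log_kernel \<phi> x = 0" unfolding kernel_op_def by (rule integral_eq_zero_AE)
    then show ?thesis by (simp add: neg_hilbert_def)
  qed
  then show ?thesis using eq[OF x] l by simp
qed

end

text \<open>The linear problem to which the profile equation reduces: \<open>- prim \<phi>\<close>, extended as
  an odd function by zero, is a profile with \<open>U x - x = l * prim \<phi> x\<close> on \<open>[0,
  1]\<close>.\<close>
definition half_profile :: "real \<Rightarrow> (real \<Rightarrow> real) \<Rightarrow> bool" where
  "half_profile l \<phi> \<longleftrightarrow> continuous_on {0..1} \<phi> \<and> prim \<phi> 1 = 0 \<and> (\<forall>x\<in>{0..1}. neg_hilbert \<phi> x = 1 + l * \<phi> x)"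

lemma half_profileD:
  assumes "half_profile l \<phi>"
  shows "continuous_on {0..1} \<phi>" "prim \<phi> 1 = 0" "\<And>x. x \<in> {0..1} \<Longrightarrow> neg_hilbert \<phi> x = 1 + l * \<phi> x" "L2 I \<phi>"
  using assms L2_I_continuous unfolding half_profile_def by auto

lemma neg_hilbert_lin:
  assumes "L2 I f" "L2 I g" shows "neg_hilbert (\<lambda>x. a * f x + b * g x) x = a * neg_hilbert f x + b * neg_hilbert g x"
  unfolding neg_hilbert_def kernel_op_inner_L2 using inner_L2_lin2[OF assms log_kernel_L2[of x], of a b] by (simp add: field_simps)

lemma prim_lin:
  assumes "L2 I f" "L2 I g" "x \<in> {0..1}" shows "prim (\<lambda>x. a * f x + b * g x) x = a * prim f x + b * prim g x"
  unfolding prim_def by (rule kernel_op_lin[OF volterra_bounded_kernel assms])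

lemma half_profile_unique:
  assumes "half_profile l \<phi>" "half_profile l \<psi>" "l \<noteq> 0" "x \<in> {0..1}" shows "\<phi> x = \<psi> x"
proof -
  note a = half_profileD[OF assms(1)] and b = half_profileD[OF assms(2)]
  let ?d = "\<lambda>x. 1 * \<phi> x + (-1) * \<psi> x"
  have "?d x = 0"
  proof (rule zero_of_homogeneous[OF _ _ _ assms(3,4)])
    show "continuous_on {0..1} ?d" by (intro continuous_intros a b)
    show "prim ?d 1 = 0" using prim_lin[OF a(4) b(4), of 1 1 "-1"] a(2) b(2) by simp
    show "neg_hilbert ?d x = l * ?d x" if "x \<in> {0..1}" for x
      using neg_hilbert_lin[OF a(4) b(4), of 1 "-1" x] a(3)[OF that] b(3)[OF that] by (simp add: algebra_simps)
  qed
  then show ?thesis by simp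
qed

text \<open>The eigenvalue equation determines \<open>neg_hilbert\<close> only up to a constant: it says that
  \<open>prim (neg_hilbert \<phi>) / x\<close> and \<open>l\<close> times the chord slope have the same
  derivative. The density \<open>recovered_deriv q\<close> may be unbounded at \<open>0\<close> a priori;
  dividing the equation by \<open>l \<noteq> 0\<close> supplies its continuous representative.\<close>
lemma density_of_eigenfunction:
  assumes q: "continuous_on {0..1} q" and l: "l \<noteq> 0" and ev0: "\<forall>x\<in>{0..1}. kernel_op drop_kernel q x = l * q x"
  shows "\<exists>c \<phi>. continuous_on {0..1} \<phi> \<and> prim \<phi> 1 = 0 \<and> (\<forall>x\<in>{0..1}. neg_hilbert \<phi> x = c + l * \<phi> x) \<and>
    (\<forall>x\<in>{0..1}. slope_drop \<phi> x = q x) \<and> (\<forall>x\<in>{0..1}. prim \<phi> x = x * chord_slope q x)"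
proof -
  note ev = bspec[OF ev0]
  let ?L = "neg_hilbert (recovered_deriv q)"
  have pL: "L2 I (recovered_deriv q)" by (rule recovered_deriv_L2[OF q])
  have cL: "continuous_on {0..1} ?L" by (rule continuous_on_subset[OF neg_hilbert_continuous[OF pL]]) simp
  define w where "w x = prim ?L x / x" for x
  have key: "x * ?L x - prim ?L x = - x * (l * q x)" if "x \<in> {0..1}" for x
    using x_neg_hilbert_prim[OF pL prim_recovered_deriv_1[OF q] that] log_ratio_y_recovered_deriv[OF q that] ev[OF that] by simp
  have const: "w x - l * chord_slope q x = w 1" if x: "x \<in> {0<..1}" for x
  proof (cases "x = 1")
    case True then show ?thesis using chord_slope_1[OF q] by simp
  next
    case False
    have xs: "0 < x" "x < 1" using x False by auto
    have "(\<lambda>x. w x - l * chord_slope q x) 1 = (\<lambda>x. w x - l * chord_slope q x) x"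
    proof (rule DERIV_isconst_end[OF xs(2)])
      show "continuous_on {x..1} (\<lambda>x. w x - l * chord_slope q x)"
        unfolding w_def using xs
        by (intro continuous_intros continuous_on_subset[OF prim_continuous[OF cL]] continuous_on_subset[OF chord_slope_continuous[OF q]]) auto
      fix y assume y: "x < y" "y < 1"
      then have y0: "0 < y" using xs by simp
      have "(w has_real_derivative (?L y * y - prim ?L y * 1) / (y * y)) (at y)"
        unfolding w_def[abs_def] using y0 y by (intro DERIV_divide prim_deriv[OF cL] DERIV_ident) auto
      then have "((\<lambda>x. w x - l * chord_slope q x) has_real_derivative (?L y * y - prim ?L y * 1) / (y * y) - l * (- q y / y)) (at y)"
        using y0 y by (intro DERIV_diff DERIV_cmult chord_slope_deriv[OF q]) auto
      moreover have "(?L y * y - prim ?L y * 1) / (y * y) - l * (- q y / y) = 0"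
      proof -
        have "?L y * y - prim ?L y * 1 = - y * (l * q y)" using key[of y] y y0 by (simp add: mult.commute)
        then show ?thesis using y0 by (simp add: field_simps)
      qed
      ultimately show "((\<lambda>x. w x - l * chord_slope q x) has_real_derivative 0) (at y)" by simp
    qed
    then show ?thesis using chord_slope_1[OF q] by simp
  qed
  have Leq: "?L x = w 1 + l * recovered_deriv q x" if x: "x \<in> {0<..1}" for x
  proof -
    have "?L x = w x - l * q x" using key[of x] x by (simp add: w_def field_simps)
    then show ?thesis using const[OF x] by (simp add: recovered_deriv_def algebra_simps)
  qed
  define \<phi> where "\<phi> x = (?L x - w 1) / l" for x
  have ph: "\<phi> x = recovered_deriv q x" if "x \<in> {0<..1}" for x using Leq[OF that] l by (simp add: \<phi>_def)
  have c: "continuous_on {0..1} \<phi>" unfolding \<phi>_def using l by (intro continuous_intros cL) auto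
  have ae: "AE x in I. \<phi> x = recovered_deriv q x" using AE_I_pos by eventually_elim (simp add: ph)
  have \<phi>L: "L2 I \<phi>" by (rule L2_I_continuous[OF c])
  have pr: "prim \<phi> x = x * chord_slope q x" if "x \<in> {0..1}" for x
    using prim_cong_AE[OF \<phi>L pL ae that] prim_recovered_deriv[OF q that] by simp
  have Lo: "neg_hilbert \<phi> x = ?L x" for x
    unfolding neg_hilbert_def kernel_op_inner_L2 using inner_L2_cong_AE[OF log_kernel_L2 \<phi>L log_kernel_L2 pL AE_I2 ae, of x x] by simp
  have "slope_drop \<phi> x = q x" if x: "x \<in> {0..1}" for x
  proof (cases "x = 0")
    case True
    have "l * q 0 = 0" using ev[of 0] by (simp add: kernel_op_def drop_kernel_def)
    then show ?thesis using True l by (simp add: slope_drop_def)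
  next
    case False
    then show ?thesis using pr[OF x] ph[of x] x by (simp add: slope_drop_def recovered_deriv_def)
  qed
  moreover have "neg_hilbert \<phi> x = w 1 + l * \<phi> x" for x unfolding Lo using l by (simp add: \<phi>_def)
  moreover have "prim \<phi> 1 = 0" using pr[of 1] chord_slope_1[OF q] by simp
  ultimately show ?thesis using c pr by (intro exI[of _ "w 1"] exI[of _ \<phi>]) auto
qed

text \<open>The constant of \<open>density_of_eigenfunction\<close> is not \<open>0\<close>, by
  \<open>zero_of_homogeneous\<close>, so division by it normalises the equation. The last clause records the
  Pohozaev identity, from which the sign of \<open>c\<close> is read off for a positive
  \<open>q\<close>.\<close>
lemma half_profile_of_eigenfunction:
  assumes q: "continuous_on {0..1} q" and l: "l \<noteq> 0" and ev0: "\<forall>x\<in>{0..1}. kernel_op drop_kernel q x = l * q x"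
    and nz: "x0 \<in> {0..1}" "q x0 \<noteq> 0"
  shows "\<exists>c \<phi>. c \<noteq> 0 \<and> half_profile l \<phi> \<and> (\<forall>x\<in>{0..1}. q x = c * slope_drop \<phi> x) \<and> (\<forall>x\<in>{0..1}. x * chord_slope q x = c * prim \<phi> x)
     \<and> l * (\<integral>x. (x * chord_slope q x)\<^sup>2 \<partial>I) = 2 * c * (\<integral>x. x * (x * chord_slope q x) \<partial>I)"
proof -
  obtain c \<phi> where c': "continuous_on {0..1} \<phi>" "prim \<phi> 1 = 0" "\<forall>x\<in>{0..1}. neg_hilbert \<phi> x = c + l * \<phi> x"
    and qq': "\<forall>x\<in>{0..1}. slope_drop \<phi> x = q x" and pp': "\<forall>x\<in>{0..1}. prim \<phi> x = x * chord_slope q x"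
    using density_of_eigenfunction[OF q l ev0] by (elim exE conjE) (rule that)
  have c: "continuous_on {0..1} \<phi>" "prim \<phi> 1 = 0" "\<And>x. x \<in> {0..1} \<Longrightarrow> neg_hilbert \<phi> x = c + l * \<phi> x"
    by (rule c'(1), rule c'(2), rule bspec[OF c'(3)], assumption)
  note qq = bspec[OF qq'] and pp = bspec[OF pp']
  have \<phi>: "L2 I \<phi>" by (rule L2_I_continuous[OF c(1)])
  have c0: "c \<noteq> 0"
  proof
    assume "c = 0"
    then have z: "\<phi> x = 0" if "x \<in> {0..1}" for x using zero_of_homogeneous[OF c(1,2) _ l that] c(3) by simp
    then have "prim \<phi> x0 = 0" unfolding prim_def kernel_op_def by (intro integral_eq_zero_AE AE_I2) simp
    then have "slope_drop \<phi> x0 = 0" using z[OF nz(1)] by (simp add: slope_drop_def)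
    then show False using qq[OF nz(1)] nz(2) by simp
  qed
  define \<psi> where "\<psi> x = (1 / c) * \<phi> x + 0 * \<phi> x" for x
  have pr: "prim \<psi> x = (1 / c) * prim \<phi> x" if "x \<in> {0..1}" for x
    unfolding \<psi>_def[abs_def] using prim_lin[OF \<phi> \<phi> that, of "1 / c" 0] by simp
  have "half_profile l \<psi>" unfolding half_profile_def
  proof (intro conjI ballI)
    show "continuous_on {0..1} \<psi>" unfolding \<psi>_def by (intro continuous_intros c)
    show "prim \<psi> 1 = 0" using pr[of 1] c(2) by simp
    show "neg_hilbert \<psi> x = 1 + l * \<psi> x" if "x \<in> {0..1}" for x
      unfolding \<psi>_def[abs_def] using neg_hilbert_lin[OF \<phi> \<phi>, of "1 / c" 0 x] c(3)[OF that] c0 by (simp add: field_simps)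
  qed
  moreover have "q x = c * slope_drop \<psi> x" if "x \<in> {0..1}" for x
    using qq[OF that] pr[OF that] c0 by (auto simp: slope_drop_def \<psi>_def field_simps)
  moreover have "x * chord_slope q x = c * prim \<psi> x" if "x \<in> {0..1}" for x
    using pp[OF that] pr[OF that] c0 by simp
  moreover have "l * (\<integral>x. (x * chord_slope q x)\<^sup>2 \<partial>I) = 2 * c * (\<integral>x. x * (x * chord_slope q x) \<partial>I)"
  proof -
    have "AE x in I. neg_hilbert \<phi> x = c + l * \<phi> x" by (rule AE_I2) (use c(3) in simp)
    from pohozaev[OF \<phi> c(2) this]
    have "l * (\<integral>x. (prim \<phi> x)\<^sup>2 \<partial>I) = 2 * c * (\<integral>x. x * prim \<phi> x \<partial>I)" .
    moreover have "(\<integral>x. (prim \<phi> x)\<^sup>2 \<partial>I) = (\<integral>x. (x * chord_slope q x)\<^sup>2 \<partial>I)"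
      by (intro Bochner_Integration.integral_cong) (use pp in auto)
    moreover have "(\<integral>x. x * prim \<phi> x \<partial>I) = (\<integral>x. x * (x * chord_slope q x) \<partial>I)"
      by (intro Bochner_Integration.integral_cong) (use pp in auto)
    ultimately show ?thesis by simp
  qed
  ultimately show ?thesis using c0 by (intro exI[of _ c] exI[of _ \<psi>]) auto
qed

lemma half_profile_eigen: assumes "half_profile l \<phi>" "x \<in> {0..1}" shows "kernel_op drop_kernel (slope_drop \<phi>) x = l * slope_drop \<phi> x"
  using drop_eigenfunction[OF half_profileD(1,2)[OF assms(1)] half_profileD(3)[OF assms(1)] assms(2)] .

lemma half_profile_slope_drop: assumes "half_profile l \<phi>" shows "continuous_on {0..1} (slope_drop \<phi>)" "L2 I (slope_drop \<phi>)"
  using slope_drop_continuous[OF half_profileD(1,2)[OF assms]] L2_I_continuous by auto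

lemma half_profile_prim_nz: assumes "half_profile l \<phi>" shows "\<exists>x\<in>{0..1}. prim \<phi> x \<noteq> 0"
proof (rule ccontr)
  assume "\<not> ?thesis"
  then have p0: "prim \<phi> y = 0" if "y \<in> {0..1}" for y using that by auto
  have z: "\<phi> y = 0" if "0 < y" "y < 1" for y
  proof -
    have "((\<lambda>_. 0) has_real_derivative \<phi> y) (at y)"
      by (rule has_field_derivative_transform_within_open[OF prim_deriv[OF half_profileD(1)[OF assms] that], of "{0<..<1}"]) (use that p0 in auto)
    then show ?thesis using DERIV_unique[OF DERIV_const] by metis
  qed
  have "AE y in I. log_kernel (1/2) y * \<phi> y = 0"
    using AE_I_pos AE_I_neq[of 1] by eventually_elim (use z in auto)
  then have "kernel_op log_kernel \<phi> (1/2) = 0" unfolding kernel_op_def by (rule integral_eq_zero_AE)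
  then have "neg_hilbert \<phi> (1/2) = 0" by (simp add: neg_hilbert_def)
  then show False using half_profileD(3)[OF assms, of "1/2"] z[of "1/2"] by simp
qed

lemma half_profile_slope_drop_nz: assumes "half_profile l \<phi>" shows "\<exists>x\<in>{0..1}. slope_drop \<phi> x \<noteq> 0"
proof (rule ccontr)
  assume "\<not> ?thesis"
  then have q0: "slope_drop \<phi> y = 0" if "y \<in> {0..1}" for y using that by auto
  have "prim \<phi> x = 0" if x: "x \<in> {0..1}" for x
  proof (cases "x = 0")
    case True then show ?thesis using prim_0[OF half_profileD(1)[OF assms]] by simp
  next
    case False
    have "chord_slope (slope_drop \<phi>) x = 0" unfolding chord_slope_def kernel_op_def by (intro integral_eq_zero_AE AE_I2) (use q0 in auto)
    then show ?thesis using chord_slope_slope_drop[OF half_profileD(1,2)[OF assms], of x] x False by simp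
  qed
  then show False using half_profile_prim_nz[OF assms] by blast
qed

lemma drop_kernel_selfadjoint: assumes "L2 I f" "L2 I g" shows "inner_L2 I f (kernel_op drop_kernel g) = inner_L2 I (kernel_op drop_kernel f) g"
proof -
  have "(\<lambda>x y. drop_kernel y x) = drop_kernel" by (intro ext) (rule drop_kernel_sym)
  then show ?thesis using adjoint[OF L2kernelD(1)[OF drop_kernel_L2kernel] assms(2,1)] by simp
qed

lemma eigen_orth:
  assumes "L2 I f" "L2 I g" "\<And>x. x \<in> {0..1} \<Longrightarrow> kernel_op drop_kernel f x = l * f x" "\<And>x. x \<in> {0..1} \<Longrightarrow> kernel_op drop_kernel g x = m * g x" "l \<noteq> m"
  shows "inner_L2 I f g = 0"
proof -
  have "inner_L2 I f (kernel_op drop_kernel g) = m * inner_L2 I f g" "inner_L2 I (kernel_op drop_kernel f) g = l * inner_L2 I f g"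
    unfolding inner_L2_def integral_mult_right_zero[symmetric]
    by (intro Bochner_Integration.integral_cong; use assms in simp)+
  then show ?thesis using drop_kernel_selfadjoint[OF assms(1,2)] assms(5) by simp
qed

lemma half_profile_orth: assumes "half_profile l \<phi>" "half_profile m \<psi>" "l \<noteq> m" shows "inner_L2 I (slope_drop \<phi>) (slope_drop \<psi>) = 0"
  by (rule eigen_orth[OF half_profile_slope_drop(2)[OF assms(1)] half_profile_slope_drop(2)[OF assms(2)] half_profile_eigen[OF assms(1)] half_profile_eigen[OF assms(2)] assms(3)])

text \<open>A zero inside would make the integral of the strictly positive row of the kernel against \<open>q
  \<ge> 0\<close> vanish.\<close>
lemma nonneg_eigen_pos:
  assumes q: "continuous_on {0..1} q" and pos: "\<And>x. x \<in> {0..1} \<Longrightarrow> 0 \<le> q x"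
    and nz: "x0 \<in> {0..1}" "q x0 \<noteq> 0" and ev: "\<And>x. x \<in> {0..1} \<Longrightarrow> kernel_op drop_kernel q x = l * q x" and x: "x \<in> {0<..1}"
  shows "q x \<noteq> 0"
proof
  assume "q x = 0"
  then have z: "(\<integral>y. drop_kernel x y * q y \<partial>I) = 0" using ev[of x] x by (simp add: kernel_op_def)
  have i: "integrable I (\<lambda>y. drop_kernel x y * q y)" by (rule L2_mult_integrable[OF drop_kernel_L2 L2_I_continuous[OF q]]) (use x in auto)
  have "AE y in I. 0 \<le> drop_kernel x y * q y" by (rule AE_I2) (use pos drop_kernel_nonneg in auto)
  then have "AE y in I. drop_kernel x y * q y = 0" using integral_nonneg_eq_0_iff_AE[OF i] z by simp
  then have "AE y in I. q y = 0"
    using AE_I_pos AE_I_neq[of x]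
  proof eventually_elim
    case (elim y)
    then show ?case using drop_kernel_pos[of x y] x by auto
  qed
  then have "(\<integral>y. (q y)\<^sup>2 \<partial>I) = 0" by (intro integral_eq_zero_AE) (auto elim: eventually_mono)
  then have "norm_L2 I q = 0" by (simp add: norm_L2_def)
  then show False using continuous_norm_L2_0[OF q _ nz(1)] nz(2) by simp
qed

text \<open>Eigenfunctions for different eigenvalues are orthogonal, which nonnegative continuous ones that are
  positive at \<open>1\<close> cannot be.\<close>
lemma nonneg_half_profiles_same:
  assumes a: "half_profile l \<phi>" "\<And>x. x \<in> {0..1} \<Longrightarrow> 0 \<le> slope_drop \<phi> x" and b: "half_profile m \<psi>" "\<And>x. x \<in> {0..1} \<Longrightarrow> 0 \<le> slope_drop \<psi> x"
  shows "l = m"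
proof (rule ccontr)
  assume "l \<noteq> m"
  obtain x0 where x0: "x0 \<in> {0..1}" "slope_drop \<phi> x0 \<noteq> 0" using half_profile_slope_drop_nz[OF a(1)] by blast
  obtain x1 where x1: "x1 \<in> {0..1}" "slope_drop \<psi> x1 \<noteq> 0" using half_profile_slope_drop_nz[OF b(1)] by blast
  have "0 < (\<integral>x. slope_drop \<phi> x * slope_drop \<psi> x \<partial>I)"
  proof (rule integral_pos[of _ 1])
    show "continuous_on {0..1} (\<lambda>x. slope_drop \<phi> x * slope_drop \<psi> x)" by (intro continuous_intros half_profile_slope_drop[OF a(1)] half_profile_slope_drop[OF b(1)])
    show "slope_drop \<phi> 1 * slope_drop \<psi> 1 \<noteq> 0"
      using nonneg_eigen_pos[OF half_profile_slope_drop(1)[OF a(1)] a(2) x0 half_profile_eigen[OF a(1)], of 1]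
        nonneg_eigen_pos[OF half_profile_slope_drop(1)[OF b(1)] b(2) x1 half_profile_eigen[OF b(1)], of 1] by simp
  qed (use a(2) b(2) in auto)
  then show False using half_profile_orth[OF a(1) b(1) \<open>l \<noteq> m\<close>] by (simp add: inner_L2_def)
qed

section \<open>A positive half profile\<close>

text \<open>The row at \<open>1/2\<close> has a logarithmic singularity, so no bounded function agrees with it:
  test against the indicator of a short interval to the right of \<open>1/2\<close>. Hence
  \<open>drop_kernel\<close> minus a bounded kernel is never the zero operator.\<close>
lemma drop_kernel_not_bounded:
  assumes B: "\<And>y. y \<in> {0..1} \<Longrightarrow> \<bar>s y\<bar> \<le> B" and s: "s \<in> borel_measurable I"
  shows "\<exists>\<phi>. L2 I \<phi> \<and> (\<integral>y. (drop_kernel (1/2) y - s y) * \<phi> y \<partial>I) \<noteq> 0"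
proof -
  (* The length e is chosen so that the logarithm exceeds pi * (|B| + 1) + 1 on the interval. *)
  define e where "e = min (1/2) (exp (- (pi * (\<bar>B\<bar> + 1) + 1)))"
  have e: "0 < e" "e \<le> 1/2" "e \<le> exp (- (pi * (\<bar>B\<bar> + 1) + 1))" by (auto simp: e_def)
  define \<phi> where "\<phi> y = (if 1/2 < y \<and> y < 1/2 + e then 1 else (0::real))" for y :: real
  have m: "\<phi> \<in> borel_measurable borel" unfolding \<phi>_def[abs_def] by measurable
  have \<phi>: "L2 I \<phi>" by (rule L2_I_bounded[of _ 1]) (use measurable_I_borel[OF m] in \<open>auto simp: \<phi>_def\<close>)
  have big: "1 \<le> drop_kernel (1/2) y - s y" if y: "1/2 < y" "y < 1/2 + e" for y
  proof -
    have y1: "y \<le> 1" using y e by simp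
    have "ln (y - 1/2) \<le> ln e" using y by simp
    also have "ln e \<le> ln (exp (- (pi * (\<bar>B\<bar> + 1) + 1)))" using e by (intro ln_mono) auto
    finally have "ln (y - 1/2) \<le> - (pi * (\<bar>B\<bar> + 1) + 1)" by (simp only: ln_exp)
    have "pi * (\<bar>B\<bar> + 1) + 1 \<le> log_ratio (1/2) y"
    proof -
      have "0 \<le> ln (1/2 + y)" using y by (intro ln_ge_zero) simp
      moreover have "log_ratio (1/2) y = ln (1/2 + y) - ln (y - 1/2)" using y by (simp add: log_ratio_def log_plus_def log_minus_def)
      ultimately show ?thesis using \<open>ln (y - 1/2) \<le> - (pi * (\<bar>B\<bar> + 1) + 1)\<close> by linarith
    qed
    moreover have "0 \<le> pi * (\<bar>B\<bar> + 1)" by simp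
    ultimately have L: "0 \<le> log_ratio (1/2) y" "pi * (\<bar>B\<bar> + 1) + 1 \<le> log_ratio (1/2) y" by linarith+
    have "1 \<le> ((1/2)\<^sup>2 + y\<^sup>2) / (2 * (1/2) * y)"
    proof -
      have "0 \<le> (1/2 - y)\<^sup>2" by simp
      then have "y \<le> (1/2)\<^sup>2 + y\<^sup>2" by (simp add: power2_diff)
      then show ?thesis using y by simp
    qed
    then have "1 * log_ratio (1/2) y \<le> ((1/2)\<^sup>2 + y\<^sup>2) / (2 * (1/2) * y) * log_ratio (1/2) y" using L(1) by (rule mult_right_mono)
    then have "pi * (\<bar>B\<bar> + 1) \<le> ((1/2)\<^sup>2 + y\<^sup>2) / (2 * (1/2) * y) * log_ratio (1/2) y - 1" using L(2) by linarith
    then have "\<bar>B\<bar> + 1 \<le> drop_kernel (1/2) y" using y by (simp add: drop_kernel_def pos_le_divide_eq mult.commute)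
    moreover have "\<bar>s y\<bar> \<le> \<bar>B\<bar>" using B[of y] y y1 by simp
    ultimately show ?thesis by linarith
  qed
  have sL: "L2 I s" by (rule L2_I_bounded[OF s B])
  have dL: "L2 I (\<lambda>y. drop_kernel (1/2) y - s y)" by (rule L2_diff[OF drop_kernel_L2 sL]) simp
  have "(\<integral>y. \<phi> y \<partial>I) \<le> (\<integral>y. (drop_kernel (1/2) y - s y) * \<phi> y \<partial>I)"
  proof (rule integral_mono[OF L2_I_integrable[OF \<phi>] L2_mult_integrable[OF dL \<phi>]])
    show "\<phi> y \<le> (drop_kernel (1/2) y - s y) * \<phi> y" if "y \<in> space I" for y
      using big[of y] by (simp add: \<phi>_def)
  qed
  moreover have "(\<integral>y. \<phi> y \<partial>I) = e"
  proof -
    have "(\<integral>y. \<phi> y \<partial>I) = (\<integral>y. indicator {1/2<..<1/2+e} y \<partial>lborel)"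
      unfolding integral_I_eq set_lebesgue_integral_def using e
      by (intro Bochner_Integration.integral_cong) (auto simp: \<phi>_def indicator_def)
    then show ?thesis using e by simp
  qed
  ultimately show ?thesis using \<phi> e(1) by (intro exI[of _ \<phi>]) auto
qed

text \<open>The eigenfunction \<open>q\<close> from \<open>hilbert_eigen\<close> is nonnegative, hence positive
  on \<open>(0, 1]\<close>; its chord slope strictly decreases to \<open>0\<close> at \<open>1\<close>. The
  Pohozaev identity shows that the normalising constant is positive, so that the signs are preserved.\<close>
theorem positive_half_profile:
  "\<exists>l \<phi>. 0 < l \<and> half_profile l \<phi> \<and> (\<forall>x\<in>{0<..<1}. 0 < prim \<phi> x) \<and> (\<forall>x\<in>{0..1}. 0 \<le> slope_drop \<phi> x)"
proof -
  obtain \<phi>0 where \<phi>0: "L2 I \<phi>0" "(\<integral>y. (drop_kernel (1/2) y - 0) * \<phi>0 y \<partial>I) \<noteq> 0"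
    using drop_kernel_not_bounded[of "\<lambda>_. 0" 0] by auto
  have h: "(1/2::real) \<in> {0..1}" by simp
  have n0: "kernel_op drop_kernel \<phi>0 (1/2) \<noteq> 0" using \<phi>0(2) by (simp add: kernel_op_def)
  obtain l q where q: "continuous_on {0..1} q" and x0': "\<exists>x\<in>{0..1}. q x \<noteq> 0"
      and ev': "\<forall>x\<in>{0..1}. kernel_op drop_kernel q x = l * q x" and pos': "(\<forall>x y. 0 \<le> drop_kernel x y) \<longrightarrow> 0 < l \<and> (\<forall>x\<in>{0..1}. 0 \<le> q x)"
    using hilbert_eigen[OF drop_kernel_L2kernel drop_kernel_sym \<phi>0(1) h n0] by (elim exE conjE) (rule that)
  have l: "l > 0" and pos: "\<And>x. x \<in> {0..1} \<Longrightarrow> 0 \<le> q x" using pos' drop_kernel_nonneg by simp_all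
  have ev: "\<And>x. x \<in> {0..1} \<Longrightarrow> kernel_op drop_kernel q x = l * q x" using ev' by blast
  obtain x0 where x0: "x0 \<in> {0..1}" "q x0 \<noteq> 0" using x0' by blast
  have qp: "0 < q x" if "x \<in> {0<..1}" for x
    using nonneg_eigen_pos[OF q pos x0 ev that] pos[of x] that by force
  have l0: "l \<noteq> 0" using l by simp
  obtain c \<phi> where c': "c \<noteq> 0" "half_profile l \<phi>" "\<forall>x\<in>{0..1}. q x = c * slope_drop \<phi> x"
      "\<forall>x\<in>{0..1}. x * chord_slope q x = c * prim \<phi> x"
    and poh: "l * (\<integral>x. (x * chord_slope q x)\<^sup>2 \<partial>I) = 2 * c * (\<integral>x. x * (x * chord_slope q x) \<partial>I)"
    using half_profile_of_eigenfunction[OF q l0 ev' x0] by (elim exE conjE) (rule that)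
  have c: "c \<noteq> 0" "half_profile l \<phi>" "\<And>x. x \<in> {0..1} \<Longrightarrow> q x = c * slope_drop \<phi> x"
      "\<And>x. x \<in> {0..1} \<Longrightarrow> x * chord_slope q x = c * prim \<phi> x"
    by (rule c'(1), rule c'(2), rule bspec[OF c'(3)], assumption, rule bspec[OF c'(4)], assumption)
  have gp: "0 < chord_slope q x" if x: "0 < x" "x < 1" for x
  proof -
    have "chord_slope q 1 < chord_slope q x"
    proof (rule DERIV_neg_imp_decreasing_open[OF x(2)])
      show "\<exists>y. (chord_slope q has_real_derivative y) (at z) \<and> y < 0" if "x < z" "z < 1" for z
        using chord_slope_deriv[OF q, of z] qp[of z] that x by (intro exI[of _ "- q z / z"]) auto
      show "continuous_on {x..1} (chord_slope q)" by (rule continuous_on_subset[OF chord_slope_continuous[OF q]]) (use x in auto)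
    qed
    then show ?thesis using chord_slope_1[OF q] by simp
  qed
  have cg: "continuous_on {0..1} (\<lambda>x. x * chord_slope q x)"
  proof (rule continuous_on_eq)
    show "continuous_on {0..1} (\<lambda>x. c * prim \<phi> x)" by (intro continuous_intros prim_continuous[OF half_profileD(1)[OF c(2)]])
  qed (simp add: c(4))
  have g0: "0 \<le> chord_slope q x" if "x \<in> {0<..1}" for x using gp[of x] chord_slope_1[OF q] that by (cases "x = 1") auto
  have "0 < (\<integral>x. (x * chord_slope q x)\<^sup>2 \<partial>I)"
    using gp[of "1/2"] by (intro integral_pos[of _ "1/2"] continuous_intros cg) auto
  moreover have "0 < (\<integral>x. x * (x * chord_slope q x) \<partial>I)"
  proof (rule integral_pos[of _ "1/2"])
    show "0 \<le> x * (x * chord_slope q x)" if "x \<in> {0..1}" for x using g0[of x] that by (cases "x = 0") auto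
  qed (use gp[of "1/2"] in \<open>auto intro!: continuous_intros cg\<close>)
  ultimately have "0 < 2 * c * (\<integral>x. x * (x * chord_slope q x) \<partial>I)" and i: "0 < (\<integral>x. x * (x * chord_slope q x) \<partial>I)"
    unfolding poh[symmetric] using l by (simp_all only: mult_pos_pos)
  then have cp: "0 < c" by (simp only: zero_less_mult_iff) linarith
  have "0 < prim \<phi> x" if x: "x \<in> {0<..<1}" for x
  proof -
    have "0 < x * chord_slope q x" using gp[of x] x by simp
    then have "0 < c * prim \<phi> x" using c(4)[of x] x by simp
    then show ?thesis using cp by (simp add: zero_less_mult_iff)
  qed
  moreover have "0 \<le> slope_drop \<phi> x" if "x \<in> {0..1}" for x
    using pos[OF that] c(3)[OF that] cp by (simp add: zero_le_mult_iff)
  ultimately show ?thesis using l c(2) by blast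
qed

section \<open>Infinitely many eigenvalues\<close>

lemma L2kernel_deflate:
  assumes "finite S" "\<And>l. l \<in> S \<Longrightarrow> continuous_on {0..1} (w l)"
  shows "L2kernel (\<lambda>x y. drop_kernel x y - (\<Sum>l\<in>S. a l * (w l x * w l y)))"
  using assms
proof (induction S rule: finite_induct)
  case empty then show ?case using drop_kernel_L2kernel by simp
next
  case (insert l S)
  have "L2kernel (\<lambda>x y. 1 * (drop_kernel x y - (\<Sum>l\<in>S. a l * (w l x * w l y))) + (- a l) * (w l x * w l y))"
    by (rule L2kernel_lin[OF insert.IH L2kernel_rank_one]) (use insert.prems in auto)
  moreover have "(\<lambda>x y. 1 * (drop_kernel x y - (\<Sum>l\<in>S. a l * (w l x * w l y))) + (- a l) * (w l x * w l y)) =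
    (\<lambda>x y. drop_kernel x y - (\<Sum>l\<in>insert l S. a l * (w l x * w l y)))"
    using insert.hyps by (intro ext) simp
  ultimately show ?case by simp
qed

text \<open>If there were finitely many eigenvalues, each would be simple (\<open>half_profile_unique\<close>).
  Subtracting the corresponding projections leaves a symmetric compact kernel which is not zero and so has an
  eigenfunction \<open>v\<close>. It is orthogonal to all the projections, hence an eigenfunction of
  \<open>drop_kernel\<close> itself, and hence proportional to one of the functions to which it is
  orthogonal.\<close>
theorem infinite_eigenvalues: "infinite {l. l \<noteq> 0 \<and> (\<exists>\<phi>. half_profile l \<phi>)}" (is "infinite ?S")
proof
  assume fin: "finite ?S"
  define f where "f l = (SOME \<phi>. half_profile l \<phi>)" for l
  have f: "half_profile l (f l)" if "l \<in> ?S" for l using that someI_ex[of "half_profile l"] by (auto simp: f_def)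
  define n where "n l = norm_L2 I (slope_drop (f l))" for l
  have n0: "n l \<noteq> 0" if l: "l \<in> ?S" for l
  proof
    assume "n l = 0"
    then have "slope_drop (f l) x = 0" if "x \<in> {0..1}" for x
      using continuous_norm_L2_0[OF half_profile_slope_drop(1)[OF f[OF l]] _ that] by (simp add: n_def)
    then show False using half_profile_slope_drop_nz[OF f[OF l]] by blast
  qed
  define w where "w l x = (1 / n l) * slope_drop (f l) x" for l x
  have wc: "continuous_on {0..1} (w l)" if "l \<in> ?S" for l
    unfolding w_def using half_profile_slope_drop(1)[OF f[OF that]] by (intro continuous_intros)
  have wL: "L2 I (w l)" if "l \<in> ?S" for l by (rule L2_I_continuous[OF wc[OF that]])
  have wev: "kernel_op drop_kernel (w l) x = l * w l x" if "l \<in> ?S" "x \<in> {0..1}" for l x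
  proof -
    have "kernel_op drop_kernel (w l) x = (\<integral>y. (1 / n l) * (drop_kernel x y * slope_drop (f l) y) \<partial>I)"
      unfolding kernel_op_def w_def by (intro Bochner_Integration.integral_cong) auto
    also have "\<dots> = (1 / n l) * kernel_op drop_kernel (slope_drop (f l)) x" unfolding kernel_op_def by (rule integral_mult_right_zero)
    finally show ?thesis using half_profile_eigen[OF f[OF that(1)] that(2)] by (simp add: w_def)
  qed
  have wn: "inner_L2 I (w l) (w l) = 1" if "l \<in> ?S" for l
  proof -
    have "norm_L2 I (w l) = 1" using norm_L2_scale[of I "1 / n l" "slope_drop (f l)"] n0[OF that] norm_L2_nonneg[of I "slope_drop (f l)"]
      by (simp add: w_def[abs_def] n_def[symmetric])
    then show ?thesis using norm_L2_sq[of I "w l"] by simp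
  qed
  have worth: "inner_L2 I (w l) (w m) = 0" if "l \<in> ?S" "m \<in> ?S" "l \<noteq> m" for l m
    by (rule eigen_orth[OF wL[OF that(1)] wL[OF that(2)] wev[OF that(1)] wev[OF that(2)] that(3)])
  define k where "k x y = drop_kernel x y - (\<Sum>l\<in>?S. l * (w l x * w l y))" for x y
  have k: "L2kernel k" unfolding k_def using L2kernel_deflate[OF fin, of w "\<lambda>l. l"] wc by simp
  have ksym: "k x y = k y x" for x y
    unfolding k_def drop_kernel_sym[of x y] by (simp add: mult.commute)
  have opk: "kernel_op k h x = kernel_op drop_kernel h x - (\<Sum>l\<in>?S. l * w l x * inner_L2 I (w l) h)" if h: "L2 I h" and x: "x \<in> {0..1}" for h x
  proof -
    have i: "integrable I (\<lambda>y. l * w l x * (w l y * h y))" if "l \<in> ?S" for l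
      by (intro integrable_mult_right L2_mult_integrable wL that h)
    have "kernel_op k h x = (\<integral>y. drop_kernel x y * h y - (\<Sum>l\<in>?S. l * w l x * (w l y * h y)) \<partial>I)"
      unfolding kernel_op_def k_def
      by (intro Bochner_Integration.integral_cong) (auto simp: left_diff_distrib sum_distrib_right mult.assoc)
    also have "\<dots> = (\<integral>y. drop_kernel x y * h y \<partial>I) - (\<integral>y. (\<Sum>l\<in>?S. l * w l x * (w l y * h y)) \<partial>I)"
      by (intro Bochner_Integration.integral_diff Bochner_Integration.integrable_sum i L2_mult_integrable[OF drop_kernel_L2[OF x] h])
    also have "(\<integral>y. (\<Sum>l\<in>?S. l * w l x * (w l y * h y)) \<partial>I) = (\<Sum>l\<in>?S. \<integral>y. l * w l x * (w l y * h y) \<partial>I)"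
      by (rule Bochner_Integration.integral_sum[OF i])
    also have "\<dots> = (\<Sum>l\<in>?S. l * w l x * inner_L2 I (w l) h)"
      unfolding inner_L2_def by (intro sum.cong refl integral_mult_right_zero)
    finally show ?thesis by (simp add: kernel_op_def)
  qed
  have sc: "continuous_on {0..1} (\<lambda>y. \<Sum>l\<in>?S. l * (w l (1/2) * w l y))"
    by (intro continuous_on_sum continuous_intros wc)
  obtain B where B: "\<And>y. y \<in> {0..1} \<Longrightarrow> \<bar>\<Sum>l\<in>?S. l * (w l (1/2) * w l y)\<bar> \<le> B"
    using compact_imp_bounded[OF compact_continuous_image[OF sc]] unfolding bounded_iff by force
  obtain \<phi>0 where \<phi>0: "L2 I \<phi>0" "(\<integral>y. (drop_kernel (1/2) y - (\<Sum>l\<in>?S. l * (w l (1/2) * w l y))) * \<phi>0 y \<partial>I) \<noteq> 0"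
    using drop_kernel_not_bounded[OF B continuous_on_measurable_I[OF sc]] by auto
  have h: "(1/2::real) \<in> {0..1}" by simp
  have nk0: "kernel_op k \<phi>0 (1/2) \<noteq> 0" using \<phi>0(2) by (simp add: kernel_op_def k_def)
  obtain \<mu> v where \<mu>: "\<mu> \<noteq> 0" and v: "continuous_on {0..1} v"
    and x0': "\<exists>x\<in>{0..1}. v x \<noteq> 0" and ev': "\<forall>x\<in>{0..1}. kernel_op k v x = \<mu> * v x"
    using hilbert_eigen[OF k ksym \<phi>0(1) h nk0] by (elim exE conjE) (rule that)
  have ev: "\<And>x. x \<in> {0..1} \<Longrightarrow> kernel_op k v x = \<mu> * v x" using ev' by blast
  obtain x0 where x0: "x0 \<in> {0..1}" "v x0 \<noteq> 0" using x0' by blast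
  have vL: "L2 I v" by (rule L2_I_continuous[OF v])
  (* The deflated operator annihilates w m, and v is in its range. *)
  have orth: "inner_L2 I (w m) v = 0" if m: "m \<in> ?S" for m
  proof -
    have z: "kernel_op k (w m) x = 0" if x: "x \<in> {0..1}" for x
    proof -
      have "(\<Sum>l\<in>?S. l * w l x * inner_L2 I (w l) (w m)) = (\<Sum>l\<in>?S. if l = m then m * w m x else 0)"
        by (intro sum.cong refl) (use worth[OF _ m] wn[OF m] in auto)
      also have "\<dots> = m * w m x" using fin m by (simp add: sum.delta)
      finally show ?thesis using opk[OF wL[OF m] x] wev[OF m x] by simp
    qed
    have "inner_L2 I (w m) (kernel_op k v) = inner_L2 I (kernel_op (\<lambda>x y. k y x) (w m)) v" by (rule adjoint[OF L2kernelD(1)[OF k] vL wL[OF m]])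
    also have "\<dots> = inner_L2 I (kernel_op k (w m)) v"
    proof -
      have "(\<lambda>x y. k y x) = k" by (intro ext) (rule ksym)
      then show ?thesis by simp
    qed
    also have "\<dots> = 0" unfolding inner_L2_def by (intro integral_eq_zero_AE AE_I2) (simp add: z)
    finally have "inner_L2 I (w m) (kernel_op k v) = 0" .
    moreover have "inner_L2 I (w m) (kernel_op k v) = \<mu> * inner_L2 I (w m) v"
      unfolding inner_L2_def integral_mult_right_zero[symmetric]
      by (intro Bochner_Integration.integral_cong) (use ev in auto)
    ultimately show ?thesis using \<mu> by simp
  qed
  have evN: "kernel_op drop_kernel v x = \<mu> * v x" if "x \<in> {0..1}" for x
    using opk[OF vL that] orth ev[OF that] by simp
  have evN': "\<forall>x\<in>{0..1}. kernel_op drop_kernel v x = \<mu> * v x" using evN by blast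
  obtain c \<phi> where c': "c \<noteq> 0" "half_profile \<mu> \<phi>" "\<forall>x\<in>{0..1}. v x = c * slope_drop \<phi> x"
    using half_profile_of_eigenfunction[OF v \<mu> evN' x0] by (elim exE conjE) (rule that)
  have c: "c \<noteq> 0" "half_profile \<mu> \<phi>" "\<And>x. x \<in> {0..1} \<Longrightarrow> v x = c * slope_drop \<phi> x"
    by (rule c'(1), rule c'(2), rule bspec[OF c'(3)], assumption)
  have \<mu>S: "\<mu> \<in> ?S" using \<mu> c(2) by blast
  have same: "f \<mu> x = \<phi> x" if "x \<in> {0..1}" for x using half_profile_unique[OF f[OF \<mu>S] c(2) \<mu> that] .
  have "v x = (c * n \<mu>) * w \<mu> x" if x: "x \<in> {0..1}" for x
  proof -
    have "prim (f \<mu>) x = prim \<phi> x" unfolding prim_def kernel_op_def by (intro Bochner_Integration.integral_cong) (use same in auto)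
    then have "slope_drop (f \<mu>) x = slope_drop \<phi> x" using same[OF x] by (simp add: slope_drop_def)
    then show ?thesis using c(3)[OF x] n0[OF \<mu>S] by (simp add: w_def)
  qed
  then have "inner_L2 I (w \<mu>) v = (\<integral>x. (c * n \<mu>) * (w \<mu> x * w \<mu> x) \<partial>I)"
    unfolding inner_L2_def by (intro Bochner_Integration.integral_cong) auto
  also have "\<dots> = c * n \<mu> * inner_L2 I (w \<mu>) (w \<mu>)" unfolding inner_L2_def by (rule integral_mult_right_zero)
  also have "\<dots> \<noteq> 0" using c(1) n0[OF \<mu>S] wn[OF \<mu>S] by simp
  finally show False using orth[OF \<mu>S] by simp
qed

section \<open>Principal values of odd functions\<close>

interpretation LI: pair_sigma_finite lborel I ..

definition odd_ext :: "(real \<Rightarrow> real) \<Rightarrow> real \<Rightarrow> real" where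
  "odd_ext \<phi> y = (if 0 \<le> y \<and> y \<le> 1 then prim \<phi> y else if - 1 \<le> y \<and> y < 0 then - prim \<phi> (- y) else 0)"

definition trunc_hilbert :: "(real \<Rightarrow> real) \<Rightarrow> real \<Rightarrow> real \<Rightarrow> real" where
  "trunc_hilbert f x e = (LINT y:{y. e < \<bar>x - y\<bar>}|lborel. f y / (x - y))"

text \<open>The primitive of the truncated kernel \<open>cut_inverse\<close>, up to sign.\<close>
definition cut_ln :: "real \<Rightarrow> real \<Rightarrow> real" where "cut_ln e t = ln (max \<bar>t\<bar> e)"

lemma cut_ln_cont: assumes "e > 0" shows "continuous_on A (\<lambda>y. cut_ln e (x - y))"
  unfolding cut_ln_def using assms by (intro continuous_intros) (auto simp: max_def)

definition cut_inverse :: "real \<Rightarrow> real \<Rightarrow> real \<Rightarrow> real" where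
  "cut_inverse e x y = (if e < \<bar>x - y\<bar> then 1 / (x - y) else 0)"

lemma cut_inverse_measurable [measurable]: "cut_inverse e x \<in> borel_measurable borel"
  unfolding cut_inverse_def by measurable

lemma cut_inverse_bound: "e > 0 \<Longrightarrow> \<bar>cut_inverse e x y\<bar> \<le> 1 / e"
  by (auto simp: cut_inverse_def frac_le)

lemma emeasure_Icc_finite: "emeasure lborel {a..b::real} < \<infinity>"
  by (auto simp: emeasure_lborel_Icc_eq)

lemma cut_inverse_integral:
  assumes e: "e > 0" and aR: "a \<le> R" and R: "x + e < R"
  shows "(LBINT y:{a..R}. cut_inverse e x y) = cut_ln e (x - a) - ln (R - x)"
proof -
  define F where "F y = - cut_ln e (x - y)" for y
  have "(LBINT y:{a..R}. cut_inverse e x y) = F R - F a"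
  proof (rule FTC_lborel[of "{x - e, x + e}", OF _ aR])
    show "continuous_on {a..R} F" unfolding F_def by (intro continuous_intros cut_ln_cont e)
    show "set_integrable lborel {a..R} (cut_inverse e x)"
      unfolding set_integrable_def
      by (rule integrableI_bounded_set_indicator[where B="1 / e"]) (use cut_inverse_bound[OF e] emeasure_Icc_finite in auto)
    fix y assume y: "y \<in> {a<..<R} - {x - e, x + e}"
    show "(F has_real_derivative cut_inverse e x y) (at y)"
    proof (cases "e < \<bar>x - y\<bar>")
      case True
      have "((\<lambda>y. - ln \<bar>x - y\<bar>) has_real_derivative - (1 / (x - y) * (-1))) (at y)"
        using True e by (intro DERIV_minus DERIV_chain2[OF DERIV_ln_abs]) (auto intro!: derivative_eq_intros)
      then have "((\<lambda>y. - ln \<bar>x - y\<bar>) has_real_derivative cut_inverse e x y) (at y)" using True by (simp add: cut_inverse_def)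
      then show ?thesis
      proof (rule has_field_derivative_transform_within_open[of _ _ _ "{y. e < \<bar>x - y\<bar>}"])
        show "open {y. e < \<bar>x - y\<bar>}" by (intro open_Collect_less continuous_intros)
      qed (use True in \<open>auto simp: F_def cut_ln_def max_def\<close>)
    next
      case False
      have "((\<lambda>y. - ln e) has_real_derivative 0) (at y)" by simp
      then have "((\<lambda>y. - ln e) has_real_derivative cut_inverse e x y) (at y)" using False by (simp add: cut_inverse_def)
      then show ?thesis
      proof (rule has_field_derivative_transform_within_open[of _ _ _ "{y. \<bar>x - y\<bar> < e}"])
        show "open {y. \<bar>x - y\<bar> < e}" by (intro open_Collect_less continuous_intros)
        show "y \<in> {y. \<bar>x - y\<bar> < e}" using False y by auto
      qed (auto simp: F_def cut_ln_def max_def)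
    qed
  qed auto
  also have "\<dots> = cut_ln e (x - a) - ln (R - x)"
    using e R by (simp add: F_def cut_ln_def max_def abs_if)
  finally show ?thesis .
qed

lemma odd_ext_outside: "1 < \<bar>y\<bar> \<Longrightarrow> odd_ext \<phi> y = 0"
  by (auto simp: odd_ext_def)

text \<open>For \<open>prim \<phi> 1 = 0\<close> the odd extension is a superposition of the odd steps with
  jumps at \<open>- z\<close> and \<open>z\<close>, with weight \<open>\<phi> z\<close>. Adding \<open>1\<close>
  to each step does not change the superposition, and turns the step into a sum of two Heaviside functions of
  \<open>y\<close>.\<close>
definition odd_step :: "real \<Rightarrow> real \<Rightarrow> real" where
  "odd_step y z = (if z \<le> y then 1 else 0) + (if - z < y then 1 else 0)"

lemma odd_ext_as_integral:
  assumes \<phi>: "L2 I \<phi>" and p1: "prim \<phi> 1 = 0"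
  shows "odd_ext \<phi> y = (\<integral>z. odd_step y z * \<phi> z \<partial>I)"
proof -
  have int: "(\<integral>z. \<phi> z \<partial>I) = 0" using p1 by (simp add: prim_1)
  consider "1 < y" | "y < -1" | "0 \<le> y" "y \<le> 1" | "-1 \<le> y" "y < 0" by linarith
  then show ?thesis
  proof cases
    case 1
    have "(\<integral>z. odd_step y z * \<phi> z \<partial>I) = (\<integral>z. 2 * \<phi> z \<partial>I)"
      by (intro Bochner_Integration.integral_cong) (use 1 in \<open>auto simp: odd_step_def\<close>)
    then show ?thesis using 1 int by (simp add: odd_ext_def)
  next
    case 2
    have "(\<integral>z. odd_step y z * \<phi> z \<partial>I) = (\<integral>z. 0 \<partial>I)"
      by (intro Bochner_Integration.integral_cong) (use 2 in \<open>auto simp: odd_step_def\<close>)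
    then show ?thesis using 2 by (simp add: odd_ext_def)
  next
    case 3
    have "(\<integral>z. odd_step y z * \<phi> z \<partial>I) = (\<integral>z. volterra y z * \<phi> z + \<phi> z \<partial>I)"
    proof (rule integral_cong_AE)
      show "AE z in I. odd_step y z * \<phi> z = volterra y z * \<phi> z + \<phi> z"
        using AE_I_pos by eventually_elim (use 3 in \<open>auto simp: odd_step_def volterra_def\<close>)
      show "(\<lambda>z. odd_step y z * \<phi> z) \<in> borel_measurable I"
        using \<phi> unfolding L2_def odd_step_def by (intro borel_measurable_times measurable_I_borel[of "\<lambda>z. (if z \<le> y then 1 else 0) + (if - z < y then 1 else 0)"]) (simp_all, measurable)
      show "(\<lambda>z. volterra y z * \<phi> z + \<phi> z) \<in> borel_measurable I"
        by (rule borel_measurable_integrable, rule Bochner_Integration.integrable_add[OF L2_mult_integrable[OF volterra_L2 \<phi>] L2_I_integrable[OF \<phi>]])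
    qed
    also have "\<dots> = prim \<phi> y + 0"
      using L2_mult_integrable[OF volterra_L2 \<phi>] L2_I_integrable[OF \<phi>] int by (simp add: prim_def kernel_op_def)
    finally show ?thesis using 3 by (simp add: odd_ext_def)
  next
    case 4
    have "(\<integral>z. odd_step y z * \<phi> z \<partial>I) = (\<integral>z. \<phi> z - volterra (- y) z * \<phi> z \<partial>I)"
      by (intro Bochner_Integration.integral_cong) (use 4 in \<open>auto simp: odd_step_def volterra_def\<close>)
    also have "\<dots> = 0 - prim \<phi> (- y)"
      using L2_mult_integrable[OF volterra_L2 \<phi>] L2_I_integrable[OF \<phi>] int by (simp add: prim_def kernel_op_def)
    finally show ?thesis using 4 by (simp add: odd_ext_def)
  qed
qed

text \<open>Integration by parts against a density that is only in \<open>L\<^sup>2\<close>, done with Fubini: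
  each step contributes \<open>cut_ln\<close> at its jump and a boundary term at \<open>R\<close>. The boundary
  terms do not depend on \<open>z\<close> and vanish because \<open>\<integral> \<phi> = 0\<close>.\<close>
lemma trunc_hilbert_odd_ext:
  assumes \<phi>: "L2 I \<phi>" and p1: "prim \<phi> 1 = 0" and e: "e > 0"
  shows "trunc_hilbert (odd_ext \<phi>) x e = (\<integral>z. (cut_ln e (x - z) + cut_ln e (x + z)) * \<phi> z \<partial>I)"
proof -
  (* R lies beyond the support and beyond the truncation window around x. *)
  define R where "R = \<bar>x\<bar> + e + 2"
  have R: "R > 1" "x + e < R" using e by (auto simp: R_def)
  have [measurable]: "\<phi> \<in> borel_measurable I" using \<phi> by (simp add: L2_def)
  have [measurable]: "snd \<in> borel_measurable (lborel \<Otimes>\<^sub>M I)"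
    using measurable_compose[OF measurable_snd measurable_ident_I] by (simp add: comp_def)
  have [measurable]: "fst \<in> borel_measurable (lborel \<Otimes>\<^sub>M I)"
    using measurable_compose[OF measurable_fst, of "\<lambda>x. x" lborel borel I] by simp
  define h where "h y = indicator {-R..R} y * cut_inverse e x y" for y :: real
  have hm [measurable]: "h \<in> borel_measurable borel" unfolding h_def by measurable
  have hint: "integrable lborel h"
  proof -
    have "integrable lborel (\<lambda>y. indicator {-R..R} y *\<^sub>R cut_inverse e x y)"
      by (rule integrableI_bounded_set_indicator[where B="1 / e"]) (use cut_inverse_bound[OF e] emeasure_Icc_finite in auto)
    then show ?thesis unfolding h_def by simp
  qed
  have "trunc_hilbert (odd_ext \<phi>) x e = (\<integral>y. h y * odd_ext \<phi> y \<partial>lborel)"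
    unfolding trunc_hilbert_def set_lebesgue_integral_def
  proof (rule Bochner_Integration.integral_cong[OF refl])
    fix y
    show "indicat_real {y. e < \<bar>x - y\<bar>} y *\<^sub>R (odd_ext \<phi> y / (x - y)) = h y * odd_ext \<phi> y"
    proof (cases "\<bar>y\<bar> \<le> 1")
      case True
      then have "y \<in> {-R..R}" using R by auto
      then show ?thesis by (simp add: h_def cut_inverse_def)
    qed (simp add: odd_ext_outside)
  qed
  also have "\<dots> = (\<integral>y. \<integral>z. h y * (odd_step y z * \<phi> z) \<partial>I \<partial>lborel)"
    unfolding odd_ext_as_integral[OF \<phi> p1] by simp
  also have "\<dots> = (\<integral>z. \<integral>y. h y * (odd_step y z * \<phi> z) \<partial>lborel \<partial>I)"
  proof -
    have m: "(\<lambda>(y, z). h y * (odd_step y z * \<phi> z)) \<in> borel_measurable (lborel \<Otimes>\<^sub>M I)"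
      unfolding odd_step_def by measurable
    have "integrable (lborel \<Otimes>\<^sub>M I) (\<lambda>(y, z). h y * (odd_step y z * \<phi> z))"
    proof (rule Bochner_Integration.integrable_bound[OF _ m])
      show "integrable (lborel \<Otimes>\<^sub>M I) (\<lambda>(y, z). 2 * (h y * \<phi> z))"
      proof -
        have "integrable (lborel \<Otimes>\<^sub>M I) (\<lambda>(y, z). h y * \<phi> z)"
        proof (rule LI.Fubini_integrable)
          show "(\<lambda>(y, z). h y * \<phi> z) \<in> borel_measurable (lborel \<Otimes>\<^sub>M I)" by measurable
          have "integrable lborel (\<lambda>y. \<bar>h y\<bar> * (\<integral>z. \<bar>\<phi> z\<bar> \<partial>I))" using hint by simp
          then show "integrable lborel (\<lambda>y. \<integral>z. norm (case (y, z) of (y, z) \<Rightarrow> h y * \<phi> z) \<partial>I)"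
            by (simp add: abs_mult)
          show "AE y in lborel. integrable I (\<lambda>z. case (y, z) of (y, z) \<Rightarrow> h y * \<phi> z)"
            using L2_I_integrable[OF \<phi>] by simp
        qed
        then have "integrable (lborel \<Otimes>\<^sub>M I) (\<lambda>p. 2 * (case p of (y, z) \<Rightarrow> h y * \<phi> z))" by (rule integrable_mult_right)
        then show ?thesis by (simp add: split_beta')
      qed
      show "AE p in lborel \<Otimes>\<^sub>M I. norm (case p of (y, z) \<Rightarrow> h y * (odd_step y z * \<phi> z)) \<le> norm (case p of (y, z) \<Rightarrow> 2 * (h y * \<phi> z))"
      proof (rule AE_I2)
        fix p
        have s: "\<bar>odd_step y z\<bar> \<le> 2" for y z by (simp add: odd_step_def)
        have "\<bar>h y * (odd_step y z * \<phi> z)\<bar> \<le> \<bar>2 * (h y * \<phi> z)\<bar>" for y z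
        proof -
          have "\<bar>h y * (odd_step y z * \<phi> z)\<bar> = \<bar>odd_step y z\<bar> * \<bar>h y * \<phi> z\<bar>" by (simp add: abs_mult)
          also have "\<dots> \<le> 2 * \<bar>h y * \<phi> z\<bar>" by (rule mult_right_mono[OF s]) simp
          finally show ?thesis by (simp add: abs_mult)
        qed
        then show "norm (case p of (y, z) \<Rightarrow> h y * (odd_step y z * \<phi> z)) \<le> norm (case p of (y, z) \<Rightarrow> 2 * (h y * \<phi> z))"
          by (simp add: split_beta')
      qed
    qed
    from LI.Fubini_integral[OF this] show ?thesis by simp
  qed
  also have "\<dots> = (\<integral>z. (cut_ln e (x - z) + cut_ln e (x + z)) * \<phi> z - 2 * ln (R - x) * \<phi> z \<partial>I)"
  proof (rule Bochner_Integration.integral_cong[OF refl])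
    fix z assume z: "z \<in> space I"
    have cut: "(\<integral>y. h y * (if P y then 1 else 0) \<partial>lborel) = cut_ln e (x - a) - ln (R - x)"
      if "a \<in> {-1..1}" "\<And>y. P y \<Longrightarrow> a \<le> y" "\<And>y. a < y \<Longrightarrow> P y" for a P
    proof -
      have "(\<integral>y. h y * (if P y then 1 else 0) \<partial>lborel) = (LBINT y:{a..R}. cut_inverse e x y)"
        unfolding set_lebesgue_integral_def
      proof (rule integral_cong_AE)
        have "(\<lambda>y. if P y then 1 else 0::real) = (if P a then indicator {a..} else indicator {a<..})"
          using that(2,3) by (intro ext) (auto simp: indicator_def order_le_less)
        then have "(\<lambda>y. if P y then 1 else 0::real) \<in> borel_measurable borel" by simp
        then show "(\<lambda>y. h y * (if P y then 1 else 0)) \<in> borel_measurable lborel"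
          unfolding measurable_lborel2 by (intro borel_measurable_times hm)
        show "(\<lambda>y. indicat_real {a..R} y *\<^sub>R cut_inverse e x y) \<in> borel_measurable lborel"
          unfolding measurable_lborel2 by (intro borel_measurable_scaleR cut_inverse_measurable borel_measurable_indicator) simp
        show "AE y in lborel. h y * (if P y then 1 else 0) = indicat_real {a..R} y *\<^sub>R cut_inverse e x y"
          using AE_lborel_singleton[of a]
        proof eventually_elim
          case (elim y)
          then show ?case using that(2,3)[of y] that(1) R by (auto simp: h_def indicator_def)
        qed
      qed
      also have "\<dots> = cut_ln e (x - a) - ln (R - x)" by (rule cut_inverse_integral[OF e]) (use that(1) R in auto)
      finally show ?thesis .
    qed
    have i: "integrable lborel (\<lambda>y. h y * (if P y then 1 else 0))" if "(\<lambda>y. (if P y then 1 else 0::real)) \<in> borel_measurable borel" for P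
      by (rule Bochner_Integration.integrable_bound[OF hint]) (use that in \<open>auto intro!: borel_measurable_times hm\<close>)
    have c1: "(\<integral>y. h y * (if z \<le> y then 1 else 0) \<partial>lborel) = cut_ln e (x - z) - ln (R - x)" using z by (intro cut) auto
    have c2: "(\<integral>y. h y * (if - z < y then 1 else 0) \<partial>lborel) = cut_ln e (x - - z) - ln (R - x)" using z by (intro cut) auto
    have i1: "integrable lborel (\<lambda>y. h y * (if z \<le> y then 1 else 0))" by (rule i) measurable
    have i2: "integrable lborel (\<lambda>y. h y * (if - z < y then 1 else 0))" by (rule i) measurable
    have "(\<integral>y. h y * (odd_step y z * \<phi> z) \<partial>lborel) =
      (\<integral>y. (h y * (if z \<le> y then 1 else 0) + h y * (if - z < y then 1 else 0)) * \<phi> z \<partial>lborel)"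
      by (intro Bochner_Integration.integral_cong) (auto simp: odd_step_def algebra_simps)
    also have "\<dots> = (cut_ln e (x - z) - ln (R - x) + (cut_ln e (x - - z) - ln (R - x))) * \<phi> z"
      unfolding c1[symmetric] c2[symmetric] Bochner_Integration.integral_add[OF i1 i2, symmetric] by (rule integral_mult_left_zero)
    finally show "(\<integral>y. h y * (odd_step y z * \<phi> z) \<partial>lborel) = (cut_ln e (x - z) + cut_ln e (x + z)) * \<phi> z - 2 * ln (R - x) * \<phi> z"
      by (simp add: algebra_simps)
  qed
  also have "\<dots> = (\<integral>z. (cut_ln e (x - z) + cut_ln e (x + z)) * \<phi> z \<partial>I) - 2 * ln (R - x) * (\<integral>z. \<phi> z \<partial>I)"
  proof -
    have "continuous_on {0..1} (\<lambda>z. cut_ln e (x - z) + cut_ln e (x - (- z)))"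
      by (intro continuous_intros cut_ln_cont[OF e] continuous_on_compose2[OF cut_ln_cont[OF e, of UNIV x], of _ "\<lambda>z. - z"]) auto
    then have "L2 I (\<lambda>z. cut_ln e (x - z) + cut_ln e (x + z))" by (intro L2_I_continuous) simp
    from L2_mult_integrable[OF this \<phi>] show ?thesis using L2_I_integrable[OF \<phi>] by simp
  qed
  also have "\<dots> = (\<integral>z. (cut_ln e (x - z) + cut_ln e (x + z)) * \<phi> z \<partial>I)" using p1 by (simp add: prim_1)
  finally show ?thesis .
qed

lemma cut_ln_bound: assumes "0 < e" "e < 1" "t \<noteq> 0" shows "\<bar>cut_ln e t\<bar> \<le> \<bar>ln \<bar>t\<bar>\<bar>"
proof (cases "e \<le> \<bar>t\<bar>")
  case True then show ?thesis by (simp add: cut_ln_def max_def)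
next
  case False
  then have "ln \<bar>t\<bar> \<le> ln e" "ln e < 0" using assms by auto
  then show ?thesis using False by (simp add: cut_ln_def max_def)
qed

text \<open>Dominated convergence: truncated logarithms are dominated by the logarithm itself, for truncation
  below \<open>1\<close>.\<close>
theorem hilbert_limit:
  assumes \<phi>: "L2 I \<phi>" and p1: "prim \<phi> 1 = 0"
  shows "((\<lambda>e. trunc_hilbert (odd_ext \<phi>) x e) \<longlongrightarrow> kernel_op log_kernel \<phi> x) (at_right 0)"
proof (rule tendsto_at_right_sequentially[of 0 1])
  fix S :: "nat \<Rightarrow> real" assume S: "\<And>n. 0 < S n" "\<And>n. S n < 1" "S \<longlonglongrightarrow> 0"
  have \<phi>m: "\<phi> \<in> borel_measurable I" using \<phi> by (simp add: L2_def)
  have "(\<lambda>n. \<integral>z. (cut_ln (S n) (x - z) + cut_ln (S n) (x + z)) * \<phi> z \<partial>I) \<longlonglongrightarrow> (\<integral>z. log_kernel x z * \<phi> z \<partial>I)"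
  proof (rule integral_dominated_convergence[where w="\<lambda>z. (\<bar>log_minus x z\<bar> + \<bar>log_plus x z\<bar>) * \<bar>\<phi> z\<bar>"])
    show "(\<lambda>z. log_kernel x z * \<phi> z) \<in> borel_measurable I" by (rule borel_measurable_integrable[OF L2_mult_integrable[OF log_kernel_L2 \<phi>]])
    show "(\<lambda>z. (cut_ln (S n) (x - z) + cut_ln (S n) (x + z)) * \<phi> z) \<in> borel_measurable I" for n
      using \<phi>m unfolding cut_ln_def by measurable
    have "L2 I (\<lambda>z. \<bar>log_minus x z\<bar>)" "L2 I (\<lambda>z. \<bar>log_plus x z\<bar>)" "L2 I (\<lambda>z. \<bar>\<phi> z\<bar>)"
      using log_minus_L2[of x] log_plus_L2[of x] \<phi> unfolding L2_def power2_abs by (auto intro: borel_measurable_abs)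
    then show "integrable I (\<lambda>z. (\<bar>log_minus x z\<bar> + \<bar>log_plus x z\<bar>) * \<bar>\<phi> z\<bar>)" by (intro L2_mult_integrable L2_add)
    show "AE z in I. norm ((cut_ln (S n) (x - z) + cut_ln (S n) (x + z)) * \<phi> z) \<le> (\<bar>log_minus x z\<bar> + \<bar>log_plus x z\<bar>) * \<bar>\<phi> z\<bar>" for n
      using AE_I_neq[of x] AE_I_neq[of "- x"]
    proof eventually_elim
      case (elim z)
      have "\<bar>cut_ln (S n) (x - z) + cut_ln (S n) (x + z)\<bar> \<le> \<bar>log_minus x z\<bar> + \<bar>log_plus x z\<bar>"
        using cut_ln_bound[OF S(1) S(2), of "x - z" n] cut_ln_bound[OF S(1) S(2), of "x + z" n] elim
        unfolding log_minus_def log_plus_def by linarith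
      then show ?case by (simp add: abs_mult mult_right_mono)
    qed
    show "AE z in I. (\<lambda>n. (cut_ln (S n) (x - z) + cut_ln (S n) (x + z)) * \<phi> z) \<longlonglongrightarrow> log_kernel x z * \<phi> z"
      using AE_I_neq[of x] AE_I_neq[of "- x"]
    proof eventually_elim
      case (elim z)
      have l: "(\<lambda>n. cut_ln (S n) t) \<longlonglongrightarrow> ln \<bar>t\<bar>" if "t \<noteq> 0" for t
      proof -
        have "\<forall>\<^sub>F n in sequentially. S n < \<bar>t\<bar>" using order_tendstoD(2)[OF S(3), of "\<bar>t\<bar>"] that by simp
        then have "\<forall>\<^sub>F n in sequentially. ln \<bar>t\<bar> = cut_ln (S n) t" by eventually_elim (simp add: cut_ln_def max_def)
        then show ?thesis by (rule Lim_transform_eventually[OF tendsto_const])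
      qed
      have "(\<lambda>n. (cut_ln (S n) (x - z) + cut_ln (S n) (x + z)) * \<phi> z) \<longlonglongrightarrow> (ln \<bar>x - z\<bar> + ln \<bar>x + z\<bar>) * \<phi> z"
        by (intro tendsto_intros l) (use elim in auto)
      then show ?case by (simp add: log_kernel_def log_plus_def log_minus_def add.commute)
    qed
  qed
  then show "(\<lambda>n. trunc_hilbert (odd_ext \<phi>) x (S n)) \<longlonglongrightarrow> kernel_op log_kernel \<phi> x"
    using trunc_hilbert_odd_ext[OF \<phi> p1 S(1)] by (simp add: kernel_op_def)
qed simp

lemma hilbert_transform_trunc_hilbert: "hilbert_transform f x = 1 / pi * Lim (at_right 0) (trunc_hilbert f x)"
  by (simp add: hilbert_transform_def trunc_hilbert_def[abs_def])

lemma hilbert_of_limit: "(trunc_hilbert f x \<longlongrightarrow> L) (at_right 0) \<Longrightarrow> hilbert_transform f x = L / pi"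
  by (simp add: hilbert_transform_trunc_hilbert tendsto_Lim)

lemma hilbert_odd_ext: assumes "L2 I \<phi>" "prim \<phi> 1 = 0" shows "hilbert_transform (odd_ext \<phi>) x = - neg_hilbert \<phi> x"
  using hilbert_of_limit[OF hilbert_limit[OF assms]] by (simp add: neg_hilbert_def)

lemma trunc_hilbert_scale:
  assumes b: "b > 0" shows "trunc_hilbert (\<lambda>y. a * f (b * y)) x e = a * trunc_hilbert f (b * x) (b * e)"
proof -
  have "trunc_hilbert f (b * x) (b * e) = (\<integral>y. indicator {y. b * e < \<bar>b * x - y\<bar>} y * (f y / (b * x - y)) \<partial>lborel)"
    by (simp add: trunc_hilbert_def set_lebesgue_integral_def)
  also have "\<dots> = \<bar>b\<bar> * (\<integral>y. indicator {y. b * e < \<bar>b * x - y\<bar>} (0 + b * y) * (f (0 + b * y) / (b * x - (0 + b * y))) \<partial>lborel)"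
    using b by (subst lborel_integral_real_affine[where c=b and t=0]) auto
  also have "\<dots> = (\<integral>y. \<bar>b\<bar> * (indicator {y. b * e < \<bar>b * x - y\<bar>} (0 + b * y) * (f (0 + b * y) / (b * x - (0 + b * y)))) \<partial>lborel)"
    by (rule integral_mult_right_zero[symmetric])
  finally have "a * trunc_hilbert f (b * x) (b * e) =
    (\<integral>y. a * (\<bar>b\<bar> * (indicator {y. b * e < \<bar>b * x - y\<bar>} (0 + b * y) * (f (0 + b * y) / (b * x - (0 + b * y))))) \<partial>lborel)"
    by (simp only: integral_mult_right_zero)
  also have "\<dots> = trunc_hilbert (\<lambda>y. a * f (b * y)) x e"
    unfolding trunc_hilbert_def set_lebesgue_integral_def
  proof (rule Bochner_Integration.integral_cong[OF refl])
    fix y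
    have D: "b * x - b * y = b * (x - y)" by (simp add: right_diff_distrib)
    show "a * (\<bar>b\<bar> * (indicat_real {y. b * e < \<bar>b * x - y\<bar>} (0 + b * y) * (f (0 + b * y) / (b * x - (0 + b * y))))) =
      indicat_real {y. e < \<bar>x - y\<bar>} y *\<^sub>R (a * f (b * y) / (x - y))"
      using b by (simp add: indicator_def D abs_mult)
  qed
  finally show ?thesis ..
qed

lemma hilbert_scale:
  assumes b: "b > 0" and L: "(trunc_hilbert f (b * x) \<longlongrightarrow> L) (at_right 0)"
  shows "(trunc_hilbert (\<lambda>y. a * f (b * y)) x \<longlongrightarrow> a * L) (at_right 0)"
proof -
  have "filterlim (\<lambda>e. b * e) (at_right 0) (at_right 0)"
    unfolding filterlim_at
  proof
    show "((\<lambda>e. b * e) \<longlongrightarrow> 0) (at_right 0)" by (auto intro!: tendsto_eq_intros)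
    show "\<forall>\<^sub>F e in at_right 0. b * e \<in> {0<..} \<and> b * e \<noteq> 0"
      unfolding eventually_at_filter using b by (intro always_eventually) auto
  qed
  from filterlim_compose[OF L this] have "((\<lambda>e. trunc_hilbert f (b * x) (b * e)) \<longlongrightarrow> L) (at_right 0)" .
  then have "((\<lambda>e. a * trunc_hilbert f (b * x) (b * e)) \<longlongrightarrow> a * L) (at_right 0)" by (intro tendsto_intros)
  then show ?thesis by (simp only: trunc_hilbert_scale[OF b, symmetric])
qed

section \<open>Odd extensions in the Sobolev space\<close>

lemma antiderivative_real_line:
  fixes h :: "real \<Rightarrow> real"
  assumes "continuous_on UNIV h"
  shows "\<exists>U. U 0 = 0 \<and> (\<forall>x. (U has_real_derivative h x) (at x))"
proof -
  have ic: "isCont h x" for x using assms by (simp add: continuous_on_eq_continuous_at)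
  have "\<exists>F. \<forall>x. - \<infinity> < ereal x \<longrightarrow> ereal x < \<infinity> \<longrightarrow> (F has_vector_derivative h x) (at x)"
    by (rule einterval_antiderivative) (use ic in auto)
  then obtain F where F: "\<And>x. (F has_vector_derivative h x) (at x)" by auto
  have "((\<lambda>x. F x - F 0) has_real_derivative h x - 0) (at x)" for x
    using F by (intro DERIV_diff DERIV_const) (simp add: has_real_derivative_iff_has_vector_derivative)
  then show ?thesis by (intro exI[of _ "\<lambda>x. F x - F 0"]) simp
qed

definition odd_ext_deriv :: "(real \<Rightarrow> real) \<Rightarrow> real \<Rightarrow> real" where
  "odd_ext_deriv \<psi> y = (if \<bar>y\<bar> \<le> 1 then \<psi> \<bar>y\<bar> else 0)"

lemma odd_ext_odd: "prim \<psi> 0 = 0 \<Longrightarrow> odd_ext \<psi> (- y) = - odd_ext \<psi> y"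
  by (auto simp: odd_ext_def)

context
  fixes \<psi> :: "real \<Rightarrow> real"
  assumes c: "continuous_on {0..1} \<psi>" and p1: "prim \<psi> 1 = 0"
begin

lemma odd_ext_alt: "odd_ext \<psi> y = prim \<psi> (max 0 (min 1 y)) - prim \<psi> (max 0 (min 1 (- y)))"
  using p1 prim_0[OF c] by (auto simp: odd_ext_def max_def min_def)

lemma odd_ext_continuous: "continuous_on A (odd_ext \<psi>)"
  unfolding odd_ext_alt[abs_def]
  by (intro continuous_on_diff continuous_on_compose2[OF prim_continuous[OF c]] continuous_intros) auto

lemma has_derivative_odd_ext: assumes "\<bar>y\<bar> \<noteq> 1" "y \<noteq> 0" shows "(odd_ext \<psi> has_real_derivative odd_ext_deriv \<psi> y) (at y)"
proof -
  consider "0 < y" "y < 1" | "-1 < y" "y < 0" | "1 < \<bar>y\<bar>" using assms by linarith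
  then show ?thesis
  proof cases
    case 1
    have "(prim \<psi> has_real_derivative odd_ext_deriv \<psi> y) (at y)" using prim_deriv[OF c 1] 1 by (simp add: odd_ext_deriv_def)
    then show ?thesis
      by (rule has_field_derivative_transform_within_open[of _ _ _ "{0<..<1}"]) (use 1 in \<open>auto simp: odd_ext_def\<close>)
  next
    case 2
    have "((\<lambda>y. - prim \<psi> (- y)) has_real_derivative - (\<psi> (- y) * (-1))) (at y)"
      using 2 by (intro DERIV_minus DERIV_chain2[OF prim_deriv[OF c]]) (auto intro!: derivative_eq_intros)
    then have "((\<lambda>y. - prim \<psi> (- y)) has_real_derivative odd_ext_deriv \<psi> y) (at y)" using 2 by (simp add: odd_ext_deriv_def)
    then show ?thesis
      by (rule has_field_derivative_transform_within_open[of _ _ _ "{-1<..<0}"]) (use 2 in \<open>auto simp: odd_ext_def\<close>)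
  next
    case 3
    have "((\<lambda>_. 0) has_real_derivative odd_ext_deriv \<psi> y) (at y)" using 3 by (simp add: odd_ext_deriv_def)
    then show ?thesis
    proof (rule has_field_derivative_transform_within_open[of _ _ _ "{y. 1 < \<bar>y\<bar>}"])
      show "open {y::real. 1 < \<bar>y\<bar>}" by (intro open_Collect_less continuous_intros)
    qed (use 3 in \<open>auto simp: odd_ext_outside\<close>)
  qed
qed

lemma cont_abs: "continuous_on {-1..1} (\<lambda>y. \<psi> \<bar>y\<bar>)"
  by (intro continuous_on_compose2[OF c] continuous_intros) auto

lemma odd_ext_deriv_indicator: "odd_ext_deriv \<psi> y = indicator {-1..1} y *\<^sub>R \<psi> \<bar>y\<bar>"
  by (auto simp: odd_ext_deriv_def indicator_def)

lemma square_integrable_odd_ext_deriv: "square_integrable (odd_ext_deriv \<psi>)"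
  unfolding square_integrable_def
proof
  have "integrable lborel (\<lambda>y. indicator {-1..1::real} y *\<^sub>R \<psi> \<bar>y\<bar>)"
    by (rule borel_integrable_compact[OF compact_Icc cont_abs])
  then have "integrable lborel (odd_ext_deriv \<psi>)" unfolding odd_ext_deriv_indicator[abs_def] .
  then show "odd_ext_deriv \<psi> \<in> borel_measurable lborel" by (rule borel_measurable_integrable)
  have "integrable lborel (\<lambda>y. indicator {-1..1::real} y *\<^sub>R (\<psi> \<bar>y\<bar>)\<^sup>2)"
    by (rule borel_integrable_compact[OF compact_Icc]) (intro continuous_intros cont_abs)
  moreover have "(\<lambda>y. (odd_ext_deriv \<psi> y)\<^sup>2) = (\<lambda>y. indicator {-1..1::real} y *\<^sub>R (\<psi> \<bar>y\<bar>)\<^sup>2)"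
    by (rule ext) (auto simp: odd_ext_deriv_def indicator_def)
  ultimately show "integrable lborel (\<lambda>y. (odd_ext_deriv \<psi> y)\<^sup>2)" by simp
qed

lemma square_integrable_odd_ext: "square_integrable (odd_ext \<psi>)"
  unfolding square_integrable_def
proof
  show "odd_ext \<psi> \<in> borel_measurable lborel"
    using borel_measurable_continuous_onI[OF odd_ext_continuous] by simp
  have "integrable lborel (\<lambda>y. indicator {-1..1::real} y *\<^sub>R (odd_ext \<psi> y)\<^sup>2)"
    by (rule borel_integrable_compact[OF compact_Icc]) (intro continuous_intros odd_ext_continuous)
  moreover have "(\<lambda>y. (odd_ext \<psi> y)\<^sup>2) = (\<lambda>y. indicator {-1..1::real} y *\<^sub>R (odd_ext \<psi> y)\<^sup>2)"
    by (rule ext) (auto simp: indicator_def odd_ext_def)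
  ultimately show "integrable lborel (\<lambda>y. (odd_ext \<psi> y)\<^sup>2)" by simp
qed

lemma weak_derivative_odd_ext: "weak_derivative (odd_ext \<psi>) (odd_ext_deriv \<psi>)"
  unfolding weak_derivative_def
proof (intro allI impI)
  fix f f' :: "real \<Rightarrow> real"
  assume d: "\<forall>x. (f has_real_derivative f' x) (at x)" and f': "continuous_on UNIV f'"
  have f: "continuous_on UNIV f" using DERIV_isCont[OF d[rule_format]] by (simp add: continuous_at_imp_continuous_on)
  note sub = continuous_on_subset[OF f, of "{-1..1}"] continuous_on_subset[OF f', of "{-1..1}"]
  have i1: "set_integrable lborel {-1..1} (\<lambda>y. \<psi> \<bar>y\<bar> * f y)" and i2: "set_integrable lborel {-1..1} (\<lambda>y. odd_ext \<psi> y * f' y)"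
    by (rule borel_integrable_atLeastAtMost', intro continuous_intros cont_abs odd_ext_continuous sub, simp)+
  have "(LBINT y:{-1..1}. \<psi> \<bar>y\<bar> * f y + odd_ext \<psi> y * f' y) = odd_ext \<psi> 1 * f 1 - odd_ext \<psi> (-1) * f (-1)"
  proof (rule FTC_lborel[of "{0}"])
    show "continuous_on {- 1..1} (\<lambda>a. odd_ext \<psi> a * f a)" by (intro continuous_intros odd_ext_continuous sub) simp
    show "set_integrable lborel {- 1..1} (\<lambda>y. \<psi> \<bar>y\<bar> * f y + odd_ext \<psi> y * f' y)" by (rule set_integral_add(1)[OF i1 i2])
    fix y :: real assume y: "y \<in> {-1<..<1} - {0}"
    have "\<bar>y\<bar> < 1" "y \<noteq> 0" using y by auto
    then have "(odd_ext \<psi> has_real_derivative \<psi> \<bar>y\<bar>) (at y)" using has_derivative_odd_ext[of y] by (simp add: odd_ext_deriv_def)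
    from DERIV_mult[OF this d[rule_format, of y]]
    show "((\<lambda>a. odd_ext \<psi> a * f a) has_real_derivative \<psi> \<bar>y\<bar> * f y + odd_ext \<psi> y * f' y) (at y)" by (simp add: mult.commute)
  qed auto
  also have "\<dots> = 0" using p1 by (simp add: odd_ext_def)
  finally have "(LBINT y:{-1..1}. \<psi> \<bar>y\<bar> * f y) + (LBINT y:{-1..1}. odd_ext \<psi> y * f' y) = 0"
    using set_integral_add(2)[OF i1 i2] by simp
  moreover have "(LBINT y:{-1..1}. \<psi> \<bar>y\<bar> * f y) = (LINT x|lborel. odd_ext_deriv \<psi> x * f x)"
    unfolding set_lebesgue_integral_def by (intro Bochner_Integration.integral_cong) (auto simp: odd_ext_deriv_def indicator_def)
  moreover have "(LBINT y:{-1..1}. odd_ext \<psi> y * f' y) = (LINT x|lborel. odd_ext \<psi> x * f' x)"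
    unfolding set_lebesgue_integral_def by (intro Bochner_Integration.integral_cong) (auto simp: odd_ext_def indicator_def)
  ultimately show "(LINT x|lborel. odd_ext \<psi> x * f' x) = - (LINT x|lborel. odd_ext_deriv \<psi> x * f x)" by simp
qed

lemma sobolev_odd_ext: "sobolev_H1 (odd_ext \<psi>)"
  unfolding sobolev_H1_def using odd_ext_continuous square_integrable_odd_ext square_integrable_odd_ext_deriv weak_derivative_odd_ext by blast

lemma supported_odd_ext: "supported_on (odd_ext \<psi>) {-1..1}"
proof -
  have "{x. odd_ext \<psi> x \<noteq> 0} \<subseteq> {-1..1}" by (auto simp: odd_ext_def split: if_splits)
  then show ?thesis unfolding supported_on_def by (intro closure_minimal) auto
qed

end

section \<open>Dilations in the Sobolev space\<close>

lemma square_integrable_scale: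
  assumes "square_integrable f" "b \<noteq> 0" shows "square_integrable (\<lambda>x. a * f (b * x))"
  unfolding square_integrable_def
proof
  have f: "f \<in> borel_measurable borel" "integrable lborel (\<lambda>x. (f x)\<^sup>2)" using assms by (auto simp: square_integrable_def)
  have "(\<lambda>x. f (b * x)) \<in> borel_measurable borel"
    by (rule measurable_compose[OF _ f(1)]) simp
  then show "(\<lambda>x. a * f (b * x)) \<in> borel_measurable lborel" by simp
  have "integrable lborel (\<lambda>x. (f (0 + b * x))\<^sup>2)" by (rule lborel_integrable_real_affine[OF f(2) assms(2)])
  then have "integrable lborel (\<lambda>x. a\<^sup>2 * (f (0 + b * x))\<^sup>2)" by (rule integrable_mult_right)
  then show "integrable lborel (\<lambda>x. (a * f (b * x))\<^sup>2)" by (simp add: power_mult_distrib)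
qed

lemma weak_derivative_scale:
  assumes w: "weak_derivative f g" and b: "b > 0"
  shows "weak_derivative (\<lambda>x. a * f (b * x)) (\<lambda>x. a * b * g (b * x))"
  unfolding weak_derivative_def
proof (intro allI impI)
  fix h h' :: "real \<Rightarrow> real"
  assume d: "\<forall>x. (h has_real_derivative h' x) (at x)" and h': "continuous_on UNIV h'"
    and cp: "compact (closure {x. h x \<noteq> 0})"
  let ?h = "\<lambda>y. h (y / b)" and ?h' = "\<lambda>y. h' (y / b) / b"
  have "(LINT x|lborel. f x * ?h' x) = - (LINT x|lborel. g x * ?h x)"
  proof (rule w[unfolded weak_derivative_def, rule_format])
    show "(?h has_real_derivative ?h' x) (at x)" for x
    proof -
      have "((\<lambda>y. y / b) has_real_derivative 1 / b) (at x)" using b by (auto intro!: derivative_eq_intros)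
      from DERIV_chain2[OF d[rule_format] this] show ?thesis by simp
    qed
    show "continuous_on UNIV ?h'" using b by (intro continuous_intros continuous_on_compose2[OF h']) auto
    have "{x. ?h x \<noteq> 0} = (\<lambda>x. b *\<^sub>R x) ` {x. h x \<noteq> 0}"
    proof (intro set_eqI iffI)
      fix x assume "x \<in> {x. ?h x \<noteq> 0}"
      then show "x \<in> (\<lambda>x. b *\<^sub>R x) ` {x. h x \<noteq> 0}" using b by (intro image_eqI[of _ _ "x / b"]) auto
    qed (use b in auto)
    moreover have "bounded {x. h x \<noteq> 0}" using cp by (simp add: compact_closure)
    ultimately have "bounded {x. ?h x \<noteq> 0}" using bounded_scaling by metis
    then show "compact (closure {x. ?h x \<noteq> 0})" by (simp add: compact_closure)
  qed
  moreover have "(LINT x|lborel. f x * ?h' x) = b * (LINT x|lborel. f (b * x) * (h' x / b))"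
    using b by (subst lborel_integral_real_affine[where c=b and t=0]) auto
  moreover have "(LINT x|lborel. g x * ?h x) = b * (LINT x|lborel. g (b * x) * h x)"
    using b by (subst lborel_integral_real_affine[where c=b and t=0]) auto
  moreover have "(LINT x|lborel. f (b * x) * (h' x / b)) = (LINT x|lborel. f (b * x) * h' x) / b"
    by simp
  ultimately have "(LINT x|lborel. f (b * x) * h' x) = - (b * (LINT x|lborel. g (b * x) * h x))" using b by simp
  then have "a * (LINT x|lborel. f (b * x) * h' x) = - (a * b * (LINT x|lborel. g (b * x) * h x))" by simp
  then show "(LINT x|lborel. a * f (b * x) * h' x) = - (LINT x|lborel. a * b * g (b * x) * h x)"
    by (simp add: mult.assoc)
qed

lemma sobolev_scale: assumes "sobolev_H1 f" "b > 0" shows "sobolev_H1 (\<lambda>x. a * f (b * x))"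
proof -
  obtain g where g: "square_integrable g" "weak_derivative f g" using assms(1) by (auto simp: sobolev_H1_def)
  have "continuous_on UNIV f" "square_integrable f" using assms(1) by (auto simp: sobolev_H1_def)
  then show ?thesis unfolding sobolev_H1_def
    using square_integrable_scale[of f b a] square_integrable_scale[OF g(1), of b "a * b"] weak_derivative_scale[OF g(2) assms(2), of a] assms(2)
    by (intro conjI exI[of _ "\<lambda>x. a * b * g (b * x)"]) (auto intro!: continuous_intros continuous_on_compose2[of UNIV f])
qed

section \<open>Profiles from half profiles\<close>

definition profile_of :: "(real \<Rightarrow> real) \<Rightarrow> real \<Rightarrow> real" where "profile_of \<phi> = odd_ext (\<lambda>x. - \<phi> x)"

context
  fixes l :: real and \<phi> :: "real \<Rightarrow> real"
  assumes s: "half_profile l \<phi>"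
begin

lemma neg_c: "continuous_on {0..1} (\<lambda>x. - \<phi> x)" by (intro continuous_intros half_profileD(1)[OF s])

lemma prim_neg: "prim (\<lambda>x. - \<phi> x) x = - prim \<phi> x" by (simp add: prim_def kernel_op_def)

lemma neg_p1: "prim (\<lambda>x. - \<phi> x) 1 = 0" using half_profileD(2)[OF s] by (simp add: prim_neg)

lemma profile_of_inner: "y \<in> {0..1} \<Longrightarrow> profile_of \<phi> y = - prim \<phi> y" by (simp add: profile_of_def odd_ext_def prim_neg)

lemma profile_of_odd: "profile_of \<phi> (- y) = - profile_of \<phi> y"
  unfolding profile_of_def by (rule odd_ext_odd[OF prim_0[OF neg_c]])

lemma hilbert_profile_of_limit: "(trunc_hilbert (profile_of \<phi>) x \<longlongrightarrow> pi * neg_hilbert \<phi> x) (at_right 0)"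
proof -
  have "kernel_op log_kernel (\<lambda>x. - \<phi> x) x = pi * neg_hilbert \<phi> x" by (simp add: neg_hilbert_def kernel_op_def)
  then show ?thesis using hilbert_limit[OF L2_I_continuous[OF neg_c] neg_p1, of x] unfolding profile_of_def by simp
qed

lemma hilbert_profile_of: "hilbert_transform (profile_of \<phi>) x = neg_hilbert \<phi> x"
  using hilbert_of_limit[OF hilbert_profile_of_limit] by simp

lemma neg_hilbert_even: "neg_hilbert \<phi> (- x) = neg_hilbert \<phi> x"
proof -
  have "log_kernel (- x) y = log_kernel x y" for y
  proof -
    have "\<bar>- x + y\<bar> = \<bar>x - y\<bar>" "\<bar>- x - y\<bar> = \<bar>x + y\<bar>" by linarith+
    then show ?thesis by (simp add: log_kernel_def log_plus_def log_minus_def)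
  qed
  then show ?thesis by (simp add: neg_hilbert_def kernel_op_def)
qed

text \<open>The function \<open>U x - x + l \<Omega> x\<close> has derivative zero off \<open>0\<close> by the
  half-profile equation, and vanishes at \<open>0\<close>.\<close>
lemma velocity_profile_of:
  "\<exists>U. U 0 = 0 \<and> (\<forall>x. (U has_real_derivative neg_hilbert \<phi> x) (at x)) \<and> (\<forall>x\<in>{-1..1}. U x - x = - l * profile_of \<phi> x)"
proof -
  obtain U where U0: "U 0 = 0" and U: "\<forall>x. (U has_real_derivative neg_hilbert \<phi> x) (at x)"
    using antiderivative_real_line[OF neg_hilbert_continuous[OF half_profileD(4)[OF s]]] by (elim exE conjE) (rule that)
  have Uc: "continuous_on A U" for A using U DERIV_isCont by (meson continuous_at_imp_continuous_on)
  have oc: "continuous_on A (profile_of \<phi>)" for A unfolding profile_of_def by (rule odd_ext_continuous[OF neg_c neg_p1])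
  define h where "h x = U x - x + l * profile_of \<phi> x" for x
  have hd: "(h has_real_derivative 0) (at x)" if x: "\<bar>x\<bar> < 1" "x \<noteq> 0" for x
  proof -
    have "(profile_of \<phi> has_real_derivative - \<phi> \<bar>x\<bar>) (at x)"
      using has_derivative_odd_ext[OF neg_c neg_p1, of x] x by (simp add: profile_of_def odd_ext_deriv_def)
    then have "(h has_real_derivative neg_hilbert \<phi> x - 1 + l * (- \<phi> \<bar>x\<bar>)) (at x)"
      unfolding h_def[abs_def] using U by (intro DERIV_add DERIV_diff DERIV_cmult DERIV_ident) auto
    moreover have "neg_hilbert \<phi> x = neg_hilbert \<phi> \<bar>x\<bar>" using neg_hilbert_even[of x] by (simp add: abs_if)
    ultimately show ?thesis using half_profileD(3)[OF s, of "\<bar>x\<bar>"] x by simp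
  qed
  have hc: "continuous_on A h" for A unfolding h_def by (intro continuous_intros Uc oc)
  have h0: "h 0 = 0" using U0 profile_of_inner[of 0] prim_0[OF half_profileD(1)[OF s]] by (simp add: h_def)
  have "h x = 0" if x: "x \<in> {-1..1}" for x
  proof -
    consider "x = 0" | "0 < x" | "x < 0" by linarith
    then show ?thesis
    proof cases
      case 2
      have "h x = h 0" by (rule DERIV_isconst_end[OF 2 hc]) (use hd x in auto)
      then show ?thesis using h0 by simp
    next
      case 3
      have "h 0 = h x" by (rule DERIV_isconst_end[OF 3 hc]) (use hd x in auto)
      then show ?thesis using h0 by simp
    qed (use h0 in simp)
  qed
  then have "\<forall>x\<in>{-1..1}. U x - x = - l * profile_of \<phi> x" by (simp add: h_def eq_neg_iff_add_eq_0)
  then show ?thesis using U0 U by (intro exI[of _ U]) simp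
qed

lemma profile_equation:
  assumes U: "\<forall>x\<in>{-1..1}. U x - x = - l * profile_of \<phi> x" and x: "x \<noteq> 0" "\<bar>x\<bar> \<noteq> 1"
  shows "(- x + U x) * odd_ext_deriv (\<lambda>x. - \<phi> x) x = (- 1 + neg_hilbert \<phi> x) * profile_of \<phi> x"
proof (cases "\<bar>x\<bar> < 1")
  case True
  have "x \<in> {-1..1}" using True by auto
  then have "- x + U x = - l * profile_of \<phi> x" using bspec[OF U] by simp
  moreover have "neg_hilbert \<phi> x = 1 + l * \<phi> \<bar>x\<bar>" using neg_hilbert_even[of x] half_profileD(3)[OF s, of "\<bar>x\<bar>"] True by (simp add: abs_if split: if_splits)
  ultimately show ?thesis using True by (simp add: odd_ext_deriv_def)
next
  case False
  then show ?thesis using x by (simp add: odd_ext_deriv_def profile_of_def odd_ext_outside)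
qed

lemma AE_regular_points: "AE x in lborel. x \<noteq> 0 \<and> \<bar>x::real\<bar> \<noteq> 1"
  using AE_lborel_singleton[of "0::real"] AE_lborel_singleton[of "1::real"] AE_lborel_singleton[of "-1::real"]
  by eventually_elim auto

lemma self_similar_profile_of: "self_similar_profile (-1) (-1) (profile_of \<phi>)"
proof -
  obtain U where U0: "U 0 = 0" "\<forall>x. (U has_real_derivative neg_hilbert \<phi> x) (at x)" "\<forall>x\<in>{-1..1}. U x - x = - l * profile_of \<phi> x"
    using velocity_profile_of by (elim exE conjE) (rule that)
  note U = U0(1) spec[OF U0(2)] bspec[OF U0(3)]
  have "velocity_of (profile_of \<phi>) U" unfolding velocity_of_def hilbert_profile_of using U by simp
  moreover have "AE x in lborel. (- 1 * x + U x) * odd_ext_deriv (\<lambda>x. - \<phi> x) x = (- 1 + hilbert_transform (profile_of \<phi>) x) * profile_of \<phi> x"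
    using AE_regular_points by eventually_elim (use profile_equation[OF U0(3)] in \<open>simp add: hilbert_profile_of\<close>)
  ultimately show ?thesis unfolding self_similar_profile_def
    using sobolev_odd_ext[OF neg_c neg_p1] weak_derivative_odd_ext[OF neg_c neg_p1] square_integrable_odd_ext_deriv[OF neg_c neg_p1]
    unfolding profile_of_def by blast
qed

lemma odd_profile_of: "odd_function (profile_of \<phi>)" by (simp add: odd_function_def profile_of_odd)

lemma supported_profile_of: "supported_on (profile_of \<phi>) {-1..1}"
  unfolding profile_of_def by (rule supported_odd_ext[OF neg_c neg_p1])

lemma profile_of_nonzero: "profile_of \<phi> \<noteq> (\<lambda>x. 0)"
proof -
  obtain x where "x \<in> {0..1}" "prim \<phi> x \<noteq> 0" using half_profile_prim_nz[OF s] by blast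
  then have "profile_of \<phi> x \<noteq> 0" using profile_of_inner by simp
  then show ?thesis by auto
qed

text \<open>At time \<open>t\<close> the solution is \<open>\<Omega> (a x) / a\<close> with \<open>a = T -
  t\<close>, since \<open>c\<^sub>l = c\<^sub>\<omega> = -1\<close>; its velocity is \<open>U (a x) /
  a\<^sup>2\<close>. Each term of the equation at \<open>x\<close> is \<open>1 / a\<^sup>2\<close> times the
  corresponding term of the profile equation at \<open>a x\<close>.\<close>
lemma solution_profile_of: "de_gregorio_solution {..<T} (self_similar_solution T (-1) (-1) (profile_of \<phi>))"
  unfolding de_gregorio_solution_def
proof
  fix t assume "t \<in> {..<T}"
  define a where "a = T - t"
  have a: "a > 0" using \<open>t \<in> {..<T}\<close> by (simp add: a_def)
  have form: "self_similar_solution T (-1) (-1) (profile_of \<phi>) x r = (1 / (T - r)) * profile_of \<phi> ((T - r) * x)" if "r < T" for x r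
    using that by (simp add: self_similar_solution_def powr_minus_divide field_simps)
  have w: "(\<lambda>x. self_similar_solution T (-1) (-1) (profile_of \<phi>) x t) = (\<lambda>x. (1 / a) * profile_of \<phi> (a * x))"
    using form[of t] a by (auto simp: a_def)
  obtain U where U0: "U 0 = 0" "\<forall>x. (U has_real_derivative neg_hilbert \<phi> x) (at x)" "\<forall>x\<in>{-1..1}. U x - x = - l * profile_of \<phi> x"
    using velocity_profile_of by (elim exE conjE) (rule that)
  note U = U0(1) spec[OF U0(2)] bspec[OF U0(3)]
  define u where "u x = U (a * x) / a\<^sup>2" for x
  have H: "hilbert_transform (\<lambda>x. (1 / a) * profile_of \<phi> (a * x)) x = (1 / a) * neg_hilbert \<phi> (a * x)" for x
    using hilbert_of_limit[OF hilbert_scale[OF a hilbert_profile_of_limit, where a="1 / a" and x=x]] by simp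
  let ?D = "odd_ext_deriv (\<lambda>x. - \<phi> x)"
  have so: "sobolev_H1 (\<lambda>x. (1 / a) * profile_of \<phi> (a * x))"
    unfolding profile_of_def by (rule sobolev_scale[OF sobolev_odd_ext[OF neg_c neg_p1] a])
  have ve: "velocity_of (\<lambda>x. (1 / a) * profile_of \<phi> (a * x)) u"
    unfolding velocity_of_def H
  proof (intro conjI allI)
    show "u 0 = 0" using U(1) by (simp add: u_def)
    fix x
    have "((\<lambda>x. U (a * x) / a\<^sup>2) has_real_derivative (neg_hilbert \<phi> (a * x) * a) / a\<^sup>2) (at x)"
      by (intro DERIV_cdivide DERIV_chain2[OF U(2)]) (auto intro!: derivative_eq_intros)
    then show "(u has_real_derivative 1 / a * neg_hilbert \<phi> (a * x)) (at x)"
      using a by (simp add: u_def[abs_def] power2_eq_square)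
  qed
  have wd: "weak_derivative (\<lambda>x. (1 / a) * profile_of \<phi> (a * x)) (\<lambda>x. ?D (a * x))"
    using weak_derivative_scale[OF weak_derivative_odd_ext[OF neg_c neg_p1] a, of "1 / a"] a by (simp add: profile_of_def)
  have sq: "square_integrable (\<lambda>x. ?D (a * x))"
    using square_integrable_scale[OF square_integrable_odd_ext_deriv[OF neg_c neg_p1], of a 1] a by simp
  have eq: "AE x in lborel. \<exists>wt. (self_similar_solution T (-1) (-1) (profile_of \<phi>) x has_real_derivative wt) (at t) \<and>
      wt + u x * ?D (a * x) = (1 / a) * neg_hilbert \<phi> (a * x) * ((1 / a) * profile_of \<phi> (a * x))"
    (* The profile may fail to be differentiable at 0 and at the end points of its support. *)
    using AE_lborel_singleton[of "0::real"] AE_lborel_singleton[of "1 / a"] AE_lborel_singleton[of "- 1 / a"]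
  proof eventually_elim
    case (elim x)
    have z: "a * x \<noteq> 0" "\<bar>a * x\<bar> \<noteq> 1"
      using elim a by (auto simp: field_simps abs_if split: if_splits)
    have dO: "(profile_of \<phi> has_real_derivative ?D (a * x)) (at ((T - t) * x))"
      unfolding profile_of_def a_def[symmetric] by (rule has_derivative_odd_ext[OF neg_c neg_p1 z(2,1)])
    have g: "((\<lambda>r. (T - r) * x) has_real_derivative (0 - 1) * x) (at t)"
      by (intro DERIV_cmult_right DERIV_diff DERIV_const DERIV_ident)
    have "((\<lambda>r. profile_of \<phi> ((T - r) * x)) has_real_derivative ?D (a * x) * ((0 - 1) * x)) (at t)"
      using DERIV_chain2[where f="profile_of \<phi>" and g="\<lambda>r. (T - r) * x", OF dO g] .
    moreover have "((\<lambda>r. 1 / (T - r)) has_real_derivative 1 / a\<^sup>2) (at t)"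
      using a by (auto intro!: derivative_eq_intros simp: a_def power2_eq_square)
    ultimately have d: "((\<lambda>r. (1 / (T - r)) * profile_of \<phi> ((T - r) * x)) has_real_derivative
        1 / a\<^sup>2 * profile_of \<phi> ((T - t) * x) + ?D (a * x) * ((0 - 1) * x) * (1 / (T - t))) (at t)"
      by (rule DERIV_mult[rotated])
    define wt where "wt = 1 / a\<^sup>2 * profile_of \<phi> (a * x) - x * ?D (a * x) / a"
    have "1 / a\<^sup>2 * profile_of \<phi> ((T - t) * x) + ?D (a * x) * ((0 - 1) * x) * (1 / (T - t)) = wt"
      by (simp add: wt_def a_def[symmetric])
    with d have "((\<lambda>r. (1 / (T - r)) * profile_of \<phi> ((T - r) * x)) has_real_derivative wt) (at t)" by simp
    then have "(self_similar_solution T (-1) (-1) (profile_of \<phi>) x has_real_derivative wt) (at t)"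
      by (rule has_field_derivative_transform_within_open[of _ _ _ "{..<T}"]) (use \<open>t \<in> {..<T}\<close> form in auto)
    moreover have "wt + u x * ?D (a * x) = (1 / a) * neg_hilbert \<phi> (a * x) * ((1 / a) * profile_of \<phi> (a * x))"
    proof -
      have "wt + u x * ?D (a * x) = (profile_of \<phi> (a * x) + (- (a * x) + U (a * x)) * ?D (a * x)) / a\<^sup>2"
        using a by (simp add: wt_def u_def field_simps power2_eq_square)
      also have "\<dots> = (neg_hilbert \<phi> (a * x) * profile_of \<phi> (a * x)) / a\<^sup>2"
        unfolding profile_equation[OF U0(3) z] by (simp add: algebra_simps)
      finally show ?thesis by (simp add: power2_eq_square)
    qed
    ultimately show ?case by blast
  qed
  show "sobolev_H1 (\<lambda>x. self_similar_solution T (-1) (-1) (profile_of \<phi>) x t) \<and>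
    (\<exists>u \<omega>x. velocity_of (\<lambda>x. self_similar_solution T (-1) (-1) (profile_of \<phi>) x t) u \<and>
      weak_derivative (\<lambda>x. self_similar_solution T (-1) (-1) (profile_of \<phi>) x t) \<omega>x \<and> square_integrable \<omega>x \<and>
      (AE x in lborel. \<exists>\<omega>t. (self_similar_solution T (-1) (-1) (profile_of \<phi>) x has_real_derivative \<omega>t) (at t) \<and>
        \<omega>t + u x * \<omega>x x = hilbert_transform (\<lambda>y. self_similar_solution T (-1) (-1) (profile_of \<phi>) y t) x *
          self_similar_solution T (-1) (-1) (profile_of \<phi>) x t))"
    unfolding w H
  proof (intro conjI exI so)
    show "velocity_of (\<lambda>x. (1 / a) * profile_of \<phi> (a * x)) u" by (rule ve)
    show "weak_derivative (\<lambda>x. (1 / a) * profile_of \<phi> (a * x)) (\<lambda>x. ?D (a * x))" by (rule wd)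
    show "square_integrable (\<lambda>x. ?D (a * x))" by (rule sq)
    show "AE x in lborel. \<exists>\<omega>t. (self_similar_solution T (-1) (-1) (profile_of \<phi>) x has_real_derivative \<omega>t) (at t) \<and>
        \<omega>t + u x * ?D (a * x) = 1 / a * neg_hilbert \<phi> (a * x) * self_similar_solution T (-1) (-1) (profile_of \<phi>) x t"
      using eq fun_cong[OF w] by simp
  qed
qed

end

section \<open>A potential equation on the unit ball\<close>

text \<open>Young's inequality with exponents \<open>4\<close> and \<open>4/3\<close>. It bounds the kernel by a
  product of integrable functions of one variable, which yields a smallness estimate on thin strips.\<close>
lemma newton_kernel_bound:
  fixes t q :: real
  assumes "0 < q" "t \<noteq> 0"
  shows "1 / (t\<^sup>2 + q) \<le> (1 / sqrt \<bar>t\<bar>) * (1 / (sqrt q * sqrt (sqrt q)))"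
proof -
  define u where "u = sqrt \<bar>t\<bar>"
  define v where "v = sqrt (sqrt q)"
  have uv: "u > 0" "v > 0" using assms by (auto simp: u_def v_def)
  have t: "t\<^sup>2 = u ^ 4"
  proof -
    have "u ^ 4 = (u\<^sup>2)\<^sup>2" by (simp add: power_mult[symmetric])
    then show ?thesis by (simp add: u_def)
  qed
  have q: "sqrt q = v\<^sup>2" "q = v ^ 4"
  proof -
    show 1: "sqrt q = v\<^sup>2" using assms by (simp add: v_def)
    have "v ^ 4 = (v\<^sup>2)\<^sup>2" by (simp add: power_mult[symmetric])
    then show "q = v ^ 4" using assms by (simp add: 1[symmetric])
  qed
  have "u * (v\<^sup>2 * v) \<le> u ^ 4 + v ^ 4"
  proof (cases "u \<le> v")
    case True
    then have "u * (v\<^sup>2 * v) \<le> v * (v\<^sup>2 * v)" using uv by (intro mult_right_mono) auto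
    also have "\<dots> = v ^ 4" by (simp add: power4_eq_xxxx power2_eq_square)
    finally show ?thesis using uv by (simp add: add_increasing)
  next
    case False
    have "v\<^sup>2 * v \<le> u\<^sup>2 * u" using False uv by (intro mult_mono power_mono) auto
    then have "u * (v\<^sup>2 * v) \<le> u * (u\<^sup>2 * u)" using uv by (intro mult_left_mono) auto
    also have "\<dots> = u ^ 4" by (simp add: power4_eq_xxxx power2_eq_square)
    finally show ?thesis using uv by (simp add: add_increasing2)
  qed
  then have "1 / (u ^ 4 + v ^ 4) \<le> 1 / (u * (v\<^sup>2 * v))" using uv by (intro divide_left_mono mult_pos_pos add_pos_pos zero_less_power) auto
  moreover have "t\<^sup>2 + q = u ^ 4 + v ^ 4" using t q(2) by simp
  moreover have "u * (sqrt q * v) = u * (v\<^sup>2 * v)" using q(1) by simp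
  ultimately have "1 / (t\<^sup>2 + q) \<le> 1 / (u * (sqrt q * v))" by (simp only:)
  then show ?thesis unfolding u_def v_def by simp
qed

lemma quarter_integral:
  "set_integrable lborel {0..1} (\<lambda>q. 1 / (sqrt q * sqrt (sqrt q)))"
  "(LBINT q:{0..1}. 1 / (sqrt q * sqrt (sqrt q))) = 4"
proof -
  have d: "((\<lambda>q. 4 * sqrt (sqrt q)) has_real_derivative 1 / (sqrt q * sqrt (sqrt q))) (at q)" if "q \<in> {0<..<1} - {}" for q
    using that by (auto intro!: derivative_eq_intros simp: field_simps)
  have c: "continuous_on {0..1} (\<lambda>q. 4 * sqrt (sqrt q))" by (intro continuous_intros)
  note F = FTC_lborel_nonneg[of "{}" 0 1, OF _ _ c d]
  show "set_integrable lborel {0..1} (\<lambda>q. 1 / (sqrt q * sqrt (sqrt q)))" by (rule F(1)) auto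
  have "(LBINT q:{0..1}. 1 / (sqrt q * sqrt (sqrt q))) = 4 * sqrt (sqrt 1) - 4 * sqrt (sqrt 0)" by (rule F(2)) auto
  then show "(LBINT q:{0..1}. 1 / (sqrt q * sqrt (sqrt q))) = 4" by simp
qed

text \<open>Up to a factor, the integral of \<open>\<bar>x - z\<bar>\<^sup>-\<^sup>2\<close> over the sphere of
  radius \<open>r\<close> in \<open>\<real>\<^sup>3\<close>, at distance \<open>x\<close> from the centre. The
  value \<open>2\<close> is the limit at the centre.\<close>
definition shell_kernel :: "real \<Rightarrow> real \<Rightarrow> real" where
  "shell_kernel x r = (if x = 0 then 2 else r / x * log_ratio x r)"

text \<open>In \<open>\<real>\<^sup>3\<close> the height \<open>y\<close> is uniformly distributed on a sphere,
  so the integral over the sphere is one over \<open>y\<close>.\<close>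
lemma nn_shell_integral:
  assumes r: "0 < r" and x: "0 \<le> x" "x \<noteq> r"
  shows "(\<integral>\<^sup>+y. ennreal (r / (x\<^sup>2 + r\<^sup>2 - 2 * x * y)) * indicator {-r..r} y \<partial>lborel) = ennreal (shell_kernel x r)"
proof (cases "x = 0")
  case True
  have "(\<integral>\<^sup>+y. ennreal (r / (x\<^sup>2 + r\<^sup>2 - 2 * x * y)) * indicator {-r..r} y \<partial>lborel) = ennreal (r / r - (- r) / r)"
    by (rule nn_integral_FTC_Icc) (use r True in \<open>auto intro!: derivative_eq_intros simp: power2_eq_square\<close>)
  then show ?thesis using True r by (simp add: shell_kernel_def)
next
  case False
  then have x0: "x > 0" using x by simp
  have D: "0 < x\<^sup>2 + r\<^sup>2 - 2 * x * y" if "y \<in> {-r..r}" for y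
  proof -
    have "x * y \<le> x * r" using that x0 by (intro mult_left_mono) auto
    moreover have "0 < (x - r)\<^sup>2" using x by simp
    moreover have "(x - r)\<^sup>2 = x\<^sup>2 + r\<^sup>2 - 2 * (x * r)" by (simp add: power2_eq_square algebra_simps)
    ultimately show ?thesis by (simp add: mult.assoc)
  qed
  define F where "F y = - (r / (2 * x)) * ln (x\<^sup>2 + r\<^sup>2 - 2 * x * y)" for y
  have "(\<integral>\<^sup>+y. ennreal (r / (x\<^sup>2 + r\<^sup>2 - 2 * x * y)) * indicator {-r..r} y \<partial>lborel) = ennreal (F r - F (- r))"
  proof (rule nn_integral_FTC_Icc)
    fix y assume y: "y \<in> {-r..r}"
    have "(F has_real_derivative - (r / (2 * x)) * (1 / (x\<^sup>2 + r\<^sup>2 - 2 * x * y) * (0 - 2 * x * 1))) (at y)"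
      unfolding F_def[abs_def]
      by (intro DERIV_cmult DERIV_chain2[OF DERIV_ln_divide] DERIV_diff DERIV_const DERIV_ident D y)
    moreover have "- (r / (2 * x)) * (1 / d * (0 - 2 * x * 1)) = r / d" for d using x0 by simp
    ultimately show "(F has_real_derivative r / (x\<^sup>2 + r\<^sup>2 - 2 * x * y)) (at y)" by (simp only:)
    show "0 \<le> r / (x\<^sup>2 + r\<^sup>2 - 2 * x * y)" using D[OF y] r by simp
  qed (use r in auto)
  also have "F r - F (- r) = shell_kernel x r"
  proof -
    have e: "x\<^sup>2 + r\<^sup>2 - 2 * x * r = \<bar>x - r\<bar>\<^sup>2" "x\<^sup>2 + r\<^sup>2 - 2 * x * (- r) = \<bar>x + r\<bar>\<^sup>2"
      by (simp_all add: power2_eq_square algebra_simps)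
    have l: "ln (\<bar>x - r\<bar>\<^sup>2) = 2 * ln \<bar>x - r\<bar>" "ln (\<bar>x + r\<bar>\<^sup>2) = 2 * ln \<bar>x + r\<bar>"
    proof -
      have gen: "ln (a\<^sup>2) = 2 * ln a" if "a > 0" for a :: real using that by (simp add: ln_realpow)
      show "ln (\<bar>x - r\<bar>\<^sup>2) = 2 * ln \<bar>x - r\<bar>" by (rule gen) (use x in simp)
      show "ln (\<bar>x + r\<bar>\<^sup>2) = 2 * ln \<bar>x + r\<bar>" by (rule gen) (use x0 r in simp)
    qed
    show ?thesis unfolding F_def e l shell_kernel_def log_ratio_def log_plus_def log_minus_def using x0 by (simp add: field_simps)
  qed
  finally show ?thesis .
qed

lemma shell_kernel_nonneg: assumes "0 < r" "0 \<le> x" "x \<noteq> r" shows "0 \<le> shell_kernel x r"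
proof (cases "x = 0")
  case False
  then have "0 < log_ratio x r" using assms unfolding log_ratio_def log_plus_def log_minus_def by (simp add: abs_if)
  then show ?thesis using assms False by (simp add: shell_kernel_def)
qed (simp add: shell_kernel_def)

text \<open>
  From here on \<open>f = prim \<phi>\<close> is positive on \<open>(0, 1)\<close>, and its chord slope \<open>S = f / x\<close> is viewed as a radial
  function on \<open>\<real>\<^sup>3\<close> that vanishes outside the unit ball. Points are described by their coordinate \<open>y\<close> along a fixed axis and by the
  square \<open>q\<close> of their distance from it; the volume element is \<open>pi dy dq\<close>.
\<close>

context
  fixes l :: real and \<phi> :: "real \<Rightarrow> real"
  assumes s: "half_profile l \<phi>" and l: "0 < l" and pos: "\<And>x. 0 < x \<Longrightarrow> x < 1 \<Longrightarrow> 0 < prim \<phi> x"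
begin

text \<open>Equals \<open>prim \<phi> r / r\<close> on \<open>(0, 1]\<close>. The form as a sum is continuous at
  \<open>0\<close>, and clamping gives the extension by zero beyond \<open>1\<close>.\<close>
definition slope :: "real \<Rightarrow> real" where
  "slope r = slope_drop \<phi> (max 0 (min 1 r)) + \<phi> (max 0 (min 1 r))"

lemma slope_cont: "continuous_on A slope"
  unfolding slope_def
  by (intro continuous_on_add continuous_on_compose2[OF half_profile_slope_drop(1)[OF s]] continuous_on_compose2[OF half_profileD(1)[OF s]] continuous_intros) auto

lemma slope_measurable [measurable]: "slope \<in> borel_measurable borel"
  by (rule borel_measurable_continuous_onI[OF slope_cont])

lemma slope_eq: assumes "0 < r" "r \<le> 1" shows "slope r = prim \<phi> r / r"
  using assms by (simp add: slope_def slope_drop_def)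

lemma slope_0: "slope 0 = \<phi> 0" by (simp add: slope_def slope_drop_def)

lemma slope_out: "1 \<le> r \<Longrightarrow> slope r = 0"
  using half_profileD(2)[OF s] by (simp add: slope_def slope_drop_def)

lemma slope_pos: "0 < r \<Longrightarrow> r < 1 \<Longrightarrow> 0 < slope r"
  using slope_eq[of r] pos[of r] by simp

lemma slope_nonneg: assumes "0 \<le> r" shows "0 \<le> slope r"
proof -
  have *: "0 \<le> slope r" if "0 < r" for r
    using slope_pos[of r] slope_out[of r] that by (cases "r < 1") auto
  show ?thesis
  proof (cases "r = 0")
    case True
    have "(slope \<longlongrightarrow> slope 0) (at_right 0)" using slope_cont[of UNIV] by (auto simp: continuous_on_def intro: tendsto_within_subset)
    moreover have "\<forall>\<^sub>F r in at_right 0. 0 \<le> slope r" unfolding eventually_at_filter using * by (intro always_eventually) auto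
    ultimately have "0 \<le> slope 0" by (rule tendsto_lowerbound) simp
    then show ?thesis using True by simp
  qed (use * assms in auto)
qed

lemma prim_neg_hilbert_half_profile: assumes "x \<in> {0..1}" shows "prim (neg_hilbert \<phi>) x = x + l * prim \<phi> x"
proof -
  have "prim (neg_hilbert \<phi>) x = prim (\<lambda>y. 1 + l * \<phi> y) x"
    unfolding prim_def kernel_op_def by (intro Bochner_Integration.integral_cong) (use half_profileD(3)[OF s] in auto)
  also have "\<dots> = 1 * x + l * prim \<phi> x" by (rule prim_const_lin[OF half_profileD(4)[OF s] assms])
  finally show ?thesis by simp
qed

text \<open>For \<open>x > 0\<close> this is the half-profile equation integrated once and divided by
  \<open>x\<close>. At \<open>x = 0\<close> it is the equation itself, as \<open>\<integral> f / r dr = -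
  \<integral> ln z \<phi> z dz\<close>.\<close>
lemma shell_average_equation:
  assumes x: "x \<in> {0..1}"
  shows "integrable I (\<lambda>r. slope r * shell_kernel x r)" "(\<integral>r. slope r * shell_kernel x r \<partial>I) = pi * (1 + l * slope x)"
proof -
  have \<phi>: "L2 I \<phi>" by (rule half_profileD(4)[OF s])
  have \<phi>m: "\<phi> \<in> borel_measurable I" using \<phi> by (simp add: L2_def)
  have "integrable I (\<lambda>r. slope r * shell_kernel x r) \<and> (\<integral>r. slope r * shell_kernel x r \<partial>I) = pi * (1 + l * slope x)"
  proof (cases "x = 0")
    case False
    then have x0: "0 < x" "x \<le> 1" using x by auto
    have eq: "AE r in I. (1 / x) * (log_ratio x r * prim \<phi> r) = slope r * shell_kernel x r"
      using AE_I_pos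
    proof eventually_elim
      case (elim r)
      then show ?case using slope_eq[of r] x0 by (simp add: shell_kernel_def)
    qed
    have i: "integrable I (\<lambda>r. (1 / x) * (log_ratio x r * prim \<phi> r))"
      by (intro integrable_mult_right L2_mult_integrable log_ratio_L2 prim_L2 \<phi>)
    have m: "(\<lambda>r. slope r * shell_kernel x r) \<in> borel_measurable I"
      by (rule measurable_I_borel) (unfold shell_kernel_def log_ratio_def log_plus_def log_minus_def, measurable)
    have "(\<integral>r. slope r * shell_kernel x r \<partial>I) = (\<integral>r. (1 / x) * (log_ratio x r * prim \<phi> r) \<partial>I)"
    proof (rule integral_cong_AE[OF m borel_measurable_integrable[OF i]])
      show "AE r in I. slope r * shell_kernel x r = (1 / x) * (log_ratio x r * prim \<phi> r)" using eq by eventually_elim simp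
    qed
    also have "\<dots> = (1 / x) * kernel_op log_ratio (prim \<phi>) x" unfolding kernel_op_def by (rule integral_mult_right_zero)
    also have "kernel_op log_ratio (prim \<phi>) x = pi * (x + l * prim \<phi> x)"
      using prim_neg_hilbert_log_ratio[OF \<phi> half_profileD(2)[OF s] x] prim_neg_hilbert_half_profile[OF x] by (simp add: field_simps)
    also have "(1 / x) * (pi * (x + l * prim \<phi> x)) = pi * (1 + l * slope x)"
      using x0 slope_eq[OF x0] by (simp add: field_simps)
    finally show ?thesis using integrable_cong_AE_imp[OF i m eq] by blast
  next
    case True
    have c: "continuous_on {0..1} slope" by (rule slope_cont)
    have i: "integrable I (\<lambda>r. slope r * 2)" by (intro integrable_mult_left L2_cont_int c)
    (* The kernel of the averaging operator that sends the density to f / y. *)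
    define k where "k y z = (if z \<le> y \<and> 0 < y then 1 / y else 0)" for y z :: real
    have "(\<integral>y. slope y \<partial>I) = (\<integral>y. \<integral>z. k y z * \<phi> z \<partial>I \<partial>I)"
    proof (rule integral_cong_AE)
      have km: "(\<lambda>(y, z). k y z) \<in> borel_measurable (I \<Otimes>\<^sub>M I)" unfolding k_def by measurable
      show "(\<lambda>y. \<integral>z. k y z * \<phi> z \<partial>I) \<in> borel_measurable I"
        using kernel_op_measurable[OF km, of \<phi>] \<phi> by (simp add: kernel_op_def[abs_def] L2_def)
      show "slope \<in> borel_measurable I" by (rule measurable_I_borel[OF slope_measurable])
      show "AE y in I. slope y = (\<integral>z. k y z * \<phi> z \<partial>I)"
        using AE_I_pos
      proof eventually_elim
        case (elim y)
        have "(\<integral>z. k y z * \<phi> z \<partial>I) = (\<integral>z. (1 / y) * (volterra y z * \<phi> z) \<partial>I)"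
          by (intro Bochner_Integration.integral_cong) (use elim in \<open>auto simp: k_def volterra_def\<close>)
        also have "\<dots> = (1 / y) * prim \<phi> y" unfolding prim_def kernel_op_def by (rule integral_mult_right_zero)
        finally show ?case using slope_eq[of y] elim by simp
      qed
    qed
    also have "\<dots> = (\<integral>z. \<integral>y. k y z * \<phi> z \<partial>I \<partial>I)"
    proof -
      have [measurable]: "\<phi> \<in> borel_measurable I" using \<phi> by (simp add: L2_def)
      obtain B where B: "\<And>x. x \<in> {0..1} \<Longrightarrow> \<bar>\<phi> x\<bar> \<le> B"
        using compact_imp_bounded[OF compact_continuous_image[OF half_profileD(1)[OF s]]] unfolding bounded_iff by force
      have km: "(\<lambda>(y, z). k y z * \<phi> z) \<in> borel_measurable (I \<Otimes>\<^sub>M I)" unfolding k_def by measurable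
      have b: "(\<integral>z. \<bar>k y z * \<phi> z\<bar> \<partial>I) \<le> B \<and> integrable I (\<lambda>z. k y z * \<phi> z)" if y: "y \<in> {0..1}" for y
      proof (cases "y = 0")
        case True
        then show ?thesis using B[of 0] by (simp add: k_def)
      next
        case False
        have m: "(\<lambda>z. k y z * \<phi> z) \<in> borel_measurable I"
          using measurable_compose[OF measurable_Pair1'[of y I I] km] y by simp
        have bd: "\<bar>k y z * \<phi> z\<bar> \<le> volterra y z * (B / y)" if "z \<in> {0..1}" for z
          using B[OF that] False y by (auto simp: k_def volterra_def abs_mult divide_right_mono)
        have Ti: "integrable I (\<lambda>z. volterra y z * (B / y))" by (intro integrable_mult_left L2_I_integrable volterra_L2)
        have i: "integrable I (\<lambda>z. k y z * \<phi> z)"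
        proof (rule Bochner_Integration.integrable_bound[OF Ti m], rule AE_I2)
          fix z assume "z \<in> space I"
          then show "norm (k y z * \<phi> z) \<le> norm (volterra y z * (B / y))"
            using order_trans[OF bd abs_ge_self] by simp
        qed
        have "(\<integral>z. \<bar>k y z * \<phi> z\<bar> \<partial>I) \<le> (\<integral>z. volterra y z * (B / y) \<partial>I)"
          by (rule integral_mono) (use i Ti bd in auto)
        also have "\<dots> = prim (\<lambda>_. 1) y * (B / y)" by (simp add: prim_def kernel_op_def)
        also have "prim (\<lambda>_. 1) y = y - 0"
          by (rule FTC_prim[of "{}"]) (use y in \<open>auto intro!: continuous_intros derivative_eq_intros\<close>)
        finally show ?thesis using i False by simp
      qed
      have "integrable (I \<Otimes>\<^sub>M I) (\<lambda>(y, z). k y z * \<phi> z)"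
      proof (rule II.Fubini_integrable[OF km])
        have "(\<lambda>(y, z). \<bar>k y z * \<phi> z\<bar>) \<in> borel_measurable (I \<Otimes>\<^sub>M I)" using km by (simp add: split_beta')
        then have m2: "(\<lambda>y. \<integral>z. \<bar>k y z * \<phi> z\<bar> \<partial>I) \<in> borel_measurable I"
          by (rule I.borel_measurable_lebesgue_integral)
        have "integrable I (\<lambda>y. \<integral>z. \<bar>k y z * \<phi> z\<bar> \<partial>I)"
          by (rule integrable_I_bounded[OF m2, of B]) (use b in auto)
        then show "integrable I (\<lambda>y. \<integral>z. norm (case (y, z) of (y, z) \<Rightarrow> k y z * \<phi> z) \<partial>I)" by simp
        show "AE y in I. integrable I (\<lambda>z. case (y, z) of (y, z) \<Rightarrow> k y z * \<phi> z)"
          by (rule AE_I2) (use b in auto)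
      qed
      from II.Fubini_integral[OF this] show ?thesis by simp
    qed
    also have "\<dots> = (\<integral>z. - ln z * \<phi> z \<partial>I)"
    proof (rule integral_cong_AE)
      have lnL: "L2 I (\<lambda>y. ln \<bar>0 - y\<bar>)" by (rule ln_L2)
      have "(\<lambda>(y, z). k z y) \<in> borel_measurable (I \<Otimes>\<^sub>M I)" unfolding k_def by measurable
      moreover have "(\<lambda>_. 1::real) \<in> borel_measurable I" by simp
      ultimately have "(\<lambda>z. \<integral>y. k y z * 1 \<partial>I) \<in> borel_measurable I"
        using kernel_op_measurable[of "\<lambda>z y. k y z"] by (simp add: kernel_op_def[abs_def])
      then have "(\<lambda>z. \<integral>y. k y z \<partial>I) \<in> borel_measurable I" by simp
      then have "(\<lambda>z. (\<integral>y. k y z \<partial>I) * \<phi> z) \<in> borel_measurable I" using \<phi>m by (rule borel_measurable_times)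
      then show "(\<lambda>z. \<integral>y. k y z * \<phi> z \<partial>I) \<in> borel_measurable I" by simp
      show "(\<lambda>z. - ln z * \<phi> z) \<in> borel_measurable I"
        by (intro borel_measurable_times[OF _ \<phi>m] measurable_I_borel) measurable
      show "AE z in I. (\<integral>y. k y z * \<phi> z \<partial>I) = - ln z * \<phi> z"
        using AE_I_pos
      proof eventually_elim
        case (elim z)
        have "(\<integral>y. k y z \<partial>I) = (LBINT y:{z..1}. 1 / y)"
          unfolding integral_I_eq set_lebesgue_integral_def
          by (intro Bochner_Integration.integral_cong) (use elim in \<open>auto simp: k_def indicator_def\<close>)
        also have "\<dots> = ln 1 - ln z"
        proof (rule FTC_lborel[of "{}"])
          show "continuous_on {z..1} ln" using elim by (intro continuous_intros) auto
          show "set_integrable lborel {z..1} (\<lambda>y. 1 / y)"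
            by (rule borel_integrable_atLeastAtMost') (use elim in \<open>auto intro!: continuous_intros\<close>)
        qed (use elim in \<open>auto intro!: derivative_eq_intros\<close>)
        finally show ?case by simp
      qed
    qed
    also have "\<dots> = (pi / 2) * neg_hilbert \<phi> 0"
    proof -
      have "kernel_op log_kernel \<phi> 0 = (\<integral>z. (- 2) * (- ln z * \<phi> z) \<partial>I)"
        unfolding kernel_op_def by (intro Bochner_Integration.integral_cong) (auto simp: log_kernel_def log_plus_def log_minus_def)
      also have "\<dots> = (- 2) * (\<integral>z. - ln z * \<phi> z \<partial>I)" by (rule integral_mult_right_zero)
      finally show ?thesis by (simp add: neg_hilbert_def)
    qed
    also have "\<dots> = (pi / 2) * (1 + l * slope 0)" using half_profileD(3)[OF s, of 0] slope_0 by simp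
    finally have "(\<integral>y. slope y \<partial>I) = (pi / 2) * (1 + l * slope 0)" .
    then show ?thesis using i True by (simp add: shell_kernel_def)
  qed
  then show "integrable I (\<lambda>r. slope r * shell_kernel x r)" "(\<integral>r. slope r * shell_kernel x r \<partial>I) = pi * (1 + l * slope x)" by auto
qed

definition radial_slope :: "real \<Rightarrow> real \<Rightarrow> real" where "radial_slope y q = slope (sqrt (y\<^sup>2 + q))"

text \<open>The integrand of the potential with kernel \<open>\<bar>z\<bar>\<^sup>-\<^sup>2\<close> at the point
  \<open>x\<close> of the axis.\<close>
definition newton_integrand :: "real \<Rightarrow> real \<times> real \<Rightarrow> real" where
  "newton_integrand x = (\<lambda>(y, q). if 0 < q then radial_slope y q / ((x - y)\<^sup>2 + q) else 0)"

lemma radial_slope_nonneg: "0 \<le> q \<Longrightarrow> 0 \<le> radial_slope y q" by (simp add: radial_slope_def slope_nonneg)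

lemma radial_slope_measurable [measurable]: "(\<lambda>p. radial_slope (fst p) (snd p)) \<in> borel_measurable (borel \<Otimes>\<^sub>M borel)"
  unfolding radial_slope_def by measurable

lemma newton_integrand_measurable: "newton_integrand x \<in> borel_measurable (lborel \<Otimes>\<^sub>M lborel)"
proof -
  have "newton_integrand x \<in> borel_measurable (borel \<Otimes>\<^sub>M borel)"
    unfolding newton_integrand_def radial_slope_def split_beta' by measurable
  moreover have "sets (lborel \<Otimes>\<^sub>M lborel) = sets (borel \<Otimes>\<^sub>M (borel :: real measure))"
    by (intro sets_pair_measure_cong) simp_all
  ultimately show ?thesis by (simp cong: measurable_cong_sets)
qed

lemma newton_integrand_nonneg: "0 \<le> newton_integrand x p"
  by (auto simp: newton_integrand_def radial_slope_nonneg split: prod.splits)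

text \<open>On the line of constant \<open>y\<close> the radius \<open>r = sqrt (y\<^sup>2 + q)\<close> replaces
  \<open>q\<close>.\<close>
lemma nn_newton_potential_section:
  assumes "\<bar>y\<bar> < 1"
  shows "(\<integral>\<^sup>+q. ennreal (newton_integrand x (y, q)) \<partial>lborel) =
    (\<integral>\<^sup>+r. ennreal (2 * (slope r * (r / (x\<^sup>2 + r\<^sup>2 - 2 * x * y)))) * indicator {\<bar>y\<bar>..1} r \<partial>lborel)"
proof -
  let ?f = "\<lambda>q. radial_slope y q / ((x - y)\<^sup>2 + q)"
  have fm: "?f \<in> borel_measurable borel" unfolding radial_slope_def by measurable
  have "(\<integral>\<^sup>+q. ennreal (newton_integrand x (y, q)) \<partial>lborel) = (\<integral>\<^sup>+q. ennreal (?f q) * indicator {\<bar>y\<bar>\<^sup>2 - y\<^sup>2..1\<^sup>2 - y\<^sup>2} q \<partial>lborel)"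
  proof (rule nn_integral_cong_AE)
    show "AE q in lborel. ennreal (newton_integrand x (y, q)) = ennreal (?f q) * indicator {\<bar>y\<bar>\<^sup>2 - y\<^sup>2..1\<^sup>2 - y\<^sup>2} q"
      using AE_lborel_singleton[of "0::real"]
    proof eventually_elim
      case (elim q)
      consider "q < 0" | "0 < q" "q \<le> 1 - y\<^sup>2" | "0 < q" "1 - y\<^sup>2 < q" using elim by linarith
      then show ?case
      proof cases
        case 3
        then have "slope (sqrt (y\<^sup>2 + q)) = 0" by (intro slope_out) simp
        then show ?thesis using 3 by (simp add: newton_integrand_def radial_slope_def)
      qed (auto simp: newton_integrand_def)
    qed
  qed
  also have "\<dots> = (\<integral>\<^sup>+q. ennreal (?f q * indicator {\<bar>y\<bar>\<^sup>2 - y\<^sup>2..1\<^sup>2 - y\<^sup>2} q) \<partial>lborel)"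
    by (intro nn_integral_cong) (auto simp: indicator_def)
  also have "\<dots> = (\<integral>\<^sup>+r. ennreal (?f (r\<^sup>2 - y\<^sup>2) * (2 * r) * indicator {\<bar>y\<bar>..1} r) \<partial>lborel)"
  proof (rule nn_integral_substitution[where g="\<lambda>r. r\<^sup>2 - y\<^sup>2" and g'="\<lambda>r. 2 * r"])
    show "set_borel_measurable borel {\<bar>y\<bar>\<^sup>2 - y\<^sup>2..1\<^sup>2 - y\<^sup>2} ?f"
      unfolding set_borel_measurable_def using fm by measurable
  qed (use assms in \<open>auto intro!: derivative_eq_intros continuous_intros\<close>)
  also have "\<dots> = (\<integral>\<^sup>+r. ennreal (2 * (slope r * (r / (x\<^sup>2 + r\<^sup>2 - 2 * x * y)))) * indicator {\<bar>y\<bar>..1} r \<partial>lborel)"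
  proof (rule nn_integral_cong)
    fix r
    show "ennreal (?f (r\<^sup>2 - y\<^sup>2) * (2 * r) * indicator {\<bar>y\<bar>..1} r) =
      ennreal (2 * (slope r * (r / (x\<^sup>2 + r\<^sup>2 - 2 * x * y)))) * indicator {\<bar>y\<bar>..1} r"
    proof (cases "r \<in> {\<bar>y\<bar>..1}")
      case True
      then have "0 \<le> r" using abs_ge_zero[of y] unfolding atLeastAtMost_iff by linarith
      then have a: "radial_slope y (r\<^sup>2 - y\<^sup>2) = slope r" by (simp add: radial_slope_def)
      have b: "(x - y)\<^sup>2 + (r\<^sup>2 - y\<^sup>2) = x\<^sup>2 + r\<^sup>2 - 2 * x * y" by (simp add: power2_eq_square algebra_simps)
      have "?f (r\<^sup>2 - y\<^sup>2) * (2 * r) = 2 * (slope r * (r / (x\<^sup>2 + r\<^sup>2 - 2 * x * y)))" unfolding a b by simp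
      then show ?thesis using True by simp
    qed simp
  qed
  finally show ?thesis .
qed

text \<open>Integrating over spheres first: Tonelli exchanges \<open>y\<close> and the radius, and
  \<open>nn_shell_integral\<close> reduces the potential to the radial equation
  \<open>shell_average_equation\<close>.\<close>
lemma nn_newton_potential:
  assumes x: "x \<in> {0..1}"
  shows "(\<integral>\<^sup>+p. ennreal (newton_integrand x p) \<partial>(lborel \<Otimes>\<^sub>M lborel)) = ennreal (2 * pi * (1 + l * slope x))"
proof -
  let ?k = "\<lambda>y r. ennreal (2 * (slope r * (r / (x\<^sup>2 + r\<^sup>2 - 2 * x * y)))) * indicator {\<bar>y\<bar>..1} r"
  have "(\<integral>\<^sup>+p. ennreal (newton_integrand x p) \<partial>(lborel \<Otimes>\<^sub>M lborel)) = (\<integral>\<^sup>+y. \<integral>\<^sup>+q. ennreal (newton_integrand x (y, q)) \<partial>lborel \<partial>lborel)"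
    by (intro lborel.nn_integral_fst[symmetric] measurable_compose[OF newton_integrand_measurable measurable_ennreal])
  also have "\<dots> = (\<integral>\<^sup>+y. \<integral>\<^sup>+r. ?k y r \<partial>lborel \<partial>lborel)"
  proof (rule nn_integral_cong_AE)
    show "AE y in lborel. (\<integral>\<^sup>+q. ennreal (newton_integrand x (y, q)) \<partial>lborel) = (\<integral>\<^sup>+r. ?k y r \<partial>lborel)"
      using AE_lborel_singleton[of "1::real"] AE_lborel_singleton[of "-1::real"]
    proof eventually_elim
      case (elim y)
      show ?case
      proof (cases "\<bar>y\<bar> < 1")
        case True then show ?thesis by (rule nn_newton_potential_section)
      next
        case False
        then have y: "1 < \<bar>y\<bar>" using elim by (auto simp: abs_if split: if_splits)
        then have "1 \<le> \<bar>y\<bar>\<^sup>2" by (intro one_le_power) simp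
        then have y2: "1 \<le> y\<^sup>2" by simp
        have "newton_integrand x (y, q) = 0" for q
        proof (cases "0 < q")
          case True
          then have "slope (sqrt (y\<^sup>2 + q)) = 0" using y2 by (intro slope_out) simp
          then show ?thesis by (simp add: newton_integrand_def radial_slope_def)
        qed (simp add: newton_integrand_def)
        then have "(\<integral>\<^sup>+q. ennreal (newton_integrand x (y, q)) \<partial>lborel) = 0" by simp
        moreover have "?k y r = 0" for r using y by (simp add: indicator_def)
        then have "(\<integral>\<^sup>+r. ?k y r \<partial>lborel) = (\<integral>\<^sup>+r. 0 \<partial>(lborel :: real measure))" by (intro nn_integral_cong)
        ultimately show ?thesis by (simp only: nn_integral_const mult_zero_left)
      qed
    qed
  qed
  also have "\<dots> = (\<integral>\<^sup>+r. \<integral>\<^sup>+y. ?k y r \<partial>lborel \<partial>lborel)"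
  proof (rule lborel_pair.Fubini'[symmetric])
    have "(\<lambda>p. ?k (fst p) (snd p)) \<in> borel_measurable (borel \<Otimes>\<^sub>M borel)"
    proof -
      have i: "indicator {\<bar>fst p\<bar>..1} (snd p) = (if \<bar>fst p\<bar> \<le> snd p \<and> snd p \<le> 1 then 1 else 0 :: ennreal)" for p :: "real \<times> real"
        by (simp add: indicator_def)
      show ?thesis unfolding i by measurable
    qed
    moreover have "sets (lborel \<Otimes>\<^sub>M lborel) = sets (borel \<Otimes>\<^sub>M (borel :: real measure))"
      by (intro sets_pair_measure_cong) simp_all
    ultimately show "case_prod ?k \<in> borel_measurable (lborel \<Otimes>\<^sub>M lborel)"
      by (simp add: split_beta' cong: measurable_cong_sets)
  qed
  also have "\<dots> = (\<integral>\<^sup>+r. ennreal (2 * (slope r * shell_kernel x r)) * indicator {0..1} r \<partial>lborel)"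
  proof (rule nn_integral_cong_AE)
    show "AE r in lborel. (\<integral>\<^sup>+y. ?k y r \<partial>lborel) = ennreal (2 * (slope r * shell_kernel x r)) * indicator {0..1} r"
      using AE_lborel_singleton[of "0::real"] AE_lborel_singleton[of x]
    proof eventually_elim
      case (elim r)
      show ?case
      proof (cases "0 < r \<and> r \<le> 1")
        case True
        have "(\<integral>\<^sup>+y. ?k y r \<partial>lborel) =
          (\<integral>\<^sup>+y. ennreal (2 * slope r) * (ennreal (r / (x\<^sup>2 + r\<^sup>2 - 2 * x * y)) * indicator {-r..r} y) \<partial>lborel)"
        proof (rule nn_integral_cong)
          fix y
          have "ennreal (2 * (slope r * c)) = ennreal (2 * slope r) * ennreal c" for c
            using slope_nonneg[of r] True by (simp add: ennreal_mult'[symmetric] mult.assoc)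
          then have gc: "ennreal (2 * (slope r * (r / (x\<^sup>2 + r\<^sup>2 - 2 * x * y)))) = ennreal (2 * slope r) * ennreal (r / (x\<^sup>2 + r\<^sup>2 - 2 * x * y))" .
          have ind: "indicator {\<bar>y\<bar>..1} r = (indicator {-r..r} y :: ennreal)" using True by (auto simp: indicator_def abs_le_iff)
          show "?k y r = ennreal (2 * slope r) * (ennreal (r / (x\<^sup>2 + r\<^sup>2 - 2 * x * y)) * indicator {-r..r} y)"
            unfolding gc ind by (simp only: mult.assoc)
        qed
        also have "\<dots> = ennreal (2 * slope r) * (\<integral>\<^sup>+y. ennreal (r / (x\<^sup>2 + r\<^sup>2 - 2 * x * y)) * indicator {-r..r} y \<partial>lborel)"
        proof (rule nn_integral_cmult)
          have "(\<lambda>y. r / (x\<^sup>2 + r\<^sup>2 - 2 * x * y)) \<in> borel_measurable borel" by measurable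
          then have "(\<lambda>y. ennreal (r / (x\<^sup>2 + r\<^sup>2 - 2 * x * y))) \<in> borel_measurable borel" by (rule measurable_compose[OF _ measurable_ennreal])
          then show "(\<lambda>y. ennreal (r / (x\<^sup>2 + r\<^sup>2 - 2 * x * y)) * indicator {- r..r} y) \<in> borel_measurable lborel"
            unfolding measurable_lborel2 by (intro borel_measurable_times_ennreal borel_measurable_indicator) simp_all
        qed
        also have "\<dots> = ennreal (2 * slope r) * ennreal (shell_kernel x r)" using nn_shell_integral[of r x] True x elim by simp
        also have "\<dots> = ennreal (2 * (slope r * shell_kernel x r)) * indicator {0..1} r"
          using slope_nonneg[of r] True by (simp add: ennreal_mult'[symmetric] mult.assoc)
        finally show ?thesis .
      next
        case False
        have nr: "r \<notin> {\<bar>y\<bar>..1}" for y :: real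
        proof
          assume "r \<in> {\<bar>y\<bar>..1}"
          then have "0 \<le> r" "r \<le> 1" using abs_ge_zero[of y] unfolding atLeastAtMost_iff by linarith+
          then show False using False elim by simp
        qed
        have "?k y r = 0" for y using nr[of y] by (simp add: indicator_def)
        then have "(\<integral>\<^sup>+y. ?k y r \<partial>lborel) = (\<integral>\<^sup>+y. 0 \<partial>(lborel :: real measure))" by (intro nn_integral_cong)
        then have I0: "(\<integral>\<^sup>+y. ?k y r \<partial>lborel) = 0" by (simp only: nn_integral_const mult_zero_left)
        have i0: "indicator {0..1} r = (0::ennreal)" using False elim by (auto simp: indicator_def)
        show ?thesis unfolding I0 i0 by simp
      qed
    qed
  qed
  also have "\<dots> = (\<integral>\<^sup>+r. ennreal (2 * (slope r * shell_kernel x r)) \<partial>I)"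
    by (simp add: nn_integral_restrict_space)
  also have "\<dots> = ennreal (\<integral>r. 2 * (slope r * shell_kernel x r) \<partial>I)"
  proof (rule nn_integral_eq_integral)
    show "integrable I (\<lambda>r. 2 * (slope r * shell_kernel x r))" by (intro integrable_mult_right shell_average_equation x)
    show "AE r in I. 0 \<le> 2 * (slope r * shell_kernel x r)"
      using AE_I_pos AE_I_neq[of x]
    proof eventually_elim
      case (elim r)
      then show ?case using slope_nonneg[of r] shell_kernel_nonneg[of r x] x by simp
    qed
  qed
  also have "(\<integral>r. 2 * (slope r * shell_kernel x r) \<partial>I) = 2 * (pi * (1 + l * slope x))"
    unfolding shell_average_equation(2)[OF x, symmetric] by (rule integral_mult_right_zero)
  finally show ?thesis by (simp add: mult.assoc)
qed

lemma newton_potential: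
  assumes x: "x \<in> {0..1}"
  shows "integrable (lborel \<Otimes>\<^sub>M lborel) (newton_integrand x)" "(\<integral>p. newton_integrand x p \<partial>(lborel \<Otimes>\<^sub>M lborel)) = 2 * pi * (1 + l * slope x)"
proof -
  have g: "0 \<le> 2 * pi * (1 + l * slope x)" using l slope_nonneg[of x] x by simp
  have "has_bochner_integral (lborel \<Otimes>\<^sub>M lborel) (newton_integrand x) (2 * pi * (1 + l * slope x))"
    by (rule has_bochner_integral_nn_integral[OF newton_integrand_measurable _ g nn_newton_potential[OF x]]) (simp add: newton_integrand_nonneg)
  then show "integrable (lborel \<Otimes>\<^sub>M lborel) (newton_integrand x)" "(\<integral>p. newton_integrand x p \<partial>(lborel \<Otimes>\<^sub>M lborel)) = 2 * pi * (1 + l * slope x)"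
    by (auto simp: has_bochner_integral_iff)
qed

section \<open>Moving planes\<close>

lemma reflect_integral:
  fixes F :: "real \<times> real \<Rightarrow> real"
  assumes F: "integrable (lborel \<Otimes>\<^sub>M lborel) F"
  shows "integrable (lborel \<Otimes>\<^sub>M lborel) (\<lambda>(y, q). F (c - y, q))"
    "(\<integral>(y, q). F (c - y, q) \<partial>(lborel \<Otimes>\<^sub>M lborel)) = (\<integral>p. F p \<partial>(lborel \<Otimes>\<^sub>M lborel))"
proof -
  let ?T = "\<lambda>(y::real, q::real). (c - y, q)"
  have m1: "(\<lambda>y::real. c - y) \<in> measurable lborel lborel" by simp
  have d: "distr lborel lborel (\<lambda>y::real. c - y) = lborel"
  proof -
    have "lborel = density (distr lborel borel (\<lambda>x. c + (-1) * x)) (\<lambda>_. ennreal \<bar>-1\<bar>)"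
      by (rule lborel_real_affine) simp
    also have "\<dots> = distr lborel borel (\<lambda>x. c - x)" by (simp add: density_1)
    finally show ?thesis by (simp cong: distr_cong)
  qed
  have T: "?T \<in> measurable (lborel \<Otimes>\<^sub>M lborel) (lborel \<Otimes>\<^sub>M lborel)"
    using m1 by measurable
  have "distr lborel lborel (\<lambda>y::real. c - y) \<Otimes>\<^sub>M distr lborel lborel (\<lambda>q::real. q) = distr (lborel \<Otimes>\<^sub>M lborel) (lborel \<Otimes>\<^sub>M lborel) ?T"
    by (rule pair_measure_distr[OF m1]) (simp_all add: distr_id2 lborel.sigma_finite_measure_axioms)
  then have D: "distr (lborel \<Otimes>\<^sub>M lborel) (lborel \<Otimes>\<^sub>M lborel) ?T = lborel \<Otimes>\<^sub>M lborel"
    by (simp add: d distr_id2)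
  have e: "(\<lambda>(y, q). F (c - y, q)) = (\<lambda>p. F (?T p))" by (auto simp: split_beta')
  have "integrable (distr (lborel \<Otimes>\<^sub>M lborel) (lborel \<Otimes>\<^sub>M lborel) ?T) F" using F D by simp
  then show "integrable (lborel \<Otimes>\<^sub>M lborel) (\<lambda>(y, q). F (c - y, q))"
    unfolding e using integrable_distr[OF T] by blast
  have "(\<integral>p. F p \<partial>(distr (lborel \<Otimes>\<^sub>M lborel) (lborel \<Otimes>\<^sub>M lborel) ?T)) = (\<integral>p. F (?T p) \<partial>(lborel \<Otimes>\<^sub>M lborel))"
    by (rule integral_distr[OF T]) (use F in blast)
  then show "(\<integral>(y, q). F (c - y, q) \<partial>(lborel \<Otimes>\<^sub>M lborel)) = (\<integral>p. F p \<partial>(lborel \<Otimes>\<^sub>M lborel))"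
    unfolding e D by simp
qed

text \<open>The difference of the potentials at \<open>\<rho>\<close> and \<open>\<sigma>\<close>, after the
  half space below the plane \<open>y = b\<close> has been folded onto the one above. The two points are mirror
  images, so both factors are differences under the reflection.\<close>
definition reflected_integrand :: "real \<Rightarrow> real \<Rightarrow> real \<Rightarrow> real \<times> real \<Rightarrow> real" where
  "reflected_integrand b \<rho> \<sigma> = (\<lambda>(y, q). if b < y \<and> 0 < q then
     (1 / ((\<rho> - y)\<^sup>2 + q) - 1 / ((\<sigma> - y)\<^sup>2 + q)) * (radial_slope y q - radial_slope (2 * b - y) q) else 0)"

lemma reflection_identity:
  assumes \<sigma>: "0 \<le> \<sigma>" "\<sigma> \<le> 1" and \<rho>: "0 \<le> \<rho>" "\<rho> \<le> 1" and b: "2 * b = \<rho> + \<sigma>"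
  shows "integrable (lborel \<Otimes>\<^sub>M lborel) (reflected_integrand b \<rho> \<sigma>)"
    "2 * pi * l * (slope \<rho> - slope \<sigma>) = (\<integral>p. reflected_integrand b \<rho> \<sigma> p \<partial>(lborel \<Otimes>\<^sub>M lborel))"
proof -
  let ?M = "lborel \<Otimes>\<^sub>M lborel :: (real \<times> real) measure"
  define F where "F p = newton_integrand \<rho> p - newton_integrand \<sigma> p" for p
  have \<sigma>I: "\<sigma> \<in> {0..1}" and \<rho>I: "\<rho> \<in> {0..1}" using assms by auto
  have F: "integrable ?M F" unfolding F_def
    by (rule Bochner_Integration.integrable_diff[OF newton_potential(1)[OF \<rho>I] newton_potential(1)[OF \<sigma>I]])
  have FI: "(\<integral>p. F p \<partial>?M) = 2 * pi * l * (slope \<rho> - slope \<sigma>)"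
    unfolding F_def Bochner_Integration.integral_diff[OF newton_potential(1)[OF \<rho>I] newton_potential(1)[OF \<sigma>I]]
      newton_potential(2)[OF \<rho>I] newton_potential(2)[OF \<sigma>I] by (simp add: algebra_simps)
  define A where "A = {p :: real \<times> real. b < fst p}"
  define B where "B = {p :: real \<times> real. fst p < b}"
  have AB: "A \<in> sets ?M" "B \<in> sets ?M"
  proof -
    have "A = {b<..} \<times> UNIV" "B = {..<b} \<times> UNIV" by (auto simp: A_def B_def)
    then show "A \<in> sets ?M" "B \<in> sets ?M" by (simp_all add: pair_measureI)
  qed
  have FA: "integrable ?M (\<lambda>p. indicator A p * F p)" and FB: "integrable ?M (\<lambda>p. indicator B p * F p)"
    using integrable_mult_indicator[OF AB(1) F] integrable_mult_indicator[OF AB(2) F] by simp_all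
  have AE_b: "AE p in ?M. fst p \<noteq> b"
  proof -
    have "AE p in ?M. p \<in> {p. fst p \<noteq> b}"
    proof (rule AE_I'[of "{b} \<times> UNIV"])
      have "emeasure ?M ({b} \<times> UNIV) = emeasure lborel {b} * emeasure lborel (UNIV :: real set)"
        by (rule lborel.emeasure_pair_measure_Times) simp_all
      then show "{b} \<times> UNIV \<in> null_sets ?M" by (auto intro!: null_setsI)
    qed auto
    then show ?thesis by simp
  qed
  have "(\<integral>p. F p \<partial>?M) = (\<integral>p. indicator A p * F p + indicator B p * F p \<partial>?M)"
  proof (rule integral_cong_AE)
    show "F \<in> borel_measurable ?M" by (rule borel_measurable_integrable[OF F])
    show "(\<lambda>p. indicator A p * F p + indicator B p * F p) \<in> borel_measurable ?M"
      by (rule borel_measurable_integrable[OF Bochner_Integration.integrable_add[OF FA FB]])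
    show "AE p in ?M. F p = indicator A p * F p + indicator B p * F p"
      using AE_b by eventually_elim (auto simp: A_def B_def indicator_def)
  qed
  also have "\<dots> = (\<integral>p. indicator A p * F p \<partial>?M) + (\<integral>p. indicator B p * F p \<partial>?M)"
    by (rule Bochner_Integration.integral_add[OF FA FB])
  also have "(\<integral>p. indicator B p * F p \<partial>?M) = (\<integral>(y, q). indicator B (2 * b - y, q) * F (2 * b - y, q) \<partial>?M)"
    by (rule reflect_integral(2)[OF FB, symmetric])
  finally have 1: "(\<integral>p. F p \<partial>?M) = (\<integral>p. indicator A p * F p \<partial>?M) + (\<integral>(y, q). indicator B (2 * b - y, q) * F (2 * b - y, q) \<partial>?M)" .
  have FR: "integrable ?M (\<lambda>(y, q). indicator B (2 * b - y, q) * F (2 * b - y, q))"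
    by (rule reflect_integral(1)[OF FB])
  have eq: "(\<lambda>p. indicator A p * F p + (case p of (y, q) \<Rightarrow> indicator B (2 * b - y, q) * F (2 * b - y, q))) = reflected_integrand b \<rho> \<sigma>"
  proof
    fix p :: "real \<times> real"
    obtain y q where p: "p = (y, q)" by (cases p)
    have sq: "(\<rho> - (2 * b - y))\<^sup>2 = (\<sigma> - y)\<^sup>2" "(\<sigma> - (2 * b - y))\<^sup>2 = (\<rho> - y)\<^sup>2"
      unfolding b by (simp_all add: power2_eq_square algebra_simps)
    have alg: "(h / u - h / v) + (k / v - k / u) = (1 / u - 1 / v) * (h - k)" for h k u v :: real
      by (simp add: algebra_simps diff_divide_distrib)
    show "indicator A p * F p + (case p of (y, q) \<Rightarrow> indicator B (2 * b - y, q) * F (2 * b - y, q)) = reflected_integrand b \<rho> \<sigma> p"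
    proof (cases "b < y \<and> 0 < q")
      case True
      then have "indicator A p = (1::real)" "indicator B (2 * b - y, q) = (1::real)" by (simp_all add: p A_def B_def)
      moreover have "F p + F (2 * b - y, q) = reflected_integrand b \<rho> \<sigma> p"
        using True alg[of "radial_slope y q" "(\<rho> - y)\<^sup>2 + q" "(\<sigma> - y)\<^sup>2 + q" "radial_slope (2 * b - y) q"]
        by (simp add: p F_def newton_integrand_def reflected_integrand_def sq)
      ultimately show ?thesis by (simp add: p)
    next
      case False
      then show ?thesis by (auto simp: p F_def newton_integrand_def reflected_integrand_def A_def B_def indicator_def)
    qed
  qed
  from Bochner_Integration.integrable_add[OF FA FR] show "integrable ?M (reflected_integrand b \<rho> \<sigma>)" unfolding eq .
  from Bochner_Integration.integral_add[OF FA FR] 1 FI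
  show "2 * pi * l * (slope \<rho> - slope \<sigma>) = (\<integral>p. reflected_integrand b \<rho> \<sigma> p \<partial>?M)" unfolding eq by simp
qed

text \<open>The assertion of the moving plane method for all planes \<open>y = b\<close> with \<open>b \<ge>
  a\<close>, restricted to the radial function: \<open>\<rho>\<close> and \<open>\<sigma>\<close> are mirror
  images under the plane at \<open>(\<rho> + \<sigma>) / 2\<close>.\<close>
definition reflection_decreasing :: "real \<Rightarrow> bool" where
  "reflection_decreasing a \<longleftrightarrow> (\<forall>\<rho> \<sigma>. 0 \<le> \<sigma> \<longrightarrow> \<sigma> \<le> \<rho> \<longrightarrow> \<rho> \<le> 1 \<longrightarrow> 2 * a \<le> \<rho> + \<sigma> \<longrightarrow> slope \<rho> \<le> slope \<sigma>)"

text \<open>A point above a plane and its mirror image have radii to which \<open>reflection_decreasing\<close>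
  applies, which is why the assertion on the axis controls all of space.\<close>
lemma reflected_pair:
  assumes b: "0 < b" "b < y" and q: "0 < q"
  shows "sqrt ((2 * b - y)\<^sup>2 + q) \<le> sqrt (y\<^sup>2 + q)"
    "2 * b \<le> sqrt (y\<^sup>2 + q) + sqrt ((2 * b - y)\<^sup>2 + q)"
    "(sqrt (y\<^sup>2 + q))\<^sup>2 - (sqrt ((2 * b - y)\<^sup>2 + q))\<^sup>2 = 4 * b * (y - b)"
proof -
  have e: "y\<^sup>2 - (2 * b - y)\<^sup>2 = 4 * b * (y - b)" by (simp add: power2_eq_square algebra_simps)
  have "0 \<le> 4 * b * (y - b)" using b by simp
  then have "(2 * b - y)\<^sup>2 \<le> y\<^sup>2" using e by linarith
  then show "sqrt ((2 * b - y)\<^sup>2 + q) \<le> sqrt (y\<^sup>2 + q)" by simp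
  have "y \<le> sqrt (y\<^sup>2 + q)" "2 * b - y \<le> sqrt ((2 * b - y)\<^sup>2 + q)"
    using q by (auto intro!: real_le_rsqrt)
  then show "2 * b \<le> sqrt (y\<^sup>2 + q) + sqrt ((2 * b - y)\<^sup>2 + q)" by linarith
  have "(sqrt (y\<^sup>2 + q))\<^sup>2 = y\<^sup>2 + q" "(sqrt ((2 * b - y)\<^sup>2 + q))\<^sup>2 = (2 * b - y)\<^sup>2 + q"
    using q by (simp_all add: add_nonneg_nonneg)
  then show "(sqrt (y\<^sup>2 + q))\<^sup>2 - (sqrt ((2 * b - y)\<^sup>2 + q))\<^sup>2 = 4 * b * (y - b)" using e by linarith
qed

lemma kernel_order:
  assumes b: "2 * b = \<rho> + \<sigma>" and "\<sigma> < \<rho>" "b < y" "0 < q"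
  shows "1 / ((\<sigma> - y)\<^sup>2 + q) < 1 / ((\<rho> - y)\<^sup>2 + (q::real))"
proof -
  have "(\<sigma> - y)\<^sup>2 - (\<rho> - y)\<^sup>2 = (\<rho> - \<sigma>) * (2 * y - 2 * b)"
    unfolding b by (simp add: power2_eq_square algebra_simps)
  moreover have "0 < (\<rho> - \<sigma>) * (2 * y - 2 * b)" using assms by simp
  ultimately have "(\<rho> - y)\<^sup>2 + q < (\<sigma> - y)\<^sup>2 + q" by linarith
  then show ?thesis using assms(4) by (intro divide_strict_left_mono mult_pos_pos add_nonneg_pos) auto
qed

lemma reflection_decreasing_radial:
  assumes "reflection_decreasing a" "0 < a" "a \<le> b" "b < y" "0 < q" shows "radial_slope y q \<le> radial_slope (2 * b - y) q"
proof (cases "1 \<le> sqrt (y\<^sup>2 + q)")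
  case True
  then have "radial_slope y q = 0" by (simp add: radial_slope_def slope_out)
  then show ?thesis using radial_slope_nonneg[of q "2 * b - y"] assms by simp
next
  case False
  have "0 < b" using assms by simp
  note R = reflected_pair[OF this assms(4,5)]
  have "0 \<le> sqrt ((2 * b - y)\<^sup>2 + q)" using assms(5) by simp
  then show ?thesis using assms(1) R(1,2) False assms(3) unfolding reflection_decreasing_def radial_slope_def by simp
qed

text \<open>The weak inequality makes the folded integrand nonpositive. It is negative on a small rectangle of
  points just outside the unit ball whose mirror images lie inside, where \<open>S\<close> is positive, so its
  integral is negative.\<close>
lemma reflection_decreasing_strict:
  assumes D: "reflection_decreasing a" and a: "0 < a" and p: "0 \<le> \<sigma>" "\<sigma> < \<rho>" "\<rho> \<le> 1" "2 * a \<le> \<rho> + \<sigma>"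
  shows "slope \<rho> < slope \<sigma>"
proof -
  let ?M = "lborel \<Otimes>\<^sub>M lborel :: (real \<times> real) measure"
  define b where "b = (\<rho> + \<sigma>) / 2"
  have b2: "2 * b = \<rho> + \<sigma>" by (simp add: b_def)
  have b: "a \<le> b" "0 < b" "b < 1" using p a by (auto simp: b_def)
  have \<sigma>1: "\<sigma> \<le> 1" and \<rho>0: "0 \<le> \<rho>" using p by auto
  note RI = reflection_identity[OF p(1) \<sigma>1 \<rho>0 p(3) b2]
  have le: "reflected_integrand b \<rho> \<sigma> z \<le> 0" for z
  proof -
    obtain y q where z: "z = (y, q)" by (cases z)
    show ?thesis
    proof (cases "b < y \<and> 0 < q")
      case True
      then show ?thesis
        using kernel_order[OF b2 p(2), of y q] reflection_decreasing_radial[OF D a b(1), of y q]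
        by (simp add: z reflected_integrand_def mult_nonneg_nonpos)
    qed (auto simp: z reflected_integrand_def)
  qed
  have "(\<integral>p. reflected_integrand b \<rho> \<sigma> p \<partial>?M) \<noteq> 0"
  proof
    assume "(\<integral>p. reflected_integrand b \<rho> \<sigma> p \<partial>?M) = 0"
    then have "(\<integral>p. - reflected_integrand b \<rho> \<sigma> p \<partial>?M) = 0" by simp
    moreover have "integrable ?M (\<lambda>p. - reflected_integrand b \<rho> \<sigma> p)" using RI(1) by simp
    moreover have "AE p in ?M. 0 \<le> - reflected_integrand b \<rho> \<sigma> p" using le by simp
    ultimately have ae: "AE p in ?M. - reflected_integrand b \<rho> \<sigma> p = 0" using integral_nonneg_eq_0_iff_AE by blast
    (* The rectangle R lies above the plane and outside the unit ball, and its mirror image lies inside. *)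
    define \<tau> where "\<tau> = min ((1 - b) / 2) (b / 2)"
    have \<tau>: "0 < \<tau>" "\<tau> \<le> (1 - b) / 2" "\<tau> \<le> b / 2" using b unfolding \<tau>_def by (simp_all only: min.cobounded1 min.cobounded2) simp
    define q1 where "q1 = 1 - b\<^sup>2 - \<tau>\<^sup>2"
    define R where "R = {b + \<tau><..<b + 3/2 * \<tau>} \<times> {q1<..<q1 + b * \<tau>}"
    have q1: "0 < q1"
    proof -
      have "(b + \<tau>)\<^sup>2 < 1" using b \<tau> by (simp add: abs_square_less_1)
      moreover have "b\<^sup>2 + \<tau>\<^sup>2 \<le> (b + \<tau>)\<^sup>2" using b \<tau> by (simp add: power2_sum)
      ultimately show ?thesis by (simp add: q1_def)
    qed
    have neg: "reflected_integrand b \<rho> \<sigma> z \<noteq> 0" if "z \<in> R" for z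
    proof -
      obtain y q where z: "z = (y, q)" by (cases z)
      have yq: "b + \<tau> < y" "y < b + 3/2 * \<tau>" "q1 < q" "q < q1 + b * \<tau>" using that by (auto simp: R_def z)
      define s where "s = y - b"
      have s: "\<tau> < s" "s < 3/2 * \<tau>" "y = b + s" using yq by (auto simp: s_def)
      have s2: "\<tau>\<^sup>2 \<le> s\<^sup>2" using s \<tau> by (intro power_mono) auto
      have s3: "s\<^sup>2 \<le> (3/2 * \<tau>)\<^sup>2" using s \<tau> by (intro power_mono) auto
      have bt: "0 < b * \<tau>" using b \<tau> by simp
      have bs: "b * \<tau> < b * s" using s b by simp
      have "y\<^sup>2 + q > 1"
      proof -
        have "y\<^sup>2 = b\<^sup>2 + 2 * (b * s) + s\<^sup>2" by (simp add: s(3) power2_sum)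
        then show ?thesis using yq(3) s2 bs bt unfolding q1_def by linarith
      qed
      then have h0: "radial_slope y q = 0" by (simp add: radial_slope_def slope_out)
      have r1: "(2 * b - y)\<^sup>2 + q < 1"
      proof -
        have "(2 * b - y)\<^sup>2 = b\<^sup>2 - 2 * (b * s) + s\<^sup>2" by (simp add: s(3) power2_diff power2_eq_square algebra_simps)
        moreover have "(3/2 * \<tau>)\<^sup>2 = \<tau>\<^sup>2 + 5/4 * \<tau>\<^sup>2" by (simp add: power2_eq_square)
        moreover have "5/4 * \<tau>\<^sup>2 \<le> b * \<tau>"
        proof -
          have "5/4 * \<tau> \<le> b" using \<tau> by simp
          then have "(5/4 * \<tau>) * \<tau> \<le> b * \<tau>" using \<tau> by (intro mult_right_mono) auto
          then show ?thesis by (simp add: power2_eq_square)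
        qed
        ultimately show ?thesis using yq(4) s3 bs unfolding q1_def by linarith
      qed
      have q0: "0 < q" using yq q1 by simp
      have h1: "0 < radial_slope (2 * b - y) q"
        unfolding radial_slope_def by (rule slope_pos) (use r1 q0 in \<open>auto intro: add_nonneg_pos\<close>)
      have h2: "0 < 1 / ((\<rho> - y)\<^sup>2 + q) - 1 / ((\<sigma> - y)\<^sup>2 + q)"
        using kernel_order[OF b2 p(2), of y q] s \<tau> q0 by simp
      have w: "reflected_integrand b \<rho> \<sigma> z = (1 / ((\<rho> - y)\<^sup>2 + q) - 1 / ((\<sigma> - y)\<^sup>2 + q)) * (radial_slope y q - radial_slope (2 * b - y) q)"
        using s \<tau> q0 by (simp add: z reflected_integrand_def)
      show ?thesis unfolding w h0 using h1 h2 by (simp only: mult_eq_0_iff) linarith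
    qed
    have "AE z in ?M. z \<notin> R" using ae by eventually_elim (use neg in force)
    moreover have Rm: "R \<in> sets ?M" unfolding R_def by (intro pair_measureI) simp_all
    ultimately have "emeasure ?M R = 0" using AE_iff_measurable[OF Rm, of "\<lambda>z. z \<notin> R"] by (auto simp: space_pair_measure)
    moreover have "emeasure ?M R = emeasure lborel {b + \<tau><..<b + 3/2 * \<tau>} * emeasure lborel {q1<..<q1 + b * \<tau>}"
      unfolding R_def by (rule lborel.emeasure_pair_measure_Times) simp_all
    moreover have "0 < b * \<tau>" using b \<tau> by simp
    ultimately show False using \<tau> by (simp add: ennreal_mult[symmetric])
  qed
  moreover have "(\<integral>p. reflected_integrand b \<rho> \<sigma> p \<partial>?M) \<le> 0"
  proof -
    have "0 \<le> (\<integral>p. - reflected_integrand b \<rho> \<sigma> p \<partial>?M)" by (rule integral_nonneg_AE) (use le in simp)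
    then show ?thesis by simp
  qed
  ultimately have "2 * pi * l * (slope \<rho> - slope \<sigma>) < 0" using RI(2) by simp
  then have neg: "2 * pi * l * (slope \<rho> - slope \<sigma>) < 0" .
  show ?thesis
  proof (rule ccontr)
    assume "\<not> slope \<rho> < slope \<sigma>"
    then have "0 \<le> 2 * pi * l * (slope \<rho> - slope \<sigma>)" using l by (intro mult_nonneg_nonneg) auto
    then show False using neg by linarith
  qed
qed

lemma compact_pairs:
  assumes c: "continuous_on UNIV f"
  shows "compact {(\<rho>, \<sigma>). 0 \<le> \<sigma> \<and> \<sigma> \<le> \<rho> \<and> \<rho> \<le> 1 \<and> d \<le> \<rho> - \<sigma> \<and> (e::real) \<le> \<rho> + \<sigma> \<and> (f \<sigma> :: real) \<le> f \<rho> + k}"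
    (is "compact ?K")
proof -
  have "?K = ({0..1} \<times> {0..1}) \<inter> {p. snd p \<le> fst p} \<inter> {p. d \<le> fst p - snd p} \<inter> {p. e \<le> fst p + snd p} \<inter> {p. f (snd p) \<le> f (fst p) + k}"
    by auto
  moreover have "closed {p::real\<times>real. snd p \<le> fst p}" "closed {p::real\<times>real. d \<le> fst p - snd p}"
    "closed {p::real\<times>real. e \<le> fst p + snd p}" "closed {p::real\<times>real. f (snd p) \<le> f (fst p) + k}"
    by (intro closed_Collect_le continuous_intros continuous_on_compose2[OF c]; simp)+
  ultimately show ?thesis by (simp add: compact_Int_closed compact_Times)
qed

lemma product_integral:
  fixes f g :: "real \<Rightarrow> real"
  assumes f: "integrable lborel f" and g: "integrable lborel g"
  shows "integrable (lborel \<Otimes>\<^sub>M lborel) (\<lambda>(y, q). f y * g q)"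
    "(\<integral>(y, q). f y * g q \<partial>(lborel \<Otimes>\<^sub>M lborel)) = (\<integral>y. f y \<partial>lborel) * (\<integral>q. g q \<partial>lborel)"
proof -
  have m: "(\<lambda>(y, q). f y * g q) \<in> borel_measurable (lborel \<Otimes>\<^sub>M lborel)"
  proof -
    have "(\<lambda>p. f (fst p)) \<in> borel_measurable (lborel \<Otimes>\<^sub>M lborel)" "(\<lambda>p. g (snd p)) \<in> borel_measurable (lborel \<Otimes>\<^sub>M lborel)"
      by (rule measurable_compose[OF measurable_fst borel_measurable_integrable[OF f]],
          rule measurable_compose[OF measurable_snd borel_measurable_integrable[OF g]])
    then have "(\<lambda>p. f (fst p) * g (snd p)) \<in> borel_measurable (lborel \<Otimes>\<^sub>M lborel)" by (rule borel_measurable_times)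
    then show ?thesis by (simp add: split_beta')
  qed
  show i: "integrable (lborel \<Otimes>\<^sub>M lborel) (\<lambda>(y, q). f y * g q)"
  proof (rule lborel_pair.Fubini_integrable[OF m])
    have "integrable lborel (\<lambda>y. \<bar>f y\<bar> * (\<integral>q. \<bar>g q\<bar> \<partial>lborel))" using f by simp
    then show "integrable lborel (\<lambda>y. \<integral>q. norm (case (y, q) of (y, q) \<Rightarrow> f y * g q) \<partial>lborel)" by (simp add: abs_mult)
    show "AE y in lborel. integrable lborel (\<lambda>q. case (y, q) of (y, q) \<Rightarrow> f y * g q)" using g by simp
  qed
  have "(\<integral>(y, q). f y * g q \<partial>(lborel \<Otimes>\<^sub>M lborel)) = (\<integral>y. \<integral>q. f y * g q \<partial>lborel \<partial>lborel)"
    using lborel_pair.integral_fst'[OF i] by simp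
  then show "(\<integral>(y, q). f y * g q \<partial>(lborel \<Otimes>\<^sub>M lborel)) = (\<integral>y. f y \<partial>lborel) * (\<integral>q. g q \<partial>lborel)" by simp
qed

text \<open>Planes that have reached \<open>a0 > 0\<close> can be moved further. For pairs at distance at least
  \<open>\<delta>\<close> the strict inequality at \<open>a0\<close> persists a little below \<open>a0\<close>,
  by compactness. Suppose that \<open>S \<rho> - S \<sigma>\<close> had a positive maximum over the remaining
  pairs. In the folded integral only a strip of width \<open>\<eta>\<close> next to the plane contributes
  positively, and it contributes at most \<open>16 sqrt \<eta>\<close> times this maximum, which is less than
  the factor \<open>2 pi l\<close> on the other side.\<close>
lemma reflection_decreasing_step:
  assumes D: "reflection_decreasing a0" and a0: "0 < a0" "a0 \<le> 1"
  shows "\<exists>a1. 0 < a1 \<and> a1 < a0 \<and> reflection_decreasing a1"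
proof -
  let ?M = "lborel \<Otimes>\<^sub>M lborel :: (real \<times> real) measure"
  (* The strip is so narrow that 16 * sqrt eta = pi * l. *)
  define \<eta> where "\<eta> = (pi * l / 16)\<^sup>2"
  have \<eta>: "0 < \<eta>" "16 * sqrt \<eta> < 2 * pi * l"
  proof -
    show "0 < \<eta>" using l by (simp add: \<eta>_def)
    have "16 * sqrt \<eta> = pi * l" using l by (simp add: \<eta>_def)
    moreover have "0 < pi * l" using l by simp
    ultimately show "16 * sqrt \<eta> < 2 * pi * l" by linarith
  qed
  define \<delta> where "\<delta> = \<eta> * a0"
  have \<delta>: "0 < \<delta>" using \<eta> a0 by (simp add: \<delta>_def)
  (* Pairs that violate the strict inequality and are at least delta apart. *)
  define K where "K = {(\<rho>, \<sigma>). 0 \<le> \<sigma> \<and> \<sigma> \<le> \<rho> \<and> \<rho> \<le> 1 \<and> \<delta> \<le> \<rho> - \<sigma> \<and> 0 \<le> \<rho> + \<sigma> \<and> slope \<sigma> \<le> slope \<rho> + 0}"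
  have K: "compact K" unfolding K_def by (rule compact_pairs[OF slope_cont])
  have small: "fst p + snd p < 2 * a0" if pK: "p \<in> K" for p
  proof (rule ccontr)
    assume n: "\<not> fst p + snd p < 2 * a0"
    have "slope (fst p) < slope (snd p)" by (rule reflection_decreasing_strict[OF D a0(1)]) (use pK n \<delta> in \<open>auto simp: K_def split: prod.splits\<close>)
    then show False using pK by (auto simp: K_def)
  qed
  obtain m where m: "m < 2 * a0" "\<And>p. p \<in> K \<Longrightarrow> fst p + snd p \<le> m"
  proof (cases "K = {}")
    case True
    then show ?thesis using that[of 0] a0 by auto
  next
    case False
    have "continuous_on K (\<lambda>p. fst p + snd p)" by (intro continuous_intros)
    then obtain p where p: "p \<in> K" "\<forall>x\<in>K. fst x + snd x \<le> fst p + snd p" using continuous_attains_sup[OF K False] by blast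
    then show ?thesis using that[of "fst p + snd p"] small by blast
  qed
  define a1 where "a1 = max (a0 / 2) ((m / 2 + a0) / 2)"
  have a1: "0 < a1" "a1 < a0" "m < 2 * a1" "a0 / 2 \<le> a1"
  proof -
    show h: "a0 / 2 \<le> a1" by (simp add: a1_def)
    then show "0 < a1" using a0 by linarith
    show "a1 < a0" using m(1) a0 by (simp add: a1_def)
    have "(m / 2 + a0) / 2 \<le> a1" by (simp add: a1_def)
    then show "m < 2 * a1" using m(1) by argo
  qed
  have far: "slope \<rho> < slope \<sigma>" if "0 \<le> \<sigma>" "\<sigma> \<le> \<rho>" "\<rho> \<le> 1" "2 * a1 \<le> \<rho> + \<sigma>" "\<delta> \<le> \<rho> - \<sigma>" for \<rho> \<sigma>
  proof (rule ccontr)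
    assume "\<not> slope \<rho> < slope \<sigma>"
    then have "(\<rho>, \<sigma>) \<in> K" using that by (auto simp: K_def)
    then have "\<rho> + \<sigma> \<le> m" using m(2)[of "(\<rho>, \<sigma>)"] by simp
    then show False using that(4) a1(3) by linarith
  qed
  define K2 where "K2 = {(\<rho>, \<sigma>). 0 \<le> \<sigma> \<and> \<sigma> \<le> \<rho> \<and> \<rho> \<le> 1 \<and> 0 \<le> \<rho> - \<sigma> \<and> 2 * a1 \<le> \<rho> + \<sigma> \<and> (0::real) \<le> 0 + 0}"
  have K2: "compact K2" unfolding K2_def by (rule compact_pairs[of "\<lambda>_. 0"]) simp
  have "(1, 1) \<in> K2" using a1 a0 by (simp add: K2_def)
  then have K2n: "K2 \<noteq> {}" by blast
  have "continuous_on K2 (\<lambda>p. slope (fst p) - slope (snd p))"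
    by (intro continuous_on_diff continuous_on_compose2[OF slope_cont[of UNIV]] continuous_intros) auto
  then obtain p where p: "p \<in> K2" "\<forall>x\<in>K2. slope (fst x) - slope (snd x) \<le> slope (fst p) - slope (snd p)"
    using continuous_attains_sup[OF K2 K2n] by blast
  obtain \<rho> \<sigma> where ps: "p = (\<rho>, \<sigma>)" by (cases p)
  define S where "S = slope \<rho> - slope \<sigma>"
  have Smax: "slope \<rho>' - slope \<sigma>' \<le> S" if "0 \<le> \<sigma>'" "\<sigma>' \<le> \<rho>'" "\<rho>' \<le> 1" "2 * a1 \<le> \<rho>' + \<sigma>'" for \<rho>' \<sigma>'
    using p(2)[rule_format, of "(\<rho>', \<sigma>')"] that by (simp add: ps S_def K2_def)
  have range: "0 \<le> \<sigma>" "\<sigma> \<le> \<rho>" "\<rho> \<le> 1" "2 * a1 \<le> \<rho> + \<sigma>" using p(1) by (auto simp: ps K2_def)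
  have "S \<le> 0"
  proof (rule ccontr)
    assume "\<not> S \<le> 0"
    then have S: "0 < S" by simp
    then have lt: "\<sigma> < \<rho>" using range(2) by (cases "\<sigma> = \<rho>") (auto simp: S_def)
    define b where "b = (\<rho> + \<sigma>) / 2"
    have b2: "2 * b = \<rho> + \<sigma>" by (simp add: b_def)
    have b: "a1 \<le> b" "0 < b" "a0 \<le> 2 * b" using range(4) a1 by (auto simp: b_def)
    have \<sigma>1: "\<sigma> \<le> 1" and \<rho>0: "0 \<le> \<rho>" using range by auto
    note RI = reflection_identity[OF range(1) \<sigma>1 \<rho>0 range(3) b2]
    define f where "f y = indicator {b..b + \<eta>} y * (1 / sqrt \<bar>\<rho> - y\<bar>)" for y
    define g where "g q = indicator {0..1} q * (1 / (sqrt q * sqrt (sqrt q)))" for q :: real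
    have f: "integrable lborel f" "(\<integral>y. f y \<partial>lborel) \<le> 4 * sqrt \<eta>"
      using inv_sqrt_integral[of b "b + \<eta>" \<rho>] \<eta>(1) by (simp_all add: f_def[abs_def] set_integrable_def set_lebesgue_integral_def)
    have g: "integrable lborel g" "(\<integral>q. g q \<partial>lborel) = 4"
      using quarter_integral by (simp_all add: g_def[abs_def] set_integrable_def set_lebesgue_integral_def)
    note PI = product_integral[OF f(1) g(1)]
    have fg: "0 \<le> f y * g q" for y q
      by (intro mult_nonneg_nonneg) (auto simp: f_def g_def indicator_def)
    (* Where the integrand is positive, the two radii are closer than delta, and so y lies in the strip. *)
    have bound: "reflected_integrand b \<rho> \<sigma> (y, q) \<le> S * (f y * g q)" if ne: "y \<noteq> \<rho>" for y q
    proof (cases "b < y \<and> 0 < q \<and> 0 < radial_slope y q - radial_slope (2 * b - y) q")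
      case False
      have "reflected_integrand b \<rho> \<sigma> (y, q) \<le> 0"
        using kernel_order[OF b2 lt, of y q] False by (auto simp: reflected_integrand_def mult_nonneg_nonpos)
      moreover have "0 \<le> S * (f y * g q)" using S fg by simp
      ultimately show ?thesis by linarith
    next
      case True
      note R = reflected_pair[OF b(2), of y q]
      let ?r = "sqrt (y\<^sup>2 + q)" and ?s = "sqrt ((2 * b - y)\<^sup>2 + q)"
      have s0: "0 \<le> ?s" using True by simp
      have r1: "?r < 1"
      proof (rule ccontr)
        assume "\<not> ?r < 1"
        then have "radial_slope y q = 0" by (simp add: radial_slope_def slope_out)
        then show False using True radial_slope_nonneg[of q "2 * b - y"] by simp
      qed
      have sr: "?s \<le> ?r" "2 * a1 \<le> ?r + ?s" using R(1,2) True b(1) by auto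
      have dS: "radial_slope y q - radial_slope (2 * b - y) q \<le> S" unfolding radial_slope_def by (rule Smax[OF s0 sr(1) _ sr(2)]) (use r1 in simp)
      have close: "?r - ?s < \<delta>"
      proof (rule ccontr)
        assume "\<not> ?r - ?s < \<delta>"
        then have "slope ?r < slope ?s" using far[OF s0 sr(1) _ sr(2)] r1 by simp
        then show False using True by (simp add: radial_slope_def)
      qed
      have y: "y < b + \<eta>"
      proof -
        have e: "4 * b * (y - b) = (?r - ?s) * (?r + ?s)" using R(3) True by (simp add: power2_eq_square algebra_simps)
        have u: "\<delta> * 2 \<le> 4 * b * \<eta>" using b(3) \<eta>(1) by (simp add: \<delta>_def mult.commute)
        have "4 * b * (y - b) < 4 * b * \<eta>"
        proof -
          have "(?r - ?s) * (?r + ?s) < \<delta> * 2"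
          proof -
            have rs: "0 < ?r + ?s" "?r + ?s < 2" using sr a1(1) r1 by linarith+
            have "(?r - ?s) * (?r + ?s) \<le> \<delta> * (?r + ?s)" using close rs by (intro mult_right_mono) auto
            also have "\<dots> < \<delta> * 2" using \<delta> rs by simp
            finally show ?thesis .
          qed
          then show ?thesis using e u by linarith
        qed
        then have "y - b < \<eta>" using b(2) by simp
        then show ?thesis by simp
      qed
      have q1: "q \<le> 1"
      proof -
        have "y\<^sup>2 + q < 1" using r1 by simp
        then show ?thesis using zero_le_power2[of y] by linarith
      qed
      have "reflected_integrand b \<rho> \<sigma> (y, q) = (1 / ((\<rho> - y)\<^sup>2 + q) - 1 / ((\<sigma> - y)\<^sup>2 + q)) * (radial_slope y q - radial_slope (2 * b - y) q)"
        using True by (simp add: reflected_integrand_def)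
      also have "\<dots> \<le> (1 / ((\<rho> - y)\<^sup>2 + q)) * S"
        using kernel_order[OF b2 lt, of y q] True dS S by (intro mult_mono) auto
      also have "\<dots> \<le> ((1 / sqrt \<bar>\<rho> - y\<bar>) * (1 / (sqrt q * sqrt (sqrt q)))) * S"
        using newton_kernel_bound[of q "\<rho> - y"] True ne S by (intro mult_right_mono) auto
      also have "\<dots> = S * (f y * g q)" using True y q1 by (simp add: f_def g_def)
      finally show ?thesis .
    qed
    have AE_ne: "AE z in ?M. fst z \<noteq> \<rho>"
    proof -
      have "AE z in ?M. z \<in> {z. fst z \<noteq> \<rho>}"
      proof (rule AE_I'[of "{\<rho>} \<times> UNIV"])
        have "emeasure ?M ({\<rho>} \<times> UNIV) = emeasure lborel {\<rho>} * emeasure lborel (UNIV :: real set)"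
          by (rule lborel.emeasure_pair_measure_Times) simp_all
        then show "{\<rho>} \<times> UNIV \<in> null_sets ?M" by (auto intro!: null_setsI)
      qed auto
      then show ?thesis by simp
    qed
    have "2 * pi * l * S = (\<integral>z. reflected_integrand b \<rho> \<sigma> z \<partial>?M)" using RI(2) by (simp add: S_def)
    also have "\<dots> \<le> (\<integral>z. S * (case z of (y, q) \<Rightarrow> f y * g q) \<partial>?M)"
    proof (rule integral_mono_AE[OF RI(1)])
      show "integrable ?M (\<lambda>z. S * (case z of (y, q) \<Rightarrow> f y * g q))" by (rule integrable_mult_right[OF PI(1)])
      show "AE z in ?M. reflected_integrand b \<rho> \<sigma> z \<le> S * (case z of (y, q) \<Rightarrow> f y * g q)"
        using AE_ne
      proof eventually_elim
        case (elim z)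
        then show ?case using bound[of "fst z" "snd z"] by (simp add: split_beta')
      qed
    qed
    also have "\<dots> = S * ((\<integral>y. f y \<partial>lborel) * (\<integral>q. g q \<partial>lborel))"
      unfolding integral_mult_right_zero PI(2) ..
    also have "\<dots> \<le> S * (4 * sqrt \<eta> * 4)" unfolding g(2) using S f(2) by (intro mult_left_mono mult_right_mono) auto
    finally have "S * (2 * pi * l) \<le> S * (16 * sqrt \<eta>)" by (simp add: algebra_simps)
    then have "2 * pi * l \<le> 16 * sqrt \<eta>" using S by (simp only: mult_le_cancel_left_pos)
    then show False using \<eta>(2) by linarith
  qed
  then have "slope \<rho>' \<le> slope \<sigma>'" if "0 \<le> \<sigma>'" "\<sigma>' \<le> \<rho>'" "\<rho>' \<le> 1" "2 * a1 \<le> \<rho>' + \<sigma>'" for \<rho>' \<sigma>'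
    using Smax[OF that] by linarith
  then have "reflection_decreasing a1" unfolding reflection_decreasing_def by blast
  then show ?thesis using a1 by blast
qed

text \<open>Planes start at \<open>1\<close>, where there is nothing to prove, and move down; the infimum of the
  admissible positions is attained by continuity and, by the previous step, not positive.\<close>
lemma reflection_decreasing_all: assumes "0 < a" shows "reflection_decreasing a"
proof -
  define A where "A = {a. 0 \<le> a \<and> a \<le> 1 \<and> reflection_decreasing a}"
  have mono: "reflection_decreasing a'" if "reflection_decreasing a" "a \<le> a'" for a a'
    unfolding reflection_decreasing_def
  proof (intro allI impI)
    fix \<rho> \<sigma> assume h: "0 \<le> \<sigma>" "\<sigma> \<le> \<rho>" "\<rho> \<le> 1" "2 * a' \<le> \<rho> + \<sigma>"
    then have "2 * a \<le> \<rho> + \<sigma>" using that(2) by linarith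
    then show "slope \<rho> \<le> slope \<sigma>" using that(1) h unfolding reflection_decreasing_def by blast
  qed
  have "reflection_decreasing 1" unfolding reflection_decreasing_def
  proof (intro allI impI)
    fix \<rho> \<sigma> :: real assume "0 \<le> \<sigma>" "\<sigma> \<le> \<rho>" "\<rho> \<le> 1" "2 * 1 \<le> \<rho> + \<sigma>"
    then have "\<rho> = \<sigma>" by linarith
    then show "slope \<rho> \<le> slope \<sigma>" by simp
  qed
  then have A1: "1 \<in> A" by (simp add: A_def)
  then have ne: "A \<noteq> {}" by blast
  have bdd: "bdd_below A" by (rule bdd_belowI[of _ 0]) (simp add: A_def)
  define a0 where "a0 = Inf A"
  have a01: "a0 \<le> 1" unfolding a0_def by (rule cInf_lower[OF A1 bdd])
  have a00: "0 \<le> a0" unfolding a0_def by (rule cInf_greatest[OF ne]) (simp add: A_def)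
  have above: "reflection_decreasing a'" if "a0 < a'" for a'
  proof -
    have "\<exists>a\<in>A. a < a'" using that cInf_less_iff[OF ne bdd] unfolding a0_def by simp
    then obtain a where "a \<in> A" "a < a'" ..
    then show ?thesis using mono[of a a'] by (simp add: A_def)
  qed
  have "a0 = 0"
  proof (rule ccontr)
    assume "a0 \<noteq> 0"
    then have a0p: "0 < a0" using a00 by simp
    have "reflection_decreasing a0" unfolding reflection_decreasing_def
    proof (intro allI impI)
      fix \<rho> \<sigma> assume h: "0 \<le> \<sigma>" "\<sigma> \<le> \<rho>" "\<rho> \<le> 1" "2 * a0 \<le> \<rho> + \<sigma>"
      show "slope \<rho> \<le> slope \<sigma>"
      proof (cases "\<sigma> = \<rho>")
        case False
        then have lt: "\<sigma> < \<rho>" using h by simp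
        have "(slope \<longlongrightarrow> slope \<sigma>) (at_right \<sigma>)"
          by (rule tendsto_within_subset[OF _ subset_UNIV]) (use slope_cont[of UNIV] in \<open>simp add: continuous_on_def\<close>)
        moreover have "\<forall>\<^sub>F t in at_right \<sigma>. slope \<rho> \<le> slope t"
          using eventually_at_right_less[of \<sigma>] eventually_at_right_real[OF lt]
        proof eventually_elim
          case (elim t)
          have "reflection_decreasing ((\<rho> + t) / 2)" by (rule above) (use elim h in auto)
          then show ?case using elim h unfolding reflection_decreasing_def by auto
        qed
        ultimately show ?thesis by (rule tendsto_lowerbound) simp
      qed simp
    qed
    from reflection_decreasing_step[OF this a0p a01] obtain a1 where "0 < a1" "a1 < a0" "reflection_decreasing a1" by (elim exE conjE)
    then have "a1 \<in> A" using a01 by (simp add: A_def)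
    then have "a0 \<le> a1" unfolding a0_def by (rule cInf_lower[OF _ bdd])
    then show False using \<open>a1 < a0\<close> by simp
  qed
  then show ?thesis using above[of a] assms by simp
qed

text \<open>Planes arbitrarily close to the centre show that the chord slope decreases, and the slope drop is
  \<open>- x\<close> times its derivative.\<close>
theorem positive_half_profile_slope_decreasing: assumes "x \<in> {0..1}" shows "0 \<le> slope_drop \<phi> x"
proof -
  have dec: "slope \<rho> \<le> slope \<sigma>" if "0 < \<sigma>" "\<sigma> \<le> \<rho>" "\<rho> \<le> 1" for \<rho> \<sigma>
  proof -
    have "reflection_decreasing \<sigma>" by (rule reflection_decreasing_all[OF that(1)])
    then show ?thesis using that unfolding reflection_decreasing_def by simp
  qed
  have inner: "0 \<le> slope_drop \<phi> x" if x: "0 < x" "x < 1" for x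
  proof (rule ccontr)
    assume "\<not> 0 \<le> slope_drop \<phi> x"
    then have "0 < - slope_drop \<phi> x / x" using x by (simp add: field_simps)
    moreover have "(chord_slope (slope_drop \<phi>) has_real_derivative - slope_drop \<phi> x / x) (at x)" by (rule chord_slope_deriv[OF half_profile_slope_drop(1)[OF s] x])
    ultimately have "\<exists>d>0. \<forall>h>0. h < d \<longrightarrow> chord_slope (slope_drop \<phi>) x < chord_slope (slope_drop \<phi>) (x + h)"
      by (rule DERIV_pos_inc_right[rotated])
    then obtain d where d: "d > 0" "\<forall>h>0. h < d \<longrightarrow> chord_slope (slope_drop \<phi>) x < chord_slope (slope_drop \<phi>) (x + h)"
      by (elim exE conjE) (rule that)
    define h where "h = min (d / 2) ((1 - x) / 2)"
    have h: "0 < h" "h < d" "x + h \<le> 1" using d(1) x by (auto simp: h_def min_def field_simps)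
    have "slope (x + h) = chord_slope (slope_drop \<phi>) (x + h)" "slope x = chord_slope (slope_drop \<phi>) x"
      using chord_slope_slope_drop[OF half_profileD(1,2)[OF s]] slope_eq x h by simp_all
    then show False using d(2)[rule_format, OF h(1,2)] dec[of x "x + h"] x h by simp
  qed
  show ?thesis
  proof (cases "x = 1")
    case True
    have "(slope_drop \<phi> \<longlongrightarrow> slope_drop \<phi> 1) (at_left 1)"
    proof -
      have "(slope_drop \<phi> \<longlongrightarrow> slope_drop \<phi> 1) (at 1 within {0..1})" using half_profile_slope_drop(1)[OF s] by (simp add: continuous_on_def)
      moreover have "at (1::real) within {0..1} = at_left 1" by (rule at_within_Icc_at_left) simp
      ultimately show ?thesis by simp
    qed
    moreover have "\<forall>\<^sub>F t in at_left 1. 0 \<le> slope_drop \<phi> t"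
      using eventually_at_left_real[OF zero_less_one]
    proof eventually_elim
      case (elim t)
      then show ?case by (intro inner) simp_all
    qed
    ultimately have "0 \<le> slope_drop \<phi> 1" by (rule tendsto_lowerbound) simp
    then show ?thesis using True by simp
  next
    case False
    show ?thesis
    proof (cases "x = 0")
      case False
      then show ?thesis using inner[of x] assms \<open>x \<noteq> 1\<close> by simp
    qed (simp add: slope_drop_def)
  qed
qed

end

section \<open>Weak derivatives and primitives\<close>

text \<open>A continuous bump on \<open>[0, 1]\<close> with integral \<open>1\<close>; its primitives are
  smoothed steps and serve as test functions.\<close>
definition ramp_density :: "real \<Rightarrow> real" where
  "ramp_density t = 6 * max 0 (min 1 t) * (1 - max 0 (min 1 t))"

lemma ramp_density_bounds: "0 \<le> ramp_density t" "ramp_density t \<le> 6"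
proof -
  define m where "m = max 0 (min 1 t)"
  have m: "0 \<le> m" "m \<le> 1" by (auto simp: m_def)
  show "0 \<le> ramp_density t" using m by (simp add: ramp_density_def m_def[symmetric])
  have "m * (1 - m) \<le> 1 * 1" using m by (intro mult_mono) auto
  then show "ramp_density t \<le> 6" by (simp add: ramp_density_def m_def[symmetric])
qed

lemma ramp_density_outside: "t \<le> 0 \<or> 1 \<le> t \<Longrightarrow> ramp_density t = 0"
  by (auto simp: ramp_density_def max_def min_def)

lemma ramp_density_continuous: "continuous_on A ramp_density"
  unfolding ramp_density_def by (intro continuous_intros)

lemma ramp_density_I: "integrable I ramp_density" "(\<integral>t. ramp_density t \<partial>I) = 1"
proof -
  show i: "integrable I ramp_density" by (rule L2_cont_int[OF ramp_density_continuous])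
  have "(\<integral>t. ramp_density t \<partial>I) = (3 * 1^2 - 2 * 1^3) - (3 * 0^2 - 2 * 0^3)"
  proof (rule FTC_I[of "{}"])
    show "continuous_on {0..1} (\<lambda>t::real. 3 * t\<^sup>2 - 2 * t ^ 3)" by (intro continuous_intros)
    show "((\<lambda>t. 3 * t\<^sup>2 - 2 * t ^ 3) has_real_derivative ramp_density t) (at t)" if "t \<in> {0<..<1} - {}" for t
      using that by (auto intro!: derivative_eq_intros simp: ramp_density_def power2_eq_square algebra_simps)
  qed (use i in auto)
  then show "(\<integral>t. ramp_density t \<partial>I) = 1" by simp
qed

lemma ramp_exists:
  "\<exists>S. (\<forall>t. (S has_real_derivative ramp_density t) (at t)) \<and> (\<forall>t\<le>0. S t = 0) \<and> (\<forall>t\<ge>1. S t = 1) \<and> (\<forall>t. 0 \<le> S t \<and> S t \<le> 1)"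
proof -
  obtain S where S0: "S 0 = 0" and d: "\<forall>t. (S has_real_derivative ramp_density t) (at t)"
    using antiderivative_real_line[OF ramp_density_continuous] by (elim exE conjE) (rule that)
  have c: "continuous_on A S" for A using d DERIV_isCont by (meson continuous_at_imp_continuous_on)
  have mono: "S x \<le> S y" if "x \<le> y" for x y
    by (rule DERIV_nonneg_imp_nondecreasing[OF that]) (use d ramp_density_bounds(1) in blast)
  have "(\<integral>t. ramp_density t \<partial>I) = S 1 - S 0" by (rule FTC_I[of "{}"]) (use c d ramp_density_I in auto)
  then have S1: "S 1 = 1" using S0 ramp_density_I by simp
  have left: "S t = 0" if "t \<le> 0" for t
  proof (cases "t = 0")
    case False
    then have lt: "t < 0" using that by simp
    have "S 0 = S t"
    proof (rule DERIV_isconst_end[OF lt c])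
      fix x assume "t < x" "x < 0"
      then show "(S has_real_derivative 0) (at x)" using spec[OF d, of x] ramp_density_outside[of x] by simp
    qed
    then show ?thesis using S0 by simp
  qed (use S0 in simp)
  have right: "S t = 1" if "1 \<le> t" for t
  proof (cases "t = 1")
    case False
    then have lt: "1 < t" using that by simp
    have "S t = S 1"
    proof (rule DERIV_isconst_end[OF lt c])
      fix x assume "1 < x" "x < t"
      then show "(S has_real_derivative 0) (at x)" using spec[OF d, of x] ramp_density_outside[of x] by simp
    qed
    then show ?thesis using S1 by simp
  qed (use S1 in simp)
  have "0 \<le> S t \<and> S t \<le> 1" for t
    using mono[of 0 t] mono[of t 1] left[of t] right[of t] S0 S1 by (cases "t \<le> 0"; cases "1 \<le> t") auto
  then show ?thesis using d left right by blast
qed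

lemma square_integrable_on_interval:
  assumes "square_integrable g" shows "set_integrable lborel {a..b} g"
proof -
  have m: "g \<in> borel_measurable lborel" and i: "integrable lborel (\<lambda>x. (g x)\<^sup>2)"
    using assms by (auto simp: square_integrable_def)
  have ind: "integrable lborel (\<lambda>x. indicator {a..b} x :: real)"
    by (rule integrable_real_indicator) (auto simp: emeasure_lborel_Icc_eq)
  show ?thesis unfolding set_integrable_def
  proof (rule Bochner_Integration.integrable_bound[OF Bochner_Integration.integrable_add[OF ind i]])
    show "(\<lambda>x. indicator {a..b} x *\<^sub>R g x) \<in> borel_measurable lborel" using m by simp
    have "\<bar>u\<bar> \<le> 1 + u\<^sup>2" for u :: real
    proof -
      have "0 \<le> (\<bar>u\<bar> - 1)\<^sup>2 + \<bar>u\<bar>\<^sup>2 + 1" by simp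
      then show ?thesis by (simp add: power2_diff)
    qed
    then show "AE x in lborel. norm (indicator {a..b} x *\<^sub>R g x) \<le> norm (indicator {a..b} x + (g x)\<^sup>2)"
      by (intro AE_I2) (auto simp: indicator_def)
  qed
qed

lemma mollified_value:
  fixes W :: "real \<Rightarrow> real"
  assumes W: "continuous_on UNIV W"
  shows "integrable lborel (\<lambda>x. W x * (real (Suc n) * ramp_density ((x - c) * real (Suc n))))" (is "?int n")
    and "(\<lambda>n. LINT x|lborel. W x * (real (Suc n) * ramp_density ((x - c) * real (Suc n)))) \<longlonglongrightarrow> W c" (is "?lim")
proof -
  define N where "N n = real (Suc n)" for n
  have N: "0 < N n" "1 \<le> N n" for n by (auto simp: N_def)
  have Wc: "continuous_on A W" for A by (rule continuous_on_subset[OF W]) simp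
  define F where "F n x = W x * (N n * ramp_density ((x - c) * N n))" for n x
  have out: "F n x = 0" if "x \<notin> {c..c + 1}" for n x
  proof -
    have "(x - c) * N n \<le> 0 \<or> 1 \<le> (x - c) * N n"
    proof (cases "x < c")
      case True then show ?thesis using N(1)[of n] by (simp add: mult_le_0_iff)
    next
      case False
      then have "1 * 1 \<le> (x - c) * N n" using that N(2)[of n] by (intro mult_mono) auto
      then show ?thesis by simp
    qed
    then show ?thesis by (simp add: F_def ramp_density_outside)
  qed
  show "?int n"
  proof -
    have "integrable lborel (\<lambda>x. indicator {c..c + 1} x *\<^sub>R F n x)"
      unfolding F_def by (rule borel_integrable_compact[OF compact_Icc])
        (intro continuous_intros Wc continuous_on_compose2[OF ramp_density_continuous[of UNIV]] subset_UNIV)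
    moreover have "(\<lambda>x. indicator {c..c + 1} x *\<^sub>R F n x) = F n"
    proof
      fix x show "indicator {c..c + 1} x *\<^sub>R F n x = F n x" using out[of x n] by (cases "x \<in> {c..c + 1}") auto
    qed
    ultimately have "integrable lborel (F n)" by simp
    then show ?thesis unfolding F_def[abs_def] N_def .
  qed
  have eq: "(LINT x|lborel. F n x) = (\<integral>t. W (c + t / N n) * ramp_density t \<partial>I)" for n
  proof -
    have "(LINT x|lborel. F n x) = \<bar>1 / N n\<bar> * (LINT t|lborel. F n (c + (1 / N n) * t))"
      using lborel_integral_real_affine[of "1 / N n" "F n" c] N(1)[of n] by simp
    also have "\<dots> = (LINT t|lborel. \<bar>1 / N n\<bar> * F n (c + (1 / N n) * t))" by (rule integral_mult_right_zero[symmetric])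
    also have "\<dots> = (LINT t|lborel. indicator {0..1} t *\<^sub>R (W (c + t / N n) * ramp_density t))"
    proof (rule Bochner_Integration.integral_cong[OF refl])
      fix t show "\<bar>1 / N n\<bar> * F n (c + (1 / N n) * t) = indicator {0..1} t *\<^sub>R (W (c + t / N n) * ramp_density t)"
        using N(1)[of n] ramp_density_outside[of t] by (cases "0 \<le> t \<and> t \<le> 1") (auto simp: F_def indicator_def)
    qed
    finally show ?thesis by (simp add: integral_I_eq set_lebesgue_integral_def)
  qed
  have "(\<lambda>n. \<integral>t. W (c + t / N n) * ramp_density t \<partial>I) \<longlonglongrightarrow> (\<integral>t. W c * ramp_density t \<partial>I)"
  proof -
    have "bounded (W ` {c..c + 1})" using compact_continuous_image[OF Wc compact_Icc] compact_imp_bounded by blast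
    then obtain B where B: "\<forall>y\<in>W ` {c..c + 1}. norm y \<le> B" unfolding bounded_iff ..
    have arg: "continuous_on A (\<lambda>t. W (c + t / N n) * ramp_density t)" for A n
      by (intro continuous_intros continuous_on_compose2[OF W] ramp_density_continuous) (use N(1)[of n] in auto)
    show ?thesis
    proof (rule integral_dominated_convergence[where w="\<lambda>_. B * 6"])
      show "(\<lambda>t. W c * ramp_density t) \<in> borel_measurable I" by (intro continuous_on_measurable_I continuous_intros ramp_density_continuous)
      show "(\<lambda>t. W (c + t / N n) * ramp_density t) \<in> borel_measurable I" for n by (intro continuous_on_measurable_I arg)
      show "AE t in I. (\<lambda>n. W (c + t / N n) * ramp_density t) \<longlonglongrightarrow> W c * ramp_density t"
      proof (rule AE_I2)
        fix t :: real
        have "(\<lambda>n. t * inverse (N n)) \<longlonglongrightarrow> t * 0" unfolding N_def by (intro tendsto_intros LIMSEQ_inverse_real_of_nat)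
        then have "(\<lambda>n. c + t / N n) \<longlonglongrightarrow> c + 0" by (intro tendsto_intros) (simp add: divide_inverse)
        then have "(\<lambda>n. W (c + t / N n)) \<longlonglongrightarrow> W (c + 0)"
          by (rule continuous_on_tendsto_compose[OF W]) auto
        then show "(\<lambda>n. W (c + t / N n) * ramp_density t) \<longlonglongrightarrow> W c * ramp_density t" by (intro tendsto_intros) simp
      qed
      show "AE t in I. norm (W (c + t / N n) * ramp_density t) \<le> B * 6" for n
      proof (rule AE_I2)
        fix t assume "t \<in> space I"
        then have t: "0 \<le> t" "t \<le> 1" by auto
        have "t / N n \<le> 1 / 1" using t N(2)[of n] by (intro frac_le) auto
        then have "c + t / N n \<in> {c..c + 1}" using t N(1)[of n] by auto
        then have "\<bar>W (c + t / N n)\<bar> \<le> B" using B by auto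
        then show "norm (W (c + t / N n) * ramp_density t) \<le> B * 6"
          using ramp_density_bounds[of t] by (simp add: abs_mult) (intro mult_mono; simp)
      qed
    qed simp
  qed
  then have "(\<lambda>n. LINT x|lborel. F n x) \<longlonglongrightarrow> W c" unfolding eq using ramp_density_I(2) by simp
  then show ?lim unfolding F_def N_def .
qed

text \<open>Test with smoothed indicators of \<open>[a, b]\<close>: their derivatives are approximate identities
  at \<open>a\<close> and \<open>b\<close>.\<close>
lemma weak_derivative_FTC:
  assumes W: "continuous_on UNIV W" and g: "square_integrable g" and wd: "weak_derivative W g" and ab: "a \<le> b"
  shows "(LBINT x:{a..b}. g x) = W b - W a"
proof -
  obtain S where S: "\<forall>t. (S has_real_derivative ramp_density t) (at t)" "\<forall>t\<le>0. S t = 0" "\<forall>t\<ge>1. S t = 1" "\<forall>t. 0 \<le> S t \<and> S t \<le> 1"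
    using ramp_exists by (elim exE conjE) (rule that)
  define N where "N n = real (Suc n)" for n
  have N: "0 < N n" "1 \<le> N n" for n by (auto simp: N_def)
  define f where "f n x = S ((x - a) * N n) - S ((x - b) * N n)" for n x
  define f' where "f' n x = N n * ramp_density ((x - a) * N n) - N n * ramp_density ((x - b) * N n)" for n x
  have le0: "(x - d) * N n \<le> 0" if "x \<le> d" for x d n using N(1)[of n] that by (simp add: mult_le_0_iff)
  have Sc: "continuous_on UNIV S" using S(1) DERIV_isCont by (meson continuous_at_imp_continuous_on)
  have f0: "f n x = 0" if "x \<notin> {a..b + 1}" for n x
  proof (cases "x < a")
    case True
    then show ?thesis using S(2) le0[of x a n] le0[of x b n] ab by (simp add: f_def)
  next
    case False
    then have x: "b + 1 < x" using that by auto
    have "1 * 1 \<le> (x - a) * N n" "1 * 1 \<le> (x - b) * N n" using x ab N(2)[of n] by (intro mult_mono; simp)+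
    then show ?thesis using S(3) by (simp add: f_def)
  qed
  have id: "(LINT x|lborel. W x * f' n x) = - (LINT x|lborel. g x * f n x)" for n
  proof -
    have d: "\<forall>x. (f n has_real_derivative f' n x) (at x)"
    proof
      fix x
      have "((\<lambda>x. S ((x - d) * N n)) has_real_derivative ramp_density ((x - d) * N n) * N n) (at x)" for d
        by (rule DERIV_chain2[OF spec[OF S(1)]]) (auto intro!: derivative_eq_intros)
      from DERIV_diff[OF this[of a] this[of b]]
      show "(f n has_real_derivative f' n x) (at x)" by (simp add: f_def[abs_def] f'_def mult.commute)
    qed
    moreover have "continuous_on UNIV (f' n)"
      unfolding f'_def by (intro continuous_intros continuous_on_compose2[OF ramp_density_continuous[of UNIV]] subset_UNIV)
    moreover have "compact (closure {x. f n x \<noteq> 0})"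
    proof -
      have "{x. f n x \<noteq> 0} \<subseteq> {a..b + 1}" using f0 by blast
      then show ?thesis using bounded_subset[OF bounded_closed_interval] by (simp add: compact_closure)
    qed
    ultimately show ?thesis using wd unfolding weak_derivative_def by blast
  qed
  have l1: "(\<lambda>n. LINT x|lborel. W x * f' n x) \<longlonglongrightarrow> W a - W b"
  proof -
    have "(LINT x|lborel. W x * f' n x) = (LINT x|lborel. W x * (N n * ramp_density ((x - a) * N n))) - (LINT x|lborel. W x * (N n * ramp_density ((x - b) * N n)))" for n
      unfolding N_def by (subst Bochner_Integration.integral_diff[symmetric, OF mollified_value(1)[OF W] mollified_value(1)[OF W]])
        (simp add: f'_def N_def algebra_simps)
    then show ?thesis using tendsto_diff[OF mollified_value(2)[OF W, of a] mollified_value(2)[OF W, of b]] by (simp add: N_def)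
  qed
  have gm: "g \<in> borel_measurable lborel" using g by (simp add: square_integrable_def)
  have l2: "(\<lambda>n. LINT x|lborel. g x * f n x) \<longlonglongrightarrow> (LINT x|lborel. indicator {a..b} x *\<^sub>R g x)"
  proof (rule integral_dominated_convergence[where w="\<lambda>x. norm (indicator {a..b + 1} x *\<^sub>R g x)"])
    show "(\<lambda>x. indicator {a..b} x *\<^sub>R g x) \<in> borel_measurable lborel" using gm by simp
    have "continuous_on UNIV (f n)" for n
      unfolding f_def by (intro continuous_intros continuous_on_compose2[OF Sc] subset_UNIV)
    then have "f n \<in> borel_measurable lborel" for n using borel_measurable_continuous_onI[of "f n"] by simp
    then show "(\<lambda>x. g x * f n x) \<in> borel_measurable lborel" for n using gm by (intro borel_measurable_times)
    show "integrable lborel (\<lambda>x. norm (indicator {a..b + 1} x *\<^sub>R g x))"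
      using square_integrable_on_interval[OF g] unfolding set_integrable_def by (rule integrable_norm)
    show "AE x in lborel. norm (g x * f n x) \<le> norm (indicator {a..b + 1} x *\<^sub>R g x)" for n
    proof (rule AE_I2)
      fix x
      have "\<bar>f n x\<bar> \<le> 1" using spec[OF S(4), of "(x - a) * N n"] spec[OF S(4), of "(x - b) * N n"] unfolding f_def by linarith
      then show "norm (g x * f n x) \<le> norm (indicator {a..b + 1} x *\<^sub>R g x)"
        using f0[of x n] mult_left_mono[of "\<bar>f n x\<bar>" 1 "\<bar>g x\<bar>"] by (cases "x \<in> {a..b + 1}") (auto simp: abs_mult)
    qed
    have ev: "\<forall>\<^sub>F n in sequentially. S ((x - d) * N n) = (if x \<le> d then 0 else 1)" for x d
    proof (cases "x \<le> d")
      case True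
      then show ?thesis using S(2) le0[OF True] by simp
    next
      case False
      obtain m :: nat where m: "1 / (x - d) < real m" using reals_Archimedean2 by blast
      have "\<forall>\<^sub>F n in sequentially. m \<le> n" by (rule eventually_ge_at_top)
      then show ?thesis
      proof eventually_elim
        case (elim n)
        have "1 / (x - d) \<le> N n" using m elim by (simp add: N_def)
        then have "1 \<le> (x - d) * N n" using False by (simp add: field_simps)
        then show ?case using S(3) False by simp
      qed
    qed
    have "AE x in lborel. x \<noteq> a" by (rule AE_lborel_singleton)
    then show "AE x in lborel. (\<lambda>n. g x * f n x) \<longlonglongrightarrow> indicator {a..b} x *\<^sub>R g x"
    proof eventually_elim
      case (elim x)
      have "\<forall>\<^sub>F n in sequentially. g x * f n x = indicator {a..b} x *\<^sub>R g x"
        using ev[of x a] ev[of x b] by eventually_elim (use elim ab in \<open>auto simp: f_def indicator_def\<close>)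
      then show ?case by (rule tendsto_eventually)
    qed
  qed
  have "- (LINT x|lborel. indicator {a..b} x *\<^sub>R g x) = W a - W b"
    by (rule LIMSEQ_unique[OF tendsto_minus[OF l2]]) (use l1 id in simp)
  then show ?thesis by (simp add: set_lebesgue_integral_def)
qed

text \<open>Applied to a weak derivative, this Cauchy--Schwarz bound is the \<open>1/2\<close>-Hoelder
  continuity of \<open>H\<^sup>1\<close> functions.\<close>
lemma square_integrable_short:
  assumes g: "square_integrable g" and ab: "a \<le> b"
  shows "(LBINT t:{a..b}. \<bar>g t\<bar>) \<le> norm_L2 lborel g * sqrt (b - a)"
proof -
  have gl: "L2 lborel (\<lambda>t. \<bar>g t\<bar>)" using g by (auto simp: square_integrable_def L2_def)
  have il: "L2 lborel (indicator {a..b} :: real \<Rightarrow> real)"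
  proof -
    have "(\<lambda>x. (indicator {a..b} x :: real)\<^sup>2) = indicator {a..b}" by (auto simp: indicator_def)
    then show ?thesis unfolding L2_def by (auto simp: emeasure_lborel_Icc_eq)
  qed
  have n1: "norm_L2 lborel (indicator {a..b}) = sqrt (b - a)"
  proof -
    have "(\<lambda>x. (indicator {a..b} x :: real)\<^sup>2) = indicator {a..b}" by (auto simp: indicator_def)
    then show ?thesis unfolding norm_L2_def using ab by simp
  qed
  have "(LBINT t:{a..b}. \<bar>g t\<bar>) = inner_L2 lborel (indicator {a..b}) (\<lambda>t. \<bar>g t\<bar>)"
    by (simp add: set_lebesgue_integral_def inner_L2_def)
  also have "\<dots> \<le> sqrt (b - a) * norm_L2 lborel (\<lambda>t. \<bar>g t\<bar>)"
    using Cauchy_Schwarz_L2[OF il gl] n1 by simp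
  also have "norm_L2 lborel (\<lambda>t. \<bar>g t\<bar>) = norm_L2 lborel g" by (simp add: norm_L2_def)
  finally show ?thesis by (simp add: mult.commute)
qed

section \<open>Rigidity of negative profiles\<close>

context
  fixes W g U :: "real \<Rightarrow> real"
  assumes W: "continuous_on UNIV W" and g: "square_integrable g" and wd: "weak_derivative W g"
    and odd: "odd_function W" and supp: "supported_on W {-1..1}" and neg: "\<forall>x\<in>{0<..<1}. W x < 0"
    and vel: "velocity_of W U"
    and eq: "AE x in lborel. (-1 * x + U x) * g x = (-1 + hilbert_transform W x) * W x"
begin

lemma W_cont: "continuous_on A W" by (rule continuous_on_subset[OF W]) simp

lemma W_outside: "1 < \<bar>x\<bar> \<Longrightarrow> W x = 0"
  using supp closure_subset[of "{x. W x \<noteq> 0}"] unfolding supported_on_def by (auto simp: abs_if split: if_splits)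

lemma W_0: "W 0 = 0"
  using odd[unfolded odd_function_def, rule_format, of 0] by simp

lemma W_1: "W 1 = 0"
proof -
  have "(W \<longlongrightarrow> W 1) (at_right 1)"
    by (rule tendsto_within_subset[OF _ subset_UNIV]) (use W in \<open>simp add: continuous_on_def\<close>)
  moreover have "(W \<longlongrightarrow> 0) (at_right 1)"
  proof (rule tendsto_eventually)
    show "\<forall>\<^sub>F x in at_right 1. W x = 0" using eventually_at_right_less[of 1] by eventually_elim (simp add: W_outside)
  qed
  ultimately show ?thesis by (rule tendsto_unique[rotated]) simp
qed

lemma g_L2: "L2 I g"
  unfolding L2_def
proof
  show "g \<in> borel_measurable I" using g unfolding square_integrable_def by (simp add: measurable_I_borel)
  have "integrable lborel (\<lambda>x. (g x)\<^sup>2)" using g unfolding square_integrable_def by simp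
  then show "integrable I (\<lambda>x. (g x)\<^sup>2)" unfolding integrable_I_iff set_integrable_def by (intro integrable_mult_indicator) auto
qed

lemma prim_g: assumes "x \<in> {0..1}" shows "prim g x = W x"
  using prim_set[OF assms, of g] weak_derivative_FTC[OF W g wd, of 0 x] assms W_0 by simp

lemma odd_ext_g: "odd_ext g = W"
proof
  fix y show "odd_ext g y = W y"
    using prim_g W_outside odd unfolding odd_function_def by (auto simp: odd_ext_def)
qed

lemma g_1: "prim g 1 = 0" using prim_g[of 1] W_1 by simp

lemma hilbert_W: "hilbert_transform W x = - neg_hilbert g x"
  using hilbert_odd_ext[OF g_L2 g_1, of x] by (simp add: odd_ext_g)

text \<open>The velocity relative to the self-similar coordinates, and its derivative.\<close>
definition drift_deriv where "drift_deriv x = hilbert_transform W x - 1"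
definition drift where "drift x = U x - x"

lemma drift_deriv_cont: "continuous_on A drift_deriv"
  unfolding drift_deriv_def hilbert_W by (intro continuous_intros continuous_on_subset[OF neg_hilbert_continuous[OF g_L2]]) simp

lemma drift_deriv: "(drift has_real_derivative drift_deriv x) (at x)"
  unfolding drift_def[abs_def] drift_deriv_def using vel[unfolded velocity_of_def] by (intro DERIV_diff DERIV_ident) blast

lemma drift_cont: "continuous_on A drift"
  using DERIV_isCont[OF drift_deriv] by (simp add: continuous_at_imp_continuous_on)

lemma drift_0: "drift 0 = 0" using vel[unfolded velocity_of_def] by (simp add: drift_def)

lemma transport_eq: "AE x in lborel. drift x * g x = drift_deriv x * W x"
  using eq by eventually_elim (simp add: drift_def drift_deriv_def algebra_simps)

text \<open>The transport equation makes the integrand \<open>W x * V' t - V x * W' t\<close> equal to \<open>(W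
  x - W t) V' t + (V t - V x) W' t\<close>. The first term is controlled by Hoelder continuity of
  \<open>W\<close>, the second by the Lipschitz continuity of \<open>V\<close> and the \<open>L\<^sup>2\<close>
  bound on \<open>W'\<close>. The exponent \<open>3/2 > 1\<close> is what matters.\<close>
lemma cross_estimate:
  "\<exists>C\<ge>0. \<forall>x\<in>{0..1}. \<forall>y\<in>{0..1}. x \<le> y \<longrightarrow> \<bar>drift y * W x - drift x * W y\<bar> \<le> C * ((y - x) * sqrt (y - x))"
proof -
  have "bounded (drift_deriv ` {0..1})" using compact_continuous_image[OF drift_deriv_cont compact_Icc] compact_imp_bounded by blast
  then obtain K where K: "\<forall>y\<in>drift_deriv ` {0..1}. norm y \<le> K" unfolding bounded_iff ..
  have K1: "\<bar>drift_deriv t\<bar> \<le> K" if "t \<in> {0..1}" for t using K that by auto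
  have K0: "0 \<le> K" using K1[of 0] by simp
  define M where "M = norm_L2 lborel g"
  have M0: "0 \<le> M" by (simp add: M_def norm_L2_nonneg)
  have "\<bar>drift y * W x - drift x * W y\<bar> \<le> (2 * M * K) * ((y - x) * sqrt (y - x))" if x: "x \<in> {0..1}" and y: "y \<in> {0..1}" and xy: "x \<le> y" for x y
  proof -
    define r where "r = sqrt (y - x)"
    have r0: "0 \<le> r" using xy by (simp add: r_def)
    have gi: "set_integrable lborel {x..y} g" by (rule square_integrable_on_interval[OF g])
    have Vdi: "set_integrable lborel {x..y} drift_deriv" by (rule borel_integrable_atLeastAtMost'[OF drift_deriv_cont])
    have Wd: "\<bar>W x - W t\<bar> \<le> M * r" if t: "t \<in> {x..y}" for t
    proof -
      have "W t - W x = (LBINT s:{x..t}. g s)" using weak_derivative_FTC[OF W g wd, of x t] t by simp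
      then have "\<bar>W x - W t\<bar> = \<bar>LBINT s:{x..t}. g s\<bar>" by simp
      also have "\<dots> \<le> (LBINT s:{x..t}. \<bar>g s\<bar>)"
        using set_integral_norm_bound[OF square_integrable_on_interval[OF g], of x t] by simp
      also have "\<dots> \<le> M * sqrt (t - x)" unfolding M_def by (rule square_integrable_short[OF g]) (use t in simp)
      also have "\<dots> \<le> M * r" unfolding r_def by (intro mult_left_mono real_sqrt_le_mono) (use t M0 in auto)
      finally show ?thesis .
    qed
    have Vdiff: "\<bar>drift t - drift x\<bar> \<le> K * (y - x)" if t: "t \<in> {x..y}" for t
    proof -
      have "norm (drift t - drift x) \<le> K * norm (t - x)"
      proof (rule field_differentiable_bound[of "{0..1}" drift drift_deriv])
        show "(drift has_field_derivative drift_deriv z) (at z within {0..1})" for z by (rule DERIV_subset[OF drift_deriv]) simp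
      qed (use K1 t x y in auto)
      also have "\<dots> \<le> K * (y - x)" using t K0 by (intro mult_left_mono) auto
      finally show ?thesis by simp
    qed
    define F where "F t = indicator {x..y} t *\<^sub>R (W x * drift_deriv t - drift x * g t)" for t
    define G where "G t = indicator {x..y} t * (M * r * K) + K * (y - x) * (indicator {x..y} t * \<bar>g t\<bar>)" for t
    have Fi: "set_integrable lborel {x..y} (\<lambda>t. W x * drift_deriv t - drift x * g t)"
      by (intro set_integral_diff set_integrable_mult_right Vdi gi)
    have Fint: "(\<integral>t. F t \<partial>lborel) = W x * (drift y - drift x) - drift x * (W y - W x)"
    proof -
      have "(LBINT t:{x..y}. drift_deriv t) = drift y - drift x"
        by (rule FTC_lborel[of "{}"]) (use xy drift_cont drift_deriv Vdi in auto)
      moreover have "(LBINT t:{x..y}. g t) = W y - W x" by (rule weak_derivative_FTC[OF W g wd xy])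
      moreover have "(LBINT t:{x..y}. W x * drift_deriv t - drift x * g t) = (LBINT t:{x..y}. W x * drift_deriv t) - (LBINT t:{x..y}. drift x * g t)"
        by (intro set_integral_diff set_integrable_mult_right Vdi gi)
      ultimately show ?thesis unfolding F_def set_lebesgue_integral_def[symmetric] by simp
    qed
    have absg: "integrable lborel (\<lambda>t. indicator {x..y} t * \<bar>g t\<bar>)"
      using set_integrable_abs[OF gi] by (simp add: set_integrable_def)
    have ind: "integrable lborel (\<lambda>t. indicator {x..y} t * (M * r * K))"
      by (intro integrable_mult_left integrable_real_indicator) (auto simp: emeasure_lborel_Icc_eq)
    have Gi: "integrable lborel G" unfolding G_def by (intro Bochner_Integration.integrable_add ind integrable_mult_right absg)
    have "\<bar>drift y * W x - drift x * W y\<bar> = \<bar>\<integral>t. F t \<partial>lborel\<bar>" unfolding Fint by (simp add: algebra_simps)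
    also have "\<dots> \<le> (\<integral>t. \<bar>F t\<bar> \<partial>lborel)" by (rule integral_abs_bound)
    also have "\<dots> \<le> (\<integral>t. G t \<partial>lborel)"
    proof (rule integral_mono_AE[OF _ Gi])
      show "integrable lborel (\<lambda>t. \<bar>F t\<bar>)" using Fi unfolding F_def set_integrable_def by (rule integrable_abs)
      show "AE t in lborel. \<bar>F t\<bar> \<le> G t"
        using transport_eq
      proof eventually_elim
        case (elim t)
        show ?case
        proof (cases "t \<in> {x..y}")
          case True
          have "W x * drift_deriv t - drift x * g t = (W x - W t) * drift_deriv t + (drift t - drift x) * g t" using elim by (simp add: algebra_simps)
          then have "\<bar>W x * drift_deriv t - drift x * g t\<bar> \<le> \<bar>W x - W t\<bar> * \<bar>drift_deriv t\<bar> + \<bar>drift t - drift x\<bar> * \<bar>g t\<bar>"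
            using abs_triangle_ineq[of "(W x - W t) * drift_deriv t" "(drift t - drift x) * g t"] by (simp add: abs_mult)
          also have "\<dots> \<le> (M * r) * K + (K * (y - x)) * \<bar>g t\<bar>"
            using Wd[OF True] Vdiff[OF True] K1[of t] True x y M0 r0 by (intro add_mono mult_mono) auto
          finally show ?thesis using True by (simp add: F_def G_def)
        qed (simp add: F_def G_def)
      qed
    qed
    also have "\<dots> = (y - x) * (M * r * K) + K * (y - x) * (LBINT t:{x..y}. \<bar>g t\<bar>)"
      unfolding G_def by (subst Bochner_Integration.integral_add[OF ind integrable_mult_right[OF absg]])
        (use xy in \<open>simp add: set_lebesgue_integral_def\<close>)
    also have "\<dots> \<le> (y - x) * (M * r * K) + K * (y - x) * (M * r)"
      unfolding M_def r_def using square_integrable_short[OF g xy] K0 xy by (intro add_left_mono mult_left_mono) auto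
    also have "\<dots> = (2 * M * K) * ((y - x) * sqrt (y - x))" by (simp add: r_def algebra_simps)
    finally show ?thesis .
  qed
  moreover have "0 \<le> 2 * M * K" using M0 K0 by simp
  ultimately show ?thesis by blast
qed

text \<open>The difference quotient of \<open>V / W\<close> is the cross difference of
  \<open>cross_estimate\<close> divided by \<open>W x * W y * (y - x)\<close>, hence of order \<open>sqrt
  \<bar>y - x\<bar>\<close>.\<close>
lemma ratio_deriv: assumes x: "0 < x" "x < 1" shows "((\<lambda>x. drift x / W x) has_real_derivative 0) (at x)"
proof -
  obtain C where C: "C \<ge> 0" "\<forall>x\<in>{0..1}. \<forall>y\<in>{0..1}. x \<le> y \<longrightarrow> \<bar>drift y * W x - drift x * W y\<bar> \<le> C * ((y - x) * sqrt (y - x))"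
    using cross_estimate by (elim exE conjE) (rule that)
  have Wx: "W x \<noteq> 0" using bspec[OF neg, of x] x by simp
  have est: "\<bar>drift y * W x - drift x * W y\<bar> \<le> C * (\<bar>y - x\<bar> * sqrt \<bar>y - x\<bar>)" if y: "0 < y" "y < 1" for y
  proof (cases "x \<le> y")
    case True
    then show ?thesis using C(2)[rule_format, of x y] x y by simp
  next
    case False
    then show ?thesis using C(2)[rule_format, of y x] x y by (simp add: abs_minus_commute mult.commute)
  qed
  have "((\<lambda>y. (drift y / W y - drift x / W x) / (y - x)) \<longlongrightarrow> 0) (at x)"
  proof (rule Lim_null_comparison)
    show "((\<lambda>y. C * sqrt \<bar>y - x\<bar> / \<bar>W x * W y\<bar>) \<longlongrightarrow> 0) (at x)"
    proof -
      have "(W \<longlongrightarrow> W x) (at x)" using W by (simp add: continuous_on_def)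
      then have "((\<lambda>y. C * sqrt \<bar>y - x\<bar> / \<bar>W x * W y\<bar>) \<longlongrightarrow> C * sqrt \<bar>x - x\<bar> / \<bar>W x * W x\<bar>) (at x)"
        by (intro tendsto_intros) (use Wx in auto)
      then show ?thesis by simp
    qed
    have "\<forall>\<^sub>F y in at x. y \<in> {0<..<1}" using x by (intro eventually_at_in_open') auto
    moreover have "\<forall>\<^sub>F y in at x. y \<noteq> x" by (simp add: eventually_at_filter)
    ultimately show "\<forall>\<^sub>F y in at x. norm ((drift y / W y - drift x / W x) / (y - x)) \<le> C * sqrt \<bar>y - x\<bar> / \<bar>W x * W y\<bar>"
    proof eventually_elim
      case (elim y)
      have Wy: "W y \<noteq> 0" using bspec[OF neg elim(1)] by simp
      have d: "0 < \<bar>y - x\<bar>" using elim(2) by simp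
      have "(drift y / W y - drift x / W x) / (y - x) = (drift y * W x - drift x * W y) / ((W x * W y) * (y - x))"
        using Wx Wy elim(2) by (simp add: field_simps)
      then have "norm ((drift y / W y - drift x / W x) / (y - x)) = \<bar>drift y * W x - drift x * W y\<bar> / (\<bar>W x * W y\<bar> * \<bar>y - x\<bar>)"
        by (simp add: abs_mult)
      also have "\<dots> \<le> C * (\<bar>y - x\<bar> * sqrt \<bar>y - x\<bar>) / (\<bar>W x * W y\<bar> * \<bar>y - x\<bar>)"
        by (rule divide_right_mono[OF est]) (use elim in auto)
      also have "\<dots> = C * sqrt \<bar>y - x\<bar> / \<bar>W x * W y\<bar>" using d by simp
      finally show ?case .
    qed
  qed
  then show ?thesis by (simp add: has_field_derivative_iff)
qed

text \<open>The quotient has derivative zero on \<open>(0, 1)\<close>; the end points follow by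
  continuity.\<close>
lemma velocity_proportional: "\<exists>l. \<forall>x\<in>{0..1}. drift x = - l * W x"
proof -
  define l where "l = - (drift (1/2) / W (1/2))"
  have inner: "drift x = - l * W x" if x: "0 < x" "x < 1" for x
  proof -
    have "drift x / W x = drift (1/2) / W (1/2)"
    proof (rule has_field_derivative_zero_constant[of "{0<..<1}" "\<lambda>x. drift x / W x", THEN exE])
      show "((\<lambda>x. drift x / W x) has_field_derivative 0) (at z within {0<..<1})" if "z \<in> {0<..<1}" for z
        by (rule DERIV_subset[OF ratio_deriv]) (use that in auto)
      fix c assume "\<forall>x\<in>{0<..<1}. drift x / W x = c"
      then show ?thesis using x by simp
    qed simp
    then show ?thesis using bspec[OF neg, of x] x by (simp add: l_def field_simps)
  qed
  have "drift 1 = - l * W 1"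
  proof -
    have "((\<lambda>x. drift x + l * W x) \<longlongrightarrow> drift 1 + l * W 1) (at_left 1)"
      by (rule tendsto_within_subset[OF _ subset_UNIV]) (intro tendsto_intros; use W drift_cont[of UNIV] in \<open>simp add: continuous_on_def\<close>)
    moreover have "((\<lambda>x. drift x + l * W x) \<longlongrightarrow> 0) (at_left 1)"
    proof (rule tendsto_eventually)
      show "\<forall>\<^sub>F x in at_left 1. drift x + l * W x = 0"
        using eventually_at_left_real[OF zero_less_one] by eventually_elim (use inner in simp)
    qed
    ultimately have "drift 1 + l * W 1 = 0" by (rule tendsto_unique[rotated]) simp
    then show ?thesis by simp
  qed
  then have "\<forall>x\<in>{0..1}. drift x = - l * W x"
    using inner drift_0 W_0 by (metis atLeastAtMost_iff less_eq_real_def mult_zero_right)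
  then show ?thesis ..
qed

text \<open>The Pohozaev identity excludes \<open>l = 0\<close>, and then gives \<open>l > 0\<close>, because
  \<open>\<integral> x f > 0\<close>. Once \<open>l \<noteq> 0\<close>, the relation \<open>V = - l
  \<Omega>\<close> makes \<open>\<Omega>\<close> as smooth as the velocity \<open>V\<close>, so the merely
  square-integrable density may be replaced by a continuous one.\<close>
lemma negative_profile_is_half_profile: "\<exists>l \<phi>. 0 < l \<and> half_profile l \<phi> \<and> (\<forall>x\<in>{0<..<1}. 0 < prim \<phi> x) \<and> W = profile_of \<phi>"
proof -
  obtain l where l: "\<forall>x\<in>{0..1}. drift x = - l * W x" using velocity_proportional ..
  define \<psi> where "\<psi> x = 0 * g x + (-1) * g x" for x
  have \<psi>L: "L2 I \<psi>" unfolding \<psi>_def by (rule L2_lin[OF g_L2 g_L2])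
  have p\<psi>: "prim \<psi> x = - W x" if "x \<in> {0..1}" for x
    using prim_lin[OF g_L2 g_L2 that, of 0 "-1"] prim_g[OF that] by (simp add: \<psi>_def[abs_def])
  have p\<psi>1: "prim \<psi> 1 = 0" using p\<psi>[of 1] W_1 by simp
  have L\<psi>: "neg_hilbert \<psi> x = 1 + drift_deriv x" for x
    using neg_hilbert_lin[OF g_L2 g_L2, of 0 "-1" x] by (simp add: \<psi>_def[abs_def] drift_deriv_def hilbert_W)
  have xW: "0 < (\<integral>x. x * (- W x) \<partial>I)"
  proof (rule integral_pos[of _ "1/2"])
    show "continuous_on {0..1} (\<lambda>x. x * - W x)" by (intro continuous_intros W_cont)
    show "0 \<le> x * - W x" if "x \<in> {0..1}" for x
      using that bspec[OF neg, of x] W_0 W_1 by (cases "x = 0 \<or> x = 1") (auto simp: mult_nonneg_nonpos)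
    show "(1 / 2) * - W (1 / 2) \<noteq> 0" using bspec[OF neg, of "1/2"] by simp
  qed simp
  have drift_deriv_l0: "drift_deriv x = 0" if "l = 0" "0 < x" "x < 1" for x
  proof -
    have "((\<lambda>_. 0) has_real_derivative drift_deriv x) (at x)"
      by (rule has_field_derivative_transform_within_open[OF drift_deriv, of "{0<..<1}"]) (use that l in auto)
    then show ?thesis using DERIV_unique[OF DERIV_const] by metis
  qed
  have l0: "l \<noteq> 0"
  proof
    assume z: "l = 0"
    have "AE x in I. neg_hilbert \<psi> x = 1 + 0 * \<psi> x"
      using AE_I_pos AE_I_neq[of 1] by eventually_elim (use drift_deriv_l0[OF z] L\<psi> in simp)
    from pohozaev[OF \<psi>L p\<psi>1 this] have "(\<integral>x. x * prim \<psi> x \<partial>I) = 0" by simp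
    moreover have "(\<integral>x. x * prim \<psi> x \<partial>I) = (\<integral>x. x * (- W x) \<partial>I)"
      by (rule Bochner_Integration.integral_cong) (use p\<psi> in auto)
    ultimately show False using xW by simp
  qed
  (* The continuous representative of the density, read off from the velocity. *)
  define \<phi> where "\<phi> x = drift_deriv x / l" for x
  have \<phi>c: "continuous_on {0..1} \<phi>" unfolding \<phi>_def by (intro continuous_intros drift_deriv_cont) (use l0 in simp)
  have \<phi>L: "L2 I \<phi>" by (rule L2_I_continuous[OF \<phi>c])
  have p\<phi>: "prim \<phi> x = - W x" if x: "x \<in> {0..1}" for x
  proof -
    have "prim \<phi> x = drift x / l - drift 0 / l"
    proof (rule FTC_prim[of "{}" x "\<lambda>x. drift x / l"])
      show "continuous_on {0..x} (\<lambda>x. drift x / l)" by (intro continuous_intros drift_cont) (use l0 in simp)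
      show "((\<lambda>x. drift x / l) has_real_derivative \<phi> s) (at s)" for s
        unfolding \<phi>_def by (rule DERIV_cdivide[OF drift_deriv])
    qed (use x L2_I_integrable[OF \<phi>L] in auto)
    then show ?thesis using bspec[OF l x] drift_0 l0 by simp
  qed
  have p\<phi>1: "prim \<phi> 1 = 0" using p\<phi>[of 1] W_1 by simp
  have oxeq: "odd_ext \<phi> = odd_ext \<psi>"
    by (rule ext) (use p\<phi> p\<psi> in \<open>auto simp: odd_ext_def\<close>)
  have "neg_hilbert \<phi> x = neg_hilbert \<psi> x" for x
    using hilbert_odd_ext[OF \<phi>L p\<phi>1, of x] hilbert_odd_ext[OF \<psi>L p\<psi>1, of x] oxeq by simp
  then have sl: "half_profile l \<phi>" unfolding half_profile_def using \<phi>c p\<phi>1 L\<psi> l0 by (auto simp: \<phi>_def)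
  have pos: "\<forall>x\<in>{0<..<1}. 0 < prim \<phi> x" using p\<phi> neg by auto
  have lpos: "0 < l"
  proof -
    have "AE x in I. neg_hilbert \<phi> x = 1 + l * \<phi> x" by (rule AE_I2) (use half_profileD(3)[OF sl] in simp)
    from pohozaev[OF \<phi>L p\<phi>1 this] have "l * (\<integral>x. (prim \<phi> x)\<^sup>2 \<partial>I) = 2 * (\<integral>x. x * prim \<phi> x \<partial>I)" by simp
    moreover have "(\<integral>x. x * prim \<phi> x \<partial>I) = (\<integral>x. x * (- W x) \<partial>I)"
      by (rule Bochner_Integration.integral_cong) (use p\<phi> in auto)
    ultimately have "0 < l * (\<integral>x. (prim \<phi> x)\<^sup>2 \<partial>I)" using xW by simp
    moreover have "0 \<le> (\<integral>x. (prim \<phi> x)\<^sup>2 \<partial>I)" by simp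
    ultimately show ?thesis by (simp add: zero_less_mult_iff)
  qed
  have "W y = profile_of \<phi> y" for y
  proof -
    have in01: "W y = profile_of \<phi> y" if "y \<in> {0..1}" for y using profile_of_inner[OF sl that] p\<phi>[OF that] by simp
    have pos_y: "W y = profile_of \<phi> y" if "0 \<le> y" for y
      using in01[of y] that W_outside[of y] odd_ext_outside[of y] by (cases "y \<le> 1") (auto simp: profile_of_def)
    show ?thesis
    proof (cases "0 \<le> y")
      case False
      then show ?thesis using pos_y[of "- y"] profile_of_odd[OF sl, of y] odd[unfolded odd_function_def, rule_format, of y] by simp
    qed (rule pos_y)
  qed
  then show ?thesis using lpos sl pos by (intro exI[of _ l] exI[of _ \<phi>]) auto
qed

end

section \<open>Uniqueness of the positive half profile\<close>

lemma positive_half_profiles_same: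
  assumes a: "half_profile l \<phi>" "0 < l" "\<forall>x\<in>{0<..<1}. 0 < prim \<phi> x" and b: "half_profile m \<psi>" "0 < m" "\<forall>x\<in>{0<..<1}. 0 < prim \<psi> x"
  shows "profile_of \<phi> = profile_of \<psi>"
proof -
  have "l = m"
  proof (rule nonneg_half_profiles_same[OF a(1) _ b(1)])
    show "0 \<le> slope_drop \<phi> x" if "x \<in> {0..1}" for x by (rule positive_half_profile_slope_decreasing[OF a(1,2) _ that]) (use a(3) in simp)
    show "0 \<le> slope_drop \<psi> x" if "x \<in> {0..1}" for x by (rule positive_half_profile_slope_decreasing[OF b(1,2) _ that]) (use b(3) in simp)
  qed
  then have e: "\<phi> x = \<psi> x" if "x \<in> {0..1}" for x using half_profile_unique[OF a(1) _ _ that] a(2) b(1) by simp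
  have "AE x in I. \<phi> x = \<psi> x" by (rule AE_I2) (use e in simp)
  then have "prim \<phi> x = prim \<psi> x" if "x \<in> {0..1}" for x
    by (rule prim_cong_AE[OF half_profileD(4)[OF a(1)] half_profileD(4)[OF b(1)] _ that])
  then show ?thesis by (intro ext) (auto simp: profile_of_def odd_ext_def prim_neg[OF a(1)] prim_neg[OF b(1)])
qed

section \<open>Rescaling\<close>

text \<open>The Hilbert transform commutes with dilations; the principal values are compared through the
  truncated integrals.\<close>
lemma neg_hilbert_scale:
  assumes a: "L2 I \<phi>" "prim \<phi> 1 = 0" and b: "L2 I \<psi>" "prim \<psi> 1 = 0" and r: "0 < r" and e: "\<And>y. odd_ext \<psi> y = c * odd_ext \<phi> (r * y)"
  shows "neg_hilbert \<psi> x = c * neg_hilbert \<phi> (r * x)"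
proof -
  have "(trunc_hilbert (\<lambda>y. c * odd_ext \<phi> (r * y)) x \<longlongrightarrow> c * kernel_op log_kernel \<phi> (r * x)) (at_right 0)"
    by (rule hilbert_scale[OF r hilbert_limit[OF a]])
  moreover have "(\<lambda>y. c * odd_ext \<phi> (r * y)) = odd_ext \<psi>" using e by auto
  ultimately have "(trunc_hilbert (odd_ext \<psi>) x \<longlongrightarrow> c * kernel_op log_kernel \<phi> (r * x)) (at_right 0)" by simp
  then have "kernel_op log_kernel \<psi> x = c * kernel_op log_kernel \<phi> (r * x)"
    by (rule tendsto_unique[rotated, OF hilbert_limit[OF b]]) simp
  then show ?thesis by (simp add: neg_hilbert_def)
qed

text \<open>A half profile that vanishes near \<open>1\<close> can be stretched without leaving \<open>[0,
  1]\<close>. The equation is scale invariant except that the derivative, and hence \<open>l\<close>, picks up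
  the factor \<open>r\<close>.\<close>
lemma dilate_half_profile:
  assumes s: "half_profile l \<phi>" and c: "0 < c" "\<forall>x\<in>{c..1}. prim \<phi> x = 0" and r: "1 \<le> r" "r * c \<le> 1"
  shows "half_profile (r * l) (\<lambda>x. \<phi> (x / r) / r)" "\<And>x. x \<in> {0..1} \<Longrightarrow> slope_drop (\<lambda>x. \<phi> (x / r) / r) x = slope_drop \<phi> (x / r) / r"
proof -
  let ?\<psi> = "\<lambda>x. \<phi> (x / r) / r"
  have r0: "0 < r" using r by simp
  have inI: "x / r \<in> {0..1}" if "x \<in> {0..1}" for x
    using that r by (auto simp: field_simps)
  note pc = half_profileD(1)[OF s]
  have \<psi>c: "continuous_on {0..1} ?\<psi>"
    by (intro continuous_intros continuous_on_compose2[OF pc]) (use r0 inI in auto)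
  have p: "prim ?\<psi> x = prim \<phi> (x / r)" if x: "x \<in> {0..1}" for x
  proof -
    have "prim ?\<psi> x = prim \<phi> (x / r) - prim \<phi> (0 / r)"
    proof (rule FTC_prim[of "{}" x "\<lambda>x. prim \<phi> (x / r)"])
      show "continuous_on {0..x} (\<lambda>x. prim \<phi> (x / r))"
        by (intro continuous_on_compose2[OF prim_continuous[OF pc]] continuous_intros) (use x r0 inI in auto)
      show "((\<lambda>x. prim \<phi> (x / r)) has_real_derivative \<phi> (t / r) / r) (at t)" if t: "t \<in> {0<..<x} - {}" for t
      proof -
        have "0 < t / r" "t / r < 1" using t x r r0 by (auto simp: field_simps)
        then have "(prim \<phi> has_real_derivative \<phi> (t / r)) (at (t / r))" by (rule prim_deriv[OF pc])
        moreover have "((\<lambda>x. x / r) has_real_derivative 1 / r) (at t)" by (rule DERIV_cdivide[OF DERIV_ident])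
        ultimately have "((\<lambda>x. prim \<phi> (x / r)) has_real_derivative \<phi> (t / r) * (1 / r)) (at t)" by (rule DERIV_chain2)
        then show ?thesis by simp
      qed
      show "integrable I ?\<psi>" by (rule L2_cont_int[OF \<psi>c])
    qed (use x in auto)
    then show ?thesis using prim_0[OF pc] by simp
  qed
  have cr: "prim \<phi> (x / r) = 0" if "1 \<le> x" "x \<le> r" for x
  proof -
    have "c \<le> 1 / r" using r r0 by (simp add: field_simps)
    also have "\<dots> \<le> x / r" using that r0 by (intro divide_right_mono) auto
    finally have "x / r \<in> {c..1}" using that r0 by simp
    then show ?thesis using c(2) by blast
  qed
  have p1: "prim ?\<psi> 1 = 0" using p[of 1] cr[of 1] r by simp
  have oxs: "odd_ext ?\<psi> y = 1 * odd_ext \<phi> ((1 / r) * y)" for y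
  proof -
    consider "0 \<le> y" "y \<le> 1" | "-1 \<le> y" "y < 0" | "1 < y" "y \<le> r" | "- r \<le> y" "y < -1" | "r < \<bar>y\<bar>" by linarith
    then show ?thesis
    proof cases
      case 1
      then show ?thesis using p[of y] inI[of y] by (simp add: odd_ext_def)
    next
      case 2
      have "y / r < 0" using 2 r0 by (simp add: divide_neg_pos)
      then show ?thesis using p[of "- y"] inI[of "- y"] 2 by (simp add: odd_ext_def)
    next
      case 3
      then show ?thesis using cr[of y] r0 by (simp add: odd_ext_def)
    next
      case 4
      have "y / r < 0" using 4 r0 by (simp add: divide_neg_pos)
      then show ?thesis using cr[of "- y"] 4 by (simp add: odd_ext_def)
    next
      case 5
      then have "1 < \<bar>y\<bar>" "1 < \<bar>(1 / r) * y\<bar>" using r r0 by (auto simp: field_simps abs_mult)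
      then show ?thesis by (simp only: odd_ext_outside mult_zero_right)
    qed
  qed
  have "neg_hilbert ?\<psi> x = 1 + (r * l) * ?\<psi> x" if x: "x \<in> {0..1}" for x
    using neg_hilbert_scale[OF half_profileD(4,2)[OF s] L2_I_continuous[OF \<psi>c] p1 _ oxs, of x] r0 half_profileD(3)[OF s inI[OF x]] by simp
  then show "half_profile (r * l) ?\<psi>" unfolding half_profile_def using \<psi>c p1 by blast
  show "slope_drop ?\<psi> x = slope_drop \<phi> (x / r) / r" if x: "x \<in> {0..1}" for x
    using p[OF x] r0 by (simp add: slope_drop_def diff_divide_distrib)
qed

text \<open>Otherwise its dilates by \<open>r\<^sub>n \<rightarrow> 1\<close> would be eigenfunctions for
  eigenvalues \<open>r\<^sub>n l \<noteq> l\<close>, orthogonal to \<open>q\<close> and yet converging to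
  \<open>q\<close>.\<close>
lemma half_profile_support_full:
  assumes s: "half_profile l \<phi>" and l: "l \<noteq> 0" and c: "0 < c" "c < 1" "\<forall>x\<in>{c..1}. prim \<phi> x = 0"
  shows False
proof -
  (* The factors decrease to 1 and never exceed 1 / c, so the dilates stay supported in the interval. *)
  define r where "r n = 1 + (1 / c - 1) * inverse (real (Suc n))" for n
  have c1: "0 < 1 / c - 1" using c by (simp add: field_simps)
  have r1: "1 < r n" for n using c1 by (simp add: r_def)
  have rc: "r n * c \<le> 1" for n
  proof -
    have "inverse (real (Suc n)) \<le> 1" by (simp add: inverse_le_1_iff)
    then have "(1 / c - 1) * inverse (real (Suc n)) \<le> (1 / c - 1) * 1" using c1 by (intro mult_left_mono) auto
    then have "r n \<le> 1 / c" by (simp add: r_def)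
    then show ?thesis using c(1) by (simp add: field_simps)
  qed
  note q = half_profile_slope_drop(1)[OF s]
  have inI: "x / r n \<in> {0..1}" if "x \<in> {0..1}" for x n
    using that r1[of n] by (auto simp: field_simps)
  have orth: "(\<integral>x. slope_drop \<phi> (x / r n) * slope_drop \<phi> x \<partial>I) = 0" for n
  proof -
    note d = dilate_half_profile[OF s c(1,3) less_imp_le[OF r1[of n]] rc[of n]]
    have "r n * l \<noteq> l" using r1[of n] l by simp
    from half_profile_orth[OF d(1) s this] have "(\<integral>x. slope_drop (\<lambda>x. \<phi> (x / r n) / r n) x * slope_drop \<phi> x \<partial>I) = 0" by (simp add: inner_L2_def)
    moreover have "(\<integral>x. slope_drop (\<lambda>x. \<phi> (x / r n) / r n) x * slope_drop \<phi> x \<partial>I) = (\<integral>x. (1 / r n) * (slope_drop \<phi> (x / r n) * slope_drop \<phi> x) \<partial>I)"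
    proof (rule Bochner_Integration.integral_cong[OF refl])
      fix x assume "x \<in> space I"
      then have "slope_drop (\<lambda>x. \<phi> (x / r n) / r n) x = slope_drop \<phi> (x / r n) / r n" using d(2)[of x] by simp
      then show "slope_drop (\<lambda>x. \<phi> (x / r n) / r n) x * slope_drop \<phi> x = (1 / r n) * (slope_drop \<phi> (x / r n) * slope_drop \<phi> x)" by simp
    qed
    ultimately have "(1 / r n) * (\<integral>x. slope_drop \<phi> (x / r n) * slope_drop \<phi> x \<partial>I) = 0" by simp
    then show ?thesis using r1[of n] by simp
  qed
  have rl: "r \<longlonglongrightarrow> 1"
  proof -
    have "r \<longlonglongrightarrow> 1 + (1 / c - 1) * 0" unfolding r_def by (intro tendsto_intros LIMSEQ_inverse_real_of_nat)
    then show ?thesis by simp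
  qed
  have "bounded (slope_drop \<phi> ` {0..1})" using compact_continuous_image[OF q compact_Icc] compact_imp_bounded by blast
  then obtain B where B: "\<forall>y\<in>slope_drop \<phi> ` {0..1}. norm y \<le> B" unfolding bounded_iff ..
  have B1: "\<bar>slope_drop \<phi> x\<bar> \<le> B" if "x \<in> {0..1}" for x using B that by auto
  have "(\<lambda>n. \<integral>x. slope_drop \<phi> (x / r n) * slope_drop \<phi> x \<partial>I) \<longlonglongrightarrow> (\<integral>x. slope_drop \<phi> x * slope_drop \<phi> x \<partial>I)"
  proof (rule integral_dominated_convergence[where w="\<lambda>_. B * B"])
    show "(\<lambda>x. slope_drop \<phi> x * slope_drop \<phi> x) \<in> borel_measurable I" by (intro continuous_on_measurable_I continuous_intros q)
    show "(\<lambda>x. slope_drop \<phi> (x / r n) * slope_drop \<phi> x) \<in> borel_measurable I" for n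
      by (intro continuous_on_measurable_I continuous_intros q continuous_on_compose2[OF q]) (use r1[of n] inI in auto)
    show "AE x in I. (\<lambda>n. slope_drop \<phi> (x / r n) * slope_drop \<phi> x) \<longlonglongrightarrow> slope_drop \<phi> x * slope_drop \<phi> x"
    proof (rule AE_I2)
      fix x assume "x \<in> space I"
      then have x: "x \<in> {0..1}" by simp
      have "(\<lambda>n. x / r n) \<longlonglongrightarrow> x / 1" by (intro tendsto_intros rl) simp
      then have "(\<lambda>n. slope_drop \<phi> (x / r n)) \<longlonglongrightarrow> slope_drop \<phi> (x / 1)"
        by (rule continuous_on_tendsto_compose[OF q]) (use x inI[OF x] in auto)
      then show "(\<lambda>n. slope_drop \<phi> (x / r n) * slope_drop \<phi> x) \<longlonglongrightarrow> slope_drop \<phi> x * slope_drop \<phi> x" by (intro tendsto_intros) simp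
    qed
    show "AE x in I. norm (slope_drop \<phi> (x / r n) * slope_drop \<phi> x) \<le> B * B" for n
    proof (rule AE_I2)
      fix x assume "x \<in> space I"
      then have x: "x \<in> {0..1}" by simp
      have "0 \<le> B" using B1[OF x] by linarith
      then show "norm (slope_drop \<phi> (x / r n) * slope_drop \<phi> x) \<le> B * B"
        unfolding real_norm_def abs_mult using B1[OF x] B1[OF inI[OF x]] by (intro mult_mono) auto
    qed
  qed simp
  then have "(\<integral>x. slope_drop \<phi> x * slope_drop \<phi> x \<partial>I) = 0" unfolding orth by (simp add: LIMSEQ_const_iff)
  moreover obtain x0 where x0: "x0 \<in> {0..1}" "slope_drop \<phi> x0 \<noteq> 0" using half_profile_slope_drop_nz[OF s] by blast
  have "0 < (\<integral>x. slope_drop \<phi> x * slope_drop \<phi> x \<partial>I)"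
    by (rule integral_pos[OF _ _ x0(1)]) (use x0 in \<open>auto intro!: continuous_intros q\<close>)
  ultimately show False by simp
qed

text \<open>If \<open>\<bar>\<beta>\<bar> \<noteq> 1\<close>, one of the two profiles vanishes near
  \<open>1\<close>. If \<open>\<beta> = -1\<close>, the two profiles are opposite, and adding their equations
  shows that \<open>\<phi>\<close> is constant, against \<open>prim \<phi> 1 = 0\<close>.\<close>
lemma rescaled_same:
  assumes a: "half_profile l \<phi>" "l \<noteq> 0" and b: "half_profile m \<psi>" "m \<noteq> 0" and \<beta>: "\<beta> \<noteq> 0" and e: "\<And>x. profile_of \<psi> x = profile_of \<phi> (\<beta> * x)"
  shows "profile_of \<psi> = profile_of \<phi>"
proof -
  have shrink: False if s: "half_profile l' \<phi>'" "l' \<noteq> 0" and h: "1 < \<bar>\<gamma>\<bar>" "\<And>x. profile_of \<phi>' x = profile_of \<theta> (\<gamma> * x)" and z: "\<And>x. 1 \<le> \<bar>x\<bar> \<Longrightarrow> profile_of \<theta> x = 0"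
    for l' \<phi>' \<theta> \<gamma>
  proof (rule half_profile_support_full[OF s, of "1 / \<bar>\<gamma>\<bar>"])
    show "\<forall>x\<in>{1 / \<bar>\<gamma>\<bar>..1}. prim \<phi>' x = 0"
    proof
      fix x assume x: "x \<in> {1 / \<bar>\<gamma>\<bar>..1}"
      have x0: "0 \<le> x" using x h(1) by (auto intro: order_trans[rotated])
      have "1 \<le> \<bar>\<gamma> * x\<bar>" using x x0 h(1) by (simp add: abs_mult field_simps)
      then have "profile_of \<phi>' x = 0" using h(2)[of x] z by simp
      then show "prim \<phi>' x = 0" using profile_of_inner[OF s(1), of x] x x0 by simp
    qed
  qed (use h in auto)
  have out: "profile_of \<theta> x = 0" if "half_profile k \<theta>" "1 \<le> \<bar>x\<bar>" for k \<theta> x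
  proof -
    have 1: "profile_of \<theta> 1 = 0" using profile_of_inner[OF that(1), of 1] half_profileD(2)[OF that(1)] by simp
    then have "profile_of \<theta> (-1) = 0" using profile_of_odd[OF that(1), of 1] by simp
    then show ?thesis using 1 that(2) odd_ext_outside[of x] by (cases "\<bar>x\<bar> = 1") (auto simp: profile_of_def abs_if split: if_splits)
  qed
  consider "1 < \<bar>\<beta>\<bar>" | "\<bar>\<beta>\<bar> < 1" | "\<beta> = 1" | "\<beta> = -1" by linarith
  then show ?thesis
  proof cases
    case 1
    then show ?thesis using shrink[OF b 1 e out[OF a(1)]] by simp
  next
    case 2
    have "1 < \<bar>1 / \<beta>\<bar>" using 2 \<beta> by (simp add: field_simps)
    moreover have "profile_of \<phi> x = profile_of \<psi> ((1 / \<beta>) * x)" for x using e[of "(1 / \<beta>) * x"] \<beta> by simp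
    ultimately show ?thesis using shrink[OF a, of "1 / \<beta>" \<psi>] out[OF b(1)] by simp
  next
    case 3
    then show ?thesis using e by auto
  next
    case 4
    have ps: "prim \<psi> x = - prim \<phi> x" if x: "x \<in> {0..1}" for x
      using e[of x] profile_of_odd[OF a(1), of x] profile_of_inner[OF a(1) x] profile_of_inner[OF b(1) x] 4 by simp
    have "odd_ext \<psi> y = (-1) * odd_ext \<phi> (1 * y)" for y using ps by (auto simp: odd_ext_def)
    then have L: "neg_hilbert \<psi> x = - neg_hilbert \<phi> x" for x
      using neg_hilbert_scale[OF half_profileD(4,2)[OF a(1)] half_profileD(4,2)[OF b(1)], of 1 "-1" x] by simp
    have eq: "\<psi> x = - \<phi> x" if x: "0 < x" "x < 1" for x
    proof -
      have "((\<lambda>x. - prim \<phi> x) has_real_derivative \<psi> x) (at x)"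
        by (rule has_field_derivative_transform_within_open[OF prim_deriv[OF half_profileD(1)[OF b(1)] x], of "{0<..<1}"]) (use ps x in auto)
      then show ?thesis using DERIV_unique DERIV_minus[OF prim_deriv[OF half_profileD(1)[OF a(1)] x]] by blast
    qed
    have k: "(m - l) * \<phi> x = 2" if x: "0 < x" "x < 1" for x
      using L[of x] eq[OF x] half_profileD(3)[OF a(1), of x] half_profileD(3)[OF b(1), of x] x by (simp add: algebra_simps)
    have "m \<noteq> l" using k[of "1/2"] by auto
    then have const: "\<phi> x = 2 / (m - l)" if "0 < x" "x < 1" for x using k[OF that] by (simp add: field_simps)
    have "AE x in I. \<phi> x = 2 / (m - l)"
      using AE_I_pos AE_I_neq[of 1] by eventually_elim (use const in simp)
    then have "(\<integral>x. \<phi> x \<partial>I) = (\<integral>x. 2 / (m - l) \<partial>I)"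
      using half_profileD(4)[OF a(1)] unfolding L2_def by (intro integral_cong_AE) auto
    then show ?thesis using half_profileD(2)[OF a(1)] \<open>m \<noteq> l\<close> by (simp add: prim_1)
  qed
qed

text \<open>The two densities agree on \<open>(0, 1)\<close>, so the slope drops agree and are not
  orthogonal.\<close>
lemma profile_determines_eigenvalue:
  assumes a: "half_profile l \<phi>" and b: "half_profile m \<psi>" and e: "profile_of \<phi> = profile_of \<psi>"
  shows "l = m"
proof (rule ccontr)
  assume n: "l \<noteq> m"
  have ps: "prim \<phi> x = prim \<psi> x" if x: "x \<in> {0..1}" for x
    using e profile_of_inner[OF a x] profile_of_inner[OF b x] by simp
  have "odd_ext \<psi> y = 1 * odd_ext \<phi> (1 * y)" for y using ps by (auto simp: odd_ext_def)
  then have L: "neg_hilbert \<psi> x = neg_hilbert \<phi> x" for x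
    using neg_hilbert_scale[OF half_profileD(4,2)[OF a] half_profileD(4,2)[OF b], of 1 1 x] by simp
  have q: "slope_drop \<phi> x = slope_drop \<psi> x" if x: "0 < x" "x < 1" for x
  proof -
    have "(prim \<phi> has_real_derivative \<psi> x) (at x)"
      by (rule has_field_derivative_transform_within_open[OF prim_deriv[OF half_profileD(1)[OF b] x], of "{0<..<1}"]) (use ps x in auto)
    then have "\<psi> x = \<phi> x" using DERIV_unique prim_deriv[OF half_profileD(1)[OF a] x] by blast
    then show ?thesis using ps[of x] x by (simp add: slope_drop_def)
  qed
  have "AE x in I. slope_drop \<phi> x * slope_drop \<psi> x = slope_drop \<phi> x * slope_drop \<phi> x"
    using AE_I_pos AE_I_neq[of 1] by eventually_elim (use q in simp)
  then have "(\<integral>x. slope_drop \<phi> x * slope_drop \<psi> x \<partial>I) = (\<integral>x. slope_drop \<phi> x * slope_drop \<phi> x \<partial>I)"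
    using half_profile_slope_drop(1)[OF a] half_profile_slope_drop(1)[OF b] by (intro integral_cong_AE continuous_on_measurable_I continuous_intros)
  then have "(\<integral>x. slope_drop \<phi> x * slope_drop \<phi> x \<partial>I) = 0" using half_profile_orth[OF a b n] by (simp add: inner_L2_def)
  moreover obtain x0 where x0: "x0 \<in> {0..1}" "slope_drop \<phi> x0 \<noteq> 0" using half_profile_slope_drop_nz[OF a] by blast
  have "0 < (\<integral>x. slope_drop \<phi> x * slope_drop \<phi> x \<partial>I)"
    by (rule integral_pos[OF _ _ x0(1)]) (use x0 in \<open>auto intro!: continuous_intros half_profile_slope_drop(1)[OF a]\<close>)
  ultimately show False by simp
qed

section \<open>Self-similar profiles with support in the unit interval\<close>

theorem theorem1p1:
  "\<exists>S :: (real \<Rightarrow> real) set.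
     infinite S \<and>
     (\<forall>\<Omega>\<in>S. self_similar_profile (-1) (-1) \<Omega> \<and> odd_function \<Omega> \<and> supported_on \<Omega> {-1..1} \<and>
        \<Omega> \<noteq> (\<lambda>x. 0) \<and>
        (\<forall>T. de_gregorio_solution {..<T} (self_similar_solution T (-1) (-1) \<Omega>))) \<and>
     pairwise (\<lambda>\<Omega> \<Omega>'. \<not> rescaling_of (\<Omega>, -1, -1) (\<Omega>', -1, -1)) S \<and>
     (\<exists>\<Omega>\<in>S. (\<forall>x\<in>{0<..<1}. \<Omega> x < 0) \<and>
        (\<forall>\<Omega>'. self_similar_profile (-1) (-1) \<Omega>' \<and> odd_function \<Omega>' \<and>
            supported_on \<Omega>' {-1..1} \<and> (\<forall>x\<in>{0<..<1}. \<Omega>' x < 0) \<longrightarrow> \<Omega>' = \<Omega>))"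
proof -
  define S where "S = {\<Omega>. \<exists>l \<phi>. l \<noteq> 0 \<and> half_profile l \<phi> \<and> \<Omega> = profile_of \<phi>}"
  have "infinite S"
  proof
    assume "finite S"
    define ev where "ev \<Omega> = (THE l. \<exists>\<phi>. half_profile l \<phi> \<and> \<Omega> = profile_of \<phi>)" for \<Omega>
    have "{l. l \<noteq> 0 \<and> (\<exists>\<phi>. half_profile l \<phi>)} \<subseteq> ev ` S"
    proof
      fix l assume "l \<in> {l. l \<noteq> 0 \<and> (\<exists>\<phi>. half_profile l \<phi>)}"
      then obtain \<phi> where s: "l \<noteq> 0" "half_profile l \<phi>" by blast
      have "ev (profile_of \<phi>) = l" unfolding ev_def
      proof (rule the_equality)
        fix m assume "\<exists>\<psi>. half_profile m \<psi> \<and> profile_of \<phi> = profile_of \<psi>"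
        then obtain \<psi> where "half_profile m \<psi>" "profile_of \<phi> = profile_of \<psi>" by blast
        then show "m = l" using profile_determines_eigenvalue[OF s(2)] by simp
      qed (use s in blast)
      moreover have "profile_of \<phi> \<in> S" using s by (auto simp: S_def)
      ultimately show "l \<in> ev ` S" by (metis imageI)
    qed
    then show False using finite_subset finite_imageI[OF \<open>finite S\<close>] infinite_eigenvalues by blast
  qed
  moreover have "self_similar_profile (-1) (-1) \<Omega> \<and> odd_function \<Omega> \<and> supported_on \<Omega> {-1..1} \<and>
        \<Omega> \<noteq> (\<lambda>x. 0) \<and> (\<forall>T. de_gregorio_solution {..<T} (self_similar_solution T (-1) (-1) \<Omega>))" if "\<Omega> \<in> S" for \<Omega>
  proof -
    obtain l \<phi> where "l \<noteq> 0 \<and> half_profile l \<phi> \<and> \<Omega> = profile_of \<phi>" using \<open>\<Omega> \<in> S\<close> unfolding S_def by (elim CollectE exE)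
    then have s: "half_profile l \<phi>" and O: "\<Omega> = profile_of \<phi>" by simp_all
    show ?thesis unfolding O
      by (intro conjI allI self_similar_profile_of[OF s] odd_profile_of[OF s] supported_profile_of[OF s] profile_of_nonzero[OF s] solution_profile_of[OF s])
  qed
  moreover have "pairwise (\<lambda>\<Omega> \<Omega>'. \<not> rescaling_of (\<Omega>, -1, -1) (\<Omega>', -1, -1)) S"
  proof (rule pairwiseI, rule notI)
    fix \<Omega> \<Omega>' assume h: "\<Omega> \<in> S" "\<Omega>' \<in> S" "\<Omega> \<noteq> \<Omega>'" and r: "rescaling_of (\<Omega>, -1, -1) (\<Omega>', -1, -1)"
    obtain l \<phi> where a: "l \<noteq> 0" "half_profile l \<phi>" "\<Omega> = profile_of \<phi>" using h(1) unfolding S_def by blast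
    obtain m \<psi> where b: "m \<noteq> 0" "half_profile m \<psi>" "\<Omega>' = profile_of \<psi>" using h(2) unfolding S_def by blast
    obtain \<beta> where \<beta>: "\<beta> \<noteq> 0" "\<Omega>' = (\<lambda>x. \<Omega> (\<beta> * x))" using r by (auto simp: rescaling_of_def)
    have "profile_of \<psi> x = profile_of \<phi> (\<beta> * x)" for x using \<beta>(2) a(3) b(3) by metis
    then have "profile_of \<psi> = profile_of \<phi>" by (rule rescaled_same[OF a(2,1) b(2,1) \<beta>(1)])
    then show False using h(3) a(3) b(3) by simp
  qed
  moreover have "\<exists>\<Omega>\<in>S. (\<forall>x\<in>{0<..<1}. \<Omega> x < 0) \<and>
        (\<forall>\<Omega>'. self_similar_profile (-1) (-1) \<Omega>' \<and> odd_function \<Omega>' \<and>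
            supported_on \<Omega>' {-1..1} \<and> (\<forall>x\<in>{0<..<1}. \<Omega>' x < 0) \<longrightarrow> \<Omega>' = \<Omega>)"
  proof -
    obtain l \<phi> where s: "0 < l" "half_profile l \<phi>" "\<forall>x\<in>{0<..<1}. 0 < prim \<phi> x"
      using positive_half_profile by (elim exE conjE) (rule that)
    show ?thesis
    proof (rule bexI[of _ "profile_of \<phi>"], intro conjI allI impI)
      have "l \<noteq> 0" using s(1) by simp
      then show "profile_of \<phi> \<in> S" unfolding S_def using s(2) by blast
      show "\<forall>x\<in>{0<..<1}. profile_of \<phi> x < 0" using s(3) profile_of_inner[OF s(2)] by simp
      fix \<Omega>' assume h: "self_similar_profile (-1) (-1) \<Omega>' \<and> odd_function \<Omega>' \<and>
            supported_on \<Omega>' {-1..1} \<and> (\<forall>x\<in>{0<..<1}. \<Omega>' x < 0)"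
      then obtain U g where c: "continuous_on UNIV \<Omega>'" and U: "velocity_of \<Omega>' U" and g: "weak_derivative \<Omega>' g" "square_integrable g"
        and eq: "AE x in lborel. (-1 * x + U x) * g x = (-1 + hilbert_transform \<Omega>' x) * \<Omega>' x"
        unfolding self_similar_profile_def sobolev_H1_def by (elim exE conjE) (rule that)
      obtain m \<psi> where "0 < m" "half_profile m \<psi>" "\<forall>x\<in>{0<..<1}. 0 < prim \<psi> x" "\<Omega>' = profile_of \<psi>"
        using negative_profile_is_half_profile[OF c g(2,1) _ _ _ U eq] h by blast
      then show "\<Omega>' = profile_of \<phi>" using positive_half_profiles_same[of m \<psi> l \<phi>] s by simp
    qed
  qed
  ultimately show ?thesis by (intro exI[of _ S]) simp
qed

end
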